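(* Let $p\in(-n,0)$, and let $\mu$ be a non-trivial Borel measure on $\mathbb{S}^{n-1}$ of the form $d\mu=f\,d\mathcal{H}^{n-1}$ for a non-negative function $f\in L_{\frac{n}{n+p}}(\mathbb{S}^{n-1})$. Then there exists $K\in\mathcal{K}_0^n$ such that $\mu=S_{K,p}$, i.e. $\mu$ is the $L_p$-surface area measure of $K$. In addition, if $\mu$ is invariant under a closed subgroup $G$ of $O(n)$, then $K$ can be chosen to be invariant under $G$.
   Context: A convex body in $\mathbb{R}^n$ is a compact convex set with non-empty interior; $\mathcal{K}_0^n$ is the family of convex bodies in $\mathbb{R}^n$ containing the origin $o$. The support function of $K$ is $h_K(u)=\max\{\langle x,u\rangle: x\in K\}$. For $x\in\partial K$, $\nu_K(x)$ is the set of all unit exterior normal vectors to $K$ at $x$. The surface area measure of $K$ is the Borel measure on $\mathbb{S}^{n-1}$ given by $S_K(\omega)=\mathcal{H}^{n-1}(\{x\in\partial K:\nu_K(x)\cap\omega\ne\emptyset\})$, where $\mathcal{H}^{n-1}$ is $(n-1)$-dimensional Hausdorff measure. For $p<1$ and $K\in\mathcal{K}_0^n$ the $L_p$-surface area measure is $dS_{K,p}=h_K^{1-p}\,dS_K$. $L_{\frac{n}{n+p}}(\mathbb{S}^{n-1})$ is taken with respect to $\mathcal{H}^{n-1}$. A measure $\mu$ (resp. a body $K$) is invariant under $G$ if $\mu(A\omega)=\mu(\omega)$ for all Borel $\omega$ (resp. $AK=K$) and all $A\in G$. *)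

theory Defs
  imports "HOL-Analysis.Analysis" "HOL-Algebra.Group"
begin

text \<open>Hausdorff measure of integer dimension \<open>k\<close>, normalised so that it agrees with Lebesgue
  measure on k-dimensional Euclidean space. The exponent is a natural number and empty covering
  sets have weight 0, so that dimension 0 gives counting measure. Covering sets must be bounded
  because \<^const>\<open>diameter\<close> is real-valued.\<close>

definition hausdorff_weight :: "nat \<Rightarrow> 'a::metric_space set \<Rightarrow> ennreal" where
  "hausdorff_weight k U =
     (if U = {} then 0 else ennreal (unit_ball_vol (real k) * (diameter U / 2) ^ k))"

definition hausdorff_premeasure :: "nat \<Rightarrow> real \<Rightarrow> 'a::metric_space set \<Rightarrow> ennreal" where
  "hausdorff_premeasure k \<delta> A =
     (INF U \<in> {U :: nat \<Rightarrow> 'a set. A \<subseteq> (\<Union>i. U i) \<and> (\<forall>i. bounded (U i) \<and> diameter (U i) \<le> \<delta>)}.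
        \<Sum>i. hausdorff_weight k (U i))"

definition hausdorff_outer :: "nat \<Rightarrow> 'a::metric_space set \<Rightarrow> ennreal" where
  "hausdorff_outer k A = (SUP \<delta> \<in> {0<..}. hausdorff_premeasure k \<delta> A)"

text \<open>\<^const>\<open>measure_of\<close> returns the given set function because \<open>hausdorff_outer k\<close> is a metric
  outer measure and hence countably additive on Borel sets.\<close>

definition hausdorff_measure :: "nat \<Rightarrow> 'a::metric_space measure" where
  "hausdorff_measure k = measure_of UNIV (sets borel) (hausdorff_outer k)"

definition sphere_measure :: "(real ^ 'n) measure" where
  "sphere_measure = restrict_space (hausdorff_measure (CARD('n) - 1)) (sphere 0 1)"

definition convex_body :: "'a::euclidean_space set \<Rightarrow> bool" where
  "convex_body K \<longleftrightarrow> compact K \<and> convex K \<and> interior K \<noteq> {}"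

definition convex_bodies_0 :: "'a::euclidean_space set set" where
  "convex_bodies_0 = {K. convex_body K \<and> 0 \<in> K}"

text \<open>For nonempty compact \<open>K\<close> the supremum is attained.\<close>

definition support_fun :: "'a::euclidean_space set \<Rightarrow> 'a \<Rightarrow> real" where
  "support_fun K u = (SUP x\<in>K. x \<bullet> u)"

definition unit_normals :: "'a::euclidean_space set \<Rightarrow> 'a \<Rightarrow> 'a set" where
  "unit_normals K x = {u. norm u = 1 \<and> (\<forall>y\<in>K. (y - x) \<bullet> u \<le> 0)}"

text \<open>For a convex body \<open>K\<close> the set function below is countably additive on the Borel sets of the
  sphere: the boundary points with more than one unit normal form a Hausdorff null set of
  dimension \<open>n - 1\<close>. It is therefore the one that \<^const>\<open>measure_of\<close> returns. The outer
  measure is used because the set of boundary points need not be Borel.\<close>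

definition surface_area_measure :: "(real ^ 'n) set \<Rightarrow> (real ^ 'n) measure" where
  "surface_area_measure K =
     measure_of (sphere 0 1) (sets (restrict_space borel (sphere 0 1)))
       (\<lambda>\<omega>. hausdorff_outer (CARD('n) - 1) {x \<in> frontier K. unit_normals K x \<inter> \<omega> \<noteq> {}})"

text \<open>Only meant for \<open>p < 1\<close> and \<open>0 \<in> K\<close>; then the support function is nonnegative, and
  \<open>0 powr (1 - p) = 0\<close> is the intended value.\<close>

definition Lp_surface_area_measure :: "real \<Rightarrow> (real ^ 'n) set \<Rightarrow> (real ^ 'n) measure" where
  "Lp_surface_area_measure p K =
     density (surface_area_measure K) (\<lambda>u. ennreal (support_fun K u powr (1 - p)))"

definition Lq_functions :: "real \<Rightarrow> 'a measure \<Rightarrow> ('a \<Rightarrow> real) set" where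
  "Lq_functions q M = {f \<in> borel_measurable M. integrable M (\<lambda>x. \<bar>f x\<bar> powr q)}"

definition orthogonal_group :: "(real ^ 'n ^ 'n) monoid" where
  "orthogonal_group = \<lparr>carrier = {A. orthogonal_matrix A}, mult = (**), one = mat 1\<rparr>"

definition measure_invariant :: "(real ^ 'n ^ 'n) set \<Rightarrow> (real ^ 'n) measure \<Rightarrow> bool" where
  "measure_invariant G M \<longleftrightarrow>
     (\<forall>A\<in>G. \<forall>\<omega>\<in>sets M. emeasure M ((\<lambda>x. A *v x) ` \<omega>) = emeasure M \<omega>)"

definition body_invariant :: "(real ^ 'n ^ 'n) set \<Rightarrow> (real ^ 'n) set \<Rightarrow> bool" where
  "body_invariant G K \<longleftrightarrow> (\<forall>A\<in>G. (\<lambda>x. A *v x) ` K = K)"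

end

theory Submission
  imports Defs "HOL-Complex_Analysis.Great_Picard"
begin

text \<open>Put \<open>q = - p\<close> and let \<open>\<Psi> K\<close> be the minimum over \<open>\<xi> \<in> K\<close> of
  \<open>F K \<xi> = \<integral> (h\<^sub>K(u) - \<xi> \<bullet> u) powr (- q) d\<mu>(u)\<close>. Maximise \<open>\<Psi>\<close> over the \<open>G\<close>-invariant convex bodies
  of volume at least 1 that contain the origin. Such a body is comparable to the image of a simplex
  under a matrix \<open>D\<close>, and \<open>\<integral> |D u| powr (- n)\<close> over the sphere is at most a constant divided
  by \<open>|det D|\<close>; as \<open>f\<close> is in \<open>L\<close> with exponent \<open>n / (n - q)\<close>, Young's inequality shows that \<open>\<Psi>\<close> tends
  to 0 along unbounded bodies, so a maximiser \<open>K\<close> exists. The minimum point is unique by strict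
  convexity, hence fixed by \<open>G\<close>, and \<open>K\<close> can be translated so that it is the origin.

  For a closed \<open>G\<close>-invariant set \<open>\<omega>\<close> of directions, compare \<open>K\<close> with
  \<open>{x \<in> K. \<forall>u\<in>\<omega>. x \<bullet> u \<le> (1 - t) h\<^sub>K(u)}\<close>, rescaled to volume at least 1. To first order in \<open>t\<close> the
  volume lost is at most \<open>n t\<close> times the cone volume of \<open>K\<close> over \<open>\<omega>\<close>, which yields that
  \<open>h\<^sub>K powr (- q) d\<mu>\<close> is at most a constant multiple of the cone-volume measure on \<open>\<omega>\<close>. The constant
  is such that the total masses are ordered the other way round, so the two measures agree on
  \<open>G\<close>-invariant closed sets and, being \<open>G\<close>-invariant, coincide. A dilation of \<open>K\<close> adjusts the
  constant.

  One-sided inequalities suffice, so the differentiability of the volume with respect to the support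
  function is never needed. The surface area measure enters only through the identity between
  \<open>h\<^sub>K dS\<^sub>K\<close> and the cone-volume measure, which is proved by flattening boundary pieces with almost
  constant normal.\<close>

section \<open>Hausdorff measures\<close>

text \<open>The origin may come to lie on the boundary of the maximiser, and then its support
  function \<open>h\<close> vanishes in some directions. This shapes the set-up: the power is
  infinite at nonpositive arguments, so finiteness of the functional makes \<open>h\<close> positive
  \<mu>-almost everywhere, and the variation is carried out over closed sets of directions on which
  \<open>h\<close> is positive. Cone volumes fit this: cones over boundary points with a normal of
  support value 0 stay in the boundary and are null, and all cones together lie inside the body. The
  constant comes from homogeneity. A dilation by \<open>s\<close> multiplies \<Psi> by
  \<open>s powr (- q)\<close> and the volume by \<open>s ^ n\<close>. A cut of depth
  \<open>t\<close> loses volume at most \<open>n t v\<close>, so restoring the volume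
  \<open>V\<close> costs a factor of about \<open>1 + q t v / V\<close>, while the functional gains
  \<open>q t\<close> times the integral of \<open>h powr (- q)\<close> over \<omega>. The factor
  \<open>q t\<close> cancels and leaves the constant \<Psi>(K) / V. The integral over the whole
  sphere is \<Psi>(K), and the cone volumes add up to at most \<open>V\<close>, which is the reverse
  order of the total masses. Young's inequality works because \<open>n / q\<close> and
  \<open>n / (n - q)\<close> are conjugate exponents.\<close>

lemma hausdorff_premeasure_le:
  assumes "A \<subseteq> (\<Union>i. U i)" "\<And>i. bounded (U i)" "\<And>i. diameter (U i) \<le> \<delta>"
  shows "hausdorff_premeasure k \<delta> A \<le> (\<Sum>i. hausdorff_weight k (U i))"
  unfolding hausdorff_premeasure_def using assms by (intro INF_lower) auto

lemma hausdorff_premeasure_mono: "A \<subseteq> B \<Longrightarrow> hausdorff_premeasure k \<delta> A \<le> hausdorff_premeasure k \<delta> B"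
  unfolding hausdorff_premeasure_def by (intro INF_superset_mono) auto

lemma hausdorff_premeasure_antimono:
  "\<delta> \<le> \<epsilon> \<Longrightarrow> hausdorff_premeasure k \<epsilon> A \<le> hausdorff_premeasure k \<delta> A"
  unfolding hausdorff_premeasure_def by (intro INF_superset_mono) (auto intro: order_trans)

lemma hausdorff_premeasure_close:
  assumes "hausdorff_premeasure k \<delta> A < x"
  obtains U where "A \<subseteq> (\<Union>i. U i)" "\<And>i. bounded (U i)" "\<And>i. diameter (U i) \<le> \<delta>"
     "(\<Sum>i. hausdorff_weight k (U i)) < x"
  using assms unfolding hausdorff_premeasure_def INF_less_iff by auto

lemma hausdorff_premeasure_UN:
  "hausdorff_premeasure k \<delta> (\<Union>i::nat. A i) \<le> (\<Sum>i. hausdorff_premeasure k \<delta> (A i))"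
proof (rule ennreal_le_epsilon)
  let ?O = "hausdorff_premeasure k \<delta>"
  fix e :: real assume "0 < e" "(\<Sum>n. ?O (A n)) < top_class.top"
  then have *: "\<And>n. ?O (A n) < ?O (A n) + e * (1/2)^Suc n"
    by (auto simp add: less_top dest!: ennreal_suminf_lessD)
  have "\<exists>B. A n \<subseteq> (\<Union>i. B i) \<and> (\<forall>i. bounded (B i) \<and> diameter (B i) \<le> \<delta>) \<and>
     (\<Sum>i. hausdorff_weight k (B i)) \<le> ?O (A n) + e * (1/2)^(Suc n)" for n
    using hausdorff_premeasure_close[OF *[of n]] by (metis less_imp_le)
  then obtain B where sbB: "\<And>n. A n \<subseteq> (\<Union>i. B n i)"
    and B: "\<And>n i. bounded (B n i)" "\<And>n i. diameter (B n i) \<le> \<delta>"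
    and Ble: "\<And>n. (\<Sum>i. hausdorff_weight k (B n i)) \<le> ?O (A n) + e * (1/2)^(Suc n)"
    by metis
  define C where "C = case_prod B o prod_decode"
  have A_C: "(\<Union>i. A i) \<subseteq> (\<Union>i. C i)"
    using sbB by (auto simp add: C_def subset_eq) (metis prod.case prod_encode_inverse)
  have "?O (\<Union>i. A i) \<le> (\<Sum>i. hausdorff_weight k (C i))"
    using A_C B by (intro hausdorff_premeasure_le) (auto simp: C_def split: prod.split)
  also have "\<dots> = (\<Sum>n. \<Sum>i. hausdorff_weight k (B n i))"
    unfolding C_def comp_def by (intro suminf_ennreal_2dimen) auto
  also have "\<dots> \<le> (\<Sum>n. ?O (A n) + e * (1/2) ^ Suc n)"
    by (intro suminf_le suminf_nonneg allI Ble) auto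
  also have "... = (\<Sum>n. ?O (A n)) + (\<Sum>n. ennreal e * ennreal ((1/2) ^ Suc n))"
    using \<open>0 < e\<close> by (subst suminf_add[symmetric])
                     (auto simp del: ennreal_suminf_cmult simp add: ennreal_mult[symmetric])
  also have "\<dots> = (\<Sum>n. ?O (A n)) + e"
    unfolding ennreal_suminf_cmult
    by (subst suminf_ennreal_eq[OF zero_le_power power_half_series]) auto
  finally show "?O (\<Union>i. A i) \<le> (\<Sum>n. ?O (A n)) + e" .
qed

lemma hausdorff_weight_empty [simp]: "hausdorff_weight k {} = 0"
  by (simp add: hausdorff_weight_def)

lemma hausdorff_premeasure_empty: "0 \<le> \<delta> \<Longrightarrow> hausdorff_premeasure k \<delta> {} = 0"
  using hausdorff_premeasure_le[of "{}" "\<lambda>_. {}" \<delta> k] by simp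

lemma hausdorff_premeasure_le_weight:
  assumes "bounded A" "diameter A \<le> \<delta>" "0 \<le> \<delta>"
  shows "hausdorff_premeasure k \<delta> A \<le> hausdorff_weight k A"
proof -
  have "hausdorff_premeasure k \<delta> A \<le> (\<Sum>i::nat. hausdorff_weight k (if i = 0 then A else {}))"
    using assms by (intro hausdorff_premeasure_le) auto
  also have "\<dots> = hausdorff_weight k A"
    by (subst suminf_finite[of "{0}"]) auto
  finally show ?thesis .
qed

lemma hausdorff_outer_mono: "A \<subseteq> B \<Longrightarrow> hausdorff_outer k A \<le> hausdorff_outer k B"
  unfolding hausdorff_outer_def by (intro SUP_mono) (auto intro: hausdorff_premeasure_mono)

lemma hausdorff_outer_empty [simp]: "hausdorff_outer k {} = 0"
proof -
  have "hausdorff_outer k {} \<le> (0::ennreal)"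
    unfolding hausdorff_outer_def by (intro SUP_least) (simp add: hausdorff_premeasure_empty)
  then show ?thesis by simp
qed

lemma hausdorff_premeasure_le_outer: "0 < \<delta> \<Longrightarrow> hausdorff_premeasure k \<delta> A \<le> hausdorff_outer k A"
  unfolding hausdorff_outer_def by (intro SUP_upper) auto

lemma hausdorff_outer_UN:
  "hausdorff_outer k (\<Union>i::nat. A i) \<le> (\<Sum>i. hausdorff_outer k (A i))"
  unfolding hausdorff_outer_def[of k "\<Union>i. A i"]
proof (intro SUP_least)
  fix \<delta> :: real assume "\<delta> \<in> {0<..}"
  then show "hausdorff_premeasure k \<delta> (\<Union>i. A i) \<le> (\<Sum>i. hausdorff_outer k (A i))"
    by (intro order_trans[OF hausdorff_premeasure_UN] suminf_le hausdorff_premeasure_le_outer) auto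
qed

lemma hausdorff_outer_Un: "hausdorff_outer k (A \<union> B) \<le> hausdorff_outer k A + hausdorff_outer k B"
proof -
  have "hausdorff_outer k (A \<union> B) \<le> hausdorff_outer k (\<Union>i::nat. if i = 0 then A else if i = 1 then B else {})"
    by (rule hausdorff_outer_mono) (auto split: if_splits)
  also have "\<dots> \<le> (\<Sum>i::nat. hausdorff_outer k (if i = 0 then A else if i = 1 then B else {}))"
    by (rule hausdorff_outer_UN)
  also have "\<dots> = hausdorff_outer k A + hausdorff_outer k B"
    by (subst suminf_finite[of "{0,1}"]) auto
  finally show ?thesis .
qed

text \<open>A covering set of diameter below \<open>d\<close> cannot meet both sets, so every cover
  of the union splits into a cover of \<open>A\<close> and a cover of \<open>B\<close> with no set
  counted twice.\<close>

lemma hausdorff_premeasure_separated: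
  assumes "\<delta> < d" and d: "\<And>x y. x \<in> A \<Longrightarrow> y \<in> B \<Longrightarrow> d \<le> dist x y" and "0 < \<delta>"
  shows "hausdorff_premeasure k \<delta> A + hausdorff_premeasure k \<delta> B \<le> hausdorff_premeasure k \<delta> (A \<union> B)"
  unfolding hausdorff_premeasure_def[of k \<delta> "A \<union> B"]
proof (rule INF_greatest, clarify)
  fix U :: "nat \<Rightarrow> 'a set"
  assume cov: "A \<union> B \<subseteq> (\<Union>i. U i)" and U: "\<forall>i. bounded (U i) \<and> diameter (U i) \<le> \<delta>"
  define P where "P = (\<lambda>i. if U i \<inter> A \<noteq> {} then U i else {})"
  define Q where "Q = (\<lambda>i. if U i \<inter> B \<noteq> {} then U i else {})"
  have disj: "U i \<inter> A = {} \<or> U i \<inter> B = {}" for i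
  proof (rule ccontr)
    assume "\<not> ?thesis"
    then obtain x y where "x \<in> U i" "x \<in> A" "y \<in> U i" "y \<in> B" by auto
    then have "d \<le> diameter (U i)" using d[of x y] diameter_bounded_bound[of "U i" x y] U by force
    with U \<open>\<delta> < d\<close> show False by (metis linorder_not_le order_trans)
  qed
  have "hausdorff_premeasure k \<delta> A + hausdorff_premeasure k \<delta> B
      \<le> (\<Sum>i. hausdorff_weight k (P i)) + (\<Sum>i. hausdorff_weight k (Q i))"
    using cov U \<open>0 < \<delta>\<close>
    by (intro add_mono hausdorff_premeasure_le) (fastforce simp: P_def Q_def)+
  also have "\<dots> = (\<Sum>i. hausdorff_weight k (P i) + hausdorff_weight k (Q i))"
    by (intro suminf_add) auto
  also have "\<dots> \<le> (\<Sum>i. hausdorff_weight k (U i))"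
  proof (intro suminf_le)
    fix i show "hausdorff_weight k (P i) + hausdorff_weight k (Q i) \<le> hausdorff_weight k (U i)"
      using disj[of i] by (auto simp: P_def Q_def)
  qed auto
  finally show "hausdorff_premeasure k \<delta> A + hausdorff_premeasure k \<delta> B \<le> (\<Sum>i. hausdorff_weight k (U i))" .
qed

lemma hausdorff_outer_separated:
  assumes "0 < d" and d: "\<And>x y. x \<in> A \<Longrightarrow> y \<in> B \<Longrightarrow> d \<le> dist x y"
  shows "hausdorff_outer k A + hausdorff_outer k B \<le> hausdorff_outer k (A \<union> B)"
proof -
  have "hausdorff_premeasure k \<delta>1 A + hausdorff_premeasure k \<delta>2 B \<le> hausdorff_outer k (A \<union> B)"
    if "0 < \<delta>1" "0 < \<delta>2" for \<delta>1 \<delta>2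
  proof -
    define \<delta> where "\<delta> = min (min \<delta>1 \<delta>2) (d / 2)"
    have \<delta>: "0 < \<delta>" "\<delta> \<le> \<delta>1" "\<delta> \<le> \<delta>2" "\<delta> < d" using that \<open>0 < d\<close> by (auto simp: \<delta>_def min_def)
    have "hausdorff_premeasure k \<delta>1 A + hausdorff_premeasure k \<delta>2 B \<le>
        hausdorff_premeasure k \<delta> A + hausdorff_premeasure k \<delta> B"
      by (intro add_mono hausdorff_premeasure_antimono \<delta>)
    also have "\<dots> \<le> hausdorff_premeasure k \<delta> (A \<union> B)"
      using \<delta> d by (intro hausdorff_premeasure_separated) auto
    also have "\<dots> \<le> hausdorff_outer k (A \<union> B)" by (intro hausdorff_premeasure_le_outer \<delta>)
    finally show ?thesis .
  qed
  then have "hausdorff_outer k A + hausdorff_premeasure k \<delta>2 B \<le> hausdorff_outer k (A \<union> B)"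
    if "0 < \<delta>2" for \<delta>2
    using that ennreal_SUP_add_left[of "{0::real<..}" "\<lambda>\<delta>. hausdorff_premeasure k \<delta> A" "hausdorff_premeasure k \<delta>2 B"]
    unfolding hausdorff_outer_def[of k A] by (metis SUP_least greaterThan_iff greaterThan_non_empty)
  then show ?thesis
    using ennreal_SUP_add_right[of "{0::real<..}" "hausdorff_outer k A" "\<lambda>\<delta>. hausdorff_premeasure k \<delta> B"]
    unfolding hausdorff_outer_def[of k B] by (metis SUP_least greaterThan_iff greaterThan_non_empty)
qed

text \<open>Caratheodory's criterion for a metric outer measure. The shells \<open>R n\<close>, cut
  out by the distance to \<open>F\<close>, are positively separated once one shell is skipped. So
  from index 2 on the even and the odd shells each have total measure at most that of
  \<open>A\<close>; their series converges, its tail tends to 0, and \<open>A' n\<close> exhausts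
  \<open>A - F\<close> in measure.\<close>

lemma closed_caratheodory_hausdorff:
  fixes F :: "'a::metric_space set"
  assumes "closed F"
  shows "hausdorff_outer k (F \<inter> A) + hausdorff_outer k (A - F) \<le> hausdorff_outer k A"
proof (cases "F = {} \<or> hausdorff_outer k A = \<infinity>")
  case True then show ?thesis by auto
next
  case False
  then have F: "F \<noteq> {}" and fin: "hausdorff_outer k A < \<infinity>" by (auto simp: less_top)
  let ?H = "hausdorff_outer k"
  define A' where "A' n = {x \<in> A. 1 / real (Suc n) \<le> infdist x F}" for n
  define R where "R n = A' (Suc n) - A' n" for n
  have A'_sub: "A' n \<subseteq> A" for n by (auto simp: A'_def)
  have A'_mono: "A' m \<subseteq> A' n" if "m \<le> n" for m n
  proof -
    have "1 / real (Suc n) \<le> 1 / real (Suc m)" using that by (simp add: frac_le)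
    then show ?thesis by (auto simp: A'_def)
  qed
  have sep_F: "?H (F \<inter> A) + ?H (A' n) \<le> ?H A" for n
  proof -
    have "?H (F \<inter> A) + ?H (A' n) \<le> ?H ((F \<inter> A) \<union> A' n)"
    proof (rule hausdorff_outer_separated[of "1 / real (Suc n)"])
      fix x y assume "x \<in> F \<inter> A" "y \<in> A' n"
      then show "1 / real (Suc n) \<le> dist x y"
        using infdist_le[of x F y] by (auto simp: A'_def dist_commute)
    qed simp
    also have "\<dots> \<le> ?H A" by (rule hausdorff_outer_mono) (auto simp: A'_def)
    finally show ?thesis .
  qed
  \<comment> \<open>Points of \<open>A' (n + 1)\<close> have distance at least
    \<open>1 / (n + 2)\<close> from \<open>F\<close>, points of \<open>R (n + 2)\<close> less than
    \<open>1 / (n + 3)\<close>. The skipped shell \<open>R (n + 1)\<close> provides the gap.\<close>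
  have sep_R: "?H (A' (Suc n)) + ?H (R (Suc (Suc n))) \<le> ?H (A' (Suc (Suc (Suc n))))" for n
  proof -
    have "1 / real (Suc (Suc (Suc n))) < 1 / real (Suc (Suc n))"
      by (rule divide_strict_left_mono) auto
    then have pos: "0 < 1 / real (Suc (Suc n)) - 1 / real (Suc (Suc (Suc n)))" by simp
    have "?H (A' (Suc n)) + ?H (R (Suc (Suc n))) \<le> ?H (A' (Suc n) \<union> R (Suc (Suc n)))"
    proof (rule hausdorff_outer_separated[OF pos])
      fix x y assume "x \<in> A' (Suc n)" "y \<in> R (Suc (Suc n))"
      then have "1 / real (Suc (Suc n)) \<le> infdist x F" "infdist y F < 1 / real (Suc (Suc (Suc n)))"
        by (auto simp: A'_def R_def)
      then show "1 / real (Suc (Suc n)) - 1 / real (Suc (Suc (Suc n))) \<le> dist x y"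
        using infdist_triangle[of x F y] by linarith
    qed
    also have "\<dots> \<le> ?H (A' (Suc (Suc (Suc n))))"
      using A'_mono[of "Suc n" "Suc (Suc (Suc n))"] by (intro hausdorff_outer_mono) (auto simp: R_def)
    finally show ?thesis .
  qed
  have even: "(\<Sum>i<n. ?H (R (Suc (Suc (2*i))))) \<le> ?H (A' (Suc (2*n)))" for n
  proof (induction n)
    case (Suc n)
    have "(\<Sum>i<Suc n. ?H (R (Suc (Suc (2*i))))) \<le> ?H (A' (Suc (2*n))) + ?H (R (Suc (Suc (2*n))))"
      using Suc by (simp add: add_right_mono)
    also have "\<dots> \<le> ?H (A' (Suc (Suc (Suc (2*n)))))" by (rule sep_R)
    finally show ?case by simp
  qed simp
  have odd: "(\<Sum>i<n. ?H (R (Suc (Suc (Suc (2*i)))))) \<le> ?H (A' (Suc (Suc (2*n))))" for n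
  proof (induction n)
    case (Suc n)
    have "(\<Sum>i<Suc n. ?H (R (Suc (Suc (Suc (2*i)))))) \<le> ?H (A' (Suc (Suc (2*n)))) + ?H (R (Suc (Suc (Suc (2*n)))))"
      using Suc by (simp add: add_right_mono)
    also have "\<dots> \<le> ?H (A' (Suc (Suc (Suc (Suc (2*n))))))" using sep_R[of "Suc (2*n)"] by simp
    finally show ?case by simp
  qed simp
  have part: "(\<Sum>i<n. ?H (R (i + 2))) \<le> 2 * ?H A" for n
  proof -
    have "(\<Sum>i<n. ?H (R (i + 2))) \<le> (\<Sum>i<2*n. ?H (R (i + 2)))"
      by (rule sum_mono2) auto
    also have "\<dots> = (\<Sum>i<n. ?H (R (Suc (Suc (2*i))))) + (\<Sum>i<n. ?H (R (Suc (Suc (Suc (2*i))))))"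
      by (induction n) (simp_all add: add_ac)
    also have "\<dots> \<le> ?H A + ?H A"
      by (intro add_mono order_trans[OF even] order_trans[OF odd] hausdorff_outer_mono A'_sub)
    finally show ?thesis by (simp add: mult_2)
  qed
  have "(\<Sum>i. ?H (R (i + 2))) \<le> 2 * ?H A"
    unfolding suminf_eq_SUP by (intro SUP_least part)
  then have sfin: "(\<Sum>i. ?H (R (i + 2))) < \<infinity>"
    using fin by (simp add: ennreal_mult_less_top order_le_less_trans)
  \<comment> \<open>A point of \<open>A - F\<close> has positive distance from the closed set
    \<open>F\<close>, so it lies in some \<open>A' j\<close>. If the least such \<open>j\<close>
    exceeds \<open>n + 2\<close>, the point lies in the shell \<open>R (j - 1)\<close>, whose index
    is at least \<open>n + 2\<close>.\<close>
  have tail: "?H (A - F) \<le> ?H (A' (n + 2)) + (\<Sum>i. ?H (R (i + n + 2)))" for n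
  proof -
    have "A - F \<subseteq> A' (n + 2) \<union> (\<Union>i. R (i + n + 2))"
    proof
      fix x assume x: "x \<in> A - F"
      then have "0 < infdist x F" using assms F
        by (metis DiffD2 infdist_nonneg in_closed_iff_infdist_zero order_less_le)
      then obtain m where "inverse (real (Suc m)) < infdist x F" using reals_Archimedean by blast
      then have xm: "x \<in> A' m" using x by (auto simp: A'_def inverse_eq_divide)
      define j where "j = (LEAST j. x \<in> A' j)"
      have xj: "x \<in> A' j" unfolding j_def using xm by (rule LeastI)
      show "x \<in> A' (n + 2) \<union> (\<Union>i. R (i + n + 2))"
      proof (cases "j \<le> n + 2")
        case True then show ?thesis using A'_mono[OF True] xj by auto
      next
        case False
        then have "x \<notin> A' (j - 1)" using not_less_Least[of "j - 1" "\<lambda>j. x \<in> A' j"] j_def by auto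
        then have "x \<in> R (j - 1)" using xj False by (auto simp: R_def)
        moreover have "j - 1 = (j - n - 3) + n + 2" using False by simp
        ultimately have "x \<in> (\<Union>i. R (i + n + 2))" by (intro UN_I[of "j - n - 3"]) auto
          then show ?thesis by blast
      qed
    qed
    then have "?H (A - F) \<le> ?H (A' (n + 2) \<union> (\<Union>i. R (i + n + 2)))" by (rule hausdorff_outer_mono)
    also have "\<dots> \<le> ?H (A' (n + 2)) + (\<Sum>i. ?H (R (i + n + 2)))"
      by (intro order_trans[OF hausdorff_outer_Un] add_left_mono hausdorff_outer_UN)
    finally show ?thesis .
  qed
  show ?thesis
  proof (rule ennreal_le_epsilon)
    fix e :: real assume "0 < e"
    have "(\<lambda>n. \<Sum>i. ?H (R (i + n + 2))) \<longlonglongrightarrow> 0"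
    proof -
      obtain r where r: "\<And>i. ?H (R (i + 2)) = ennreal (r i)" "\<And>i. 0 \<le> r i"
      proof -
        have "?H (R (i + 2)) < \<infinity>" for i using ennreal_suminf_lessD[OF sfin] by auto
        then have "?H (R (i + 2)) = ennreal (enn2real (?H (R (i + 2))))" for i
          by (simp add: less_top)
        then show ?thesis using that[of "\<lambda>i. enn2real (?H (R (i + 2)))"] by auto
      qed
      have s: "summable r" using r sfin by (intro summable_suminf_not_top) auto
      have "(\<lambda>n. ennreal (\<Sum>i. r (i + n))) \<longlonglongrightarrow> ennreal 0"
        using suminf_exist_split2[OF s] by (intro tendsto_ennrealI) auto
      moreover have "ennreal (\<Sum>i. r (i + n)) = (\<Sum>i. ?H (R (i + n + 2)))" for n
        using s r(2) by (subst suminf_ennreal2[symmetric]) (auto simp: r(1)[symmetric] summable_ignore_initial_segment)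
      ultimately show ?thesis by simp
    qed
    then have "\<forall>\<^sub>F n in sequentially. (\<Sum>i. ?H (R (i + n + 2))) < ennreal e"
      using \<open>0 < e\<close> by (intro order_tendstoD(2)) auto
    then obtain n where n: "(\<Sum>i. ?H (R (i + n + 2))) < ennreal e"
      by (auto simp: eventually_sequentially)
    have "?H (F \<inter> A) + ?H (A - F) \<le> ?H (F \<inter> A) + (?H (A' (n + 2)) + ennreal e)"
      using n by (intro add_left_mono order_trans[OF tail[of n]]) auto
    also have "\<dots> \<le> ?H A + ennreal e"
      unfolding add.assoc[symmetric] by (intro add_right_mono sep_F)
    finally show "?H (F \<inter> A) + ?H (A - F) \<le> ?H A + ennreal e" .
  qed
qed

lemma measure_space_hausdorff_outer:
  "measure_space UNIV (sets (borel :: 'a::metric_space measure)) (hausdorff_outer k)"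
proof -
  have oms: "outer_measure_space (Pow UNIV) (hausdorff_outer k :: 'a set \<Rightarrow> _)"
    unfolding outer_measure_space_def positive_def increasing_def countably_subadditive_def
    by (auto intro: hausdorff_outer_mono hausdorff_outer_UN)
  interpret P: sigma_algebra UNIV "Pow UNIV :: 'a set set" by (rule sigma_algebra_Pow)
  let ?L = "lambda_system UNIV (Pow UNIV) (hausdorff_outer k :: 'a set \<Rightarrow> _)"
  have ms: "measure_space UNIV ?L (hausdorff_outer k)" by (rule P.caratheodory_lemma[OF oms])
  then have sa: "sigma_algebra UNIV ?L" by (simp add: measure_space_def)
  have cl: "{F. closed F} \<subseteq> ?L"
  proof clarify
    fix F :: "'a set" assume F: "closed F"
    show "F \<in> ?L" unfolding lambda_system_def
    proof (clarsimp)
      fix A :: "'a set"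
      have "A - F = (UNIV - F) \<inter> A" by auto
      then have "hausdorff_outer k (F \<inter> A) + hausdorff_outer k ((UNIV - F) \<inter> A) \<le> hausdorff_outer k A"
        using closed_caratheodory_hausdorff[OF F, of k A] by simp
      moreover have "hausdorff_outer k A \<le> hausdorff_outer k (F \<inter> A) + hausdorff_outer k ((UNIV - F) \<inter> A)"
        by (rule order_trans[OF _ hausdorff_outer_Un]) (rule hausdorff_outer_mono, auto)
      ultimately show "hausdorff_outer k (F \<inter> A) + hausdorff_outer k ((UNIV - F) \<inter> A) = hausdorff_outer k A"
        by (rule antisym)
    qed
  qed
  have "sets (borel :: 'a measure) = sigma_sets UNIV {F. closed F}"
    unfolding borel_eq_closed by (subst sets_measure_of) auto
  also have "\<dots> \<subseteq> ?L" by (rule sigma_algebra.sigma_sets_subset[OF sa cl])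
  finally have sub: "sets (borel :: 'a measure) \<subseteq> ?L" .
  show ?thesis
    by (rule measure_down[OF ms _ sub]) (use sets.sigma_algebra_axioms[of "borel :: 'a measure"] in simp)
qed

lemma sets_hausdorff_measure [simp, measurable_cong]: "sets (hausdorff_measure k) = sets borel"
  unfolding hausdorff_measure_def using sets.sigma_sets_eq[of borel] by (simp add: sets_measure_of)

lemma space_hausdorff_measure [simp]: "space (hausdorff_measure k) = UNIV"
  unfolding hausdorff_measure_def by (simp add: space_measure_of)

text \<open>\<open>measure_of\<close> falls back to the zero measure when the set function is not
  countably additive; \<open>measure_space_hausdorff_outer\<close> excludes this on the Borel
  sets.\<close>

lemma emeasure_hausdorff_measure:
  assumes "A \<in> sets borel"
  shows "emeasure (hausdorff_measure k) A = hausdorff_outer k A"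
proof (rule emeasure_measure_of[OF hausdorff_measure_def])
  have "measure_space UNIV (sets (borel::'a measure)) (hausdorff_outer k)" by (rule measure_space_hausdorff_outer)
  then show "positive (sets (hausdorff_measure k :: 'a measure)) (hausdorff_outer k)" "countably_additive (sets (hausdorff_measure k :: 'a measure)) (hausdorff_outer k)"
    by (auto simp: measure_space_def)
qed (use assms in auto)

section \<open>Hausdorff measure under Lipschitz maps and similarities\<close>

lemma hausdorff_outer_lipschitz:
  fixes \<phi> :: "'i \<Rightarrow> 'a::euclidean_space" and \<psi> :: "'i \<Rightarrow> 'b::euclidean_space"
  assumes L: "0 < L"
    and lip: "\<And>i j. i \<in> I \<Longrightarrow> j \<in> I \<Longrightarrow> dist (\<psi> i) (\<psi> j) \<le> L * dist (\<phi> i) (\<phi> j)"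
  shows "hausdorff_outer k (\<psi> ` I) \<le> ennreal (L ^ k) * hausdorff_outer k (\<phi> ` I)"
proof -
  have key: "hausdorff_premeasure k \<delta> (\<psi> ` I) \<le> ennreal (L ^ k) * hausdorff_premeasure k (\<delta> / L) (\<phi> ` I)"
    if "0 < \<delta>" for \<delta>
  proof -
    have "ennreal ((1 / L) ^ k) * hausdorff_premeasure k \<delta> (\<psi> ` I) \<le> hausdorff_premeasure k (\<delta> / L) (\<phi> ` I)"
      unfolding hausdorff_premeasure_def[of k "\<delta> / L"]
    proof (rule INF_greatest, clarify)
      fix U :: "nat \<Rightarrow> 'a set"
      assume cov: "\<phi> ` I \<subseteq> (\<Union>i. U i)" and U: "\<forall>i. bounded (U i) \<and> diameter (U i) \<le> \<delta> / L"
      \<comment> \<open>Transporting the cover through the index set admits parametrisations that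
        are not injective, such as the one of a cone, which collapses at the apex.\<close>
      define V where "V n = \<psi> ` {i \<in> I. \<phi> i \<in> U n}" for n
      have near: "dist x y \<le> L * diameter (U n)" if xy: "x \<in> V n" "y \<in> V n" for x y n
      proof -
        obtain i j where ij: "i \<in> I" "j \<in> I" "\<phi> i \<in> U n" "\<phi> j \<in> U n" "x = \<psi> i" "y = \<psi> j"
          using xy unfolding V_def by blast
        then have "dist x y \<le> L * dist (\<phi> i) (\<phi> j)" using lip by auto
        also have "\<dots> \<le> L * diameter (U n)"
          using ij U L by (intro mult_left_mono diameter_bounded_bound) auto
        finally show ?thesis .
      qed
      have dU: "0 \<le> diameter (U n)" for n using U by (intro diameter_ge_0) auto
      have bV: "bounded (V n)" for n
        using near[of _ n] bounded_two_points by blast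
      have dV: "diameter (V n) \<le> L * diameter (U n)" for n
        using near[of _ n] dU[of n] L by (intro diameter_le) (auto simp: dist_norm)
      have dV': "diameter (V n) \<le> \<delta>" for n
      proof -
        have "L * diameter (U n) \<le> L * (\<delta> / L)" using U L by (intro mult_left_mono) auto
        then show ?thesis using dV[of n] L by simp
      qed
      have w: "ennreal ((1 / L) ^ k) * hausdorff_weight k (V n) \<le> hausdorff_weight k (U n)" for n
      proof (cases "V n = {}")
        case False
        then have ne: "U n \<noteq> {}" by (auto simp: V_def)
        have "(1 / L) ^ k * (unit_ball_vol (real k) * (diameter (V n) / 2) ^ k)
             \<le> (1 / L) ^ k * (unit_ball_vol (real k) * (L * diameter (U n) / 2) ^ k)"
          using L dV[of n] diameter_ge_0[OF bV[of n]]
          by (intro mult_left_mono power_mono divide_right_mono) auto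
        also have "\<dots> = unit_ball_vol (real k) * (diameter (U n) / 2) ^ k"
          using L by (simp add: power_mult_distrib power_divide)
        finally have fin: "(1 / L) ^ k * (unit_ball_vol (real k) * (diameter (V n) / 2) ^ k)
            \<le> unit_ball_vol (real k) * (diameter (U n) / 2) ^ k" .
        have "ennreal ((1 / L) ^ k) * hausdorff_weight k (V n)
            = ennreal ((1 / L) ^ k * (unit_ball_vol (real k) * (diameter (V n) / 2) ^ k))"
          using False L by (simp add: hausdorff_weight_def ennreal_mult')
        also have "\<dots> \<le> ennreal (unit_ball_vol (real k) * (diameter (U n) / 2) ^ k)"
          by (rule ennreal_leI[OF fin])
        also have "\<dots> = hausdorff_weight k (U n)" using ne by (simp add: hausdorff_weight_def)
        finally show ?thesis .
      qed simp
      have "ennreal ((1 / L) ^ k) * hausdorff_premeasure k \<delta> (\<psi> ` I)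
          \<le> ennreal ((1 / L) ^ k) * (\<Sum>n. hausdorff_weight k (V n))"
        using cov bV dV' by (intro mult_left_mono hausdorff_premeasure_le) (fastforce simp: V_def)+
      also have "\<dots> = (\<Sum>n. ennreal ((1 / L) ^ k) * hausdorff_weight k (V n))" by simp
      also have "\<dots> \<le> (\<Sum>n. hausdorff_weight k (U n))" by (intro suminf_le w) auto
      finally show "ennreal ((1 / L) ^ k) * hausdorff_premeasure k \<delta> (\<psi> ` I) \<le> (\<Sum>n. hausdorff_weight k (U n))" .
    qed
    then have "ennreal (L ^ k) * (ennreal ((1 / L) ^ k) * hausdorff_premeasure k \<delta> (\<psi> ` I))
        \<le> ennreal (L ^ k) * hausdorff_premeasure k (\<delta> / L) (\<phi> ` I)"
      by (rule mult_left_mono) simp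
    moreover have "ennreal (L ^ k) * (ennreal ((1 / L) ^ k) * x) = x" for x
      using L by (simp add: mult.assoc[symmetric] ennreal_mult[symmetric] power_divide)
    ultimately show ?thesis by simp
  qed
  show ?thesis
    unfolding hausdorff_outer_def[of k "\<psi> ` I"]
  proof (rule SUP_least)
    fix \<delta> :: real assume "\<delta> \<in> {0<..}"
    then have "0 < \<delta>" by simp
    have "ennreal (L ^ k) * hausdorff_premeasure k (\<delta> / L) (\<phi> ` I) \<le> ennreal (L ^ k) * hausdorff_outer k (\<phi> ` I)"
      using \<open>0 < \<delta>\<close> L by (intro mult_left_mono hausdorff_premeasure_le_outer) auto
    with key[OF \<open>0 < \<delta>\<close>] show "hausdorff_premeasure k \<delta> (\<psi> ` I) \<le> ennreal (L ^ k) * hausdorff_outer k (\<phi> ` I)"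
      by (rule order_trans)
  qed
qed

lemma hausdorff_outer_similarity:
  fixes f :: "'a::euclidean_space \<Rightarrow> 'b::euclidean_space"
  assumes "0 < r" "\<And>x y. x \<in> A \<Longrightarrow> y \<in> A \<Longrightarrow> dist (f x) (f y) = r * dist x y"
  shows "hausdorff_outer k (f ` A) = ennreal (r ^ k) * hausdorff_outer k A"
proof (rule antisym)
  show "hausdorff_outer k (f ` A) \<le> ennreal (r ^ k) * hausdorff_outer k A"
    using hausdorff_outer_lipschitz[of r A f "\<lambda>x. x" k] assms by simp
  have "hausdorff_outer k ((\<lambda>x. x) ` A) \<le> ennreal ((1 / r) ^ k) * hausdorff_outer k (f ` A)"
    using assms by (intro hausdorff_outer_lipschitz) auto
  then have "ennreal (r ^ k) * hausdorff_outer k A \<le> ennreal (r ^ k) * (ennreal ((1 / r) ^ k) * hausdorff_outer k (f ` A))"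
    by (intro mult_left_mono) auto
  also have "\<dots> = hausdorff_outer k (f ` A)"
    using assms(1) by (simp add: mult.assoc[symmetric] ennreal_mult[symmetric] power_divide)
  finally show "ennreal (r ^ k) * hausdorff_outer k A \<le> hausdorff_outer k (f ` A)" .
qed

lemma hausdorff_outer_isometry:
  fixes f :: "'a::euclidean_space \<Rightarrow> 'b::euclidean_space"
  assumes "\<And>x y. x \<in> A \<Longrightarrow> y \<in> A \<Longrightarrow> dist (f x) (f y) = dist x y"
  shows "hausdorff_outer k (f ` A) = hausdorff_outer k A"
  using hausdorff_outer_similarity[of 1 A f k] assms by simp

lemma hausdorff_outer_translation:
  fixes v :: "'a::euclidean_space"
  shows "hausdorff_outer k ((+) v ` A) = hausdorff_outer k A"
  by (rule hausdorff_outer_isometry) simp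

lemma hausdorff_outer_scaleR:
  fixes A :: "'a::euclidean_space set"
  assumes "0 < r"
  shows "hausdorff_outer k ((*\<^sub>R) r ` A) = ennreal (r ^ k) * hausdorff_outer k A"
  using assms by (intro hausdorff_outer_similarity) (auto simp: dist_norm scaleR_diff_right[symmetric])

section \<open>Finiteness on bounded flat sets\<close>

lemma hausdorff_premeasure_Un:
  assumes "0 \<le> \<delta>"
  shows "hausdorff_premeasure k \<delta> (A \<union> B) \<le> hausdorff_premeasure k \<delta> A + hausdorff_premeasure k \<delta> B"
proof -
  have "hausdorff_premeasure k \<delta> (A \<union> B) \<le> hausdorff_premeasure k \<delta> (\<Union>i::nat. if i = 0 then A else if i = 1 then B else {})"
    by (rule hausdorff_premeasure_mono) (auto split: if_splits)
  also have "\<dots> \<le> (\<Sum>i::nat. hausdorff_premeasure k \<delta> (if i = 0 then A else if i = 1 then B else {}))"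
    by (rule hausdorff_premeasure_UN)
  also have "\<dots> = hausdorff_premeasure k \<delta> A + hausdorff_premeasure k \<delta> B"
    using assms by (subst suminf_finite[of "{0,1}"]) (auto simp: hausdorff_premeasure_empty)
  finally show ?thesis .
qed

lemma hausdorff_premeasure_finite_UN:
  assumes "finite I" "0 \<le> \<delta>"
  shows "hausdorff_premeasure k \<delta> (\<Union>i\<in>I. A i) \<le> (\<Sum>i\<in>I. hausdorff_premeasure k \<delta> (A i))"
  using assms(1)
proof (induction I)
  case empty then show ?case using assms(2) by (simp add: hausdorff_premeasure_empty)
next
  case (insert i I)
  then show ?case
    using hausdorff_premeasure_Un[OF assms(2), of k "A i" "\<Union>i\<in>I. A i"]
    by (auto intro: order_trans add_left_mono)
qed

text \<open>With \<open>k = card D\<close>, the cube splits into \<open>N ^ k\<close> cubes of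
  diameter at most \<open>k / N\<close> (by comparison with the sum of the coordinates). The powers
  of \<open>N\<close> cancel in the total weight, which leaves the bound \<open>W\<close> for every
  \<delta>.\<close>

lemma hausdorff_outer_cube_finite:
  fixes D :: "'a::euclidean_space set"
  assumes D: "D \<subseteq> Basis"
  shows "hausdorff_outer (card D) {x. (\<forall>b\<in>D. 0 \<le> x \<bullet> b \<and> x \<bullet> b < 1) \<and> (\<forall>b\<in>Basis - D. x \<bullet> b = 0)} < \<infinity>"
    (is "hausdorff_outer ?k ?C < _")
proof -
  have finD: "finite D" using finite_subset[OF D finite_Basis] .
  define W where "W = unit_ball_vol (real ?k) * (real ?k / 2) ^ ?k"
  have "hausdorff_outer ?k ?C \<le> ennreal W"
    unfolding hausdorff_outer_def
  proof (rule SUP_least)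
    fix \<delta> :: real assume \<delta>: "\<delta> \<in> {0<..}"
    obtain N0 where "real ?k / \<delta> < real N0" using reals_Archimedean2 by blast
    define N where "N = Suc N0"
    have N: "0 < N" "real ?k / real N \<le> \<delta>"
      using \<open>real ?k / \<delta> < real N0\<close> \<delta> by (auto simp: N_def field_simps)
    define G where "G = (PiE D (\<lambda>_. {..<N}) :: ('a \<Rightarrow> nat) set)"
    define Q where "Q g = {x. (\<forall>b\<in>D. real (g b) / N \<le> x \<bullet> b \<and> x \<bullet> b < (real (g b) + 1) / N) \<and> (\<forall>b\<in>Basis - D. x \<bullet> b = 0)}"
      for g :: "'a \<Rightarrow> nat"
    have cov: "?C \<subseteq> (\<Union>g\<in>G. Q g)"
    proof
      fix x assume x: "x \<in> ?C"
      define g where "g = restrict (\<lambda>b. nat \<lfloor>real N * (x \<bullet> b)\<rfloor>) D"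
      have "nat \<lfloor>real N * (x \<bullet> b)\<rfloor> < N" if "b \<in> D" for b
      proof -
        have "real N * (x \<bullet> b) < real N * 1" using x that N by (intro mult_strict_left_mono) auto
        moreover have "0 \<le> real N * (x \<bullet> b)" using x that by auto
        ultimately show ?thesis using N by (simp add: floor_less_iff nat_less_iff)
      qed
      then have "g \<in> G" by (auto simp: G_def g_def)
      moreover have "x \<in> Q g"
      proof -
        have "real (g b) / N \<le> x \<bullet> b \<and> x \<bullet> b < (real (g b) + 1) / N" if "b \<in> D" for b
        proof -
          have "0 \<le> real N * (x \<bullet> b)" using x that by auto
          then have "real (g b) \<le> real N * (x \<bullet> b)" "real N * (x \<bullet> b) < real (g b) + 1"
            using that by (auto simp: g_def of_nat_nat)
          then show ?thesis using N by (simp add: field_simps)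
        qed
        then show ?thesis using x by (auto simp: Q_def)
      qed
      ultimately show "x \<in> (\<Union>g\<in>G. Q g)" by auto
    qed
    have norm_Q: "norm (x - y) \<le> real ?k / N" if "x \<in> Q g" "y \<in> Q g" for x y g
    proof -
      have "norm (x - y) \<le> (\<Sum>b\<in>Basis. \<bar>(x - y) \<bullet> b\<bar>)" by (rule norm_le_l1)
      also have "\<dots> = (\<Sum>b\<in>D. \<bar>(x - y) \<bullet> b\<bar>)"
        using D that by (intro sum.mono_neutral_right) (auto simp: Q_def inner_diff_left)
      also have "\<dots> \<le> (\<Sum>b\<in>D. 1 / N)"
      proof (rule sum_mono)
        fix b assume "b \<in> D"
        then have "real (g b) / N \<le> x \<bullet> b" "x \<bullet> b < real (g b) / N + 1 / N"
          "real (g b) / N \<le> y \<bullet> b" "y \<bullet> b < real (g b) / N + 1 / N"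
          using that by (auto simp: Q_def add_divide_distrib)
        then show "\<bar>(x - y) \<bullet> b\<bar> \<le> 1 / N" by (simp add: inner_diff_left abs_le_iff)
      qed
      also have "\<dots> = real ?k / N" by simp
      finally show ?thesis .
    qed
    have bQ: "bounded (Q g)" for g
    proof (cases "Q g = {}")
      case False
      then obtain y where "y \<in> Q g" by auto
      then have "Q g \<subseteq> cball y (real ?k / N)" using norm_Q by (auto simp: dist_norm)
      then show ?thesis using bounded_cball bounded_subset by blast
    qed simp
    have dQ: "diameter (Q g) \<le> real ?k / N" for g
      using norm_Q[of _ g] by (intro diameter_le) auto
    have "hausdorff_premeasure ?k \<delta> ?C \<le> hausdorff_premeasure ?k \<delta> (\<Union>g\<in>G. Q g)"
      by (rule hausdorff_premeasure_mono[OF cov])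
    also have "\<dots> \<le> (\<Sum>g\<in>G. hausdorff_premeasure ?k \<delta> (Q g))"
      using \<delta> finD by (intro hausdorff_premeasure_finite_UN) (auto simp: G_def intro!: finite_PiE)
    also have "\<dots> \<le> (\<Sum>g\<in>G. ennreal (W / real N ^ ?k))"
    proof (rule sum_mono)
      fix g
      have "hausdorff_premeasure ?k \<delta> (Q g) \<le> hausdorff_weight ?k (Q g)"
        using bQ dQ[of g] N \<delta> by (intro hausdorff_premeasure_le_weight) auto
      also have "\<dots> \<le> ennreal (unit_ball_vol (real ?k) * (real ?k / N / 2) ^ ?k)"
        using dQ[of g] diameter_ge_0[OF bQ[of g]]
        by (auto simp: hausdorff_weight_def intro!: ennreal_leI mult_left_mono power_mono divide_right_mono)
      also have "\<dots> = ennreal (W / real N ^ ?k)" by (simp add: W_def power_divide)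
      finally show "hausdorff_premeasure ?k \<delta> (Q g) \<le> ennreal (W / real N ^ ?k)" .
    qed
    also have "\<dots> = of_nat (N ^ ?k) * ennreal (W / real N ^ ?k)"
      using finD by (simp add: G_def card_PiE)
    also have "\<dots> = ennreal (real (N ^ ?k)) * ennreal (W / real N ^ ?k)"
      by (simp only: ennreal_of_nat_eq_real_of_nat)
    also have "\<dots> = ennreal W" using N by (subst ennreal_mult'[symmetric]) (auto simp: W_def)
    finally show "hausdorff_premeasure ?k \<delta> ?C \<le> ennreal W" .
  qed
  then show ?thesis using le_less_trans by fastforce
qed

lemma hausdorff_outer_bounded_finite:
  fixes D :: "'a::euclidean_space set"
  assumes D: "D \<subseteq> Basis" and "bounded A" and A: "\<And>x b. x \<in> A \<Longrightarrow> b \<in> Basis - D \<Longrightarrow> x \<bullet> b = 0"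
  shows "hausdorff_outer (card D) A < \<infinity>"
proof -
  let ?C = "{x::'a. (\<forall>b\<in>D. 0 \<le> x \<bullet> b \<and> x \<bullet> b < 1) \<and> (\<forall>b\<in>Basis - D. x \<bullet> b = 0)}"
  obtain R where R: "0 < R" "\<And>x. x \<in> A \<Longrightarrow> norm x < R"
    using \<open>bounded A\<close> by (meson bounded_pos_less)
  define v where "v = (\<Sum>b\<in>D. (- R) *\<^sub>R b)"
  have fD: "finite D" using finite_subset[OF D finite_Basis] .
  have vb: "v \<bullet> b = (if b \<in> D then - R else 0)" if "b \<in> Basis" for b
  proof -
    have "v \<bullet> b = (\<Sum>c\<in>D. if c = b then - R else 0)"
      unfolding v_def inner_sum_left using D that by (intro sum.cong) (auto simp: inner_Basis)
    then show ?thesis using fD by simp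
  qed
  have "A \<subseteq> (+) v ` ((*\<^sub>R) (2 * R) ` ?C)"
  proof
    fix x assume x: "x \<in> A"
    define y where "y = (1 / (2 * R)) *\<^sub>R (x - v)"
    have "y \<in> ?C"
    proof -
      have "0 \<le> y \<bullet> b \<and> y \<bullet> b < 1" if "b \<in> D" for b
      proof -
        have "b \<in> Basis" using that D by auto
        then have xb: "\<bar>x \<bullet> b\<bar> < R" using R(2)[OF x] Basis_le_norm[of b x] by linarith
        have yb: "y \<bullet> b = (x \<bullet> b + R) / (2 * R)" using that \<open>b \<in> Basis\<close> by (simp add: y_def inner_diff_left vb)
        show ?thesis unfolding yb using xb R(1) by (auto simp: field_simps)
      qed
      moreover have "y \<bullet> b = 0" if "b \<in> Basis - D" for b
        using that A[OF x that] by (simp add: y_def inner_diff_left vb)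
      ultimately show ?thesis by auto
    qed
    moreover have "x = v + (2 * R) *\<^sub>R y" using R(1) by (simp add: y_def)
    ultimately show "x \<in> (+) v ` ((*\<^sub>R) (2 * R) ` ?C)" by blast
  qed
  then have "hausdorff_outer (card D) A \<le> hausdorff_outer (card D) ((+) v ` ((*\<^sub>R) (2 * R) ` ?C))"
    by (rule hausdorff_outer_mono)
  also have "\<dots> = ennreal ((2 * R) ^ card D) * hausdorff_outer (card D) ?C"
    using R(1) by (simp add: hausdorff_outer_translation hausdorff_outer_scaleR)
  also have "\<dots> < \<infinity>" using hausdorff_outer_cube_finite[OF D] by (simp add: ennreal_mult_less_top)
  finally show ?thesis .
qed

section \<open>Comparison with Lebesgue measure\<close>

text \<open>The classical Fubini argument for uniqueness of Haar measure.\<close>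

lemma translation_invariant_lborel:
  fixes M :: "'a::euclidean_space measure"
  assumes sets[measurable_cong]: "sets M = sets borel" and sf: "sigma_finite_measure M"
    and inv: "\<And>v A. A \<in> sets borel \<Longrightarrow> emeasure M ((+) v ` A) = emeasure M A"
    and A[measurable]: "A \<in> sets borel" and Q[measurable]: "Q \<in> sets borel" and sym: "\<And>x. - x \<in> Q \<longleftrightarrow> x \<in> Q"
  shows "emeasure M Q * emeasure lborel A = emeasure lborel Q * emeasure M A"
proof -
  interpret M: sigma_finite_measure M by (rule sf)
  interpret pair_sigma_finite lborel M by unfold_locales
  have invM: "(\<integral>\<^sup>+x. f (x + v) \<partial>M) = (\<integral>\<^sup>+x. f x \<partial>M)" if [measurable]: "f \<in> borel_measurable borel" for f v
  proof -
    have "distr M borel (\<lambda>x. x + v) = M"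
    proof (rule measure_eqI)
      fix B assume "B \<in> sets (distr M borel (\<lambda>x. x + v))"
      then have [measurable]: "B \<in> sets borel" by simp
      have "emeasure (distr M borel (\<lambda>x. x + v)) B = emeasure M ((\<lambda>x. x + v) -` B \<inter> space M)"
        by (rule emeasure_distr) measurable
      also have "(\<lambda>x. x + v) -` B \<inter> space M = (+) (- v) ` B"
        using sets_eq_imp_space_eq[OF sets] by (auto simp: image_iff intro!: bexI[of _ "_ + v"])
      also have "emeasure M \<dots> = emeasure M B" by (rule inv) measurable
      finally show "emeasure (distr M borel (\<lambda>x. x + v)) B = emeasure M B" .
    qed (simp add: sets)
    then have "(\<integral>\<^sup>+x. f x \<partial>M) = (\<integral>\<^sup>+x. f x \<partial>distr M borel (\<lambda>x. x + v))" by simp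
    also have "\<dots> = (\<integral>\<^sup>+x. f (x + v) \<partial>M)" by (rule nn_integral_distr) measurable
    finally show ?thesis by simp
  qed
  have invL: "(\<integral>\<^sup>+x. f (v + x) \<partial>lborel) = (\<integral>\<^sup>+x. f x \<partial>lborel)" if [measurable]: "f \<in> borel_measurable borel" for f and v :: 'a
    using nn_integral_distr[of "\<lambda>x. v + x" lborel borel f] by (simp add: lborel_distr_plus)
  have "emeasure M Q * emeasure lborel A = (\<integral>\<^sup>+x. indicator Q x * emeasure lborel A \<partial>M)"
    by (simp add: nn_integral_multc sets)
  also have "\<dots> = (\<integral>\<^sup>+x. (\<integral>\<^sup>+y. indicator Q x * indicator A y \<partial>lborel) \<partial>M)"
    by (intro nn_integral_cong) (simp add: nn_integral_cmult)
  also have "\<dots> = (\<integral>\<^sup>+x. (\<integral>\<^sup>+y. indicator Q x * indicator A (x + y) \<partial>lborel) \<partial>M)"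
    by (intro nn_integral_cong invL[symmetric]) measurable
  also have "\<dots> = (\<integral>\<^sup>+y. (\<integral>\<^sup>+x. indicator Q x * indicator A (x + y) \<partial>M) \<partial>lborel)"
    by (rule Fubini') measurable
  also have "\<dots> = (\<integral>\<^sup>+y. (\<integral>\<^sup>+x. indicator Q (x - y) * indicator A x \<partial>M) \<partial>lborel)"
  proof (rule nn_integral_cong)
    fix y
    show "(\<integral>\<^sup>+x. indicator Q x * indicator A (x + y) \<partial>M) = (\<integral>\<^sup>+x. indicator Q (x - y) * indicator A x \<partial>M)"
      using invM[of "\<lambda>x. indicator Q (x - y) * indicator A x" y] by simp
  qed
  also have "\<dots> = (\<integral>\<^sup>+x. (\<integral>\<^sup>+y. indicator Q (x - y) * indicator A x \<partial>lborel) \<partial>M)"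
    by (rule Fubini'[symmetric]) measurable
  also have "\<dots> = (\<integral>\<^sup>+x. emeasure lborel Q * indicator A x \<partial>M)"
  proof (rule nn_integral_cong)
    fix x
    have "(\<integral>\<^sup>+y. indicator Q (x - y) * indicator A x \<partial>lborel) = (\<integral>\<^sup>+y. indicator Q (x - y) \<partial>lborel) * indicator A x"
      by (rule nn_integral_multc) measurable
    also have "(\<integral>\<^sup>+y. indicator Q (x - y) \<partial>lborel) = (\<integral>\<^sup>+y. indicator Q (- x + y) \<partial>lborel)"
      using sym[of "x - _"] by (intro nn_integral_cong) (auto simp: indicator_def)
    also have "\<dots> = (\<integral>\<^sup>+y. indicator Q y \<partial>lborel)" by (rule invL) measurable
    finally show "(\<integral>\<^sup>+y. indicator Q (x - y) * indicator A x \<partial>lborel) = emeasure lborel Q * indicator A x" by simp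
  qed
  also have "\<dots> = emeasure lborel Q * emeasure M A" by (simp add: nn_integral_cmult sets)
  finally show ?thesis .
qed

lemma emeasure_lborel_unit_ball:
  "0 < emeasure lborel (ball (0::'a::euclidean_space) 1)" "emeasure lborel (ball (0::'a::euclidean_space) 1) < \<infinity>"
  by (simp_all add: emeasure_ball)

text \<open>The factor is found by testing on the unit ball, which is symmetric and has finite
  positive volume. Finiteness on balls supplies \<sigma>-finiteness.\<close>

lemma translation_invariant_lborel_const:
  fixes M :: "'a::euclidean_space measure"
  assumes "sets M = sets borel" "\<And>v A. A \<in> sets borel \<Longrightarrow> emeasure M ((+) v ` A) = emeasure M A"
    and "\<And>r. emeasure M (ball 0 r) < \<infinity>" and A: "A \<in> sets borel"
  shows "emeasure M A = emeasure M (ball 0 1) / emeasure lborel (ball (0::'a) 1) * emeasure lborel A"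
proof -
  have sp: "space M = UNIV" using sets_eq_imp_space_eq[OF assms(1)] by simp
  have "sigma_finite_measure M"
  proof
    show "\<exists>B. countable B \<and> B \<subseteq> sets M \<and> \<Union> B = space M \<and> (\<forall>a\<in>B. emeasure M a \<noteq> \<infinity>)"
    proof (intro exI conjI)
      show "\<Union> (range (\<lambda>n::nat. ball (0::'a) (real n))) = space M"
        by (auto simp: sp) (metis reals_Archimedean2)
      show "\<forall>a\<in>range (\<lambda>n::nat. ball (0::'a) (real n)). emeasure M a \<noteq> \<infinity>" using assms(3) by (auto simp: less_top)
    qed (auto simp: assms(1))
  qed
  then have eq: "emeasure M (ball 0 1) * emeasure lborel A = emeasure lborel (ball (0::'a) 1) * emeasure M A"
    using assms by (intro translation_invariant_lborel) auto
  let ?b = "emeasure lborel (ball (0::'a) 1)"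
  have "emeasure M (ball 0 1) / ?b * emeasure lborel A = (?b * emeasure M A) / ?b"
    by (metis eq ennreal_times_divide mult.commute)
  also have "\<dots> = emeasure M A"
    using emeasure_lborel_unit_ball[where 'a='a]
    by (metis ennreal_mult_divide_eq infinity_ennreal_def less_irrefl mult.commute)
  finally show ?thesis by simp
qed

text \<open>A covering set lies in the ball around one of its points whose radius is its diameter.
  The weight uses half the diameter, hence the factor \<open>2 ^ n\<close>. The bound serves to show
  that the Hausdorff measure of the unit ball is not 0.\<close>

lemma lborel_le_hausdorff_outer:
  fixes A :: "'a::euclidean_space set"
  assumes A: "A \<in> sets borel"
  shows "emeasure lborel A \<le> ennreal (2 ^ DIM('a)) * hausdorff_outer (DIM('a)) A"
proof -
  let ?n = "DIM('a)"
  have "ennreal ((1/2) ^ ?n) * emeasure lborel A \<le> hausdorff_premeasure ?n 1 A"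
    unfolding hausdorff_premeasure_def
  proof (rule INF_greatest, clarify)
    fix U :: "nat \<Rightarrow> 'a set"
    assume cov: "A \<subseteq> (\<Union>i. U i)" and U: "\<forall>i. bounded (U i) \<and> diameter (U i) \<le> 1"
    define V where "V i = (if U i = {} then {} else cball (SOME x. x \<in> U i) (diameter (U i)))" for i
    have UV: "U i \<subseteq> V i" for i
    proof
      fix x assume x: "x \<in> U i"
      then have "(SOME x. x \<in> U i) \<in> U i" by (rule someI)
      then have "dist (SOME x. x \<in> U i) x \<le> diameter (U i)"
        using U x by (intro diameter_bounded_bound) auto
      then show "x \<in> V i" using x by (auto simp: V_def)
    qed
    have w: "emeasure lborel (V i) = ennreal (2 ^ ?n) * hausdorff_weight ?n (U i)" for i
      using diameter_ge_0[of "U i"] U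
      by (auto simp: V_def hausdorff_weight_def emeasure_cball ennreal_mult[symmetric] power_divide)
    have "emeasure lborel A \<le> emeasure lborel (\<Union>i. V i)"
    proof (rule emeasure_mono)
      show "A \<subseteq> (\<Union>i. V i)" using cov UV by blast
      show "(\<Union>i. V i) \<in> sets lborel" by (auto simp: V_def)
    qed
    also have "\<dots> \<le> (\<Sum>i. emeasure lborel (V i))"
      by (intro emeasure_subadditive_countably) (auto simp: V_def)
    also have "\<dots> = ennreal (2 ^ ?n) * (\<Sum>i. hausdorff_weight ?n (U i))" by (simp add: w)
    finally have "ennreal ((1/2) ^ ?n) * emeasure lborel A
        \<le> ennreal ((1/2) ^ ?n) * (ennreal (2 ^ ?n) * (\<Sum>i. hausdorff_weight ?n (U i)))"
      by (rule mult_left_mono) simp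
    also have "\<dots> = (\<Sum>i. hausdorff_weight ?n (U i))"
      by (simp add: mult.assoc[symmetric] ennreal_mult[symmetric] power_divide)
    finally show "ennreal ((1/2) ^ ?n) * emeasure lborel A \<le> (\<Sum>i. hausdorff_weight ?n (U i))" .
  qed
  also have "\<dots> \<le> hausdorff_outer ?n A" by (rule hausdorff_premeasure_le_outer) simp
  finally have "ennreal (2 ^ ?n) * (ennreal ((1/2) ^ ?n) * emeasure lborel A) \<le> ennreal (2 ^ ?n) * hausdorff_outer ?n A"
    by (rule mult_left_mono) simp
  moreover have "ennreal (2 ^ ?n) * (ennreal ((1/2) ^ ?n) * x) = x" for x
    by (simp add: mult.assoc[symmetric] ennreal_mult[symmetric] power_divide)
  ultimately show ?thesis by simp
qed

lemma borel_translation_image: "A \<in> sets borel \<Longrightarrow> (+) (v::'a::euclidean_space) ` A \<in> sets borel"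
proof -
  assume [measurable]: "A \<in> sets borel"
  have "(+) v ` A = (\<lambda>x. x - v) -` A \<inter> space borel"
    by (auto simp: image_iff intro!: bexI[of _ "_ - v"])
  also have "\<dots> \<in> sets borel" by measurable
  finally show ?thesis .
qed

text \<open>Both measures are translation invariant and finite on balls, hence proportional.
  Finiteness comes from the cube bound, positivity of the factor from
  \<open>lborel_le_hausdorff_outer\<close>. In the applications \<open>c\<close> stands on both
  sides of a relation and is cancelled.\<close>

lemma hausdorff_outer_full_dimension:
  obtains c where "0 < c" "\<And>A :: 'a::euclidean_space set. A \<in> sets borel \<Longrightarrow>
    hausdorff_outer (DIM('a)) A = ennreal c * emeasure lborel A"
proof -
  let ?n = "DIM('a)"
  let ?c = "emeasure (hausdorff_measure ?n) (ball (0::'a) 1) / emeasure lborel (ball (0::'a) 1)"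
  have fin: "hausdorff_outer ?n (ball (0::'a) r) < \<infinity>" for r
    by (rule hausdorff_outer_bounded_finite) auto
  have eq: "hausdorff_outer ?n A = ?c * emeasure lborel A" if "A \<in> sets borel" for A :: "'a set"
    using translation_invariant_lborel_const[of "hausdorff_measure ?n", OF _ _ _ that] that fin
    by (simp add: emeasure_hausdorff_measure borel_translation_image hausdorff_outer_translation)
  have "emeasure lborel (ball (0::'a) 1) \<le> ennreal (2 ^ ?n) * hausdorff_outer ?n (ball (0::'a) 1)"
    by (rule lborel_le_hausdorff_outer) simp
  then have pos: "hausdorff_outer ?n (ball (0::'a) 1) \<noteq> 0"
    using emeasure_lborel_unit_ball(1)[where 'a='a] by auto
  have cfin: "?c < \<infinity>"
    using fin[of 1] emeasure_lborel_unit_ball(1)[where 'a='a]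
    by (auto simp: emeasure_hausdorff_measure ennreal_divide_eq_top_iff less_top[symmetric])
  have cpos: "?c \<noteq> 0" using eq[of "ball 0 1"] pos by auto
  show ?thesis
  proof (rule that)
    show "0 < enn2real ?c" using cfin cpos by (simp add: enn2real_positive_iff less_top zero_less_iff_neq_zero)
    fix A :: "'a set" assume "A \<in> sets borel"
    then show "hausdorff_outer ?n A = ennreal (enn2real ?c) * emeasure lborel A"
      using eq cfin by (simp add: less_top)
  qed
qed

lemma lborel_lipschitz:
  fixes \<phi> \<psi> :: "'i \<Rightarrow> 'a::euclidean_space"
  assumes L: "0 < L"
    and lip: "\<And>i j. i \<in> I \<Longrightarrow> j \<in> I \<Longrightarrow> dist (\<psi> i) (\<psi> j) \<le> L * dist (\<phi> i) (\<phi> j)"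
    and "\<phi> ` I \<in> sets borel" "\<psi> ` I \<in> sets borel"
  shows "emeasure lborel (\<psi> ` I) \<le> ennreal (L ^ DIM('a)) * emeasure lborel (\<phi> ` I)"
proof -
  obtain c where c: "0 < c" "\<And>A :: 'a set. A \<in> sets borel \<Longrightarrow>
    hausdorff_outer (DIM('a)) A = ennreal c * emeasure lborel A"
    using hausdorff_outer_full_dimension by blast
  have "ennreal (1 / c) * (ennreal c * emeasure lborel (\<psi> ` I))
      \<le> ennreal (1 / c) * (ennreal (L ^ DIM('a)) * (ennreal c * emeasure lborel (\<phi> ` I)))"
    using hausdorff_outer_lipschitz[of L I \<psi> \<phi> "DIM('a)"] L lip assms(3,4)
    by (intro mult_left_mono) (auto simp: c(2))
  moreover have "ennreal (1 / c) * (ennreal c * x) = x" for x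
    using c(1) by (simp add: mult.assoc[symmetric] ennreal_mult[symmetric])
  ultimately show ?thesis by (metis mult.left_commute)
qed

section \<open>Slicing by parallel hyperplanes\<close>

lemma orthogonal_transformation_dist:
  assumes "orthogonal_transformation f"
  shows "dist (f x) (f y) = dist x y"
  using orthogonal_transformation_norm[OF assms, of "x - y"] assms
  by (simp add: dist_norm orthogonal_transformation_def linear_diff)

lemma hausdorff_outer_hyperplane_finite:
  fixes u :: "real^'n"
  assumes u: "norm u = 1" and A: "bounded A" "\<And>x. x \<in> A \<Longrightarrow> x \<bullet> u = 0"
  shows "hausdorff_outer (CARD('n) - 1) A < \<infinity>"
proof -
  obtain i :: 'n where True by blast
  define b where "b = (axis i 1 :: real^'n)"
  have b: "b \<in> Basis" by (auto simp: b_def)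
  then have nb: "norm b = 1" by simp
  obtain f where f: "orthogonal_transformation f" "f u = b"
    using orthogonal_transformation_exists[of u b] u nb by auto
  have "hausdorff_outer (card (Basis - {b})) (f ` A) < \<infinity>"
  proof (rule hausdorff_outer_bounded_finite)
    show "bounded (f ` A)"
      using A(1) f(1) orthogonal_transformation_norm[OF f(1)] by (auto simp: bounded_iff)
    fix x c assume "x \<in> f ` A" "c \<in> Basis - (Basis - {b})"
    then show "x \<bullet> c = 0" using A(2) f by (auto simp: orthogonal_transformation_def)
  qed auto
  moreover have "hausdorff_outer (CARD('n) - 1) (f ` A) = hausdorff_outer (CARD('n) - 1) A"
    by (intro hausdorff_outer_isometry orthogonal_transformation_dist f(1))
  moreover have "card (Basis - {b}) = CARD('n) - 1" using b by simp
  ultimately show ?thesis by simp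
qed

text \<open>\<open>N\<close> is the image of the product of Hausdorff measure on the hyperplane and
  Lebesgue measure on the line under \<open>(x, t) \<mapsto> x + t u\<close>, hence a Borel measure.
  It is translation invariant and finite on balls, so it is proportional to Lebesgue
  measure.\<close>

lemma hyperplane_slices_unit:
  fixes u :: "real^'n"
  assumes u: "norm u = 1"
  defines "N \<equiv> \<lambda>A. \<integral>\<^sup>+t. hausdorff_outer (CARD('n) - 1) {x. x \<bullet> u = 0 \<and> x + t *\<^sub>R u \<in> A} \<partial>lborel"
  shows "N (ball 0 1) < \<infinity>"
    and "A \<in> sets borel \<Longrightarrow> N A = N (ball 0 1) / emeasure lborel (ball (0::real^'n) 1) * emeasure lborel A"
proof -
  let ?k = "CARD('n) - 1"
  let ?P = "{x. x \<bullet> u = 0}"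
  define M0 where "M0 = restrict_space (hausdorff_measure ?k) ?P"
  have uu: "u \<bullet> u = 1" using u by (simp add: norm_eq_1)
  have P[measurable]: "?P \<in> sets borel" by measurable
  have space_M0: "space M0 = ?P" by (simp add: M0_def space_restrict_space)
  have em_M0: "emeasure M0 B = hausdorff_outer ?k B" if "B \<in> sets borel" "B \<subseteq> ?P" for B
    using that by (simp add: M0_def emeasure_restrict_space emeasure_hausdorff_measure)
  interpret M0: sigma_finite_measure M0
  proof
    show "\<exists>B. countable B \<and> B \<subseteq> sets M0 \<and> \<Union> B = space M0 \<and> (\<forall>a\<in>B. emeasure M0 a \<noteq> \<infinity>)"
    proof (intro exI conjI)
      show "\<Union> (range (\<lambda>n::nat. ball 0 (real n) \<inter> ?P)) = space M0"
        by (auto simp: space_M0) (metis reals_Archimedean2)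
      show "range (\<lambda>n::nat. ball 0 (real n) \<inter> ?P) \<subseteq> sets M0"
        by (auto simp: M0_def sets_restrict_space image_iff)
      show "\<forall>a\<in>range (\<lambda>n::nat. ball 0 (real n) \<inter> ?P). emeasure M0 a \<noteq> \<infinity>"
      proof clarify
        fix n :: nat assume "emeasure M0 (ball 0 (real n) \<inter> ?P) = \<infinity>"
        moreover have "hausdorff_outer ?k (ball 0 (real n) \<inter> ?P) < \<infinity>"
          by (rule hausdorff_outer_hyperplane_finite[OF u]) (auto simp: bounded_Int)
        ultimately show False by (simp add: em_M0)
      qed
    qed auto
  qed
  interpret pair_sigma_finite M0 lborel by unfold_locales
  have fst_meas: "fst \<in> measurable (M0 \<Otimes>\<^sub>M lborel) borel"
  proof -
    have "(\<lambda>x. x) \<in> measurable M0 borel" unfolding M0_def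
      by (intro measurable_restrict_space1) (simp add: measurable_def)
    then show ?thesis using measurable_compose[OF measurable_fst] by fastforce
  qed
  define \<Phi> where "\<Phi> = (\<lambda>z. fst z + snd z *\<^sub>R u)"
  have \<Phi>[measurable]: "\<Phi> \<in> measurable (M0 \<Otimes>\<^sub>M lborel) borel"
    unfolding \<Phi>_def using fst_meas by measurable
  define NM where "NM = distr (M0 \<Otimes>\<^sub>M lborel) borel \<Phi>"
  let ?S = "\<lambda>A t. {x. x \<bullet> u = 0 \<and> x + t *\<^sub>R u \<in> A}"
  have slice_meas: "?S A t \<in> sets borel" if [measurable]: "A \<in> sets borel" for A t by measurable
  have vim: "(\<lambda>x. (x, t)) -` (\<Phi> -` A \<inter> space (M0 \<Otimes>\<^sub>M lborel)) = ?S A t" for A t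
    by (auto simp: \<Phi>_def space_pair_measure space_M0)
  have N_meas: "(\<lambda>t. hausdorff_outer ?k (?S A t)) \<in> borel_measurable lborel" if "A \<in> sets borel" for A
  proof -
    have "\<Phi> -` A \<inter> space (M0 \<Otimes>\<^sub>M lborel) \<in> sets (M0 \<Otimes>\<^sub>M lborel)" using that by measurable
    from measurable_emeasure_Pair2[OF this] show ?thesis
      unfolding vim using em_M0 slice_meas[OF that] by (subst (asm) em_M0) auto
  qed
  have em_NM: "emeasure NM A = N A" if [measurable]: "A \<in> sets borel" for A
  proof -
    have "emeasure NM A = emeasure (M0 \<Otimes>\<^sub>M lborel) (\<Phi> -` A \<inter> space (M0 \<Otimes>\<^sub>M lborel))"
      unfolding NM_def by (rule emeasure_distr) measurable
    also have "\<dots> = (\<integral>\<^sup>+t. emeasure M0 (?S A t) \<partial>lborel)"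
    proof -
      have Bm: "\<Phi> -` A \<inter> space (M0 \<Otimes>\<^sub>M lborel) \<in> sets (M0 \<Otimes>\<^sub>M lborel)" by measurable
      show ?thesis using emeasure_pair_measure_alt2[OF Bm] unfolding vim .
    qed
    also have "\<dots> = N A" unfolding N_def
      using slice_meas[OF that] by (intro nn_integral_cong em_M0) auto
    finally show ?thesis .
  qed
  have fin: "N (ball 0 r) < \<infinity>" for r
  proof (cases "0 < r")
    case True
    have "N (ball 0 r) \<le> (\<integral>\<^sup>+t. hausdorff_outer ?k (cball 0 r \<inter> ?P) * indicator {-r..r} t \<partial>lborel)"
      unfolding N_def
    proof (rule nn_integral_mono)
      fix t
      have nrm: "(norm (x + t *\<^sub>R u))\<^sup>2 = (norm x)\<^sup>2 + t\<^sup>2" if "x \<bullet> u = 0" for x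
        using that uu by (simp only: power2_norm_eq_inner) (simp add: inner_add_left inner_add_right inner_commute power2_eq_square)
      have sub: "norm x < r \<and> \<bar>t\<bar> < r" if "x \<in> ?S (ball 0 r) t" for x
      proof -
        have "(norm x)\<^sup>2 + t\<^sup>2 < r\<^sup>2"
          using that nrm[of x] power_strict_mono[of "norm (x + t *\<^sub>R u)" r 2] by simp
        moreover have "0 \<le> (norm x)\<^sup>2" "0 \<le> t\<^sup>2" by simp_all
        ultimately have "(norm x)\<^sup>2 < r\<^sup>2" "\<bar>t\<bar>\<^sup>2 < r\<^sup>2" unfolding power2_abs by linarith+
        then have "norm x < r" "\<bar>t\<bar> < r" using less_imp_le[OF True] power_less_imp_less_base[of "norm x" 2 r] power_less_imp_less_base[of "\<bar>t\<bar>" 2 r] by blast+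
        then show ?thesis by simp
      qed
      show "hausdorff_outer ?k (?S (ball 0 r) t) \<le> hausdorff_outer ?k (cball 0 r \<inter> ?P) * indicator {-r..r} t"
      proof (cases "?S (ball 0 r) t = {}")
        case False
        then obtain x where "x \<in> ?S (ball 0 r) t" by blast
        then have "t \<in> {-r..r}" using sub[of x] by auto
        moreover have "hausdorff_outer ?k (?S (ball 0 r) t) \<le> hausdorff_outer ?k (cball 0 r \<inter> ?P)"
          using sub by (intro hausdorff_outer_mono) force
        ultimately show ?thesis by simp
      next
        case True
        show ?thesis unfolding True by simp
      qed
    qed
    also have "\<dots> = hausdorff_outer ?k (cball 0 r \<inter> ?P) * ennreal (2 * r)"
      using True by (simp add: nn_integral_cmult)
    also have "\<dots> < \<infinity>"
    proof -
      have "hausdorff_outer ?k (cball 0 r \<inter> ?P) < \<infinity>"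
        by (rule hausdorff_outer_hyperplane_finite[OF u]) (auto simp: bounded_Int)
      then show ?thesis by (simp add: ennreal_mult_less_top)
    qed
    finally show ?thesis .
  next
    case False
    then have "ball (0::real^'n) r = {}" by auto
    then have "N (ball 0 r) = N {}" by (rule arg_cong)
    also have "\<dots> = 0" by (simp add: N_def)
    finally show ?thesis by simp
  qed
  then show "N (ball 0 1) < \<infinity>" .
  \<comment> \<open>The vector \<open>v\<close> splits into \<open>s u\<close>, which shifts the
    heights of the slices and is absorbed by the integral over \<open>t\<close>, and
    \<open>w\<close>, which moves every slice within its own hyperplane.\<close>
  have inv: "N ((+) v ` A) = N A" if [measurable]: "A \<in> sets borel" for v A
  proof -
    define s where "s = v \<bullet> u"
    define w where "w = v - s *\<^sub>R u"
    have w: "w \<bullet> u = 0" by (simp add: w_def s_def inner_diff_left uu)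
    have "?S ((+) v ` A) t = (+) w ` ?S A (- s + 1 * t)" for t
    proof (intro Set.set_eqI iffI)
      fix x assume "x \<in> ?S ((+) v ` A) t"
      then obtain a where a: "x \<bullet> u = 0" "a \<in> A" "x + t *\<^sub>R u = v + a" by auto
      then have "(x - w) + (- s + 1 * t) *\<^sub>R u = a" by (simp add: w_def algebra_simps)
      then have "x - w \<in> ?S A (- s + 1 * t)" using a w by (simp add: inner_diff_left)
      moreover have "x = w + (x - w)" by simp
      ultimately show "x \<in> (+) w ` ?S A (- s + 1 * t)" by (rule image_eqI[rotated])
    next
      fix x assume "x \<in> (+) w ` ?S A (- s + 1 * t)"
      then obtain y where y: "x = w + y" "y \<bullet> u = 0" "y + (- s + 1 * t) *\<^sub>R u \<in> A" by blast
      have "x + t *\<^sub>R u = v + (y + (- s + 1 * t) *\<^sub>R u)" by (simp add: y(1) w_def algebra_simps)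
      then have "x + t *\<^sub>R u \<in> (+) v ` A" using y(3) by (rule image_eqI)
      moreover have "x \<bullet> u = 0" using y w by (simp add: inner_add_left)
      ultimately show "x \<in> ?S ((+) v ` A) t" by simp
    qed
    then have "N ((+) v ` A) = (\<integral>\<^sup>+t. hausdorff_outer ?k (?S A (- s + 1 * t)) \<partial>lborel)"
      unfolding N_def by (simp add: hausdorff_outer_translation)
    also have "\<dots> = N A"
      unfolding N_def using nn_integral_real_affine[of "\<lambda>t. hausdorff_outer ?k (?S A t)" 1 "- s"] N_meas[of A]
      by simp
    finally show ?thesis .
  qed
  show "N A = N (ball 0 1) / emeasure lborel (ball (0::real^'n) 1) * emeasure lborel A" if "A \<in> sets borel"
  proof -
    have "sets NM = sets borel" by (simp add: NM_def)
    moreover have "emeasure NM ((+) v ` A) = emeasure NM A" if "A \<in> sets borel" for v A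
      using that by (simp add: em_NM inv borel_translation_image)
    moreover have "emeasure NM (ball 0 r) < \<infinity>" for r using fin by (simp add: em_NM)
    ultimately show ?thesis
      using translation_invariant_lborel_const[of NM A] that by (simp add: em_NM)
  qed
qed

text \<open>An orthogonal map that takes \<open>u0\<close> to \<open>u\<close> carries the slices of
  the unit ball orthogonal to \<open>u0\<close> onto those orthogonal to \<open>u\<close>, so the
  factor is the same for all directions.\<close>

lemma hyperplane_slices_exist:
  "\<exists>c\<ge>0. \<forall>u (A :: (real^'n) set). norm u = 1 \<longrightarrow> A \<in> sets borel \<longrightarrow>
     (\<integral>\<^sup>+t. hausdorff_outer (CARD('n) - 1) {x. x \<bullet> u = 0 \<and> x + t *\<^sub>R u \<in> A} \<partial>lborel) = ennreal c * emeasure lborel A"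
proof -
  let ?k = "CARD('n) - 1"
  define N where "N u A = (\<integral>\<^sup>+t. hausdorff_outer ?k {x. x \<bullet> u = 0 \<and> x + t *\<^sub>R u \<in> A} \<partial>lborel)" for u and A :: "(real^'n) set"
  obtain u0 :: "real^'n" where u0: "norm u0 = 1" using vector_choose_size[of 1] by auto
  let ?c = "N u0 (ball 0 1) / emeasure lborel (ball (0::real^'n) 1)"
  have "?c < \<infinity>" using hyperplane_slices_unit(1)[OF u0] emeasure_lborel_unit_ball(1)[where 'a="real^'n"]
    by (auto simp: ennreal_divide_eq_top_iff less_top[symmetric] N_def)
  then have c: "?c = ennreal (enn2real ?c)" by (simp add: less_top)
  have same: "N u (ball 0 1) = N u0 (ball 0 1)" if u: "norm u = 1" for u
  proof -
    obtain f where f: "orthogonal_transformation f" "f u0 = u"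
      using orthogonal_transformation_exists[of u0 u] u u0 by auto
    have lin: "linear f" using f(1) by (simp add: orthogonal_transformation_def)
    have "{x. x \<bullet> u = 0 \<and> x + t *\<^sub>R u \<in> ball 0 1} = f ` {x. x \<bullet> u0 = 0 \<and> x + t *\<^sub>R u0 \<in> ball 0 1}" for t
    proof (rule Set.set_eqI, rule iffI)
      fix x assume x: "x \<in> {x. x \<bullet> u = 0 \<and> x + t *\<^sub>R u \<in> ball 0 1}"
      obtain y where y: "x = f y" using orthogonal_transformation_surj[OF f(1)] by blast
      have "f y + t *\<^sub>R f u0 = f (y + t *\<^sub>R u0)" by (simp add: linear_add[OF lin] linear_scale[OF lin])
      then show "x \<in> f ` {x. x \<bullet> u0 = 0 \<and> x + t *\<^sub>R u0 \<in> ball 0 1}"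
        using x f orthogonal_transformation_norm[OF f(1), of "y + t *\<^sub>R u0"]
        by (auto simp: y orthogonal_transformation_def)
    next
      fix x assume "x \<in> f ` {x. x \<bullet> u0 = 0 \<and> x + t *\<^sub>R u0 \<in> ball 0 1}"
      then obtain y where y: "x = f y" "y \<bullet> u0 = 0" "norm (y + t *\<^sub>R u0) < 1" by auto
      have "f y + t *\<^sub>R f u0 = f (y + t *\<^sub>R u0)" by (simp add: linear_add[OF lin] linear_scale[OF lin])
      then show "x \<in> {x. x \<bullet> u = 0 \<and> x + t *\<^sub>R u \<in> ball 0 1}"
        using y f orthogonal_transformation_norm[OF f(1), of "y + t *\<^sub>R u0"]
        by (auto simp: y orthogonal_transformation_def)
    qed
    then show ?thesis unfolding N_def
      using hausdorff_outer_isometry[of _ f] orthogonal_transformation_dist[OF f(1)] by simp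
  qed
  have "N u A = ennreal (enn2real ?c) * emeasure lborel A" if "norm u = 1" "A \<in> sets borel" for u A
    using hyperplane_slices_unit(2)[OF that] same[OF that(1)] c by (simp add: N_def)
  then show ?thesis unfolding N_def by (intro exI[of _ "enn2real ?c"]) (auto simp: N_def)
qed

text \<open>\<open>hausdorff_scale\<close> is the ratio between the Hausdorff and the Lebesgue measure of hyperplanes.
  Its value (which is 1) never matters, since it occurs on both sides of the Minkowski equation.\<close>

definition hausdorff_scale :: "'n::finite itself \<Rightarrow> real" where
  "hausdorff_scale _ = (SOME c. 0 \<le> c \<and> (\<forall>u (A :: (real^'n) set). norm u = 1 \<longrightarrow> A \<in> sets borel \<longrightarrow>
     (\<integral>\<^sup>+t. hausdorff_outer (CARD('n) - 1) {x. x \<bullet> u = 0 \<and> x + t *\<^sub>R u \<in> A} \<partial>lborel) = ennreal c * emeasure lborel A))"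

lemma hausdorff_scale:
  shows "0 \<le> hausdorff_scale TYPE('n::finite)"
    and "norm u = 1 \<Longrightarrow> A \<in> sets borel \<Longrightarrow>
     (\<integral>\<^sup>+t. hausdorff_outer (CARD('n) - 1) {x. x \<bullet> u = 0 \<and> x + t *\<^sub>R u \<in> A} \<partial>lborel)
       = ennreal (hausdorff_scale TYPE('n)) * emeasure lborel (A :: (real^'n) set)"
  using someI_ex[OF hyperplane_slices_exist[where 'n='n]] unfolding hausdorff_scale_def by auto

section \<open>Cones with apex at the origin\<close>

definition cone_of :: "'a::real_vector set \<Rightarrow> 'a set" where
  "cone_of B = (\<lambda>(t, x). t *\<^sub>R x) ` ({0..1} \<times> B)"

lemma cone_of_image: "cone_of B = (\<lambda>z. fst z *\<^sub>R snd z) ` ({0..1} \<times> B)"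
  by (simp add: cone_of_def case_prod_beta)

lemma compact_cone_of: "compact B \<Longrightarrow> compact (cone_of (B :: 'a::real_normed_vector set))"
  unfolding cone_of_image by (intro compact_continuous_image compact_Times continuous_intros) auto

text \<open>At height \<open>s\<close> the cone is a copy of the base scaled by
  \<open>s / h\<close>, and the integral of \<open>(s / h) ^ (n - 1)\<close> over
  \<open>[0, h]\<close> is \<open>h / n\<close>.\<close>

lemma hausdorff_flat_cone:
  fixes u :: "real^'n"
  assumes u: "norm u = 1" and h: "0 < h" and B: "compact B" "\<And>x. x \<in> B \<Longrightarrow> x \<bullet> u = h"
  shows "ennreal h * hausdorff_outer (CARD('n) - 1) B
     = ennreal (hausdorff_scale TYPE('n) * real CARD('n)) * emeasure lborel (cone_of B)"
proof -
  let ?k = "CARD('n) - 1"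
  let ?H = "hausdorff_outer ?k"
  let ?c = "hausdorff_scale TYPE('n)"
  have uu: "u \<bullet> u = 1" using u by (simp add: norm_eq_1)
  have [measurable]: "cone_of B \<in> sets borel" by (rule borel_compact[OF compact_cone_of[OF B(1)]])
  \<comment> \<open>Height 0 is left out because the similarity needs a positive ratio
    \<open>s / h\<close>; it is a null set of heights.\<close>
  have slice: "?H {x. x \<bullet> u = 0 \<and> x + s *\<^sub>R u \<in> cone_of B} = ennreal ((s / h) ^ ?k) * indicator {0..h} s * ?H B"
    if s0: "s \<noteq> 0" for s
  proof (cases "0 < s \<and> s \<le> h")
    case True
    have "{x. x \<bullet> u = 0 \<and> x + s *\<^sub>R u \<in> cone_of B} = (\<lambda>x. (s / h) *\<^sub>R x - s *\<^sub>R u) ` B"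
    proof (intro Set.set_eqI iffI)
      fix x assume "x \<in> {x. x \<bullet> u = 0 \<and> x + s *\<^sub>R u \<in> cone_of B}"
      then obtain t b where x: "x \<bullet> u = 0" "b \<in> B" "x + s *\<^sub>R u = t *\<^sub>R b" by (auto simp: cone_of_def)
      have "(x + s *\<^sub>R u) \<bullet> u = t * h" using B(2)[OF x(2)] by (simp add: x(3))
      then have "s = t * h" using x(1) by (simp add: inner_add_left uu)
      then have "t = s / h" using h by simp
      then have "x = (s / h) *\<^sub>R b - s *\<^sub>R u" using x(3) by (simp add: eq_diff_eq)
      then show "x \<in> (\<lambda>x. (s / h) *\<^sub>R x - s *\<^sub>R u) ` B" using x(2) by blast
    next
      fix x assume "x \<in> (\<lambda>x. (s / h) *\<^sub>R x - s *\<^sub>R u) ` B"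
      then obtain b where b: "b \<in> B" "x = (s / h) *\<^sub>R b - s *\<^sub>R u" by blast
      have "s / h \<in> {0..1}" using True h by simp
      then have "x + s *\<^sub>R u \<in> cone_of B" using b by (force simp: cone_of_def)
      moreover have "x \<bullet> u = 0" using b B(2)[OF b(1)] h by (simp add: inner_diff_left uu)
      ultimately show "x \<in> {x. x \<bullet> u = 0 \<and> x + s *\<^sub>R u \<in> cone_of B}" by simp
    qed
    moreover have "?H ((\<lambda>x. (s / h) *\<^sub>R x - s *\<^sub>R u) ` B) = ennreal ((s / h) ^ ?k) * ?H B"
      using True h by (intro hausdorff_outer_similarity) (auto simp: dist_norm scaleR_diff_right[symmetric])
    ultimately show ?thesis using True by simp
  next
    case False
    have empty: "{x. x \<bullet> u = 0 \<and> x + s *\<^sub>R u \<in> cone_of B} = {}"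
    proof (rule ccontr)
      assume "\<not> ?thesis"
      then obtain x t b where x: "x \<bullet> u = 0" "b \<in> B" "0 \<le> t" "t \<le> 1" "x + s *\<^sub>R u = t *\<^sub>R b" by (auto simp: cone_of_def)
      have "(x + s *\<^sub>R u) \<bullet> u = t * h" using B(2)[OF x(2)] by (simp add: x(5))
      then have "s = t * h" using x(1) by (simp add: inner_add_left uu)
      then show False using False x h s0 mult_left_le_one_le[of h t] by (auto simp: zero_less_mult_iff)
    qed
    show ?thesis unfolding empty using False s0 by (auto simp: indicator_def)
  qed
  have "ennreal ?c * emeasure lborel (cone_of B) = (\<integral>\<^sup>+s. ?H {x. x \<bullet> u = 0 \<and> x + s *\<^sub>R u \<in> cone_of B} \<partial>lborel)"
    by (rule hausdorff_scale(2)[OF u, symmetric]) measurable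
  also have "\<dots> = (\<integral>\<^sup>+s. ennreal ((s / h) ^ ?k) * indicator {0..h} s * ?H B \<partial>lborel)"
  proof (rule nn_integral_cong_AE)
    have "AE s::real in lborel. s \<noteq> 0" by (rule AE_lborel_singleton)
    then show "AE s in lborel. ?H {x. x \<bullet> u = 0 \<and> x + s *\<^sub>R u \<in> cone_of B} = ennreal ((s / h) ^ ?k) * indicator {0..h} s * ?H B"
      by eventually_elim (rule slice)
  qed
  also have "\<dots> = (\<integral>\<^sup>+s. ennreal ((s / h) ^ ?k) * indicator {0..h} s \<partial>lborel) * ?H B"
    by (rule nn_integral_multc) measurable
  also have "(\<integral>\<^sup>+s. ennreal ((s / h) ^ ?k) * indicator {0..h} s \<partial>lborel) =
      ennreal ((h ^ CARD('n) / (h ^ ?k * CARD('n))) - (0 ^ CARD('n) / (h ^ ?k * CARD('n))))"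
  proof (rule nn_integral_FTC_Icc)
    fix s :: real
    show "((\<lambda>s. s ^ CARD('n) / (h ^ ?k * CARD('n))) has_real_derivative (s / h) ^ ?k) (at s)"
      using h by (auto intro!: derivative_eq_intros simp: power_divide)
  qed (use h in auto)
  also have "(h ^ CARD('n) / (h ^ ?k * CARD('n))) - (0 ^ CARD('n) / (h ^ ?k * CARD('n))) = h / CARD('n)"
    using h by (simp add: power_eq_if[of h "CARD('n)"])
  finally have eq: "ennreal ?c * emeasure lborel (cone_of B) = ennreal (h / CARD('n)) * ?H B" .
  have "ennreal (?c * real CARD('n)) * emeasure lborel (cone_of B) = ennreal (real CARD('n)) * (ennreal ?c * emeasure lborel (cone_of B))"
    using hausdorff_scale(1)[where 'n='n] by (simp add: ennreal_mult mult_ac)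
  also have "\<dots> = ennreal h * ?H B"
    unfolding eq using h by (simp add: mult.assoc[symmetric] ennreal_mult[symmetric])
  finally show ?thesis by simp
qed

section \<open>Support functions and normals\<close>

lemma support_fun_upper:
  assumes "compact K" "x \<in> K"
  shows "x \<bullet> u \<le> support_fun K u"
  unfolding support_fun_def
proof (rule cSUP_upper[OF assms(2)])
  have "compact ((\<lambda>x. x \<bullet> u) ` K)" by (intro compact_continuous_image assms continuous_intros)
  then show "bdd_above ((\<lambda>x. x \<bullet> u) ` K)" by (simp add: bounded_imp_bdd_above compact_imp_bounded)
qed

lemma support_fun_attained:
  assumes "compact K" "K \<noteq> {}"
  obtains x where "x \<in> K" "support_fun K u = x \<bullet> u"
proof -
  have "continuous_on K (\<lambda>x. x \<bullet> u)" by (intro continuous_intros)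
  from continuous_attains_sup[OF assms this]
  obtain x where x: "x \<in> K" "\<And>y. y \<in> K \<Longrightarrow> y \<bullet> u \<le> x \<bullet> u" by blast
  have "support_fun K u = x \<bullet> u"
    unfolding support_fun_def by (rule cSup_eq_maximum) (use x in auto)
  with x(1) show ?thesis by (rule that)
qed

lemma support_fun_least:
  assumes "K \<noteq> {}" "\<And>x. x \<in> K \<Longrightarrow> x \<bullet> u \<le> a"
  shows "support_fun K u \<le> a"
  unfolding support_fun_def using assms by (rule cSUP_least)

lemma support_fun_diff_le:
  assumes "compact K" "K \<noteq> {}" "K \<subseteq> cball 0 R"
  shows "support_fun K u - support_fun K v \<le> R * norm (u - v)"
proof -
  obtain x where x: "x \<in> K" "support_fun K u = x \<bullet> u" using support_fun_attained[OF assms(1,2)] by blast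
  have "support_fun K u - support_fun K v \<le> x \<bullet> u - x \<bullet> v"
    using support_fun_upper[OF assms(1) x(1), of v] x(2) by simp
  also have "\<dots> = x \<bullet> (u - v)" by (simp add: inner_diff_right)
  also have "\<dots> \<le> norm x * norm (u - v)" by (rule norm_cauchy_schwarz)
  also have "\<dots> \<le> R * norm (u - v)" using x(1) assms(3) by (intro mult_right_mono) auto
  finally show ?thesis .
qed

lemma support_fun_lipschitz:
  assumes "compact K" "K \<noteq> {}" "K \<subseteq> cball 0 R"
  shows "\<bar>support_fun K u - support_fun K v\<bar> \<le> R * norm (u - v)"
  using support_fun_diff_le[OF assms, of u v] support_fun_diff_le[OF assms, of v u]
  by (simp add: norm_minus_commute)

lemma continuous_support_fun:
  assumes "compact K" "K \<noteq> {}"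
  shows "continuous_on S (support_fun K)"
proof -
  obtain R where R: "0 < R" "K \<subseteq> cball 0 R"
    using compact_imp_bounded[OF assms(1)] unfolding bounded_pos by (auto simp: subset_eq)
  have "R-lipschitz_on S (support_fun K)"
    using support_fun_lipschitz[OF assms R(2)] R(1) by (intro lipschitz_onI) (auto simp: dist_norm)
  then show ?thesis by (rule lipschitz_on_continuous_on)
qed

lemma borel_measurable_support_fun [measurable]:
  assumes "compact K" "K \<noteq> {}"
  shows "support_fun K \<in> borel_measurable borel"
  using continuous_support_fun[OF assms, of UNIV] by (rule borel_measurable_continuous_onI)

lemma support_fun_nonneg:
  assumes "compact K" "0 \<in> K"
  shows "0 \<le> support_fun K u"
  using support_fun_upper[OF assms, of u] by simp

lemma support_fun_pos:
  assumes "compact K" "0 \<in> interior K" "norm u = 1"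
  shows "0 < support_fun K u"
proof -
  obtain e where e: "0 < e" "cball 0 e \<subseteq> K" using assms(2) by (auto simp: mem_interior_cball)
  have "(e *\<^sub>R u) \<bullet> u \<le> support_fun K u" using e assms by (intro support_fun_upper) auto
  then show ?thesis using e assms(3) by (simp add: norm_eq_1)
qed

lemma unit_normals_iff:
  assumes "compact K" "x \<in> K"
  shows "u \<in> unit_normals K x \<longleftrightarrow> norm u = 1 \<and> x \<bullet> u = support_fun K u"
proof
  assume "u \<in> unit_normals K x"
  then have u: "norm u = 1" "\<And>y. y \<in> K \<Longrightarrow> y \<bullet> u \<le> x \<bullet> u" by (auto simp: unit_normals_def inner_diff_left)
  then have "support_fun K u \<le> x \<bullet> u" using assms(2) by (intro support_fun_least) auto
  then show "norm u = 1 \<and> x \<bullet> u = support_fun K u" using u support_fun_upper[OF assms, of u] by auto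
next
  assume "norm u = 1 \<and> x \<bullet> u = support_fun K u"
  then show "u \<in> unit_normals K x"
    using support_fun_upper[OF assms(1), of _ u] by (auto simp: unit_normals_def inner_diff_left)
qed

lemma unit_normals_frontier:
  assumes "compact K" "x \<in> K" "u \<in> unit_normals K x"
  shows "x \<in> frontier K"
proof (rule ccontr)
  assume "x \<notin> frontier K"
  then have "x \<in> interior K" using assms closure_subset[of K] by (auto simp: frontier_def)
  then obtain e where e: "0 < e" "cball x e \<subseteq> K" by (auto simp: mem_interior_cball)
  have u: "norm u = 1" using assms(3) by (simp add: unit_normals_def)
  then have "x + e *\<^sub>R u \<in> K" using e by (intro subsetD[OF e(2)]) (simp add: dist_norm)
  then have "(x + e *\<^sub>R u - x) \<bullet> u \<le> 0" using assms(3) unfolding unit_normals_def by blast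
  then show False using e(1) u by (simp add: norm_eq_1)
qed

text \<open>The preimage under the Gauss map, written with the support function. For closed \<omega>
  it is thereby the projection of a compact set of pairs (point, normal), hence compact.\<close>

definition normal_preimage :: "'a::euclidean_space set \<Rightarrow> 'a set \<Rightarrow> 'a set" where
  "normal_preimage K \<omega> = {x \<in> K. \<exists>u\<in>\<omega>. norm u = 1 \<and> x \<bullet> u = support_fun K u}"

lemma normal_preimage_eq:
  assumes "compact K"
  shows "{x \<in> frontier K. unit_normals K x \<inter> \<omega> \<noteq> {}} = normal_preimage K \<omega>"
  using unit_normals_iff[OF assms] unit_normals_frontier[OF assms] compact_imp_closed[OF assms]
  by (fastforce simp: normal_preimage_def frontier_def)

lemma normal_preimage_mono: "\<omega> \<subseteq> \<omega>' \<Longrightarrow> normal_preimage K \<omega> \<subseteq> normal_preimage K \<omega>'"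
  by (auto simp: normal_preimage_def)

lemma normal_preimage_subset: "normal_preimage K \<omega> \<subseteq> K"
  by (auto simp: normal_preimage_def)

lemma compact_normal_preimage:
  fixes K :: "'a::euclidean_space set"
  assumes K: "compact K" and \<omega>: "closed \<omega>"
  shows "compact (normal_preimage K \<omega>)"
proof (cases "K = {}")
  case False
  let ?S = "{z \<in> K \<times> (\<omega> \<inter> sphere 0 1). fst z \<bullet> snd z = support_fun K (snd z)}"
  have cK: "compact (K \<times> (\<omega> \<inter> sphere 0 1))" by (intro compact_Times K closed_Int_compact \<omega>) auto
  have "continuous_on UNIV (\<lambda>z::'a\<times>'a. fst z \<bullet> snd z - support_fun K (snd z))"
    by (intro continuous_intros continuous_on_compose2[OF continuous_support_fun[OF K False, of UNIV]]) auto
  then have "closed {z::'a\<times>'a. fst z \<bullet> snd z - support_fun K (snd z) = 0}"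
    by (intro closed_Collect_eq) (auto intro: continuous_intros)
  then have "compact ((K \<times> (\<omega> \<inter> sphere 0 1)) \<inter> {z. fst z \<bullet> snd z - support_fun K (snd z) = 0})"
    by (intro compact_Int_closed cK)
  then have "compact (fst ` ((K \<times> (\<omega> \<inter> sphere 0 1)) \<inter> {z. fst z \<bullet> snd z - support_fun K (snd z) = 0}))"
    by (intro compact_continuous_image continuous_intros)
  also have "fst ` ((K \<times> (\<omega> \<inter> sphere 0 1)) \<inter> {z. fst z \<bullet> snd z - support_fun K (snd z) = 0}) = normal_preimage K \<omega>"
    by (force simp: normal_preimage_def)
  finally show ?thesis .
qed (simp add: normal_preimage_def)

lemma cone_of_image_image: "cone_of (f ` B) = (\<lambda>z. fst z *\<^sub>R f (snd z)) ` ({0..1} \<times> B)"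
proof -
  have "{0..1::real} \<times> f ` B = (\<lambda>z. (fst z, f (snd z))) ` ({0..1} \<times> B)" by force
  then show ?thesis by (simp add: cone_of_image image_image)
qed

text \<open>Points with normals close to \<open>u0\<close> lie on an almost flat graph over the hyperplane orthogonal
  to \<open>u0\<close>; \<open>t x \<mapsto> t (x + (h - x \<bullet> u0) u0)\<close> flattens the cone over them almost isometrically.\<close>

lemma hausdorff_cone_piece:
  fixes K :: "(real^'n) set"
  assumes K: "compact K" "K \<subseteq> cball 0 R" and u0: "norm u0 = 1"
    and B: "compact B" "B \<subseteq> K" "\<And>x. x \<in> B \<Longrightarrow> \<exists>u. norm u = 1 \<and> norm (u - u0) \<le> \<epsilon> \<and> x \<bullet> u = support_fun K u"
    and \<delta>: "0 < \<delta>" "\<delta> \<le> support_fun K u0" and \<epsilon>: "0 < \<epsilon>" "\<epsilon> \<le> 1" "4 * R * \<epsilon> \<le> \<delta>" and R: "0 < R"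
    and \<eta>: "\<eta> = \<epsilon> * (1 + 24 * R / \<delta>)" "\<eta> < 1" and \<theta>: "\<theta> = ((1 + \<eta>) / (1 - \<eta>)) ^ CARD('n)"
    and cn: "cn = hausdorff_scale TYPE('n) * real CARD('n)"
  shows "ennreal (support_fun K u0) * hausdorff_outer (CARD('n) - 1) B \<le> ennreal \<theta> * (ennreal cn * emeasure lborel (cone_of B))"
    and "ennreal cn * emeasure lborel (cone_of B) \<le> ennreal \<theta> * (ennreal (support_fun K u0) * hausdorff_outer (CARD('n) - 1) B)"
proof -
  let ?k = "CARD('n) - 1"
  let ?H = "hausdorff_outer ?k"
  define h where "h = support_fun K u0"
  have h: "0 < h" "\<delta> \<le> h" using \<delta> by (auto simp: h_def)
  have u0u0: "u0 \<bullet> u0 = 1" using u0 by (simp add: norm_eq_1)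
  \<comment> \<open>\<open>y\<close> lies below the supporting hyperplane at \<open>x\<close> with
    normal \<open>u\<close>; replacing \<open>u\<close> by \<open>u0\<close> costs at most
    \<epsilon> times the distance. Used in both orders, this makes \<psi> Lipschitz with constant
    \<epsilon>.\<close>
  have half: "(y - x) \<bullet> u0 \<le> \<epsilon> * norm (x - y)" if xy: "x \<in> B" "y \<in> B" for x y
  proof -
    obtain u where u: "norm u = 1" "norm (u - u0) \<le> \<epsilon>" "x \<bullet> u = support_fun K u" using B(3)[OF xy(1)] by blast
    have "(y - x) \<bullet> u \<le> 0" using support_fun_upper[OF K(1), of y u] xy B(2) u(3) by (auto simp: inner_diff_left)
    then have "(y - x) \<bullet> u0 \<le> (y - x) \<bullet> (u0 - u)" by (simp add: inner_diff_right)
    also have "\<dots> \<le> norm (y - x) * norm (u0 - u)" by (rule norm_cauchy_schwarz)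
    also have "\<dots> \<le> norm (y - x) * \<epsilon>" using u(2) by (intro mult_left_mono) (auto simp: norm_minus_commute)
    finally show ?thesis by (simp add: norm_minus_commute mult.commute)
  qed
  define \<psi> where "\<psi> x = h - x \<bullet> u0" for x
  have \<psi>_lip: "\<bar>\<psi> x - \<psi> y\<bar> \<le> \<epsilon> * norm (x - y)" if "x \<in> B" "y \<in> B" for x y
    using half[OF that] half[OF that(2,1)] by (simp add: \<psi>_def inner_diff_left norm_minus_commute abs_le_iff)
  have BR: "norm x \<le> R" if "x \<in> B" for x using that B(2) K(2) by force
  have \<psi>_bound: "\<bar>\<psi> x\<bar> \<le> 2 * R * \<epsilon>" if x: "x \<in> B" for x
  proof -
    obtain u where u: "norm u = 1" "norm (u - u0) \<le> \<epsilon>" "x \<bullet> u = support_fun K u" using B(3)[OF x] by blast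
    have "K \<noteq> {}" using x B(2) by auto
    have "\<bar>support_fun K u0 - support_fun K u\<bar> \<le> R * norm (u0 - u)"
      by (rule support_fun_lipschitz[OF K(1) \<open>K \<noteq> {}\<close> K(2)])
    also have "\<dots> \<le> R * \<epsilon>" using u(2) R by (intro mult_left_mono) (auto simp: norm_minus_commute)
    finally have 1: "\<bar>h - x \<bullet> u\<bar> \<le> R * \<epsilon>" by (simp add: h_def u(3))
    have "\<bar>x \<bullet> (u - u0)\<bar> \<le> norm x * norm (u - u0)" by (rule Cauchy_Schwarz_ineq2)
    also have "\<dots> \<le> R * \<epsilon>" using BR[OF x] u(2) R by (intro mult_mono) auto
    finally have "\<bar>x \<bullet> u - x \<bullet> u0\<bar> \<le> R * \<epsilon>" by (simp add: inner_diff_right)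
    with 1 show ?thesis unfolding \<psi>_def by linarith
  qed
  define I where "I = {0..1::real} \<times> B"
  define \<phi> where "\<phi> z = fst z *\<^sub>R snd z" for z :: "real \<times> (real^'n)"
  define \<rho> where "\<rho> z = fst z *\<^sub>R (snd z + \<psi> (snd z) *\<^sub>R u0)" for z :: "real \<times> (real^'n)"
  \<comment> \<open>The two cone maps differ by \<open>t \<psi>(x) - s \<psi>(y)\<close> times
    \<open>u0\<close>. Written as \<open>(t - s) \<psi>(x) + s (\<psi>(x) - \<psi>(y))\<close>, it
    is controlled once \<open>\<bar>t - s\<bar>\<close> and \<open>s * norm (x - y)\<close> are
    bounded by the distance \<Delta> of the cone points. The constants collected on the way are
    those in \<eta>.\<close>
  have main: "norm ((\<rho> i - \<rho> j) - (\<phi> i - \<phi> j)) \<le> \<eta> * norm (\<phi> i - \<phi> j)" if ij: "i \<in> I" "j \<in> I" for i j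
  proof -
    obtain t x s y where i: "i = (t, x)" and j: "j = (s, y)" by (metis surj_pair)
    have ts: "0 \<le> t" "t \<le> 1" "0 \<le> s" "s \<le> 1" and x: "x \<in> B" and y: "y \<in> B" using ij by (auto simp: I_def i j)
    define \<Delta> where "\<Delta> = norm (t *\<^sub>R x - s *\<^sub>R y)"
    have sxy: "s * norm (x - y) \<le> \<Delta> + \<bar>t - s\<bar> * R"
    proof -
      have "s * norm (x - y) = norm (s *\<^sub>R (x - y))" using ts by simp
      also have "s *\<^sub>R (x - y) = (t *\<^sub>R x - s *\<^sub>R y) - (t - s) *\<^sub>R x" by (simp add: algebra_simps)
      also have "norm \<dots> \<le> \<Delta> + norm ((t - s) *\<^sub>R x)" unfolding \<Delta>_def by (rule norm_triangle_ineq4)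
      also have "norm ((t - s) *\<^sub>R x) \<le> \<bar>t - s\<bar> * R" using BR[OF x] by (simp add: mult_left_mono)
      finally show ?thesis by simp
    qed
    have "\<bar>(t - s) * (x \<bullet> u0)\<bar> \<le> \<Delta> + \<epsilon> * (s * norm (x - y))"
    proof -
      have "(t - s) * (x \<bullet> u0) = (t *\<^sub>R x - s *\<^sub>R y) \<bullet> u0 - s * ((x - y) \<bullet> u0)"
        by (simp add: inner_diff_left algebra_simps)
      moreover have "\<bar>(t *\<^sub>R x - s *\<^sub>R y) \<bullet> u0\<bar> \<le> \<Delta>"
        using Cauchy_Schwarz_ineq2[of "t *\<^sub>R x - s *\<^sub>R y" u0] u0 by (simp add: \<Delta>_def)
      moreover have "\<bar>s * ((x - y) \<bullet> u0)\<bar> \<le> s * (\<epsilon> * norm (x - y))"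
        using \<psi>_lip[OF x y] ts by (auto simp: abs_mult \<psi>_def inner_diff_left abs_minus_commute intro!: mult_left_mono)
      ultimately show ?thesis by (simp add: mult_ac)
    qed
    also have "\<dots> \<le> \<Delta> + \<epsilon> * (\<Delta> + \<bar>t - s\<bar> * R)" using sxy \<epsilon> by (intro add_left_mono mult_left_mono) auto
    also have "\<dots> \<le> 2 * \<Delta> + \<bar>t - s\<bar> * (\<delta> / 4)"
    proof -
      have "\<epsilon> * \<Delta> \<le> 1 * \<Delta>" using \<epsilon> by (intro mult_right_mono) (auto simp: \<Delta>_def)
      moreover have "\<bar>t - s\<bar> * (\<epsilon> * R) \<le> \<bar>t - s\<bar> * (\<delta> / 4)" using \<epsilon>(3) by (intro mult_left_mono) (auto simp: mult_ac)
      ultimately show ?thesis by (simp add: algebra_simps)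
    qed
    finally have a: "\<bar>t - s\<bar> * \<bar>x \<bullet> u0\<bar> \<le> 2 * \<Delta> + \<bar>t - s\<bar> * (\<delta> / 4)" by (simp add: abs_mult)
    \<comment> \<open>The components along \<open>u0\<close> stay away from 0, so a change of the
      parameter \<open>t\<close> is visible in the distance of the cone points.\<close>
    have "\<delta> / 2 \<le> \<bar>x \<bullet> u0\<bar>" using \<psi>_bound[OF x] \<epsilon>(3) h unfolding \<psi>_def by linarith
    then have "\<bar>t - s\<bar> * (\<delta> / 2) \<le> \<bar>t - s\<bar> * \<bar>x \<bullet> u0\<bar>" by (intro mult_left_mono) auto
    with a have "\<bar>t - s\<bar> * \<delta> \<le> 8 * \<Delta>" by (simp add: field_simps)
    then have tsb: "\<bar>t - s\<bar> \<le> 8 * \<Delta> / \<delta>" using \<delta>(1) by (simp add: field_simps)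
    have "(\<rho> i - \<rho> j) - (\<phi> i - \<phi> j) = (t * \<psi> x - s * \<psi> y) *\<^sub>R u0"
      by (simp add: \<rho>_def \<phi>_def i j algebra_simps)
    then have "norm ((\<rho> i - \<rho> j) - (\<phi> i - \<phi> j)) = \<bar>t * \<psi> x - s * \<psi> y\<bar>" using u0 by simp
    also have "t * \<psi> x - s * \<psi> y = (t - s) * \<psi> x + s * (\<psi> x - \<psi> y)" by (simp add: algebra_simps)
    also have "\<bar>\<dots>\<bar> \<le> \<bar>t - s\<bar> * \<bar>\<psi> x\<bar> + s * \<bar>\<psi> x - \<psi> y\<bar>"
      using ts by (intro order_trans[OF abs_triangle_ineq]) (auto simp: abs_mult)
    also have "\<dots> \<le> \<bar>t - s\<bar> * (2 * R * \<epsilon>) + s * (\<epsilon> * norm (x - y))"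
      using \<psi>_bound[OF x] \<psi>_lip[OF x y] ts by (intro add_mono mult_left_mono) auto
    also have "\<dots> = \<epsilon> * (\<bar>t - s\<bar> * (2 * R) + s * norm (x - y))" by (simp add: algebra_simps)
    also have "\<dots> \<le> \<epsilon> * (\<bar>t - s\<bar> * (2 * R) + (\<Delta> + \<bar>t - s\<bar> * R))"
      using sxy \<epsilon> by (intro mult_left_mono add_left_mono) auto
    also have "\<dots> = \<epsilon> * (\<Delta> + \<bar>t - s\<bar> * (3 * R))" by (simp add: algebra_simps)
    also have "\<dots> \<le> \<epsilon> * (\<Delta> + (8 * \<Delta> / \<delta>) * (3 * R))"
      using tsb \<epsilon> R by (intro mult_left_mono add_left_mono mult_right_mono) auto
    also have "\<dots> = \<eta> * \<Delta>" by (simp add: \<eta>(1) algebra_simps)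
    finally show ?thesis by (simp add: \<Delta>_def \<phi>_def i j)
  qed
  have \<eta>0: "0 < \<eta>" using \<epsilon> R \<delta> by (simp add: \<eta>(1) add_pos_pos)
  have up: "dist (\<rho> i) (\<rho> j) \<le> (1 + \<eta>) * dist (\<phi> i) (\<phi> j)" if "i \<in> I" "j \<in> I" for i j
    using main[OF that] norm_triangle_sub[of "\<rho> i - \<rho> j" "\<phi> i - \<phi> j"] by (simp add: dist_norm algebra_simps)
  have low: "dist (\<phi> i) (\<phi> j) \<le> (1 / (1 - \<eta>)) * dist (\<rho> i) (\<rho> j)" if "i \<in> I" "j \<in> I" for i j
  proof -
    have "norm (\<phi> i - \<phi> j) - norm (\<rho> i - \<rho> j) \<le> norm ((\<rho> i - \<rho> j) - (\<phi> i - \<phi> j))"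
      by (metis norm_minus_commute norm_triangle_ineq2)
    then have "(1 - \<eta>) * norm (\<phi> i - \<phi> j) \<le> norm (\<rho> i - \<rho> j)"
      using main[OF that] by (simp add: algebra_simps)
    then show ?thesis using \<eta>(2) by (simp add: dist_norm field_simps)
  qed
  define F where "F x = x + \<psi> x *\<^sub>R u0" for x
  have I1: "(1, x) \<in> I" if "x \<in> B" for x using that by (simp add: I_def)
  have F_up: "?H (F ` B) \<le> ennreal ((1 + \<eta>) ^ ?k) * ?H ((\<lambda>x. x) ` B)"
    using \<eta>0 up[OF I1 I1] by (intro hausdorff_outer_lipschitz) (auto simp: \<rho>_def \<phi>_def F_def)
  have F_low: "?H ((\<lambda>x. x) ` B) \<le> ennreal ((1 / (1 - \<eta>)) ^ ?k) * ?H (F ` B)"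
    using \<eta> low[OF I1 I1] by (intro hausdorff_outer_lipschitz) (auto simp: \<rho>_def \<phi>_def F_def)
  have imF: "\<rho> ` I = cone_of (F ` B)"
    unfolding cone_of_image_image by (simp add: \<rho>_def I_def F_def)
  have imB: "\<phi> ` I = cone_of B"
    unfolding cone_of_image by (simp add: \<phi>_def I_def)
  have cF: "compact (F ` B)"
    unfolding F_def \<psi>_def by (intro compact_continuous_image continuous_intros B(1))
  have bor: "\<phi> ` I \<in> sets borel" "\<rho> ` I \<in> sets borel"
    unfolding imB imF by (auto intro!: borel_compact compact_cone_of cF B(1))
  have L_up: "emeasure lborel (cone_of (F ` B)) \<le> ennreal ((1 + \<eta>) ^ CARD('n)) * emeasure lborel (cone_of B)"
    using lborel_lipschitz[of "1 + \<eta>" I \<rho> \<phi>] up \<eta>0 bor by (simp add: imF imB)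
  have L_low: "emeasure lborel (cone_of B) \<le> ennreal ((1 / (1 - \<eta>)) ^ CARD('n)) * emeasure lborel (cone_of (F ` B))"
    using lborel_lipschitz[of "1 / (1 - \<eta>)" I \<phi> \<rho>] low \<eta> bor by (simp add: imF imB)
  have flat: "ennreal h * ?H (F ` B) = ennreal cn * emeasure lborel (cone_of (F ` B))"
    unfolding cn by (rule hausdorff_flat_cone[OF u0 h(1) cF]) (auto simp: F_def \<psi>_def inner_add_left u0u0)
  have p1: "1 \<le> 1 + \<eta>" "1 \<le> 1 / (1 - \<eta>)" using \<eta>0 \<eta>(2) by auto
  \<comment> \<open>Flattening and returning costs a factor \<open>1 + \<eta>\<close> and a factor
    \<open>1 / (1 - \<eta>)\<close>, one with exponent \<open>n - 1\<close> and the other with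
    exponent \<open>n\<close>. Both are at least 1, so the smaller exponent may be raised to
    \<open>n\<close>, which gives \<theta>.\<close>
  have th: "ennreal (a ^ ?k) * ennreal (b ^ CARD('n)) \<le> ennreal \<theta>" if "a = 1 + \<eta> \<and> b = 1 / (1 - \<eta>) \<or> b = 1 + \<eta> \<and> a = 1 / (1 - \<eta>)" for a b
  proof -
    have ab: "1 \<le> a" "1 \<le> b" using that p1 by auto
    have "a ^ ?k * b ^ CARD('n) \<le> a ^ CARD('n) * b ^ CARD('n)"
      using ab by (intro mult_right_mono power_increasing) auto
    also have "\<dots> = (a * b) ^ CARD('n)" by (simp add: power_mult_distrib)
    also have "a * b = (1 + \<eta>) / (1 - \<eta>)" using that by auto
    finally show ?thesis using ab by (simp add: \<theta> ennreal_mult[symmetric] ennreal_leI)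
  qed
  show "ennreal (support_fun K u0) * ?H B \<le> ennreal \<theta> * (ennreal cn * emeasure lborel (cone_of B))"
  proof -
    have "ennreal h * ?H B \<le> ennreal h * (ennreal ((1 / (1 - \<eta>)) ^ ?k) * ?H (F ` B))"
      using F_low by (intro mult_left_mono) auto
    also have "\<dots> = ennreal ((1 / (1 - \<eta>)) ^ ?k) * (ennreal cn * emeasure lborel (cone_of (F ` B)))"
      unfolding flat[symmetric] by (simp add: mult_ac)
    also have "\<dots> \<le> ennreal ((1 / (1 - \<eta>)) ^ ?k) * (ennreal cn * (ennreal ((1 + \<eta>) ^ CARD('n)) * emeasure lborel (cone_of B)))"
      using L_up by (intro mult_left_mono) auto
    also have "\<dots> = (ennreal ((1 / (1 - \<eta>)) ^ ?k) * ennreal ((1 + \<eta>) ^ CARD('n))) * (ennreal cn * emeasure lborel (cone_of B))"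
      by (simp add: mult_ac)
    also have "\<dots> \<le> ennreal \<theta> * (ennreal cn * emeasure lborel (cone_of B))"
      by (intro mult_right_mono th) auto
    finally show ?thesis by (simp add: h_def)
  qed
  show "ennreal cn * emeasure lborel (cone_of B) \<le> ennreal \<theta> * (ennreal (support_fun K u0) * ?H B)"
  proof -
    have "ennreal cn * emeasure lborel (cone_of B) \<le> ennreal cn * (ennreal ((1 / (1 - \<eta>)) ^ CARD('n)) * emeasure lborel (cone_of (F ` B)))"
      using L_low by (intro mult_left_mono) auto
    also have "\<dots> = ennreal ((1 / (1 - \<eta>)) ^ CARD('n)) * (ennreal h * ?H (F ` B))"
      unfolding flat by (simp add: mult_ac)
    also have "\<dots> \<le> ennreal ((1 / (1 - \<eta>)) ^ CARD('n)) * (ennreal h * (ennreal ((1 + \<eta>) ^ ?k) * ?H B))"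
      using F_up by (intro mult_left_mono) auto
    also have "\<dots> = (ennreal ((1 + \<eta>) ^ ?k) * ennreal ((1 / (1 - \<eta>)) ^ CARD('n))) * (ennreal h * ?H B)"
      by (simp add: mult_ac)
    also have "\<dots> \<le> ennreal \<theta> * (ennreal h * ?H B)"
      by (intro mult_right_mono th) auto
    finally show ?thesis by (simp add: h_def)
  qed
qed

text \<open>The point is uniformity: \<epsilon> depends on \<open>K\<close>, \<delta> and \<theta>,
  but neither on the direction nor on the piece, so finitely many balls of radius \<epsilon> can
  cover a compact set of directions.\<close>

lemma hausdorff_cone_piece_small:
  fixes K :: "(real^'n) set"
  assumes K: "compact K" and \<delta>: "0 < \<delta>" and \<theta>: "1 < \<theta>"
  obtains \<epsilon> where "0 < \<epsilon>"
    "\<And>u0 B. \<lbrakk>norm u0 = 1; \<delta> \<le> support_fun K u0; compact B; B \<subseteq> normal_preimage K (cball u0 \<epsilon>)\<rbrakk> \<Longrightarrow>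
      ennreal (support_fun K u0) * hausdorff_outer (CARD('n) - 1) B
        \<le> ennreal \<theta> * (ennreal (hausdorff_scale TYPE('n) * real CARD('n)) * emeasure lborel (cone_of B)) \<and>
      ennreal (hausdorff_scale TYPE('n) * real CARD('n)) * emeasure lborel (cone_of B)
        \<le> ennreal \<theta> * (ennreal (support_fun K u0) * hausdorff_outer (CARD('n) - 1) B)"
proof -
  obtain R where R: "0 < R" "K \<subseteq> cball 0 R"
    using compact_imp_bounded[OF K] unfolding bounded_pos by (auto simp: subset_eq)
  let ?\<theta> = "\<lambda>\<eta>::real. ((1 + \<eta>) / (1 - \<eta>)) ^ CARD('n)"
  have "(?\<theta> \<longlongrightarrow> ((1 + 0) / (1 - 0)) ^ CARD('n)) (at_right 0)"
    by (intro tendsto_intros) auto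
  then have "eventually (\<lambda>\<eta>. ?\<theta> \<eta> < \<theta>) (at_right 0)" using \<theta> by (intro order_tendstoD(2)) auto
  moreover have "eventually (\<lambda>\<eta>::real. \<eta> \<in> {0<..<1}) (at_right 0)" by (rule eventually_at_right_real) simp
  ultimately have "eventually (\<lambda>\<eta>. ?\<theta> \<eta> < \<theta> \<and> \<eta> \<in> {0<..<1}) (at_right (0::real))" by (rule eventually_conj)
  then obtain \<eta> where "?\<theta> \<eta> < \<theta> \<and> \<eta> \<in> {0<..<1}"
    using eventually_happens'[OF trivial_limit_at_right_real] by blast
  then have \<eta>: "0 < \<eta>" "\<eta> < 1" "?\<theta> \<eta> < \<theta>" by auto
  define C where "C = 1 + 24 * R / \<delta>"
  have C: "0 < C" using R \<delta> by (simp add: C_def add_pos_pos)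
  define \<epsilon> where "\<epsilon> = min (min 1 (\<delta> / (4 * R))) (\<eta> / C)"
  have \<epsilon>: "0 < \<epsilon>" "\<epsilon> \<le> 1" "\<epsilon> \<le> \<delta> / (4 * R)" "\<epsilon> \<le> \<eta> / C" using R \<delta> \<eta> C by (auto simp: \<epsilon>_def)
  define \<eta>' where "\<eta>' = \<epsilon> * C"
  have \<eta>': "0 < \<eta>'" "\<eta>' \<le> \<eta>" using \<epsilon> C by (auto simp: \<eta>'_def field_simps)
  have \<theta>': "?\<theta> \<eta>' \<le> \<theta>"
  proof -
    have "?\<theta> \<eta>' \<le> ?\<theta> \<eta>" using \<eta> \<eta>' by (intro power_mono frac_le) auto
    then show ?thesis using \<eta> by simp
  qed
  show ?thesis
  proof (rule that[OF \<epsilon>(1)], intro conjI)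
    fix u0 :: "real^'n" and B
    assume u0: "norm u0 = 1" "\<delta> \<le> support_fun K u0" and B: "compact B" "B \<subseteq> normal_preimage K (cball u0 \<epsilon>)"
    have BK: "B \<subseteq> K" using B(2) normal_preimage_subset by blast
    have near: "\<exists>u. norm u = 1 \<and> norm (u - u0) \<le> \<epsilon> \<and> x \<bullet> u = support_fun K u" if xB: "x \<in> B" for x
    proof -
      obtain u where "u \<in> cball u0 \<epsilon>" "norm u = 1" "x \<bullet> u = support_fun K u"
        using B(2) xB unfolding normal_preimage_def by blast
      then show ?thesis by (auto simp: dist_norm norm_minus_commute intro!: exI[of _ u])
    qed
    have e4: "4 * R * \<epsilon> \<le> \<delta>" using \<epsilon>(3) R by (simp add: field_simps)
    have eta: "\<eta>' = \<epsilon> * (1 + 24 * R / \<delta>)" "\<eta>' < 1" using \<eta>' \<eta> by (auto simp: \<eta>'_def C_def)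
    note * = hausdorff_cone_piece[OF K R(2) u0(1) B(1) BK near \<delta> u0(2) \<epsilon>(1,2) e4 R(1) eta refl refl]
    note mono = mult_right_mono[OF ennreal_leI[OF \<theta>']]
    show "ennreal (support_fun K u0) * hausdorff_outer (CARD('n) - 1) B
        \<le> ennreal \<theta> * (ennreal (hausdorff_scale TYPE('n) * real CARD('n)) * emeasure lborel (cone_of B))"
      by (rule order_trans[OF *(1) mono]) auto
    show "ennreal (hausdorff_scale TYPE('n) * real CARD('n)) * emeasure lborel (cone_of B)
        \<le> ennreal \<theta> * (ennreal (support_fun K u0) * hausdorff_outer (CARD('n) - 1) B)"
      by (rule order_trans[OF *(2) mono]) auto
  qed
qed

lemma hausdorff_outer_finite_UN:
  "finite I \<Longrightarrow> hausdorff_outer k (\<Union>i\<in>I. A i) \<le> (\<Sum>i\<in>I. hausdorff_outer k (A i))"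
proof (induction I rule: finite_induct)
  case (insert i I)
  have "hausdorff_outer k (\<Union>j\<in>insert i I. A j) \<le> hausdorff_outer k (A i) + hausdorff_outer k (\<Union>j\<in>I. A j)"
    using hausdorff_outer_Un[of k "A i" "\<Union>j\<in>I. A j"] by simp
  also have "\<dots> \<le> hausdorff_outer k (A i) + (\<Sum>j\<in>I. hausdorff_outer k (A j))"
    using insert.IH by (rule add_left_mono)
  finally show ?case using insert.hyps by simp
qed simp

lemma compact_finite_cball_cover:
  fixes X :: "'a::metric_space set"
  assumes "compact X" "0 < \<epsilon>"
  obtains T where "finite T" "T \<subseteq> X" "X \<subseteq> (\<Union>u\<in>T. cball u \<epsilon>)"
proof -
  obtain T where T: "T \<subseteq> X" "finite T" "X \<subseteq> (\<Union>x\<in>T. ball x \<epsilon>)"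
    using assms by (elim compactE_image[where C = X and f = "\<lambda>x. ball x \<epsilon>"]) auto
  have "(\<Union>x\<in>T. ball x \<epsilon>) \<subseteq> (\<Union>x\<in>T. cball x \<epsilon>)" by (rule UN_mono[OF subset_refl ball_subset_cball])
  with T(3) have "X \<subseteq> (\<Union>x\<in>T. cball x \<epsilon>)" by (rule order_trans)
  with T(2,1) show ?thesis by (rule that)
qed

lemma cone_of_mono: "A \<subseteq> B \<Longrightarrow> cone_of A \<subseteq> cone_of B"
  unfolding cone_of_def by auto

text \<open>Finitely many balls of directions, of the radius that belongs to the value 2 of
  \<theta>, cover the sphere. The estimate turns null cones into null boundary pieces and shows that
  the boundary has finite measure.\<close>

lemma hausdorff_le_cone:
  fixes K :: "(real^'n) set"
  assumes K: "compact K" "0 \<in> interior K"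
  obtains C where "\<And>B. compact B \<Longrightarrow> B \<subseteq> normal_preimage K UNIV \<Longrightarrow>
    hausdorff_outer (CARD('n) - 1) B \<le> ennreal C * emeasure lborel (cone_of B)"
proof -
  let ?H = "hausdorff_outer (CARD('n) - 1)"
  obtain \<delta> where \<delta>: "0 < \<delta>" "cball 0 \<delta> \<subseteq> K" using K(2) by (auto simp: mem_interior_cball)
  have h: "\<delta> \<le> support_fun K u" if "norm u = 1" for u
  proof -
    have "(\<delta> *\<^sub>R u) \<bullet> u \<le> support_fun K u" using \<delta> that by (intro support_fun_upper[OF K(1)]) auto
    then show ?thesis using that by (simp add: norm_eq_1)
  qed
  define cn where "cn = hausdorff_scale TYPE('n) * real CARD('n)"
  have cn0: "0 \<le> cn" using hausdorff_scale(1)[where 'n='n] by (simp add: cn_def)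
  obtain \<epsilon> where \<epsilon>: "0 < \<epsilon>" and piece: "\<And>u0 B. \<lbrakk>norm u0 = 1; \<delta> \<le> support_fun K u0; compact B; B \<subseteq> normal_preimage K (cball u0 \<epsilon>)\<rbrakk> \<Longrightarrow>
      ennreal (support_fun K u0) * ?H B \<le> ennreal 2 * (ennreal cn * emeasure lborel (cone_of B))"
    using hausdorff_cone_piece_small[OF K(1) \<delta>(1), of 2] unfolding cn_def by (metis one_less_numeral_iff semiring_norm(76))
  obtain T where T: "finite T" "T \<subseteq> sphere (0::real^'n) 1" "sphere 0 1 \<subseteq> (\<Union>u\<in>T. cball u \<epsilon>)"
    using compact_finite_cball_cover[of "sphere (0::real^'n) 1" \<epsilon>] \<epsilon> by auto
  show ?thesis
  proof (rule that)
    fix B assume B: "compact B" "B \<subseteq> normal_preimage K UNIV"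
    define Bu where "Bu u = B \<inter> normal_preimage K (cball u \<epsilon>)" for u
    have Bu: "?H (Bu u) \<le> ennreal (2 * cn / \<delta>) * emeasure lborel (cone_of B)" if "u \<in> T" for u
    proof -
      have u: "norm u = 1" using that T by auto
      have cB: "compact (Bu u)" unfolding Bu_def by (intro compact_Int B compact_normal_preimage K) auto
      have "ennreal \<delta> * ?H (Bu u) \<le> ennreal (support_fun K u) * ?H (Bu u)"
        using h[OF u] by (intro mult_right_mono ennreal_leI) auto
      also have "\<dots> \<le> ennreal 2 * (ennreal cn * emeasure lborel (cone_of (Bu u)))"
        by (rule piece[OF u h[OF u] cB]) (auto simp: Bu_def)
      also have "\<dots> \<le> ennreal 2 * (ennreal cn * emeasure lborel (cone_of B))"
        using compact_cone_of[OF B(1)]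
        by (intro mult_left_mono emeasure_mono cone_of_mono) (auto simp: Bu_def intro: borel_compact)
      finally have "ennreal (1 / \<delta>) * (ennreal \<delta> * ?H (Bu u)) \<le> ennreal (1 / \<delta>) * (ennreal 2 * (ennreal cn * emeasure lborel (cone_of B)))"
        by (rule mult_left_mono) simp
      moreover have "ennreal (1 / \<delta>) * (ennreal \<delta> * x) = x" for x
        using \<delta>(1) by (simp add: mult.assoc[symmetric] ennreal_mult[symmetric])
      moreover have "ennreal (1 / \<delta>) * (ennreal 2 * (ennreal cn * x)) = ennreal (2 * cn / \<delta>) * x" for x
      proof -
        have "ennreal (1 / \<delta>) * (ennreal 2 * ennreal cn) = ennreal (1 / \<delta> * (2 * cn))"
          using \<delta>(1) cn0 by (simp only: ennreal_mult[symmetric] mult_nonneg_nonneg zero_le_numeral zero_le_divide_1_iff less_imp_le)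
        then show ?thesis by (simp add: mult.assoc[symmetric])
      qed
      ultimately show ?thesis by metis
    qed
    have "B \<subseteq> (\<Union>u\<in>T. Bu u)"
    proof
      fix x assume x: "x \<in> B"
      then obtain u where u: "norm u = 1" "x \<in> K" "x \<bullet> u = support_fun K u" using B(2) by (auto simp: normal_preimage_def)
      then have "u \<in> (\<Union>u\<in>T. cball u \<epsilon>)" by (intro subsetD[OF T(3)]) simp
      then obtain w where w: "w \<in> T" "u \<in> cball w \<epsilon>" by blast
      then have "x \<in> Bu w" using x u unfolding Bu_def normal_preimage_def by blast
      then show "x \<in> (\<Union>u\<in>T. Bu u)" using w(1) by blast
    qed
    then have "?H B \<le> ?H (\<Union>u\<in>T. Bu u)" by (rule hausdorff_outer_mono)
    also have "\<dots> \<le> (\<Sum>u\<in>T. ?H (Bu u))" by (rule hausdorff_outer_finite_UN[OF T(1)])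
    also have "\<dots> \<le> (\<Sum>u\<in>T. ennreal (2 * cn / \<delta>) * emeasure lborel (cone_of B))" by (rule sum_mono[OF Bu])
    also have "\<dots> = ennreal (real (card T)) * (ennreal (2 * cn / \<delta>) * emeasure lborel (cone_of B))"
      by (simp add: ennreal_of_nat_eq_real_of_nat)
    also have "\<dots> = ennreal (real (card T) * (2 * cn / \<delta>)) * emeasure lborel (cone_of B)"
      using \<delta>(1) cn0 by (subst ennreal_mult) (auto simp: mult.assoc)
    finally show "?H B \<le> ennreal (real (card T) * (2 * cn / \<delta>)) * emeasure lborel (cone_of B)" .
  qed
qed

section \<open>Boundary points with several normals\<close>

lemma emeasure_lborel_translation:
  fixes v :: "'a::euclidean_space"
  assumes [measurable]: "A \<in> sets borel"
  shows "emeasure lborel ((+) v ` A) = emeasure lborel A"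
proof -
  have "emeasure lborel A = emeasure (distr lborel borel ((+) (- v))) A" by (simp add: lborel_distr_plus)
  also have "\<dots> = emeasure lborel ((+) (- v) -` A \<inter> space lborel)" by (rule emeasure_distr) measurable
  also have "(+) (- v) -` A \<inter> space lborel = (+) v ` A"
  proof (rule Set.set_eqI)
    fix x
    have "x = v + y \<longleftrightarrow> y = - v + x" for y by (auto simp: algebra_simps)
    then show "x \<in> (+) (- v) -` A \<inter> space lborel \<longleftrightarrow> x \<in> (+) v ` A" by (simp add: image_iff)
  qed
  finally show ?thesis by simp
qed

text \<open>A bounded set meeting every line parallel to a fixed axis at most once is null, because its
  translates along that axis are disjoint.\<close>

lemma graph_null:
  fixes Z :: "'a::euclidean_space set"
  assumes Z: "compact Z" and b: "b \<in> Basis" and graph: "\<And>x s. x \<in> Z \<Longrightarrow> 0 < s \<Longrightarrow> x + s *\<^sub>R b \<notin> Z"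
  shows "emeasure lborel Z = 0"
proof -
  have Zb: "Z \<in> sets borel" by (rule borel_compact[OF Z])
  obtain R where R: "0 < R" "\<And>x. x \<in> Z \<Longrightarrow> norm x \<le> R"
    using compact_imp_bounded[OF Z] unfolding bounded_pos by auto
  define v where "v m = (1 / real (Suc m)) *\<^sub>R b" for m
  have disj: "disjoint_family (\<lambda>m. (+) (v m) ` Z)"
  proof -
    have False if "x \<in> Z" "y \<in> Z" "v m + x = v n + y" "m < n" for x y m n
    proof -
      have "1 / real (Suc n) < 1 / real (Suc m)" using that(4) by (intro divide_strict_left_mono) auto
      moreover have "y = x + (1 / real (Suc m) - 1 / real (Suc n)) *\<^sub>R b"
        using that(3) by (simp add: v_def scaleR_diff_left algebra_simps)
      ultimately show False using graph[OF that(1), of "1 / real (Suc m) - 1 / real (Suc n)"] that(2) by simp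
    qed
    then have F: "m = n" if "x \<in> Z" "y \<in> Z" "v m + x = v n + y" for x y m n
      using that by (metis linorder_neqE_nat)
    show ?thesis unfolding disjoint_family_on_def using F by blast
  qed
  have "(\<Sum>m. emeasure lborel ((+) (v m) ` Z)) = emeasure lborel (\<Union>m. (+) (v m) ` Z)"
    using disj Zb by (intro suminf_emeasure) (auto intro: borel_translation_image)
  also have "\<dots> \<le> emeasure lborel (cball (0::'a) (R + 1))"
  proof (rule emeasure_mono)
    show "(\<Union>m. (+) (v m) ` Z) \<subseteq> cball 0 (R + 1)"
    proof clarify
      fix m x assume x: "x \<in> Z"
      have "norm (v m + x) \<le> norm (v m) + norm x" by (rule norm_triangle_ineq)
      moreover have "norm (v m) \<le> 1" using b by (simp add: v_def)
      ultimately show "v m + x \<in> cball 0 (R + 1)" using R(2)[OF x] by simp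
    qed
  qed simp
  also have "\<dots> < \<infinity>" using R(1) by (simp add: emeasure_cball)
  finally have fin: "(\<Sum>m::nat. emeasure lborel Z) < \<infinity>" using Zb by (simp add: emeasure_lborel_translation)
  then have Zfin: "emeasure lborel Z < \<infinity>" using ennreal_suminf_lessD[OF fin] by auto
  have "(\<Sum>m::nat. ennreal (measure lborel Z)) \<noteq> top_class.top"
    using fin Zfin by (simp add: emeasure_eq_ennreal_measure less_top)
  then have "summable (\<lambda>m::nat. measure lborel Z)" by (intro summable_suminf_not_top) auto
  then have "measure lborel Z = 0" by (simp add: summable_const_iff)
  then show ?thesis using Zfin by (simp add: emeasure_eq_ennreal_measure less_top)
qed

text \<open>Quantitative form of having two normals at \<open>y\<close>: the boundary points
  \<open>u / h(u)\<close> and \<open>v / h(v)\<close> of the polar body have coordinates along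
  \<open>b\<close> on different sides of \<open>r\<close>, each with margin \<epsilon>. Multiplied
  out, the conditions are closed, so the set is compact.\<close>

definition kink_set :: "'a::euclidean_space set \<Rightarrow> 'a \<Rightarrow> real \<Rightarrow> real \<Rightarrow> 'a set" where
  "kink_set K b r \<epsilon> = {y \<in> K. \<exists>u v. norm u = 1 \<and> norm v = 1 \<and> y \<bullet> u = support_fun K u \<and> y \<bullet> v = support_fun K v \<and>
     \<epsilon> \<le> support_fun K u \<and> \<epsilon> \<le> support_fun K v \<and>
     u \<bullet> b \<le> (r - \<epsilon>) * support_fun K u \<and> (r + \<epsilon>) * support_fun K v \<le> v \<bullet> b}"

lemma compact_kink_set:
  fixes K :: "'a::euclidean_space set"
  assumes K: "compact K"
  shows "compact (kink_set K b r \<epsilon>)"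
proof (cases "K = {}")
  case False
  let ?S = "sphere (0::'a) 1"
  let ?P = "K \<times> (?S \<times> ?S)"
  let ?C = "{z. fst z \<bullet> fst (snd z) = support_fun K (fst (snd z))} \<inter> {z. fst z \<bullet> snd (snd z) = support_fun K (snd (snd z))} \<inter>
     {z. \<epsilon> \<le> support_fun K (fst (snd z))} \<inter> {z. \<epsilon> \<le> support_fun K (snd (snd z))} \<inter>
     {z. fst (snd z) \<bullet> b \<le> (r - \<epsilon>) * support_fun K (fst (snd z))} \<inter>
     {z. (r + \<epsilon>) * support_fun K (snd (snd z)) \<le> snd (snd z) \<bullet> b} :: ('a \<times> 'a \<times> 'a) set"
  have c1: "continuous_on UNIV (\<lambda>z::'a\<times>'a\<times>'a. support_fun K (fst (snd z)))"
    "continuous_on UNIV (\<lambda>z::'a\<times>'a\<times>'a. support_fun K (snd (snd z)))"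
    by (intro continuous_on_compose2[OF continuous_support_fun[OF K False, of UNIV]] continuous_intros; simp)+
  have "closed ?C"
    by (intro closed_Int closed_Collect_eq closed_Collect_le c1 continuous_intros)
  then have "compact (?P \<inter> ?C)" by (intro compact_Int_closed compact_Times K) auto
  then have "compact (fst ` (?P \<inter> ?C))" by (intro compact_continuous_image continuous_intros)
  also have "fst ` (?P \<inter> ?C) = kink_set K b r \<epsilon>"
  proof (rule Set.set_eqI, rule iffI)
    fix y assume "y \<in> kink_set K b r \<epsilon>"
    then obtain u v where "y \<in> K" "norm u = 1" "norm v = 1" "y \<bullet> u = support_fun K u" "y \<bullet> v = support_fun K v"
     "\<epsilon> \<le> support_fun K u" "\<epsilon> \<le> support_fun K v"
     "u \<bullet> b \<le> (r - \<epsilon>) * support_fun K u" "(r + \<epsilon>) * support_fun K v \<le> v \<bullet> b"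
      unfolding kink_set_def by blast
    then have "(y, u, v) \<in> ?P \<inter> ?C" by simp
    then show "y \<in> fst ` (?P \<inter> ?C)" by (intro image_eqI[of y fst "(y, u, v)"]) auto
  next
    fix y assume "y \<in> fst ` (?P \<inter> ?C)"
    then obtain u v where "(y, u, v) \<in> ?P \<inter> ?C" by force
    then show "y \<in> kink_set K b r \<epsilon>" unfolding kink_set_def
      by (intro CollectI conjI exI[of _ u] exI[of _ v]) simp_all
  qed
  finally show ?thesis .
qed (simp add: kink_set_def)

text \<open>Both normals bound the gauge of \<open>K\<close> from below; moving in direction \<open>b\<close> the gauge must grow
  with slope above \<open>r\<close> after the first kink and below \<open>r\<close> before the second one.\<close>

lemma cone_kink_set_null:
  fixes K :: "'a::euclidean_space set"
  assumes K: "compact K" and b: "b \<in> Basis" and \<epsilon>: "0 < \<epsilon>"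
  shows "emeasure lborel (cone_of (kink_set K b r \<epsilon>)) = 0"
proof (rule graph_null[OF compact_cone_of[OF compact_kink_set[OF K]] b])
  fix x s assume x: "x \<in> cone_of (kink_set K b r \<epsilon>)" and s: "0 < (s::real)"
  show "x + s *\<^sub>R b \<notin> cone_of (kink_set K b r \<epsilon>)"
  proof
    assume x': "x + s *\<^sub>R b \<in> cone_of (kink_set K b r \<epsilon>)"
    obtain t y v where y: "0 \<le> t" "y \<in> K" "x = t *\<^sub>R y" "y \<bullet> v = support_fun K v" "\<epsilon> \<le> support_fun K v" "(r + \<epsilon>) * support_fun K v \<le> v \<bullet> b"
      using x by (auto simp: cone_of_def kink_set_def)
    obtain t' y' u where y': "0 \<le> t'" "y' \<in> K" "x + s *\<^sub>R b = t' *\<^sub>R y'" "y' \<bullet> u = support_fun K u" "\<epsilon> \<le> support_fun K u" "u \<bullet> b \<le> (r - \<epsilon>) * support_fun K u"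
      using x' by (auto simp: cone_of_def kink_set_def)
    have "(x + s *\<^sub>R b) \<bullet> v \<le> t' * support_fun K v"
      using support_fun_upper[OF K y'(2), of v] y'(1) by (simp add: y'(3) mult_left_mono)
    moreover have "(x + s *\<^sub>R b) \<bullet> v = t * support_fun K v + s * (v \<bullet> b)"
      unfolding y(3) by (simp add: inner_add_left y(4) inner_commute[of b])
    moreover have "s * ((r + \<epsilon>) * support_fun K v) \<le> s * (v \<bullet> b)" using y(6) s by (intro mult_left_mono) auto
    ultimately have "(s * (r + \<epsilon>)) * support_fun K v \<le> (t' - t) * support_fun K v" by (simp add: algebra_simps)
    then have 1: "s * (r + \<epsilon>) \<le> t' - t" using y(5) \<epsilon> by (auto simp: mult_le_cancel_right)
    have "x \<bullet> u \<le> t * support_fun K u"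
      using support_fun_upper[OF K y(2), of u] y(1) by (simp add: y(3) mult_left_mono)
    moreover have "x \<bullet> u = t' * support_fun K u - s * (u \<bullet> b)"
    proof -
      have "x = t' *\<^sub>R y' - s *\<^sub>R b" using y'(3) by (simp add: eq_diff_eq)
      then show ?thesis by (simp add: inner_diff_left y'(4) inner_commute[of b])
    qed
    moreover have "s * (u \<bullet> b) \<le> s * ((r - \<epsilon>) * support_fun K u)" using y'(6) s by (intro mult_left_mono) auto
    ultimately have "(t' - t) * support_fun K u \<le> (s * (r - \<epsilon>)) * support_fun K u" by (simp add: algebra_simps)
    then have 2: "t' - t \<le> s * (r - \<epsilon>)" using y'(5) \<epsilon> by (auto simp: mult_le_cancel_right)
    have "s * (r - \<epsilon>) < s * (r + \<epsilon>)" using s \<epsilon> by (intro mult_strict_left_mono) auto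
    with 1 2 show False by linarith
  qed
qed

definition kinks :: "'a::euclidean_space set \<Rightarrow> 'a set" where
  "kinks K = (\<Union>b\<in>Basis. \<Union>r\<in>\<rat>. \<Union>m. kink_set K b r (1 / real (Suc m)))"

text \<open>Distinct unit normals give distinct points \<open>u / h(u)\<close> and
  \<open>v / h(v)\<close>: equal points have equal norms, hence equal support values, hence equal
  normals. So some coordinate differs, a rational lies strictly between its two values, and a margin
  \<open>1 / (m + 1)\<close> fits on both sides.\<close>

lemma multiple_normals_in_kinks:
  fixes K :: "'a::euclidean_space set"
  assumes y: "y \<in> K" and u: "norm u = 1" "y \<bullet> u = support_fun K u" "0 < support_fun K u"
    and v: "norm v = 1" "y \<bullet> v = support_fun K v" "0 < support_fun K v" and "u \<noteq> v"
  shows "y \<in> kinks K"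
proof -
  have aux: "y \<in> kinks K"
    if u: "norm u = 1" "y \<bullet> u = support_fun K u" "0 < support_fun K u"
    and v: "norm v = 1" "y \<bullet> v = support_fun K v" "0 < support_fun K v"
    and b: "b \<in> Basis" and less: "(u \<bullet> b) / support_fun K u < (v \<bullet> b) / support_fun K v" for u v b :: 'a
  proof -
    obtain r where r: "r \<in> \<rat>" "(u \<bullet> b) / support_fun K u < r" "r < (v \<bullet> b) / support_fun K v"
      using Rats_dense_in_real[OF less] by blast
    define e where "e = min (min (support_fun K u) (support_fun K v)) (min (r - (u \<bullet> b) / support_fun K u) ((v \<bullet> b) / support_fun K v - r))"
    have "0 < e" using u v r by (simp add: e_def)
    then obtain m where "inverse (real (Suc m)) < e" using reals_Archimedean by blast
    then have m: "1 / real (Suc m) \<le> support_fun K u" "1 / real (Suc m) \<le> support_fun K v"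
       "(u \<bullet> b) / support_fun K u \<le> r - 1 / real (Suc m)" "r + 1 / real (Suc m) \<le> (v \<bullet> b) / support_fun K v"
      by (auto simp: e_def inverse_eq_divide)
    have A: "u \<bullet> b \<le> (r - 1 / real (Suc m)) * support_fun K u" using m(3) u(3) by (simp only: pos_divide_le_eq)
    have B: "(r + 1 / real (Suc m)) * support_fun K v \<le> v \<bullet> b" using m(4) v(3) by (simp only: pos_le_divide_eq)
    have "y \<in> kink_set K b r (1 / real (Suc m))"
      unfolding kink_set_def by (intro CollectI conjI exI[of _ u] exI[of _ v] y u v m(1,2) A B)
    then show ?thesis using b r(1) by (auto simp: kinks_def)
  qed
  have "\<exists>b\<in>Basis. (u \<bullet> b) / support_fun K u \<noteq> (v \<bullet> b) / support_fun K v"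
  proof (rule ccontr)
    assume "\<not> ?thesis"
    then have eqb: "(u \<bullet> b) / support_fun K u = (v \<bullet> b) / support_fun K v" if "b \<in> Basis" for b using that by blast
    have eq: "u /\<^sub>R support_fun K u = v /\<^sub>R support_fun K v"
    proof (rule euclidean_eqI)
      fix b :: 'a assume "b \<in> Basis"
      from eqb[OF this] show "(u /\<^sub>R support_fun K u) \<bullet> b = (v /\<^sub>R support_fun K v) \<bullet> b"
        by (simp only: inner_scaleR_left divide_inverse mult.commute)
    qed
    then have "norm (u /\<^sub>R support_fun K u) = norm (v /\<^sub>R support_fun K v)" by simp
    then have "support_fun K u = support_fun K v" using u v by (simp add: inverse_eq_iff_eq)
    then show False using eq u(3) \<open>u \<noteq> v\<close> by simp
  qed
  then obtain b where b: "b \<in> Basis" "(u \<bullet> b) / support_fun K u \<noteq> (v \<bullet> b) / support_fun K v" by blast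
  then consider "(u \<bullet> b) / support_fun K u < (v \<bullet> b) / support_fun K v" | "(v \<bullet> b) / support_fun K v < (u \<bullet> b) / support_fun K u"
    by linarith
  then show ?thesis
  proof cases
    case 1 show ?thesis by (rule aux[OF u v b(1) 1])
  next
    case 2 show ?thesis by (rule aux[OF v u b(1) 2])
  qed
qed

lemma cone_of_UN: "cone_of (\<Union>i\<in>I. A i) = (\<Union>i\<in>I. cone_of (A i))"
  by (auto simp: cone_of_def)

lemma cone_kinks_null:
  fixes K :: "'a::euclidean_space set"
  assumes K: "compact K"
  shows "cone_of (kinks K) \<in> null_sets lborel"
  unfolding kinks_def cone_of_UN
proof (intro null_sets_UN' countable_finite[OF finite_Basis] countable_rat countableI_type)
  fix b r m assume "b \<in> (Basis :: 'a set)"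
  then show "cone_of (kink_set K b r (1 / real (Suc m))) \<in> null_sets lborel"
    using cone_kink_set_null[OF K, of b] compact_cone_of[OF compact_kink_set[OF K]]
    by (auto simp: null_sets_def intro: borel_compact)
qed

text \<open>The cones over the countably many kink sets are Lebesgue null, and
  \<open>hausdorff_le_cone\<close> transfers this to the compact sets themselves.\<close>

lemma hausdorff_kinks_null:
  fixes K :: "(real^'n) set"
  assumes K: "compact K" "0 \<in> interior K"
  shows "hausdorff_outer (CARD('n) - 1) (kinks K) = 0"
proof -
  obtain C where C: "\<And>B. compact B \<Longrightarrow> B \<subseteq> normal_preimage K UNIV \<Longrightarrow>
    hausdorff_outer (CARD('n) - 1) B \<le> ennreal C * emeasure lborel (cone_of B)"
    using hausdorff_le_cone[OF K] by blast
  have "kinks K \<in> null_sets (hausdorff_measure (CARD('n) - 1))"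
    unfolding kinks_def
  proof (intro null_sets_UN' countable_finite[OF finite_Basis] countable_rat countableI_type)
    fix b r m assume b: "b \<in> (Basis :: (real^'n) set)"
    let ?B = "kink_set K b r (1 / real (Suc m))"
    have "?B \<subseteq> normal_preimage K UNIV" by (auto simp: kink_set_def normal_preimage_def)
    then have "hausdorff_outer (CARD('n) - 1) ?B \<le> ennreal C * emeasure lborel (cone_of ?B)"
      by (intro C compact_kink_set K)
    also have "\<dots> = 0" by (simp add: cone_kink_set_null[OF K(1) b])
    finally show "?B \<in> null_sets (hausdorff_measure (CARD('n) - 1))"
      using borel_compact[OF compact_kink_set[OF K(1)]]
      by (auto simp: null_sets_def emeasure_hausdorff_measure)
  qed
  then show ?thesis using emeasure_hausdorff_measure[of "kinks K"] by (auto simp: null_sets_def)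
qed

text \<open>Push-forward along a relation that is single-valued off the null set \<open>N\<close>.
  Measurability of preimages is assumed for closed sets only; \<open>f\<close> extends
  \<open>M\<close> to sets that are determined up to a part of \<open>N\<close>. It is instantiated
  with Hausdorff outer measure for the Gauss map, and with completed Lebesgue measure for the map
  from cone points to normals.\<close>

lemma multivalued_image_measure:
  fixes M :: "'a measure" and R :: "'a \<Rightarrow> 'b::metric_space \<Rightarrow> bool"
  defines "Pre \<equiv> \<lambda>\<omega>. {x \<in> space M. \<exists>u\<in>\<omega>. R x u}"
  assumes RS: "\<And>x u. R x u \<Longrightarrow> u \<in> S"
    and pre: "\<And>\<omega>. closed \<omega> \<Longrightarrow> Pre \<omega> \<in> sets M"
    and N: "N \<in> null_sets M" and uniq: "\<And>x u v. R x u \<Longrightarrow> R x v \<Longrightarrow> u \<noteq> v \<Longrightarrow> x \<in> N"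
    and f: "\<And>A B. A \<in> sets M \<Longrightarrow> A \<subseteq> B \<Longrightarrow> B \<subseteq> A \<union> N \<Longrightarrow> f B = emeasure M A"
    and \<omega>: "\<omega> \<in> sets (restrict_space borel S)"
  shows "emeasure (measure_of S (sets (restrict_space borel S)) (\<lambda>\<omega>. f (Pre \<omega>))) \<omega> = f (Pre \<omega>)"
proof -
  define X where "X = Pre UNIV - N"
  have X: "X \<in> sets M" using pre[of UNIV] N by (auto simp: X_def)
  define g where "g x = (THE u. R x u)" for x
  have g: "R x u \<longleftrightarrow> u = g x" if xX: "x \<in> X" for x u
  proof -
    obtain w where w: "R x w" using xX by (auto simp: X_def Pre_def)
    have "R x v \<Longrightarrow> v = w" for v using uniq[of x v w] w xX by (auto simp: X_def)
    then have "g x = w" unfolding g_def using w by blast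
    then show ?thesis using w uniq[of x u w] xX by (auto simp: X_def)
  qed
  have XM: "X \<subseteq> space M" using sets.sets_into_space[OF X] .
  define MX where "MX = restrict_space M X"
  have sMX: "space MX = X" using XM by (auto simp: MX_def space_restrict_space)
  have "g \<in> borel_measurable MX"
  proof (rule borel_measurableI)
    fix T :: "'b set" assume "open T"
    \<comment> \<open>On \<open>X\<close> the relation is a function, so the preimage of the open
      set \<open>T\<close> is the complement of the preimage of a closed set.\<close>
    then have "Pre (- T) \<in> sets M" by (intro pre closed_Compl)
    then have "X - Pre (- T) \<in> sets M" using X by auto
    moreover have "g -` T \<inter> space MX = X - Pre (- T)"
      unfolding sMX using g XM by (auto simp: Pre_def)
    ultimately show "g -` T \<inter> space MX \<in> sets MX"
      using XM by (auto simp: MX_def sets_restrict_space)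
  qed
  moreover have "g x \<in> S" if "x \<in> X" for x using RS g[OF that] by blast
  ultimately have gm: "g \<in> measurable MX (restrict_space borel S)"
    by (intro measurable_restrict_space2) (auto simp: sMX)
  define \<nu> where "\<nu> = distr MX (restrict_space borel S) g"
  have em: "emeasure \<nu> \<omega> = f (Pre \<omega>)" if \<omega>: "\<omega> \<in> sets (restrict_space borel S)" for \<omega>
  proof -
    let ?A = "g -` \<omega> \<inter> X"
    have "?A \<in> sets MX" using measurable_sets[OF gm \<omega>] by (simp add: sMX)
    then have A: "?A \<in> sets M" using X by (auto simp: MX_def sets_restrict_space)
    have "f (Pre \<omega>) = emeasure M ?A"
    proof (rule f[OF A])
      show "?A \<subseteq> Pre \<omega>" using g XM by (auto simp: Pre_def)
      show "Pre \<omega> \<subseteq> ?A \<union> N"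
      proof
        fix x assume x: "x \<in> Pre \<omega>"
        show "x \<in> ?A \<union> N"
        proof (cases "x \<in> N")
          case False
          then have "x \<in> X" using x by (auto simp: X_def Pre_def)
          then show ?thesis using x g by (auto simp: Pre_def)
        qed simp
      qed
    qed
    also have "\<dots> = emeasure MX ?A" using X XM by (simp add: MX_def emeasure_restrict_space)
    also have "\<dots> = emeasure \<nu> \<omega>" unfolding \<nu>_def using emeasure_distr[OF gm \<omega>] by (simp add: sMX)
    finally show ?thesis by simp
  qed
  have sp: "space (restrict_space borel S) = S" by (simp add: space_restrict_space)
  have sub: "sets (restrict_space borel S) \<subseteq> Pow S" using sets.space_closed[of "restrict_space borel S"] by (simp add: sp)
  have "sigma_sets S (sets (restrict_space borel S)) = sets (restrict_space borel S)"
    using sets.sigma_sets_eq[of "restrict_space borel S"] by (simp add: sp)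
  then have "measure_of S (sets (restrict_space borel S)) (\<lambda>\<omega>. f (Pre \<omega>)) = measure_of S (sets (restrict_space borel S)) (emeasure \<nu>)"
    using em by (intro measure_of_eq sub) auto
  also have "\<dots> = \<nu>" using measure_of_of_measure[of \<nu>] by (simp add: \<nu>_def sp)
  finally show ?thesis using em[OF \<omega>] by simp
qed

section \<open>Null sets of several normals and the surface area measure\<close>

lemma support_fun_translation:
  fixes K :: "'a::euclidean_space set"
  assumes "compact K" "K \<noteq> {}"
  shows "support_fun ((+) v ` K) u = support_fun K u + v \<bullet> u"
proof (rule antisym)
  have c: "compact ((+) v ` K)" by (intro compact_continuous_image assms continuous_intros)
  show "support_fun ((+) v ` K) u \<le> support_fun K u + v \<bullet> u"
    using assms support_fun_upper[OF assms(1)] by (intro support_fun_least) (auto simp: inner_add_left)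
  have "support_fun K u \<le> support_fun ((+) v ` K) u - v \<bullet> u"
  proof (rule support_fun_least[OF assms(2)])
    fix x assume "x \<in> K"
    then have "(v + x) \<bullet> u \<le> support_fun ((+) v ` K) u" by (intro support_fun_upper[OF c]) auto
    then show "x \<bullet> u \<le> support_fun ((+) v ` K) u - v \<bullet> u" by (simp add: inner_add_left)
  qed
  then show "support_fun K u + v \<bullet> u \<le> support_fun ((+) v ` K) u" by simp
qed

lemma normal_preimage_translation:
  fixes K :: "'a::euclidean_space set"
  assumes "compact K" "K \<noteq> {}"
  shows "normal_preimage ((+) v ` K) \<omega> = (+) v ` normal_preimage K \<omega>"
  unfolding normal_preimage_def support_fun_translation[OF assms] by (force simp: inner_add_left)

lemma kinks_borel: "compact K \<Longrightarrow> kinks (K :: 'a::euclidean_space set) \<in> sets borel"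
  unfolding kinks_def
  by (intro sets.countable_UN'' countable_finite[OF finite_Basis] countable_rat countableI_type
      borel_compact compact_kink_set)

lemma convex_body_recentre:
  fixes K :: "'a::euclidean_space set"
  assumes "convex_body K"
  obtains z where "compact ((+) (- z) ` K)" "0 \<in> interior ((+) (- z) ` K)"
proof -
  obtain z where z: "z \<in> interior K" using assms by (auto simp: convex_body_def)
  have "compact ((+) (- z) ` K)"
    using assms by (intro compact_continuous_image continuous_intros) (simp add: convex_body_def)
  moreover have "interior ((+) (- z) ` K) = (+) (- z) ` interior K" by (rule interior_translation)
  then have "0 \<in> interior ((+) (- z) ` K)" using z by force
  ultimately show ?thesis by (rule that)
qed

text \<open>The kink argument needs positive support values, so an interior point is first moved to
  the origin. Translation changes neither the normals at corresponding points nor Hausdorff null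
  sets.\<close>

lemma multiple_normals_null:
  fixes K :: "(real^'n) set"
  assumes K: "convex_body K"
  obtains N where "N \<in> null_sets (hausdorff_measure (CARD('n) - 1))"
    "\<And>y u v. \<lbrakk>y \<in> K; norm u = 1; norm v = 1; y \<bullet> u = support_fun K u; y \<bullet> v = support_fun K v; u \<noteq> v\<rbrakk> \<Longrightarrow> y \<in> N"
proof -
  obtain z where z: "compact ((+) (- z) ` K)" "0 \<in> interior ((+) (- z) ` K)"
    by (rule convex_body_recentre[OF K])
  have cK: "compact K" "K \<noteq> {}" using K by (auto simp: convex_body_def)
  let ?K = "(+) (- z) ` K"
  let ?N = "(+) z ` kinks ?K"
  show ?thesis
  proof (rule that[of ?N])
    have "?N \<in> sets borel" by (intro borel_translation_image kinks_borel z)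
    then show "?N \<in> null_sets (hausdorff_measure (CARD('n) - 1))"
      using hausdorff_kinks_null[OF z] by (auto simp: null_sets_def emeasure_hausdorff_measure hausdorff_outer_translation)
    fix y u v assume *: "y \<in> K" "norm u = 1" "norm v = 1" "y \<bullet> u = support_fun K u" "y \<bullet> v = support_fun K v" "u \<noteq> v"
    have eq: "(- z + y) \<bullet> w = support_fun ?K w" if "y \<bullet> w = support_fun K w" for w
      using that by (simp only: support_fun_translation[OF cK] inner_add_left)
    have "- z + y \<in> ?K" using *(1) by (rule imageI)
    then have "- z + y \<in> kinks ?K"
      by (rule multiple_normals_in_kinks[OF _ *(2) eq[OF *(4)] support_fun_pos[OF z *(2)] *(3) eq[OF *(5)] support_fun_pos[OF z *(3)] *(6)])
    then show "y \<in> ?N" by (intro image_eqI[of _ _ "- z + y"]) auto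
  qed
qed

lemma hausdorff_frontier_finite:
  fixes K :: "(real^'n) set"
  assumes K: "convex_body K"
  shows "hausdorff_outer (CARD('n) - 1) (normal_preimage K \<omega>) < \<infinity>"
proof -
  obtain z where z: "compact ((+) (- z) ` K)" "0 \<in> interior ((+) (- z) ` K)"
    by (rule convex_body_recentre[OF K])
  have cK: "compact K" "K \<noteq> {}" using K by (auto simp: convex_body_def)
  let ?B = "normal_preimage ((+) (- z) ` K) UNIV"
  obtain C where C: "\<And>B. compact B \<Longrightarrow> B \<subseteq> ?B \<Longrightarrow>
    hausdorff_outer (CARD('n) - 1) B \<le> ennreal C * emeasure lborel (cone_of B)"
    using hausdorff_le_cone[OF z] by blast
  have cB: "compact ?B" by (rule compact_normal_preimage[OF z(1)]) simp
  have "hausdorff_outer (CARD('n) - 1) (normal_preimage K \<omega>) \<le> hausdorff_outer (CARD('n) - 1) (normal_preimage K UNIV)"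
    by (intro hausdorff_outer_mono normal_preimage_mono) simp
  also have "\<dots> = hausdorff_outer (CARD('n) - 1) ?B"
    by (simp only: normal_preimage_translation[OF cK] hausdorff_outer_translation)
  also have "\<dots> \<le> ennreal C * emeasure lborel (cone_of ?B)" using cB by (intro C) auto
  also have "\<dots> < \<infinity>"
    using emeasure_bounded_finite[OF compact_imp_bounded[OF compact_cone_of[OF cB]]] by (simp add: ennreal_mult_less_top)
  finally show ?thesis .
qed

lemma emeasure_surface_area_measure:
  fixes K :: "(real^'n) set"
  assumes K: "convex_body K" and \<omega>: "\<omega> \<in> sets (restrict_space borel (sphere 0 1))"
  shows "emeasure (surface_area_measure K) \<omega> = hausdorff_outer (CARD('n) - 1) (normal_preimage K \<omega>)"
proof -
  let ?M = "hausdorff_measure (CARD('n) - 1) :: (real^'n) measure"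
  let ?R = "\<lambda>x u. x \<in> K \<and> norm u = 1 \<and> x \<bullet> u = support_fun K u"
  have cK: "compact K" using K by (simp add: convex_body_def)
  obtain N where N: "N \<in> null_sets ?M"
    "\<And>y u v. \<lbrakk>y \<in> K; norm u = 1; norm v = 1; y \<bullet> u = support_fun K u; y \<bullet> v = support_fun K v; u \<noteq> v\<rbrakk> \<Longrightarrow> y \<in> N"
    using multiple_normals_null[OF K] by blast
  have pre: "{x \<in> space ?M. \<exists>u\<in>\<omega>. ?R x u} = normal_preimage K \<omega>" for \<omega>
    by (auto simp: normal_preimage_def)
  have "emeasure (measure_of (sphere 0 1) (sets (restrict_space borel (sphere 0 1)))
      (\<lambda>\<omega>. hausdorff_outer (CARD('n) - 1) {x \<in> space ?M. \<exists>u\<in>\<omega>. ?R x u})) \<omega> =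
    hausdorff_outer (CARD('n) - 1) {x \<in> space ?M. \<exists>u\<in>\<omega>. ?R x u}"
  proof (rule multivalued_image_measure[OF _ _ N(1) _ _ \<omega>])
    fix \<omega> :: "(real^'n) set" assume "closed \<omega>"
    then show "{x \<in> space ?M. \<exists>u\<in>\<omega>. ?R x u} \<in> sets ?M"
      unfolding pre using compact_normal_preimage[OF cK, of \<omega>] by (auto intro: borel_compact)
  next
    fix A B :: "(real^'n) set" assume A: "A \<in> sets ?M" "A \<subseteq> B" "B \<subseteq> A \<union> N"
    have "hausdorff_outer (CARD('n) - 1) B \<le> hausdorff_outer (CARD('n) - 1) A + hausdorff_outer (CARD('n) - 1) N"
      by (intro order_trans[OF hausdorff_outer_mono[OF A(3)] hausdorff_outer_Un])
    also have "hausdorff_outer (CARD('n) - 1) N = 0"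
      using N(1) by (auto simp: null_sets_def emeasure_hausdorff_measure)
    finally have "hausdorff_outer (CARD('n) - 1) B \<le> hausdorff_outer (CARD('n) - 1) A" by simp
    with hausdorff_outer_mono[OF A(2)] show "hausdorff_outer (CARD('n) - 1) B = emeasure ?M A"
      using A(1) by (auto simp: emeasure_hausdorff_measure intro: antisym)
  qed (use N(2) in auto)
  then show ?thesis
    unfolding surface_area_measure_def normal_preimage_eq[OF cK] pre .
qed

lemma sets_surface_area_measure [simp, measurable_cong]:
  "sets (surface_area_measure K) = sets (restrict_space borel (sphere 0 1))"
  unfolding surface_area_measure_def
  using sets.sigma_sets_eq[of "restrict_space borel (sphere (0::real^'n) 1)"] sets.space_closed[of "restrict_space borel (sphere (0::real^'n) 1)"]
  by (subst sets_measure_of) (auto simp: space_restrict_space)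

section \<open>The cone-volume measure\<close>

text \<open>The measure \<open>h\<^sub>K dS\<^sub>K / n\<close>.\<close>

definition cone_measure :: "'a::euclidean_space set \<Rightarrow> 'a measure" where
  "cone_measure K = measure_of (sphere 0 1) (sets (restrict_space borel (sphere 0 1)))
     (\<lambda>\<omega>. emeasure lebesgue (cone_of (normal_preimage K \<omega>)))"

lemma sets_cone_measure [simp, measurable_cong]:
  "sets (cone_measure (K::'a::euclidean_space set)) = sets (restrict_space borel (sphere 0 1))"
  unfolding cone_measure_def
  using sets.sigma_sets_eq[of "restrict_space borel (sphere (0::'a) 1)"] sets.space_closed[of "restrict_space borel (sphere (0::'a) 1)"]
  by (subst sets_measure_of) (auto simp: space_restrict_space)

lemma cone_of_subset:
  assumes "convex K" "0 \<in> K" "B \<subseteq> K"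
  shows "cone_of B \<subseteq> K"
proof
  fix x assume "x \<in> cone_of B"
  then obtain t y where "0 \<le> t" "t \<le> 1" "y \<in> B" "x = t *\<^sub>R y" by (auto simp: cone_of_def)
  then have "0 \<le> t" "t \<le> 1" "y \<in> K" "x = t *\<^sub>R y" using assms(3) by auto
  then show "x \<in> K" using convexD[OF assms(1) assms(2), of y "1 - t" t] by simp
qed

text \<open>The apex of the cones is fixed at the origin, which may lie on the boundary, so
  \<open>K\<close> cannot be recentred here. Cone points over a boundary point with a normal of
  support value 0 stay on the frontier, which is null because \<open>K\<close> is convex; the
  remaining ambiguous points lie in the cone over the kinks.\<close>

lemma cone_multiple_normals_null:
  fixes K :: "'a::euclidean_space set"
  assumes K: "convex_body K" "0 \<in> K"
  obtains N where "N \<in> null_sets lborel"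
    "\<And>t t' y y' u v. \<lbrakk>0 \<le> t; 0 \<le> t'; t \<le> 1; t' \<le> 1; y \<in> K; y' \<in> K; t *\<^sub>R y = t' *\<^sub>R y'; norm u = 1; norm v = 1;
       y \<bullet> u = support_fun K u; y' \<bullet> v = support_fun K v; u \<noteq> v\<rbrakk> \<Longrightarrow> t *\<^sub>R y \<in> N"
proof -
  have cK: "compact K" "convex K" using K(1) by (auto simp: convex_body_def)
  let ?N = "frontier K \<union> (cone_of (kinks K) \<union> {0})"
  have fr: "frontier K \<in> null_sets lborel"
  proof -
    have "frontier K \<in> null_sets lebesgue" using negligible_convex_frontier[OF cK(2)] by (simp add: negligible_iff_null_sets)
    then show ?thesis using null_sets_completion_iff[of "frontier K" lborel] borel_closed[OF frontier_closed] by auto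
  qed
  have N: "?N \<in> null_sets lborel" by (intro null_sets.Un fr cone_kinks_null[OF cK(1)]) (simp add: null_sets_def)
  have zero: "t *\<^sub>R y \<in> frontier K" if "0 \<le> t" "t \<le> 1" "y \<in> K" "norm u = 1" "y \<bullet> u = support_fun K u" "support_fun K u = 0" for t y u
  proof -
    have "t *\<^sub>R y \<in> cone_of K" using that by (auto simp: cone_of_def)
    then have "t *\<^sub>R y \<in> K" using cone_of_subset[OF cK(2) K(2)] by blast
    moreover have "u \<in> unit_normals K (t *\<^sub>R y)"
      using that \<open>t *\<^sub>R y \<in> K\<close> by (subst unit_normals_iff[OF cK(1)]) auto
    ultimately show ?thesis by (rule unit_normals_frontier[OF cK(1)])
  qed
  have h0: "0 \<le> support_fun K u" for u by (rule support_fun_nonneg[OF cK(1) K(2)])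
  \<comment> \<open>Two parameters \<open>t < t'\<close> for the same cone point give
    \<open>t' h(v) = t (y \<bullet> v) \<le> t h(v)\<close>, which forces \<open>h(v) = 0\<close>.
    So where support values are positive, a cone point determines its boundary point.\<close>
  have less: "support_fun K v = 0"
    if "0 < t" "t < t'" "y \<in> K" "t *\<^sub>R y = t' *\<^sub>R y'" "y' \<bullet> v = support_fun K v" for t t' y y' v
  proof -
    have "t * (y \<bullet> v) = t' * (y' \<bullet> v)" using that(4) by (metis inner_scaleR_left)
    then have "t' * support_fun K v \<le> t * support_fun K v"
      using support_fun_upper[OF cK(1) that(3), of v] that(1,5) by (metis mult_left_mono less_imp_le)
    then show ?thesis using that(2) h0[of v] by (metis less_le_not_le linorder_not_le mult_strict_right_mono order_le_less)
  qed
  show ?thesis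
  proof (rule that[OF N])
    fix t t' y y' u v
    assume *: "0 \<le> t" "0 \<le> t'" "t \<le> 1" "t' \<le> 1" "y \<in> K" "y' \<in> K" "t *\<^sub>R y = t' *\<^sub>R y'" "norm u = 1" "norm v = 1"
       "y \<bullet> u = support_fun K u" "y' \<bullet> v = support_fun K v" "u \<noteq> v"
    show "t *\<^sub>R y \<in> ?N"
    proof (cases "t = 0 \<or> t' = 0")
      case True then show ?thesis using *(7) by auto
    next
      case False
      then have t: "0 < t" "0 < t'" using * by auto
      consider "support_fun K u = 0" | "support_fun K v = 0" | "0 < support_fun K u" "0 < support_fun K v"
        using h0[of u] h0[of v] by force
      then show ?thesis
      proof cases
        case 1 then show ?thesis using zero[of t y u] * by auto
      next
        case 2 then show ?thesis using zero[of t' y' v] * by auto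
      next
        case 3
        have "t = t'"
          using less[of t t' y y' v] less[of t' t y' y u] * t 3 by (metis less_irrefl linorder_neqE_linordered_idom)
        then have "y = y'" using *(7) t by simp
        then have "y \<in> kinks K" using multiple_normals_in_kinks[of y K u v] * 3 by auto
        then have "t *\<^sub>R y \<in> cone_of (kinks K)"
          unfolding cone_of_def by (intro image_eqI[of _ _ "(t, y)"]) (use * in auto)
        then show ?thesis by simp
      qed
    qed
  qed
qed

lemma emeasure_cone_measure:
  fixes K :: "'a::euclidean_space set"
  assumes K: "convex_body K" "0 \<in> K" and \<omega>: "\<omega> \<in> sets (restrict_space borel (sphere 0 1))"
  shows "emeasure (cone_measure K) \<omega> = emeasure lebesgue (cone_of (normal_preimage K \<omega>))"
proof -
  let ?R = "\<lambda>x u. \<exists>t y. 0 \<le> t \<and> t \<le> 1 \<and> x = t *\<^sub>R y \<and> y \<in> K \<and> norm u = 1 \<and> y \<bullet> u = support_fun K u"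
  have cK: "compact K" using K by (simp add: convex_body_def)
  obtain N where N: "N \<in> null_sets lborel"
    "\<And>t t' y y' u v. \<lbrakk>0 \<le> t; 0 \<le> t'; t \<le> 1; t' \<le> 1; y \<in> K; y' \<in> K; t *\<^sub>R y = t' *\<^sub>R y'; norm u = 1; norm v = 1;
       y \<bullet> u = support_fun K u; y' \<bullet> v = support_fun K v; u \<noteq> v\<rbrakk> \<Longrightarrow> t *\<^sub>R y \<in> N"
    using cone_multiple_normals_null[OF K] by blast
  have pre: "{x \<in> space lborel. \<exists>u\<in>\<omega>. ?R x u} = cone_of (normal_preimage K \<omega>)" for \<omega>
    by (fastforce simp: normal_preimage_def cone_of_def)
  have "emeasure (measure_of (sphere 0 1) (sets (restrict_space borel (sphere 0 1)))
      (\<lambda>\<omega>. emeasure lebesgue {x \<in> space lborel. \<exists>u\<in>\<omega>. ?R x u})) \<omega> =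
    emeasure lebesgue {x \<in> space lborel. \<exists>u\<in>\<omega>. ?R x u}"
  proof (rule multivalued_image_measure[OF _ _ N(1) _ _ \<omega>])
    fix \<omega> :: "'a set" assume "closed \<omega>"
    then show "{x \<in> space lborel. \<exists>u\<in>\<omega>. ?R x u} \<in> sets lborel"
      unfolding pre using compact_cone_of[OF compact_normal_preimage[OF cK, of \<omega>]] by (auto intro: borel_compact)
  next
    fix A B :: "'a set" assume A: "A \<in> sets lborel" "A \<subseteq> B" "B \<subseteq> A \<union> N"
    have "B - A \<subseteq> N" using A by auto
    then have "B - A \<in> null_sets lebesgue"
      using N(1) null_sets_completion_subset null_sets_completionI by blast
    then have "emeasure lebesgue (A \<union> (B - A)) = emeasure lebesgue A"
      using A(1) by (intro emeasure_Un_null_set) auto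
    also have "A \<union> (B - A) = B" using A(2) by auto
    finally show "emeasure lebesgue B = emeasure lborel A" using A(1) by simp
  next
    fix x u v assume "?R x u" "?R x v" "u \<noteq> v"
    then show "x \<in> N" using N(2) by metis
  qed auto
  then show ?thesis unfolding cone_measure_def pre .
qed

lemma emeasure_cone_measure_closed:
  fixes K :: "'a::euclidean_space set"
  assumes K: "convex_body K" "0 \<in> K" and \<omega>: "closed \<omega>" "\<omega> \<subseteq> sphere 0 1"
  shows "emeasure (cone_measure K) \<omega> = emeasure lborel (cone_of (normal_preimage K \<omega>))"
proof -
  have "\<omega> \<in> sets (restrict_space borel (sphere 0 1))"
    using \<omega> by (auto simp: sets_restrict_space intro!: image_eqI[of _ _ \<omega>])
  moreover have "compact (cone_of (normal_preimage K \<omega>))"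
    using K \<omega> by (intro compact_cone_of compact_normal_preimage) (auto simp: convex_body_def)
  ultimately show ?thesis using emeasure_cone_measure[OF K] by (simp add: borel_compact)
qed

section \<open>Comparing measures on the sphere through compact sets\<close>

lemma sphere_setI: "A \<in> sets borel \<Longrightarrow> A \<subseteq> sphere 0 1 \<Longrightarrow> A \<in> sets (restrict_space borel (sphere (0::'a::euclidean_space) 1))"
  by (auto simp: sets_restrict_space intro!: image_eqI[of _ _ A])

lemma sphere_setD:
  assumes "A \<in> sets (restrict_space borel (sphere (0::'a::euclidean_space) 1))"
  shows "A \<in> sets borel" "A \<subseteq> sphere 0 1"
proof -
  obtain C where "C \<in> sets borel" "A = sphere 0 1 \<inter> C" using assms unfolding sets_restrict_space by blast
  then show "A \<in> sets borel" "A \<subseteq> sphere 0 1" by auto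
qed

lemma sphere_inner_regular:
  fixes M :: "'a::euclidean_space measure"
  assumes sets[measurable_cong, simp]: "sets M = sets (restrict_space borel (sphere 0 1))"
    and fin: "emeasure M (sphere 0 1) < \<infinity>" and B: "B \<in> sets M"
  shows "emeasure M B = (SUP K \<in> {K. K \<subseteq> B \<and> compact K}. emeasure M K)"
proof -
  have sp: "space M = sphere 0 1" using sets_eq_imp_space_eq[OF sets] by (simp add: space_restrict_space)
  let ?D = "distr M borel (\<lambda>x. x)"
  have id[measurable]: "(\<lambda>x. x) \<in> measurable M borel"
    by (subst measurable_cong_sets[OF sets refl]) (intro measurable_restrict_space1, simp)
  have Bs: "B \<subseteq> sphere 0 1" using sets.sets_into_space[OF B] sp by simp
  have Bb: "B \<in> sets borel" using B by (auto simp: sets_restrict_space)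
  have em: "emeasure ?D A = emeasure M A" if "A \<in> sets borel" "A \<subseteq> sphere 0 1" for A
    using that by (subst emeasure_distr) (auto simp: sp Int_absorb2)
  have "emeasure ?D (space ?D) = emeasure M (sphere 0 1)" by (subst emeasure_distr) (auto simp: sp)
  then have "emeasure ?D B = (SUP K \<in> {K. K \<subseteq> B \<and> compact K}. emeasure ?D K)"
    using fin by (intro inner_regular Bb) auto
  also have "\<dots> = (SUP K \<in> {K. K \<subseteq> B \<and> compact K}. emeasure M K)"
    using Bs by (intro SUP_cong em refl) (auto intro: borel_compact)
  finally show ?thesis using em[OF Bb Bs] by simp
qed

text \<open>Inner regularity of \<open>M\<close> extends the comparison from compact sets to Borel
  sets inside one ball. The balls of the cover are peeled off one at a time, which splits
  \<open>B\<close> into disjoint pieces.\<close>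

lemma sphere_measure_le_local:
  fixes M N :: "'a::euclidean_space measure"
  assumes M: "sets M = sets (restrict_space borel (sphere 0 1))" "emeasure M (sphere 0 1) < \<infinity>"
    and N: "sets N = sets (restrict_space borel (sphere 0 1))"
    and T: "finite T"
    and loc: "\<And>u \<omega>. u \<in> T \<Longrightarrow> compact \<omega> \<Longrightarrow> \<omega> \<subseteq> X \<inter> cball u \<epsilon> \<Longrightarrow> emeasure M \<omega> \<le> \<theta> * emeasure N \<omega>"
    and B: "B \<in> sets M" "B \<subseteq> X" "B \<subseteq> (\<Union>u\<in>T. cball u \<epsilon>)"
  shows "emeasure M B \<le> \<theta> * emeasure N B"
  using T loc B
proof (induction T arbitrary: B rule: finite_induct)
  case (insert u T)
  have sph: "A \<inter> cball u \<epsilon> \<in> sets M" if "A \<in> sets M" for A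
    using sphere_setD[of A] that unfolding M(1) by (intro sphere_setI sets.Int) auto
  have 1: "B \<inter> cball u \<epsilon> \<in> sets M" by (rule sph) fact
  then have 2: "B - cball u \<epsilon> \<in> sets M" using insert.prems(2) sets.Diff[of B M "B \<inter> cball u \<epsilon>"] by (simp add: Diff_Int)
  have "emeasure M (B \<inter> cball u \<epsilon>) = (SUP K \<in> {K. K \<subseteq> B \<inter> cball u \<epsilon> \<and> compact K}. emeasure M K)"
    by (rule sphere_inner_regular[OF M 1])
  also have "\<dots> \<le> \<theta> * emeasure N (B \<inter> cball u \<epsilon>)"
  proof (rule SUP_least, clarify)
    fix K assume K: "K \<subseteq> B \<inter> cball u \<epsilon>" "compact K"
    have "emeasure M K \<le> \<theta> * emeasure N K" using K insert.prems(3) by (intro insert.prems(1)) auto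
    also have "\<dots> \<le> \<theta> * emeasure N (B \<inter> cball u \<epsilon>)"
      using K 1 M(1) N by (intro mult_left_mono emeasure_mono) auto
    finally show "emeasure M K \<le> \<theta> * emeasure N (B \<inter> cball u \<epsilon>)" .
  qed
  finally have a: "emeasure M (B \<inter> cball u \<epsilon>) \<le> \<theta> * emeasure N (B \<inter> cball u \<epsilon>)" .
  have b: "emeasure M (B - cball u \<epsilon>) \<le> \<theta> * emeasure N (B - cball u \<epsilon>)"
  proof (rule insert.IH[OF _ 2])
    show "emeasure M \<omega> \<le> \<theta> * emeasure N \<omega>" if "v \<in> T" "compact \<omega>" "\<omega> \<subseteq> X \<inter> cball v \<epsilon>" for v \<omega>
      using insert.prems(1)[of v \<omega>] that by simp
    show "B - cball u \<epsilon> \<subseteq> X" using insert.prems(3) by blast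
    show "B - cball u \<epsilon> \<subseteq> (\<Union>u\<in>T. cball u \<epsilon>)" using insert.prems(4) by blast
  qed
  have un: "(B \<inter> cball u \<epsilon>) \<union> (B - cball u \<epsilon>) = B" "(B \<inter> cball u \<epsilon>) \<inter> (B - cball u \<epsilon>) = {}" by auto
  have "emeasure M B = emeasure M (B \<inter> cball u \<epsilon>) + emeasure M (B - cball u \<epsilon>)"
    using plus_emeasure[OF 1 2 un(2)] un(1) by simp
  also have "\<dots> \<le> \<theta> * (emeasure N (B \<inter> cball u \<epsilon>) + emeasure N (B - cball u \<epsilon>))"
    unfolding distrib_left by (intro add_mono a b)
  also have "emeasure N (B \<inter> cball u \<epsilon>) + emeasure N (B - cball u \<epsilon>) = emeasure N B"
    using plus_emeasure[of "B \<inter> cball u \<epsilon>" N "B - cball u \<epsilon>"] 1 2 un M(1) N by simp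
  finally show ?case .
qed simp

text \<open>The square is the form in which \<theta> occurs: in both applications two independent
  errors of size \<theta> are multiplied.\<close>

lemma ennreal_le_of_le_mult:
  assumes "\<And>\<theta>. 1 < \<theta> \<Longrightarrow> x \<le> ennreal (\<theta> ^ 2) * y"
  shows "x \<le> y"
proof (cases y)
  case (real r)
  then have "x \<le> ennreal (2\<^sup>2 * r)" using assms[of 2] by (simp add: ennreal_mult)
  then obtain s where s: "x = ennreal s" "0 \<le> s" by (cases x) (auto simp: top_unique)
  have "s \<le> \<theta>\<^sup>2 * r" if "1 < \<theta>" for \<theta>
    using assms[OF that] real s that by (simp add: ennreal_mult[symmetric])
  then have "eventually (\<lambda>\<theta>. s \<le> \<theta>\<^sup>2 * r) (at_right 1)"
    by (auto simp: eventually_at_right_field intro!: exI[of _ 2])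
  moreover have "((\<lambda>\<theta>::real. \<theta>\<^sup>2 * r) \<longlongrightarrow> 1\<^sup>2 * r) (at_right 1)" by (intro tendsto_intros)
  ultimately have "s \<le> 1\<^sup>2 * r" by (intro tendsto_lowerbound) auto
  then show ?thesis using s real by (simp add: ennreal_leI)
qed simp

lemma measurable_support_fun_sphere:
  fixes K :: "'a::euclidean_space set"
  assumes "sets M = sets (restrict_space borel (sphere (0::'a) 1))" "compact K" "K \<noteq> {}"
  shows "support_fun K \<in> borel_measurable M"
  by (subst measurable_cong_sets[OF assms(1) refl])
     (intro measurable_restrict_space1 borel_measurable_support_fun assms)

lemma cone_measure_finite:
  fixes K :: "'a::euclidean_space set"
  assumes "convex_body K" "0 \<in> K"
  shows "emeasure (cone_measure K) \<omega> \<le> emeasure lborel K" "emeasure (cone_measure K) \<omega> < \<infinity>"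
proof -
  have K: "compact K" "convex K" using assms by (auto simp: convex_body_def)
  have "emeasure (cone_measure K) \<omega> \<le> emeasure (cone_measure K) (space (cone_measure K))" by (rule emeasure_space)
  also have "space (cone_measure K) = sphere 0 1"
    using sets_eq_imp_space_eq[OF sets_cone_measure[of K]] by (simp add: space_restrict_space)
  also have "emeasure (cone_measure K) (sphere 0 1) = emeasure lborel (cone_of (normal_preimage K (sphere 0 1)))"
    by (rule emeasure_cone_measure_closed[OF assms]) auto
  also have "\<dots> \<le> emeasure lborel K"
    using K assms(2) by (intro emeasure_mono cone_of_subset normal_preimage_subset) (auto intro: borel_compact)
  finally show *: "emeasure (cone_measure K) \<omega> \<le> emeasure lborel K" .
  show "emeasure (cone_measure K) \<omega> < \<infinity>"
    using * emeasure_bounded_finite[OF compact_imp_bounded[OF K(1)]] by (simp add: order_le_less_trans)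
qed

lemma space_surface_area_measure: "space (surface_area_measure (K :: (real^'n) set)) = sphere 0 1"
  using sets_eq_imp_space_eq[OF sets_surface_area_measure[of K]] by (simp add: space_restrict_space)

lemma space_cone_measure: "space (cone_measure (K :: 'a::euclidean_space set)) = sphere 0 1"
  using sets_eq_imp_space_eq[OF sets_cone_measure[of K]] by (simp add: space_restrict_space)

text \<open>Over a small ball of directions the support function is constant up to a factor
  \<theta>, and flattening costs another factor \<theta>. Hence the two measures agree up to
  \<open>\<theta>\<^sup>2\<close> on small compact sets, therefore on all Borel sets where the
  support function is at least \<delta>, and \<theta> tends to 1.\<close>

lemma surface_cone_measure_bound:
  fixes K :: "(real^'n) set"
  assumes K: "convex_body K" "0 \<in> K" and \<delta>: "0 < \<delta>"
    and B: "B \<in> sets (restrict_space borel (sphere 0 1))" "\<And>u. u \<in> B \<Longrightarrow> \<delta> \<le> support_fun K u"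
  shows "emeasure (density (surface_area_measure K) (\<lambda>u. ennreal (support_fun K u))) B
    = ennreal (hausdorff_scale TYPE('n) * real CARD('n)) * emeasure (cone_measure K) B"
proof -
  let ?S = "surface_area_measure K" and ?V = "cone_measure K" and ?h = "support_fun K"
  define cn where "cn = hausdorff_scale TYPE('n) * real CARD('n)"
  have cn0: "0 \<le> cn" using hausdorff_scale(1)[where 'n='n] by (simp add: cn_def)
  have cK: "compact K" "K \<noteq> {}" using K by (auto simp: convex_body_def)
  obtain R where R: "0 < R" "K \<subseteq> cball 0 R"
    using compact_imp_bounded[OF cK(1)] unfolding bounded_pos by (auto simp: subset_eq)
  have hm[measurable]: "?h \<in> borel_measurable ?S" by (rule measurable_support_fun_sphere[OF _ cK]) simp
  define A where "A = density ?S (\<lambda>u. ennreal (?h u))"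
  define V where "V = density ?V (\<lambda>_. ennreal cn)"
  have sets_A: "sets A = sets (restrict_space borel (sphere 0 1))" and sets_V: "sets V = sets (restrict_space borel (sphere 0 1))"
    by (simp_all add: A_def V_def)
  have emV: "emeasure V \<omega> = ennreal cn * emeasure ?V \<omega>" if "\<omega> \<in> sets (restrict_space borel (sphere 0 1))" for \<omega>
    unfolding V_def using that by (intro emeasure_density_const) simp
  have emA: "emeasure A \<omega> = (\<integral>\<^sup>+u. ennreal (?h u) * indicator \<omega> u \<partial>?S)" if "\<omega> \<in> sets (restrict_space borel (sphere 0 1))" for \<omega>
    unfolding A_def using that by (intro emeasure_density) auto
  have hR: "?h u \<le> R" if "norm u = 1" for u
  proof (rule support_fun_least[OF cK(2)])
    fix x assume "x \<in> K"
    then show "x \<bullet> u \<le> R" using norm_cauchy_schwarz[of x u] that R(2) by force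
  qed
  have Sfin: "emeasure ?S \<omega> < \<infinity>" if "\<omega> \<in> sets (restrict_space borel (sphere 0 1))" for \<omega>
    using hausdorff_frontier_finite[OF K(1), of \<omega>] emeasure_surface_area_measure[OF K(1) that] by simp
  have sph: "sphere (0::real^'n) 1 \<in> sets (restrict_space borel (sphere 0 1))" by (intro sphere_setI) auto
  have Afin: "emeasure A (sphere 0 1) < \<infinity>"
  proof -
    have "emeasure A (sphere 0 1) \<le> (\<integral>\<^sup>+u. ennreal R * indicator (sphere 0 1) u \<partial>?S)"
      unfolding emA[OF sph] using hR
      by (intro nn_integral_mono mult_right_mono ennreal_leI) (auto simp: space_surface_area_measure)
    also have "\<dots> = ennreal R * emeasure ?S (sphere 0 1)" using sph by (intro nn_integral_cmult_indicator) simp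
    finally show ?thesis using Sfin[OF sph] by (simp add: ennreal_mult_less_top order_le_less_trans)
  qed
  have Vfin: "emeasure V (sphere 0 1) < \<infinity>"
    unfolding emV[OF sph] using cone_measure_finite(2)[OF K] by (simp add: ennreal_mult_less_top)
  define X where "X = {u \<in> sphere 0 1. \<delta> \<le> ?h u}"
  have cX: "compact X"
  proof -
    have "closed {u. \<delta> \<le> ?h u}" by (intro closed_Collect_le continuous_intros continuous_support_fun cK)
    then have "compact (sphere 0 1 \<inter> {u. \<delta> \<le> ?h u})" by (intro compact_Int_closed) auto
    then show ?thesis by (simp add: X_def Int_def)
  qed
  have BX: "B \<subseteq> X" using B sets.sets_into_space[OF B(1)] by (auto simp: X_def space_restrict_space)
  have both: "emeasure A B \<le> ennreal (\<theta>^2) * emeasure V B \<and> emeasure V B \<le> ennreal (\<theta>^2) * emeasure A B" if \<theta>: "1 < \<theta>" for \<theta>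
  proof -
    obtain \<epsilon>0 where \<epsilon>0: "0 < \<epsilon>0" and piece:
    "\<And>u0 B. \<lbrakk>norm u0 = 1; \<delta> \<le> ?h u0; compact B; B \<subseteq> normal_preimage K (cball u0 \<epsilon>0)\<rbrakk> \<Longrightarrow>
      ennreal (?h u0) * hausdorff_outer (CARD('n) - 1) B \<le> ennreal \<theta> * (ennreal cn * emeasure lborel (cone_of B)) \<and>
      ennreal cn * emeasure lborel (cone_of B) \<le> ennreal \<theta> * (ennreal (?h u0) * hausdorff_outer (CARD('n) - 1) B)"
      using hausdorff_cone_piece_small[OF cK(1) \<delta> \<theta>] unfolding cn_def by blast
    \<comment> \<open>The second bound makes the oscillation of the support function, at most
      \<open>R * \<epsilon>\<close>, no larger than \<open>\<theta> - 1\<close> times its value,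
      which is at least \<delta>.\<close>
    define \<epsilon> where "\<epsilon> = min \<epsilon>0 (\<delta> * (\<theta> - 1) / R)"
    have \<epsilon>: "0 < \<epsilon>" "\<epsilon> \<le> \<epsilon>0" "R * \<epsilon> \<le> \<delta> * (\<theta> - 1)"
      using \<epsilon>0 \<delta> \<theta> R by (auto simp: \<epsilon>_def min_def field_simps)
    obtain T where T: "finite T" "T \<subseteq> X" "X \<subseteq> (\<Union>u\<in>T. cball u \<epsilon>)"
      using compact_finite_cball_cover[OF cX \<epsilon>(1)] by blast
    have close: "?h v \<le> \<theta> * ?h u" if "u \<in> X" "dist u v \<le> \<epsilon>" for u v
    proof -
      have "?h v - ?h u \<le> R * norm (v - u)" by (rule support_fun_diff_le[OF cK R(2)])
      also have "\<dots> \<le> R * \<epsilon>" using that(2) R by (intro mult_left_mono) (auto simp: dist_norm norm_minus_commute)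
      also have "\<dots> \<le> \<delta> * (\<theta> - 1)" by (rule \<epsilon>)
      also have "\<dots> \<le> ?h u * (\<theta> - 1)" using that(1) \<theta> by (intro mult_right_mono) (auto simp: X_def)
      finally show ?thesis by (simp add: algebra_simps)
    qed
    have loc: "emeasure A \<omega> \<le> ennreal (\<theta>^2) * emeasure V \<omega> \<and> emeasure V \<omega> \<le> ennreal (\<theta>^2) * emeasure A \<omega>"
      if u: "u \<in> T" and \<omega>: "compact \<omega>" "\<omega> \<subseteq> X \<inter> cball u \<epsilon>" for u \<omega>
    proof -
      have uX: "u \<in> X" using u T(2) by auto
      have \<omega>S: "\<omega> \<subseteq> sphere 0 1" using \<omega>(2) by (auto simp: X_def)
      have \<omega>m: "\<omega> \<in> sets (restrict_space borel (sphere 0 1))" by (intro sphere_setI \<omega>S borel_compact \<omega>)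
      have SH: "emeasure ?S \<omega> = hausdorff_outer (CARD('n) - 1) (normal_preimage K \<omega>)"
        by (rule emeasure_surface_area_measure[OF K(1) \<omega>m])
      have VL: "emeasure V \<omega> = ennreal cn * emeasure lborel (cone_of (normal_preimage K \<omega>))"
        unfolding emV[OF \<omega>m] using emeasure_cone_measure_closed[OF K compact_imp_closed[OF \<omega>(1)] \<omega>S] by simp
      have "\<omega> \<subseteq> cball u \<epsilon>0" using \<omega>(2) \<epsilon>(2) by auto
      then have p: "ennreal (?h u) * emeasure ?S \<omega> \<le> ennreal \<theta> * emeasure V \<omega>"
        "emeasure V \<omega> \<le> ennreal \<theta> * (ennreal (?h u) * emeasure ?S \<omega>)"
        using piece[of u "normal_preimage K \<omega>"] uX compact_normal_preimage[OF cK(1) compact_imp_closed[OF \<omega>(1)]]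
        by (auto simp: SH VL X_def normal_preimage_mono)
      have sq: "ennreal \<theta> * (ennreal \<theta> * x) = ennreal (\<theta>^2) * x" for x
        using \<theta> by (simp add: mult.assoc[symmetric] ennreal_mult[symmetric] power2_eq_square)
      have h0: "0 \<le> ?h u" by (rule support_fun_nonneg[OF cK(1) K(2)])
      have "emeasure A \<omega> \<le> (\<integral>\<^sup>+v. ennreal (\<theta> * ?h u) * indicator \<omega> v \<partial>?S)"
        unfolding emA[OF \<omega>m] using close[OF uX] \<omega>(2)
        by (intro nn_integral_mono) (auto simp: indicator_def intro!: ennreal_leI)
      also have "\<dots> = ennreal \<theta> * (ennreal (?h u) * emeasure ?S \<omega>)"
        using \<omega>m \<theta> h0 by (subst nn_integral_cmult_indicator) (auto simp: ennreal_mult mult.assoc)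
      also have "\<dots> \<le> ennreal \<theta> * (ennreal \<theta> * emeasure V \<omega>)" by (intro mult_left_mono p) auto
      finally have 1: "emeasure A \<omega> \<le> ennreal (\<theta>^2) * emeasure V \<omega>" unfolding sq .
      have "ennreal (?h u) * emeasure ?S \<omega> = (\<integral>\<^sup>+v. ennreal (?h u) * indicator \<omega> v \<partial>?S)"
        using \<omega>m by (subst nn_integral_cmult_indicator) auto
      also have "\<dots> \<le> (\<integral>\<^sup>+v. ennreal \<theta> * (ennreal (?h v) * indicator \<omega> v) \<partial>?S)"
      proof (intro nn_integral_mono)
        fix v
        have "?h u \<le> \<theta> * ?h v" if "v \<in> \<omega>"
        proof (rule close)
          show "v \<in> X" "dist v u \<le> \<epsilon>" using \<omega>(2) that by (auto simp: dist_commute)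
        qed
        then show "ennreal (?h u) * indicator \<omega> v \<le> ennreal \<theta> * (ennreal (?h v) * indicator \<omega> v)"
          using \<theta> support_fun_nonneg[OF cK(1) K(2), of v] by (auto simp: indicator_def ennreal_mult[symmetric] intro!: ennreal_leI)
      qed
      also have "\<dots> = ennreal \<theta> * emeasure A \<omega>"
        unfolding emA[OF \<omega>m] using \<omega>m by (intro nn_integral_cmult) auto
      finally have "ennreal \<theta> * (ennreal (?h u) * emeasure ?S \<omega>) \<le> ennreal \<theta> * (ennreal \<theta> * emeasure A \<omega>)"
        by (rule mult_left_mono) simp
      then have "emeasure V \<omega> \<le> ennreal (\<theta>^2) * emeasure A \<omega>" using p(2) unfolding sq by (rule order_trans[rotated])
      with 1 show ?thesis by simp
    qed
    have BT: "B \<subseteq> (\<Union>u\<in>T. cball u \<epsilon>)" using BX T(3) by blast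
    have BA: "B \<in> sets A" "B \<in> sets V" using B(1) sets_A sets_V by auto
    have "emeasure A B \<le> ennreal (\<theta>^2) * emeasure V B"
      by (rule sphere_measure_le_local[OF sets_A Afin sets_V T(1) _ BA(1) BX BT]) (use loc in blast)
    moreover have "emeasure V B \<le> ennreal (\<theta>^2) * emeasure A B"
      by (rule sphere_measure_le_local[OF sets_V Vfin sets_A T(1) _ BA(2) BX BT]) (use loc in blast)
    ultimately show ?thesis by simp
  qed
  have "emeasure A B = emeasure V B"
  proof (rule antisym)
    show "emeasure A B \<le> emeasure V B" by (rule ennreal_le_of_le_mult) (rule conjunct1[OF both])
    show "emeasure V B \<le> emeasure A B" by (rule ennreal_le_of_le_mult) (rule conjunct2[OF both])
  qed
  then show ?thesis using emV[OF B(1)] by (simp add: A_def cn_def)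
qed

lemma measurable_positive_support:
  fixes K :: "'a::euclidean_space set"
  assumes "compact K" "K \<noteq> {}"
  shows "(\<lambda>u. ennreal c * indicator {u. 0 < support_fun K u} u) \<in> borel_measurable (cone_measure K)"
proof -
  have [measurable]: "support_fun K \<in> borel_measurable (cone_measure K)"
    by (rule measurable_support_fun_sphere[OF _ assms]) simp
  have "(\<lambda>u. if 0 < support_fun K u then ennreal c else 0) \<in> borel_measurable (cone_measure K)" by measurable
  also have "(\<lambda>u. if 0 < support_fun K u then ennreal c else 0) = (\<lambda>u. ennreal c * indicator {u. 0 < support_fun K u} u)"
    by (auto simp: indicator_def)
  finally show ?thesis .
qed

text \<open>The comparison is available where the support function is at least
  \<open>1 / (m + 1)\<close>, and these sets increase to the set where it is positive. Where it
  vanishes the left-hand density is 0, and the indicator reproduces this on the right.\<close>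

lemma density_surface_area_measure:
  fixes K :: "(real^'n) set"
  assumes K: "convex_body K" "0 \<in> K"
  shows "density (surface_area_measure K) (\<lambda>u. ennreal (support_fun K u))
    = density (cone_measure K) (\<lambda>u. ennreal (hausdorff_scale TYPE('n) * real CARD('n)) * indicator {u. 0 < support_fun K u} u)"
    (is "?A = ?V")
proof (rule measure_eqI)
  let ?S = "surface_area_measure K" and ?C = "cone_measure K" and ?h = "support_fun K"
  let ?cn = "hausdorff_scale TYPE('n) * real CARD('n)"
  let ?\<Omega> = "restrict_space borel (sphere (0::real^'n) 1)"
  have cK: "compact K" "K \<noteq> {}" using K by (auto simp: convex_body_def)
  have hm[measurable]: "?h \<in> borel_measurable ?S" "?h \<in> borel_measurable ?C"
    by (rule measurable_support_fun_sphere[OF _ cK]; simp)+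
  show "sets ?A = sets ?V" by simp
  fix B assume "B \<in> sets ?A"
  then have B[measurable]: "B \<in> sets ?\<Omega>" by simp
  have hO[measurable]: "?h \<in> borel_measurable ?\<Omega>" by (rule measurable_support_fun_sphere[OF refl cK])
  define Bm where "Bm m = {u \<in> B. 1 / real (Suc m) \<le> ?h u}" for m
  have BmO: "Bm m \<in> sets ?\<Omega>" for m
  proof -
    have "Bm m = B \<inter> {u \<in> space ?\<Omega>. 1 / real (Suc m) \<le> ?h u}"
      using sets.sets_into_space[OF B] by (auto simp: Bm_def)
    also have "\<dots> \<in> sets ?\<Omega>" by measurable
    finally show ?thesis .
  qed
  have inc: "incseq Bm"
  proof (rule incseq_SucI)
    fix m
    have "1 / real (Suc (Suc m)) \<le> 1 / real (Suc m)" by (simp add: frac_le)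
    then show "Bm m \<subseteq> Bm (Suc m)" by (auto simp: Bm_def)
  qed
  define P where "P = {u \<in> B. 0 < ?h u}"
  have UN: "(\<Union>m. Bm m) = P"
  proof
    show "(\<Union>m. Bm m) \<subseteq> P"
    proof clarify
      fix m x assume x: "x \<in> Bm m"
      have "0 < 1 / real (Suc m)" by simp
      also have "\<dots> \<le> ?h x" using x by (simp add: Bm_def)
      finally show "x \<in> P" using x by (simp add: Bm_def P_def)
    qed
    show "P \<subseteq> (\<Union>m. Bm m)"
    proof
      fix x assume x: "x \<in> P"
      then obtain m where "inverse (real (Suc m)) < ?h x" using reals_Archimedean by (auto simp: P_def)
      then show "x \<in> (\<Union>m. Bm m)" using x by (auto simp: Bm_def P_def inverse_eq_divide intro!: exI[of _ m])
    qed
  qed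
  have "emeasure ?A P = (SUP m. emeasure ?A (Bm m))"
    unfolding UN[symmetric] using BmO inc by (intro SUP_emeasure_incseq[symmetric]) auto
  also have "\<dots> = (SUP m. ennreal ?cn * emeasure ?C (Bm m))"
    by (intro SUP_cong refl surface_cone_measure_bound[OF K _ BmO]) (auto simp: Bm_def)
  also have "\<dots> = ennreal ?cn * (SUP m. emeasure ?C (Bm m))" by (simp add: SUP_mult_left_ennreal)
  also have "(SUP m. emeasure ?C (Bm m)) = emeasure ?C P"
    unfolding UN[symmetric] using BmO inc by (intro SUP_emeasure_incseq) auto
  finally have eqP: "emeasure ?A P = ennreal ?cn * emeasure ?C P" .
  have PO: "P \<in> sets ?\<Omega>" unfolding UN[symmetric] using BmO by auto
  have "emeasure ?A B = (\<integral>\<^sup>+u. ennreal (?h u) * indicator B u \<partial>?S)" by (intro emeasure_density) auto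
  also have "\<dots> = (\<integral>\<^sup>+u. ennreal (?h u) * indicator P u \<partial>?S)"
    by (intro nn_integral_cong) (auto simp: P_def indicator_def ennreal_neg)
  also have "\<dots> = emeasure ?A P" using PO by (intro emeasure_density[symmetric]) auto
  also have "\<dots> = ennreal ?cn * emeasure ?C P" by (rule eqP)
  also have "\<dots> = (\<integral>\<^sup>+u. ennreal ?cn * indicator P u \<partial>?C)" using PO by (intro nn_integral_cmult_indicator[symmetric]) simp
  also have "\<dots> = (\<integral>\<^sup>+u. (ennreal ?cn * indicator {u. 0 < ?h u} u) * indicator B u \<partial>?C)"
    by (intro nn_integral_cong) (auto simp: P_def indicator_def)
  also have "\<dots> = emeasure ?V B"
    by (intro emeasure_density[symmetric] measurable_positive_support cK) auto
  finally show "emeasure ?A B = emeasure ?V B" .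
qed

text \<open>\<open>h powr (1 - p)\<close> is \<open>h\<close> times \<open>h powr (- p)\<close>, and
  the first factor turns the surface area measure into the cone measure. The indicator of positive
  support values is absorbed because \<open>0 powr (- p) = 0\<close>.\<close>

lemma Lp_surface_area_measure_eq:
  fixes K :: "(real^'n) set"
  assumes K: "convex_body K" "0 \<in> K"
  shows "Lp_surface_area_measure p K = density (cone_measure K)
    (\<lambda>u. ennreal (hausdorff_scale TYPE('n) * real CARD('n) * support_fun K u powr (- p)))"
proof -
  let ?S = "surface_area_measure K" and ?C = "cone_measure K" and ?h = "support_fun K"
  let ?cn = "hausdorff_scale TYPE('n) * real CARD('n)"
  have cK: "compact K" "K \<noteq> {}" using K by (auto simp: convex_body_def)
  have hm[measurable]: "?h \<in> borel_measurable ?S" "?h \<in> borel_measurable ?C"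
    by (rule measurable_support_fun_sphere[OF _ cK]; simp)+
  have h0: "0 \<le> ?h u" for u by (rule support_fun_nonneg[OF cK(1) K(2)])
  have pw: "?h u powr (1 - p) = ?h u * ?h u powr (- p)" for u
  proof (cases "?h u = 0")
    case False
    then have "0 < ?h u" using h0[of u] by simp
    then show ?thesis using powr_add[of "?h u" 1 "- p"] by simp
  qed simp
  note ind = measurable_positive_support[OF cK]
  have "Lp_surface_area_measure p K = density ?S (\<lambda>u. ennreal (?h u) * ennreal (?h u powr (- p)))"
    unfolding Lp_surface_area_measure_def pw using h0 by (simp add: ennreal_mult)
  also have "\<dots> = density (density ?S (\<lambda>u. ennreal (?h u))) (\<lambda>u. ennreal (?h u powr (- p)))"
    by (intro density_density_eq[symmetric]) measurable
  also have "\<dots> = density (density ?C (\<lambda>u. ennreal ?cn * indicator {u. 0 < ?h u} u)) (\<lambda>u. ennreal (?h u powr (- p)))"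
    unfolding density_surface_area_measure[OF K] ..
  also have "\<dots> = density ?C (\<lambda>u. (ennreal ?cn * indicator {u. 0 < ?h u} u) * ennreal (?h u powr (- p)))"
    by (intro density_density_eq ind) measurable
  also have "(\<lambda>u. (ennreal ?cn * indicator {u. 0 < ?h u} u) * ennreal (?h u powr (- p))) =
      (\<lambda>u. ennreal (?cn * ?h u powr (- p)))"
  proof
    fix u
    have "?h u = 0 \<or> 0 < ?h u" using h0[of u] by linarith
    then show "(ennreal ?cn * indicator {u. 0 < ?h u} u) * ennreal (?h u powr (- p)) = ennreal (?cn * ?h u powr (- p))"
      using hausdorff_scale(1)[where 'n='n] by (auto simp: ennreal_mult)
  qed
  finally show ?thesis .
qed

section \<open>The unit ball and the measure of the sphere\<close>

lemma support_fun_unit_ball: "norm u = 1 \<Longrightarrow> support_fun (cball (0::'a::euclidean_space) 1) u = 1"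
proof (rule antisym)
  assume u: "norm u = 1"
  show "support_fun (cball 0 1) u \<le> 1"
  proof (rule support_fun_least)
    fix x :: 'a assume "x \<in> cball 0 1"
    then show "x \<bullet> u \<le> 1" using norm_cauchy_schwarz[of x u] u by simp
  qed simp
  have "u \<bullet> u \<le> support_fun (cball 0 1) u" using u by (intro support_fun_upper) auto
  then show "1 \<le> support_fun (cball 0 1) u" using u by (simp add: norm_eq_1)
qed

lemma normal_preimage_unit_ball: "\<omega> \<subseteq> sphere 0 1 \<Longrightarrow> normal_preimage (cball (0::'a::euclidean_space) 1) \<omega> = \<omega>"
proof
  assume \<omega>: "\<omega> \<subseteq> sphere (0::'a) 1"
  show "\<omega> \<subseteq> normal_preimage (cball 0 1) \<omega>"
  proof
    fix x assume x: "x \<in> \<omega>"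
    then have n: "norm x = 1" using \<omega> by auto
    then have "x \<bullet> x = support_fun (cball 0 1) x" by (simp add: support_fun_unit_ball norm_eq_1[symmetric])
    then show "x \<in> normal_preimage (cball 0 1) \<omega>" using x n by (auto simp: normal_preimage_def)
  qed
  show "normal_preimage (cball 0 1) \<omega> \<subseteq> \<omega>"
  proof
    fix x assume "x \<in> normal_preimage (cball 0 1) \<omega>"
    then obtain u where u: "u \<in> \<omega>" "norm u = 1" "norm x \<le> 1" "x \<bullet> u = support_fun (cball 0 1) u"
      by (auto simp: normal_preimage_def)
    then have xu: "x \<bullet> u = 1" by (simp add: support_fun_unit_ball)
    have "(norm (x - u))\<^sup>2 = (norm x)\<^sup>2 - 1"
      using u(2) xu by (simp add: power2_norm_eq_inner inner_diff_left inner_diff_right inner_commute norm_eq_1)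
    also have "\<dots> \<le> 0" using u(3) by (simp add: power_le_one)
    finally show "x \<in> \<omega>" using u(1) by simp
  qed
qed

lemma convex_body_unit_ball: "convex_body (cball (0::'a::euclidean_space) 1)"
  by (simp add: convex_body_def)

text \<open>For the unit ball the Gauss map is the identity and the support function is 1 on the
  sphere, so Hausdorff measure on the sphere is both a surface area measure and a multiple of a cone
  measure. Integrals over the sphere thereby reduce to Lebesgue volumes.\<close>

lemma sphere_measure_eq:
  "(sphere_measure :: (real^'n) measure) =
    density (cone_measure (cball 0 1)) (\<lambda>_. ennreal (hausdorff_scale TYPE('n) * real CARD('n)))"
proof -
  let ?B = "cball (0::real^'n) 1"
  let ?\<Omega> = "restrict_space borel (sphere (0::real^'n) 1)"
  have "(sphere_measure :: (real^'n) measure) = surface_area_measure ?B"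
  proof (rule measure_eqI)
    show "sets (sphere_measure :: (real^'n) measure) = sets (surface_area_measure ?B)"
      by (simp add: sphere_measure_def sets_restrict_space)
    fix \<omega> assume "\<omega> \<in> sets (sphere_measure :: (real^'n) measure)"
    then have \<omega>: "\<omega> \<in> sets ?\<Omega>" by (simp add: sphere_measure_def sets_restrict_space)
    then have w: "\<omega> \<subseteq> sphere 0 1" "\<omega> \<in> sets borel"
      using sets.sets_into_space[OF \<omega>] by (auto simp: space_restrict_space sets_restrict_space)
    show "emeasure sphere_measure \<omega> = emeasure (surface_area_measure ?B) \<omega>"
      using w by (simp add: sphere_measure_def emeasure_restrict_space emeasure_hausdorff_measure
          emeasure_surface_area_measure[OF convex_body_unit_ball \<omega>] normal_preimage_unit_ball)
  qed
  also have "\<dots> = density (surface_area_measure ?B) (\<lambda>u. ennreal (support_fun ?B u))"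
  proof -
    have "density (surface_area_measure ?B) (\<lambda>u. ennreal (support_fun ?B u)) = density (surface_area_measure ?B) (\<lambda>_. 1)"
      by (intro density_cong AE_I2 measurable_compose[OF measurable_support_fun_sphere measurable_ennreal])
         (auto simp: space_surface_area_measure support_fun_unit_ball)
    then show ?thesis by (simp add: density_1)
  qed
  also have "\<dots> = density (cone_measure ?B) (\<lambda>u. ennreal (hausdorff_scale TYPE('n) * real CARD('n)) * indicator {u. 0 < support_fun ?B u} u)"
    by (rule density_surface_area_measure[OF convex_body_unit_ball]) simp
  also have "\<dots> = density (cone_measure ?B) (\<lambda>_. ennreal (hausdorff_scale TYPE('n) * real CARD('n)))"
    by (intro density_cong AE_I2 measurable_positive_support)
       (auto simp: space_cone_measure support_fun_unit_ball)
  finally show ?thesis .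
qed

section \<open>The functional\<close>

text \<open>Tangent line of a convex function at \<open>m\<close>. With \<open>y = x / m\<close> it
  follows from \<open>exp z \<ge> 1 + z\<close> and \<open>ln y \<le> y - 1\<close>; the second is
  strict unless \<open>y = 1\<close>, which gives strict convexity.\<close>

lemma powr_neg_tangent:
  fixes x m q :: real
  assumes "0 < x" "0 < m" "0 < q"
  shows "m powr (- q) - q * m powr (- q - 1) * (x - m) \<le> x powr (- q)"
    and "x \<noteq> m \<Longrightarrow> m powr (- q) - q * m powr (- q - 1) * (x - m) < x powr (- q)"
proof -
  define y where "y = x / m"
  have y: "0 < y" "x = m * y" using assms by (auto simp: y_def)
  have e: "1 - q * ln y \<le> y powr (- q)"
    using exp_ge_add_one_self[of "- q * ln y"] y(1) by (simp add: powr_def)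
  have eq: "m powr (- q) * (1 - q * (y - 1)) = m powr (- q) - q * m powr (- q - 1) * (x - m)"
  proof -
    have "m powr (- q) = m powr (- q - 1) * m" using assms(2) by (simp add: powr_diff)
    then have "q * m powr (- q - 1) * (x - m) = m powr (- q) * (q * (y - 1))" by (simp add: y(2) algebra_simps)
    then show ?thesis by (simp add: algebra_simps)
  qed
  have pw: "x powr (- q) = m powr (- q) * y powr (- q)" using y assms by (simp add: powr_mult)
  have l: "ln y \<le> y - 1" using y(1) by (rule ln_le_minus_one)
  have "1 - q * (y - 1) \<le> y powr (- q)" using e mult_left_mono[OF l, of q] assms(3) by linarith
  then show "m powr (- q) - q * m powr (- q - 1) * (x - m) \<le> x powr (- q)"
    unfolding eq[symmetric] pw by (intro mult_left_mono) auto
  assume "x \<noteq> m"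
  then have "y \<noteq> 1" using y(2) by auto
  then have "ln y < y - 1" using l ln_eq_minus_one[OF y(1)] by linarith
  then have "1 - q * (y - 1) < y powr (- q)" using e mult_strict_left_mono[of "ln y" "y - 1" q] assms(3) by linarith
  then show "m powr (- q) - q * m powr (- q - 1) * (x - m) < x powr (- q)"
    unfolding eq[symmetric] pw using assms(2) by (intro mult_strict_left_mono) auto
qed

text \<open>The value at \<open>t \<le> 0\<close> makes this lower semicontinuous and monotone.\<close>

definition inv_pow :: "real \<Rightarrow> real \<Rightarrow> ennreal" where
  "inv_pow q t = (if t \<le> 0 then \<infinity> else ennreal (t powr (- q)))"

lemma inv_pow_measurable [measurable]: "inv_pow q \<in> borel_measurable borel"
  unfolding inv_pow_def by measurable

lemma inv_pow_antimono: "0 < q \<Longrightarrow> s \<le> t \<Longrightarrow> inv_pow q t \<le> inv_pow q s"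
  by (auto simp: inv_pow_def intro!: ennreal_leI powr_mono2')

lemma inv_pow_pos: "0 < inv_pow q t"
  by (simp add: inv_pow_def)

lemma inv_pow_mult: "0 < s \<Longrightarrow> inv_pow q (s * t) = ennreal (s powr (- q)) * inv_pow q t"
  by (auto simp: inv_pow_def powr_mult ennreal_mult mult_le_0_iff ennreal_mult_top zero_less_mult_iff)

text \<open>A value below \<open>inv_pow q t0\<close> is still below \<open>inv_pow q s\<close> for
  some \<open>s > t0\<close>; eventually \<open>t n < s\<close>, and monotonicity finishes. For
  \<open>t0 \<le> 0\<close> such an \<open>s\<close> exists because the power is unbounded near
  0.\<close>

lemma inv_pow_le_liminf:
  assumes q: "0 < q" and t: "t \<longlonglongrightarrow> (t0::real)"
  shows "inv_pow q t0 \<le> liminf (\<lambda>n. inv_pow q (t n))"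
  unfolding le_Liminf_iff
proof (intro allI impI)
  fix y assume y: "y < inv_pow q t0"
  then obtain r where r: "y = ennreal r" "0 \<le> r" by (cases y) auto
  have "\<exists>s>t0. y < inv_pow q s"
  proof (cases "t0 \<le> 0")
    case True
    define s where "s = (r + 1) powr (- 1 / q)"
    have "s powr (- q) = r + 1" using r(2) q by (simp add: s_def powr_powr)
    moreover have "0 < s" using r(2) by (simp add: s_def)
    ultimately have "y < inv_pow q s" using r by (simp add: inv_pow_def ennreal_less_iff)
    then show ?thesis using \<open>0 < s\<close> True by (intro exI[of _ s]) auto
  next
    case False
    then have r': "r < t0 powr (- q)" using y r by (simp add: inv_pow_def ennreal_less_iff)
    have "((\<lambda>s. s powr (- q)) \<longlongrightarrow> t0 powr (- q)) (at_right t0)" using False by (intro tendsto_intros) auto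
    then have "eventually (\<lambda>s. r < s powr (- q)) (at_right t0)" using r' by (intro order_tendstoD(1))
    moreover have "eventually (\<lambda>s. s > t0) (at_right t0)" by (rule eventually_at_right_less)
    ultimately have "eventually (\<lambda>s. r < s powr (- q) \<and> s > t0) (at_right t0)" by (rule eventually_conj)
    then obtain s where "r < s powr (- q)" "t0 < s"
      using eventually_happens'[OF trivial_limit_at_right_real] by blast
    then show ?thesis using False r by (intro exI[of _ s]) (simp add: inv_pow_def ennreal_less_iff)
  qed
  then obtain s where s: "t0 < s" "y < inv_pow q s" by blast
  have "eventually (\<lambda>n. t n < s) sequentially" using t s(1) by (rule order_tendstoD(2))
  then show "eventually (\<lambda>n. y < inv_pow q (t n)) sequentially"
  proof eventually_elim
    case (elim n)
    then have "inv_pow q s \<le> inv_pow q (t n)" using q by (intro inv_pow_antimono) auto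
    then show ?case using s(2) by simp
  qed
qed

lemma inv_pow_midpoint:
  assumes q: "0 < q" and a: "inv_pow q a < \<infinity>" and b: "inv_pow q b < \<infinity>" and ab: "a \<noteq> b"
  shows "2 * inv_pow q ((a + b) / 2) < inv_pow q a + inv_pow q b"
proof -
  have p: "0 < a" "0 < b" using a b by (auto simp: inv_pow_def split: if_splits)
  define m where "m = (a + b) / 2"
  have m: "0 < m" "a \<noteq> m" "b \<noteq> m" using p ab by (auto simp: m_def)
  have "m powr (- q) - q * m powr (- q - 1) * (a - m) + (m powr (- q) - q * m powr (- q - 1) * (b - m)) < a powr (- q) + b powr (- q)"
    by (intro add_strict_mono powr_neg_tangent(2) p m q)
  moreover have "q * m powr (- q - 1) * (a - m) + q * m powr (- q - 1) * (b - m) = 0"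
    unfolding distrib_left[symmetric] by (simp add: m_def field_simps)
  ultimately have "2 * m powr (- q) < a powr (- q) + b powr (- q)" by linarith
  then have "ennreal (2 * m powr (- q)) < ennreal (a powr (- q) + b powr (- q))" using p by (intro ennreal_lessI add_pos_pos) auto
  then show ?thesis using p m(1) unfolding m_def[symmetric] by (simp add: inv_pow_def ennreal_mult)
qed

section \<open>Dilations and orthogonal symmetries\<close>

lemma support_fun_scaleR:
  fixes K :: "(real^'n) set"
  assumes K: "compact K" "K \<noteq> {}" and s: "0 < s"
  shows "support_fun ((*\<^sub>R) s ` K) u = s * support_fun K u"
proof (rule antisym)
  have c: "compact ((*\<^sub>R) s ` K)" by (intro compact_continuous_image K continuous_intros)
  show "support_fun ((*\<^sub>R) s ` K) u \<le> s * support_fun K u"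
    using K s support_fun_upper[OF K(1)] by (intro support_fun_least) auto
  have "support_fun K u \<le> support_fun ((*\<^sub>R) s ` K) u / s"
  proof (rule support_fun_least[OF K(2)])
    fix x assume "x \<in> K"
    then have "(s *\<^sub>R x) \<bullet> u \<le> support_fun ((*\<^sub>R) s ` K) u" by (intro support_fun_upper[OF c]) auto
    then show "x \<bullet> u \<le> support_fun ((*\<^sub>R) s ` K) u / s" using s by (simp add: field_simps)
  qed
  then show "s * support_fun K u \<le> support_fun ((*\<^sub>R) s ` K) u" using s by (simp add: field_simps)
qed

lemma orthogonal_matrix_simps:
  fixes A :: "real^'n^'n"
  assumes "orthogonal_matrix A"
  shows "transpose A *v (A *v x) = x" "A *v (transpose A *v x) = x"
    and "x \<bullet> (transpose A *v u) = (A *v x) \<bullet> u" "x \<bullet> (A *v u) = (transpose A *v x) \<bullet> u"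
    and "norm (A *v x) = norm x" "norm (transpose A *v x) = norm x"
proof -
  show 1: "transpose A *v (A *v x) = x" "A *v (transpose A *v x) = x" for x
    using assms by (simp_all only: orthogonal_matrix_def matrix_vector_mul_assoc matrix_vector_mul_lid)
  have dot: "x \<bullet> (transpose A *v u) = (A *v x) \<bullet> u" for A :: "real^'n^'n" and x u
    by (metis dot_lmul_matrix inner_commute transpose_matrix_vector vector_transpose_matrix)
  show 2: "x \<bullet> (transpose A *v u) = (A *v x) \<bullet> u" for x u by (rule dot)
  show 3: "x \<bullet> (A *v u) = (transpose A *v x) \<bullet> u" for x u
    using dot[of x "transpose A" u] by (simp only: transpose_transpose)
  show "norm (A *v x) = norm x" unfolding norm_eq_sqrt_inner 3 1 ..
  show "norm (transpose A *v x) = norm x" unfolding norm_eq_sqrt_inner 2 1 ..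
qed

lemma invariant_image_eqI:
  fixes A :: "real^'n^'n"
  assumes "orthogonal_matrix A" "\<And>x. x \<in> K \<Longrightarrow> A *v x \<in> K" "\<And>x. x \<in> K \<Longrightarrow> transpose A *v x \<in> K"
  shows "(\<lambda>x. A *v x) ` K = K"
proof
  show "(\<lambda>x. A *v x) ` K \<subseteq> K" using assms(2) by blast
  show "K \<subseteq> (\<lambda>x. A *v x) ` K"
  proof
    fix x assume "x \<in> K"
    then have "transpose A *v x \<in> K" by (rule assms(3))
    then show "x \<in> (\<lambda>x. A *v x) ` K"
      by (rule image_eqI[rotated]) (simp only: orthogonal_matrix_simps[OF assms(1)])
  qed
qed

lemma invariant_memD:
  fixes A :: "real^'n^'n"
  assumes "orthogonal_matrix A" "(\<lambda>x. A *v x) ` K = K" "x \<in> K"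
  shows "A *v x \<in> K" "transpose A *v x \<in> K"
proof -
  show "A *v x \<in> K" using assms(2,3) by blast
  obtain y where "y \<in> K" "x = A *v y" using assms(2,3) by blast
  then show "transpose A *v x \<in> K" by (simp only: orthogonal_matrix_simps[OF assms(1)])
qed

text \<open>Images under \<open>A\<close> are handled as preimages under its transpose, which makes
  them measurable. The carrier \<open>S\<close> is kept general because the sphere, a ball and the
  whole space all occur.\<close>

lemma orthogonal_measurable:
  fixes A :: "real^'n^'n"
  assumes A: "orthogonal_matrix A" and sets: "sets N = sets (restrict_space borel S)"
    and S: "\<forall>x\<in>S. A *v x \<in> S \<and> transpose A *v x \<in> S"
  shows "(\<lambda>x. transpose A *v x) \<in> measurable N N"
    and "\<omega> \<in> sets N \<Longrightarrow> (\<lambda>x. transpose A *v x) -` \<omega> \<inter> space N = (\<lambda>x. A *v x) ` \<omega>"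
    and "\<omega> \<in> sets N \<Longrightarrow> (\<lambda>x. A *v x) ` \<omega> \<in> sets N"
proof -
  have sp: "space N = S" using sets_eq_imp_space_eq[OF sets] by (simp add: space_restrict_space)
  let ?T = "\<lambda>x. transpose A *v x"
  have "?T \<in> borel_measurable borel"
    by (intro borel_measurable_continuous_onI matrix_vector_mult_linear_continuous_on)
  then have "?T \<in> measurable (restrict_space borel S) (restrict_space borel S)"
  proof (intro measurable_restrict_space2 measurable_restrict_space1)
    show "?T \<in> space (restrict_space borel S) \<rightarrow> S"
      by (rule Pi_I) (simp only: space_restrict_space space_borel Int_UNIV_right S[rule_format])
  qed
  then show T: "?T \<in> measurable N N" by (subst measurable_cong_sets[OF sets sets])
  show eq: "?T -` \<omega> \<inter> space N = (\<lambda>x. A *v x) ` \<omega>" if \<omega>: "\<omega> \<in> sets N" for \<omega>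
  proof (rule Set.set_eqI, rule iffI)
    fix x assume "x \<in> ?T -` \<omega> \<inter> space N"
    then have "?T x \<in> \<omega>" by blast
    then show "x \<in> (\<lambda>x. A *v x) ` \<omega>"
      by (rule image_eqI[rotated]) (simp only: orthogonal_matrix_simps[OF A])
  next
    fix x assume "x \<in> (\<lambda>x. A *v x) ` \<omega>"
    then obtain y where y: "y \<in> \<omega>" "x = A *v y" by blast
    have "y \<in> S" using sets.sets_into_space[OF \<omega>] y(1) by (auto simp: sp)
    then have "x \<in> S" unfolding y(2) using S by blast
    moreover have "?T x = y" by (simp only: y(2) orthogonal_matrix_simps[OF A])
    ultimately show "x \<in> ?T -` \<omega> \<inter> space N" using y(1) by (simp only: sp Int_iff vimage_eq simp_thms)
  qed
  show "(\<lambda>x. A *v x) ` \<omega> \<in> sets N" if "\<omega> \<in> sets N" for \<omega>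
    using measurable_sets[OF T that] unfolding eq[OF that] .
qed

lemma invariant_distr:
  fixes A :: "real^'n^'n"
  assumes A: "orthogonal_matrix A" and sets: "sets N = sets (restrict_space borel S)"
    and S: "\<forall>x\<in>S. A *v x \<in> S \<and> transpose A *v x \<in> S"
    and inv: "\<And>\<omega>. \<omega> \<in> sets N \<Longrightarrow> emeasure N ((\<lambda>x. A *v x) ` \<omega>) = emeasure N \<omega>"
  shows "distr N N (\<lambda>x. transpose A *v x) = N"
proof (rule measure_eqI)
  note T = orthogonal_measurable[OF A sets S]
  fix \<omega> assume "\<omega> \<in> sets (distr N N (\<lambda>x. transpose A *v x))"
  then have \<omega>: "\<omega> \<in> sets N" by simp
  show "emeasure (distr N N (\<lambda>x. transpose A *v x)) \<omega> = emeasure N \<omega>"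
    using emeasure_distr[OF T(1) \<omega>] unfolding T(2)[OF \<omega>] inv[OF \<omega>] .
qed simp

lemma orthogonal_sphere:
  fixes A :: "real^'n^'n"
  assumes "orthogonal_matrix A"
  shows "\<forall>x\<in>sphere 0 r. A *v x \<in> sphere 0 r \<and> transpose A *v x \<in> sphere 0 r"
    and "\<forall>x\<in>cball 0 r. A *v x \<in> cball 0 r \<and> transpose A *v x \<in> cball 0 r"
  by (simp_all only: sphere_def cball_def mem_Collect_eq dist_0_norm orthogonal_matrix_simps[OF assms] simp_thms Ball_def)

lemma support_fun_invariant:
  fixes K :: "(real^'n) set"
  assumes A: "orthogonal_matrix A" and inv: "(\<lambda>x. A *v x) ` K = K"
  shows "support_fun K (transpose A *v u) = support_fun K u"
proof -
  have "(\<lambda>x. x \<bullet> (transpose A *v u)) ` K = (\<lambda>x. x \<bullet> u) ` ((\<lambda>x. A *v x) ` K)"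
    unfolding image_image orthogonal_matrix_simps(3)[OF A] ..
  then show ?thesis unfolding support_fun_def inv by simp
qed

text \<open>\<open>mu_subsphere\<close> is what makes \<open>F K\<close> strictly convex: two points
  with difference \<open>v\<close> give the same integrand exactly in the directions orthogonal to
  \<open>v\<close>.\<close>

locale sphere_functional =
  fixes \<mu> :: "(real^'n) measure" and q :: real
  assumes sets_mu: "sets \<mu> = sets (restrict_space borel (sphere 0 1))"
    and mu_finite: "emeasure \<mu> (sphere 0 1) < \<infinity>" and mu_pos: "emeasure \<mu> (sphere 0 1) \<noteq> 0"
    and mu_subsphere: "\<And>v. v \<noteq> 0 \<Longrightarrow> emeasure \<mu> {u \<in> sphere 0 1. u \<bullet> v = 0} = 0"
    and q_pos: "0 < q"
begin

lemma space_mu: "space \<mu> = sphere 0 1"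
  using sets_eq_imp_space_eq[OF sets_mu] by (simp add: space_restrict_space)

lemma measurable_mu: "f \<in> borel_measurable borel \<Longrightarrow> f \<in> borel_measurable \<mu>"
  by (subst measurable_cong_sets[OF sets_mu refl]) (intro measurable_restrict_space1)

definition F :: "(real^'n) set \<Rightarrow> real^'n \<Rightarrow> ennreal" where
  "F K \<xi> = (\<integral>\<^sup>+u. inv_pow q (support_fun K u - \<xi> \<bullet> u) \<partial>\<mu>)"

lemma F_measurable:
  assumes "compact K" "K \<noteq> {}"
  shows "(\<lambda>u. inv_pow q (support_fun K u - \<xi> \<bullet> u)) \<in> borel_measurable \<mu>"
proof (rule measurable_mu)
  have [measurable]: "support_fun K \<in> borel_measurable borel" by (rule borel_measurable_support_fun[OF assms])
  show "(\<lambda>u. inv_pow q (support_fun K u - \<xi> \<bullet> u)) \<in> borel_measurable borel" by measurable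
qed

lemma F_le_liminf:
  assumes K: "compact K" "K \<noteq> {}" and \<xi>: "\<xi> \<longlonglongrightarrow> \<xi>0"
  shows "F K \<xi>0 \<le> liminf (\<lambda>n. F K (\<xi> n))"
proof -
  have "F K \<xi>0 \<le> (\<integral>\<^sup>+u. liminf (\<lambda>n. inv_pow q (support_fun K u - \<xi> n \<bullet> u)) \<partial>\<mu>)"
    unfolding F_def by (intro nn_integral_mono inv_pow_le_liminf q_pos tendsto_intros \<xi>)
  also have "\<dots> \<le> liminf (\<lambda>n. F K (\<xi> n))"
    unfolding F_def by (intro nn_integral_liminf F_measurable K)
  finally show ?thesis .
qed

lemma F_finite_interior:
  assumes K: "compact K" "\<xi> \<in> interior K"
  shows "F K \<xi> < \<infinity>"
proof -
  obtain r where r: "0 < r" "cball \<xi> r \<subseteq> K" using K(2) by (auto simp: mem_interior_cball)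
  have "F K \<xi> \<le> (\<integral>\<^sup>+u. inv_pow q r \<partial>\<mu>)"
    unfolding F_def
  proof (intro nn_integral_mono inv_pow_antimono q_pos)
    fix u assume "u \<in> space \<mu>"
    then have u: "norm u = 1" by (simp add: space_mu)
    have "(\<xi> + r *\<^sub>R u) \<bullet> u \<le> support_fun K u" using r u by (intro support_fun_upper K(1) subsetD[OF r(2)]) (simp add: dist_norm)
    then show "r \<le> support_fun K u - \<xi> \<bullet> u" using u by (simp add: inner_add_left norm_eq_1)
  qed
  also have "\<dots> < \<infinity>" using mu_finite r(1) by (simp add: space_mu inv_pow_def ennreal_mult_less_top)
  finally show ?thesis .
qed

lemma F_pos:
  assumes K: "compact K" "K \<noteq> {}"
  shows "0 < F K \<xi>"
proof (rule ccontr)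
  assume "\<not> 0 < F K \<xi>"
  then have "F K \<xi> = 0" by simp
  then have "AE u in \<mu>. inv_pow q (support_fun K u - \<xi> \<bullet> u) = 0"
    unfolding F_def using F_measurable[OF K] by (simp add: nn_integral_0_iff_AE)
  then have "AE u in \<mu>. False"
    by eventually_elim (use inv_pow_pos[of q] in \<open>metis less_irrefl\<close>)
  then show False using mu_pos AE_iff_measurable[of "space \<mu>" \<mu> "\<lambda>_. False"] by (simp add: space_mu[symmetric])
qed

text \<open>Otherwise strict convexity would make the midpoint better in almost every direction, the
  exceptions forming the great subsphere orthogonal to \<open>\<eta> - \<xi>\<close>. Finiteness of
  the minimum turns the strict inequality between integrands into one between integrals.\<close>

lemma F_unique_minimizer:
  assumes K: "compact K" "convex K" and \<xi>: "\<xi> \<in> K" "\<eta> \<in> K" and fin: "F K \<xi> < \<infinity>"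
    and eq: "F K \<eta> = F K \<xi>" and minimal: "\<And>\<zeta>. \<zeta> \<in> K \<Longrightarrow> F K \<xi> \<le> F K \<zeta>"
  shows "\<eta> = \<xi>"
proof (rule ccontr)
  assume ne: "\<eta> \<noteq> \<xi>"
  have Kne: "K \<noteq> {}" using \<xi> by auto
  define \<zeta> where "\<zeta> = (1/2) *\<^sub>R \<xi> + (1/2) *\<^sub>R \<eta>"
  have "\<zeta> \<in> K" unfolding \<zeta>_def using convexD[OF K(2) \<xi>, of "1/2" "1/2"] by simp
  let ?f = "\<lambda>\<xi> u. inv_pow q (support_fun K u - \<xi> \<bullet> u)"
  note meas = F_measurable[OF K(1) Kne]
  have fin_AE: "AE u in \<mu>. ?f \<xi> u \<noteq> \<infinity>" "AE u in \<mu>. ?f \<eta> u \<noteq> \<infinity>"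
    using nn_integral_PInf_AE[OF meas[of \<xi>]] nn_integral_PInf_AE[OF meas[of \<eta>]] fin eq by (auto simp: F_def)
  have ne_AE: "AE u in \<mu>. u \<bullet> (\<eta> - \<xi>) \<noteq> 0"
  proof (rule AE_I)
    show "emeasure \<mu> {u \<in> sphere 0 1. u \<bullet> (\<eta> - \<xi>) = 0} = 0" using ne by (intro mu_subsphere) simp
    have "closed {u. u \<bullet> (\<eta> - \<xi>) = 0}" by (intro closed_Collect_eq continuous_intros)
    then have "sphere 0 1 \<inter> {u. u \<bullet> (\<eta> - \<xi>) = 0} \<in> sets borel" by (intro borel_closed closed_Int) auto
    then show "{u \<in> sphere 0 1. u \<bullet> (\<eta> - \<xi>) = 0} \<in> sets \<mu>"
      unfolding sets_mu by (intro sphere_setI) (auto simp: Int_def)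
  qed (auto simp: space_mu)
  have less: "AE u in \<mu>. 2 * ?f \<zeta> u < ?f \<xi> u + ?f \<eta> u"
    using fin_AE ne_AE
  proof eventually_elim
    case (elim u)
    have mid: "support_fun K u - \<zeta> \<bullet> u = ((support_fun K u - \<xi> \<bullet> u) + (support_fun K u - \<eta> \<bullet> u)) / 2"
      by (simp add: \<zeta>_def inner_add_left field_simps)
    have "support_fun K u - \<xi> \<bullet> u \<noteq> support_fun K u - \<eta> \<bullet> u"
      using elim(3) by (simp add: inner_diff_right inner_commute)
    then show ?case unfolding mid using elim(1,2) by (intro inv_pow_midpoint q_pos) (auto simp: less_top)
  qed
  have int: "(\<integral>\<^sup>+u. 2 * ?f \<zeta> u \<partial>\<mu>) = 2 * F K \<zeta>" unfolding F_def by (intro nn_integral_cmult meas)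
  have int2: "(\<integral>\<^sup>+u. ?f \<xi> u + ?f \<eta> u \<partial>\<mu>) = 2 * F K \<xi>"
    using nn_integral_add[OF meas[of \<xi>] meas[of \<eta>]] eq by (simp add: F_def mult_2)
  have "(\<integral>\<^sup>+u. 2 * ?f \<zeta> u \<partial>\<mu>) < (\<integral>\<^sup>+u. ?f \<xi> u + ?f \<eta> u \<partial>\<mu>)"
  proof (rule nn_integral_less)
    show "(\<lambda>u. 2 * ?f \<zeta> u) \<in> borel_measurable \<mu>" "(\<lambda>u. ?f \<xi> u + ?f \<eta> u) \<in> borel_measurable \<mu>"
      using meas by auto
    show le: "AE u in \<mu>. 2 * ?f \<zeta> u \<le> ?f \<xi> u + ?f \<eta> u" using less by eventually_elim simp
    have "(\<integral>\<^sup>+u. 2 * ?f \<zeta> u \<partial>\<mu>) \<le> 2 * F K \<xi>" using nn_integral_mono_AE[OF le] int2 by simp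
    also have "\<dots> < \<infinity>" using fin by (simp add: ennreal_mult_less_top)
    finally show "(\<integral>\<^sup>+u. 2 * ?f \<zeta> u \<partial>\<mu>) \<noteq> \<infinity>" by simp
    show "\<not> (AE u in \<mu>. ?f \<xi> u + ?f \<eta> u \<le> 2 * ?f \<zeta> u)"
    proof
      assume "AE u in \<mu>. ?f \<xi> u + ?f \<eta> u \<le> 2 * ?f \<zeta> u"
      with less have "AE u in \<mu>. False" by eventually_elim simp
      then show False using mu_pos AE_iff_measurable[of "space \<mu>" \<mu> "\<lambda>_. False"] by (simp add: space_mu[symmetric])
    qed
  qed
  then have lt: "2 * F K \<zeta> < 2 * F K \<xi>" by (simp add: int int2)
  have "2 * F K \<xi> \<le> 2 * F K \<zeta>" by (intro mult_left_mono minimal \<open>\<zeta> \<in> K\<close>) simp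
  with lt show False by simp
qed

definition \<Psi> :: "(real^'n) set \<Rightarrow> ennreal" where
  "\<Psi> K = (INF \<xi>\<in>K. F K \<xi>)"

lemma \<Psi>_le: "\<xi> \<in> K \<Longrightarrow> \<Psi> K \<le> F K \<xi>"
  unfolding \<Psi>_def by (rule INF_lower)

text \<open>Compactness and Fatou's lemma. It serves for the existence of a minimum point and, in
  the first variation, for the limit of the minimum points of the cut bodies.\<close>

lemma minimizing_sequence_limit:
  assumes K: "compact K" "K \<noteq> {}" and x: "\<And>n. x n \<in> K" and lim: "(\<lambda>n. F K (x n)) \<longlonglongrightarrow> m"
  obtains r \<xi> where "strict_mono r" "(x \<circ> r) \<longlonglongrightarrow> \<xi>" "\<xi> \<in> K" "F K \<xi> \<le> m"
proof -
  obtain \<xi> r where r: "\<xi> \<in> K" "strict_mono r" "(x \<circ> r) \<longlonglongrightarrow> \<xi>"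
    using K(1) x unfolding compact_def by metis
  have "F K \<xi> \<le> liminf (\<lambda>n. F K ((x \<circ> r) n))" by (rule F_le_liminf[OF K r(3)])
  also have "(\<lambda>n. F K ((x \<circ> r) n)) \<longlonglongrightarrow> m"
    using LIMSEQ_subseq_LIMSEQ[OF lim r(2)] by (simp add: o_def)
  then have "liminf (\<lambda>n. F K ((x \<circ> r) n)) = m" by (intro lim_imp_Liminf) auto
  finally show ?thesis using r that by blast
qed

lemma \<Psi>_attained:
  assumes K: "compact K" "K \<noteq> {}"
  obtains \<xi> where "\<xi> \<in> K" "F K \<xi> = \<Psi> K"
proof -
  have ne: "F K ` K \<noteq> {}" using K(2) by auto
  obtain g :: "nat \<Rightarrow> ennreal" where g: "range g \<subseteq> F K ` K" "\<Psi> K = (INF i. g i)" "decseq g"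
    using ennreal_Inf_countable_INF[OF ne] unfolding \<Psi>_def by blast
  then have "\<forall>n. \<exists>y\<in>K. g n = F K y" by auto
  then obtain x where x: "\<And>n. x n \<in> K" "\<And>n. g n = F K (x n)" by metis
  have "g = (\<lambda>n. F K (x n))" using x(2) by (rule ext)
  moreover have "g \<longlonglongrightarrow> \<Psi> K" using LIMSEQ_INF[OF g(3)] unfolding g(2) .
  ultimately have lim: "(\<lambda>n. F K (x n)) \<longlonglongrightarrow> \<Psi> K" by simp
  obtain \<xi> where \<xi>: "\<xi> \<in> K" "F K \<xi> \<le> \<Psi> K" by (rule minimizing_sequence_limit[OF K x(1) lim])
  show ?thesis by (rule that[OF \<xi>(1) antisym[OF \<xi>(2) \<Psi>_le[OF \<xi>(1)]]])
qed

lemma \<Psi>_finite: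
  assumes "convex_body K"
  shows "\<Psi> K < \<infinity>"
proof -
  obtain z where z: "z \<in> interior K" using assms by (auto simp: convex_body_def)
  have "\<Psi> K \<le> F K z" using z interior_subset by (intro \<Psi>_le) auto
  also have "\<dots> < \<infinity>" using z assms by (intro F_finite_interior) (auto simp: convex_body_def)
  finally show ?thesis .
qed

lemma \<Psi>_pos:
  assumes "compact K" "K \<noteq> {}"
  shows "0 < \<Psi> K"
  using \<Psi>_attained[OF assms] F_pos[OF assms] by metis

lemma F_translation:
  assumes "compact K" "K \<noteq> {}"
  shows "F ((+) v ` K) (v + \<xi>) = F K \<xi>"
  unfolding F_def support_fun_translation[OF assms] by (simp add: inner_add_left)

lemma \<Psi>_translation:
  assumes "compact K" "K \<noteq> {}"
  shows "\<Psi> ((+) v ` K) = \<Psi> K"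
  unfolding \<Psi>_def by (simp add: image_image F_translation[OF assms])

lemma \<Psi>_scaleR:
  assumes K: "compact K" "K \<noteq> {}" and s: "0 < s"
  shows "\<Psi> ((*\<^sub>R) s ` K) = ennreal (s powr (- q)) * \<Psi> K"
proof -
  have F: "F ((*\<^sub>R) s ` K) (s *\<^sub>R \<xi>) = ennreal (s powr (- q)) * F K \<xi>" for \<xi>
  proof -
    have "F ((*\<^sub>R) s ` K) (s *\<^sub>R \<xi>) = (\<integral>\<^sup>+u. ennreal (s powr (- q)) * inv_pow q (support_fun K u - \<xi> \<bullet> u) \<partial>\<mu>)"
      unfolding F_def support_fun_scaleR[OF K s] by (simp add: inv_pow_mult[OF s, symmetric] right_diff_distrib)
    also have "\<dots> = ennreal (s powr (- q)) * F K \<xi>" unfolding F_def by (intro nn_integral_cmult F_measurable K)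
    finally show ?thesis .
  qed
  obtain \<xi> where \<xi>: "\<xi> \<in> K" "F K \<xi> = \<Psi> K" by (rule \<Psi>_attained[OF K])
  show ?thesis
  proof (rule antisym)
    have "\<Psi> ((*\<^sub>R) s ` K) \<le> F ((*\<^sub>R) s ` K) (s *\<^sub>R \<xi>)" using \<xi> by (intro \<Psi>_le) auto
    then show "\<Psi> ((*\<^sub>R) s ` K) \<le> ennreal (s powr (- q)) * \<Psi> K" using F \<xi> by simp
    show "ennreal (s powr (- q)) * \<Psi> K \<le> \<Psi> ((*\<^sub>R) s ` K)"
      unfolding \<Psi>_def[of "(*\<^sub>R) s ` K"]
    proof (rule INF_greatest)
      fix \<eta> assume "\<eta> \<in> (*\<^sub>R) s ` K"
      then obtain \<zeta> where "\<zeta> \<in> K" "\<eta> = s *\<^sub>R \<zeta>" by blast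
      then show "ennreal (s powr (- q)) * \<Psi> K \<le> F ((*\<^sub>R) s ` K) \<eta>"
        using \<Psi>_le[of \<zeta> K] by (simp add: F mult_left_mono)
    qed
  qed
qed

lemma F_invariant:
  assumes K: "compact K" "K \<noteq> {}" and A: "orthogonal_matrix A" and inv: "(\<lambda>x. A *v x) ` K = K"
    and mu_inv: "\<And>\<omega>. \<omega> \<in> sets \<mu> \<Longrightarrow> emeasure \<mu> ((\<lambda>x. A *v x) ` \<omega>) = emeasure \<mu> \<omega>"
  shows "F K (A *v \<xi>) = F K \<xi>"
proof -
  let ?T = "\<lambda>u. transpose A *v u"
  have "distr \<mu> \<mu> ?T = \<mu>"
    by (rule invariant_distr[OF A sets_mu orthogonal_sphere(1)[OF A]]) (rule mu_inv)
  then have "F K \<xi> = (\<integral>\<^sup>+u. inv_pow q (support_fun K u - \<xi> \<bullet> u) \<partial>distr \<mu> \<mu> ?T)"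
    by (simp only: F_def)
  also have "\<dots> = (\<integral>\<^sup>+u. inv_pow q (support_fun K (?T u) - \<xi> \<bullet> ?T u) \<partial>\<mu>)"
    using F_measurable[OF K] by (intro nn_integral_distr orthogonal_measurable(1)[OF A sets_mu orthogonal_sphere(1)[OF A]]) simp
  also have "\<dots> = F K (A *v \<xi>)"
    unfolding F_def support_fun_invariant[OF A inv] orthogonal_matrix_simps(3)[OF A] ..
  finally show ?thesis by simp
qed

end

section \<open>Volume of linear images\<close>

lemma emeasure_lborel_isometry:
  fixes f :: "'a::euclidean_space \<Rightarrow> 'a"
  assumes "\<And>x y. dist (f x) (f y) = dist x y" "A \<in> sets borel" "f ` A \<in> sets borel"
  shows "emeasure lborel (f ` A) = emeasure lborel A"
proof -
  obtain c where c: "0 < c" "\<And>A :: 'a set. A \<in> sets borel \<Longrightarrow> hausdorff_outer (DIM('a)) A = ennreal c * emeasure lborel A"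
    using hausdorff_outer_full_dimension by blast
  have "ennreal (1 / c) * (ennreal c * emeasure lborel (f ` A)) = ennreal (1 / c) * (ennreal c * emeasure lborel A)"
    using hausdorff_outer_isometry[of A f "DIM('a)"] assms by (simp add: c(2)[symmetric])
  moreover have "ennreal (1 / c) * (ennreal c * x) = x" for x
    using c(1) by (simp add: mult.assoc[symmetric] ennreal_mult[symmetric])
  ultimately show ?thesis by metis
qed

definition matrix_volume :: "real^'n^'n \<Rightarrow> ennreal" where
  "matrix_volume D = emeasure lborel ((*v) D ` ball 0 1) / emeasure lborel (ball (0::real^'n) 1)"

lemma invertible_image_borel:
  fixes D :: "real^'n^'n"
  assumes D: "det D \<noteq> 0" and A: "A \<in> sets borel"
  shows "(*v) D ` A \<in> sets borel"
proof -
  obtain B where B: "D ** B = mat 1" "B ** D = mat 1"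
    using D unfolding invertible_det_nz[symmetric] invertible_def by blast
  have "(*v) D ` A = (*v) B -` A \<inter> space borel"
  proof (rule Set.set_eqI, rule iffI)
    fix x assume "x \<in> (*v) D ` A"
    then obtain a where "a \<in> A" "x = D *v a" by blast
    moreover from this have "B *v x = a" by (simp only: matrix_vector_mul_assoc B matrix_vector_mul_lid)
    ultimately show "x \<in> (*v) B -` A \<inter> space borel" by simp
  next
    fix x assume "x \<in> (*v) B -` A \<inter> space borel"
    then have "B *v x \<in> A" by simp
    moreover have "x = D *v (B *v x)" by (simp only: matrix_vector_mul_assoc B matrix_vector_mul_lid)
    ultimately show "x \<in> (*v) D ` A" by blast
  qed
  also have "\<dots> \<in> sets borel"
    by (rule measurable_sets[OF borel_measurable_continuous_onI[OF matrix_vector_mult_linear_continuous_on] A])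
  finally show ?thesis .
qed

text \<open>The volume of the image under \<open>D\<close> is itself a translation invariant
  measure, finite on balls, hence a multiple of Lebesgue measure; the unit ball determines the
  factor.\<close>

lemma emeasure_matrix_volume:
  fixes D :: "real^'n^'n"
  assumes D: "det D \<noteq> 0" and A: "A \<in> sets borel"
  shows "emeasure lborel ((*v) D ` A) = matrix_volume D * emeasure lborel A"
proof -
  obtain B where B: "D ** B = mat 1" "B ** D = mat 1"
    using D unfolding invertible_det_nz[symmetric] invertible_def by blast
  have BD: "B *v (D *v x) = x" "D *v (B *v x) = x" for x by (simp_all only: matrix_vector_mul_assoc B matrix_vector_mul_lid)
  have Bm: "(*v) B \<in> measurable lborel borel"
    using borel_measurable_continuous_onI[OF matrix_vector_mult_linear_continuous_on[of UNIV B]] by simp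
  define M where "M = distr lborel borel ((*v) B)"
  have em: "emeasure M C = emeasure lborel ((*v) D ` C)" if C: "C \<in> sets borel" for C
  proof -
    have "emeasure M C = emeasure lborel ((*v) B -` C \<inter> space lborel)" unfolding M_def by (rule emeasure_distr[OF Bm C])
    also have "(*v) B -` C \<inter> space lborel = (*v) D ` C"
    proof (rule Set.set_eqI, rule iffI)
      fix x assume "x \<in> (*v) B -` C \<inter> space lborel"
      then have "B *v x \<in> C" by simp
      then show "x \<in> (*v) D ` C" by (rule image_eqI[rotated]) (simp only: BD)
    next
      fix x assume "x \<in> (*v) D ` C"
      then obtain y where "y \<in> C" "x = D *v y" by blast
      then show "x \<in> (*v) B -` C \<inter> space lborel" by (simp add: BD)
    qed
    finally show ?thesis .
  qed
  have "emeasure M A = emeasure M (ball 0 1) / emeasure lborel (ball (0::real^'n) 1) * emeasure lborel A"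
  proof (rule translation_invariant_lborel_const[OF _ _ _ A])
    show "sets M = sets borel" by (simp add: M_def)
    fix v and C :: "(real^'n) set" assume C: "C \<in> sets borel"
    have "(*v) D ` ((+) v ` C) = (+) (D *v v) ` ((*v) D ` C)"
      by (simp only: image_image matrix_vector_right_distrib)
    then show "emeasure M ((+) v ` C) = emeasure M C"
      using C by (simp only: em borel_translation_image emeasure_lborel_translation invertible_image_borel[OF D])
  next
    fix r
    have "bounded ((*v) D ` ball 0 r)" by (intro bounded_linear_image bounded_ball matrix_vector_mul_bounded_linear)
    from emeasure_bounded_finite[OF this] show "emeasure M (ball 0 r) < \<infinity>" by (simp add: em)
  qed
  then show ?thesis using A by (simp add: em matrix_volume_def)
qed

lemma matrix_volume_mult:
  fixes A B :: "real^'n^'n"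
  assumes "det A \<noteq> 0" "det B \<noteq> 0"
  shows "matrix_volume (A ** B) = matrix_volume A * matrix_volume B"
proof -
  have b: "ball (0::real^'n) 1 \<in> sets borel" by simp
  have "(*v) (A ** B) ` ball 0 1 = (*v) A ` ((*v) B ` ball 0 1)"
    by (simp only: image_image matrix_vector_mul_assoc)
  then have "matrix_volume (A ** B) = matrix_volume A * emeasure lborel ((*v) B ` ball 0 1) / emeasure lborel (ball (0::real^'n) 1)"
    unfolding matrix_volume_def[of "A ** B"]
    by (simp only: emeasure_matrix_volume[OF assms(1) invertible_image_borel[OF assms(2) b]])
  then show ?thesis unfolding matrix_volume_def[of B] by (simp only: ennreal_times_divide)
qed

lemma matrix_volume_finite: "matrix_volume (D :: real^'n^'n) < \<infinity>"
proof -
  have "bounded ((*v) D ` ball 0 1)" by (intro bounded_linear_image bounded_ball matrix_vector_mul_bounded_linear)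
  then have "emeasure lborel ((*v) D ` ball 0 1) < \<infinity>" by (rule emeasure_bounded_finite)
  then show ?thesis using emeasure_lborel_unit_ball(1)[where 'a="real^'n"]
    unfolding matrix_volume_def by (auto simp: ennreal_divide_eq_top_iff less_top[symmetric])
qed

lemma matrix_volume_orthogonal:
  fixes A :: "real^'n^'n"
  assumes "orthogonal_matrix A"
  shows "matrix_volume A = 1"
proof -
  have "orthogonal_transformation ((*v) A)" using assms by (simp add: orthogonal_transformation_matrix)
  then have d: "dist (A *v x) (A *v y) = dist x y" for x y by (rule orthogonal_transformation_dist)
  have dA: "det A \<noteq> 0" using det_orthogonal_matrix[OF assms] by auto
  have "emeasure lborel ((*v) A ` ball 0 1) = emeasure lborel (ball (0::real^'n) 1)"
    by (rule emeasure_lborel_isometry[OF d _ invertible_image_borel[OF dA]]) auto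
  then show ?thesis
    using emeasure_lborel_unit_ball[where 'a="real^'n"] unfolding matrix_volume_def
    by (metis ennreal_divide_self infinity_ennreal_def less_irrefl)
qed

section \<open>Factoring a matrix into dilations, shears and swaps of coordinates\<close>

definition column_matrix :: "'n \<Rightarrow> real^'n \<Rightarrow> real^'n^'n" where
  "column_matrix k w = (\<chi> i j. if j = k then w $ i else if i = j then 1 else 0)"

lemma column_matrix_mult: "column_matrix k w *v x = x + x $ k *\<^sub>R (w - axis k 1)"
proof -
  have "(column_matrix k w *v x) $ i = (x + x $ k *\<^sub>R (w - axis k 1)) $ i" for i
  proof -
    have "(column_matrix k w *v x) $ i = (\<Sum>j\<in>UNIV. (if j = k then w $ i else if i = j then 1 else 0) * x $ j)"
      by (simp add: column_matrix_def matrix_vector_mult_def)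
    also have "\<dots> = (\<Sum>j\<in>UNIV. (if j = k then w $ i * x $ k else 0) + (if j = i then if i = k then 0 else x $ i else 0))"
      by (intro sum.cong) auto
    also have "\<dots> = w $ i * x $ k + (if i = k then 0 else x $ i)" by (simp add: sum.distrib)
    finally show ?thesis by (simp add: axis_def algebra_simps)
  qed
  then show ?thesis by (simp add: vec_eq_iff)
qed

lemma det_column_matrix:
  fixes w :: "real^'n"
  shows "det (column_matrix k w) = w $ k"
proof -
  have "(\<chi> i j. if j = k then (mat 1 *v w) $ i else (mat 1 :: real^'n^'n) $ i $ j) = column_matrix k w"
    unfolding matrix_vector_mul_lid by (simp add: column_matrix_def vec_eq_iff mat_def)
  then show ?thesis using cramer_lemma[of k "mat 1 :: real^'n^'n" w] by simp
qed

lemma matrix_volume_scale: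
  assumes "c \<noteq> 0"
  shows "matrix_volume (column_matrix k (c *\<^sub>R axis k 1) :: real^'n^'n) = ennreal \<bar>c\<bar>"
proof -
  let ?D = "column_matrix k (c *\<^sub>R axis k 1) :: real^'n^'n"
  have dD: "det ?D \<noteq> 0" using assms by (simp add: det_column_matrix)
  let ?c = "\<lambda>b::real^'n. if b = axis k 1 then c else 1"
  define T where "T x = (0::real^'n) + (\<Sum>j\<in>Basis. (?c j * (x \<bullet> j)) *\<^sub>R j)" for x
  have T: "T x = ?D *v x" for x
  proof -
    have "T x = (\<Sum>j\<in>Basis. (x \<bullet> j) *\<^sub>R j + (if j = axis k 1 then ((c - 1) * (x $ k)) *\<^sub>R j else 0))"
      unfolding T_def by (simp, intro sum.cong) (auto simp: algebra_simps inner_axis)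
    also have "\<dots> = x + ((c - 1) * (x $ k)) *\<^sub>R axis k 1"
      by (simp add: sum.distrib euclidean_representation sum.If_cases sum.delta)
    finally show ?thesis by (simp add: column_matrix_mult algebra_simps)
  qed
  have "lborel = density (distr lborel borel T) (\<lambda>_. ennreal (\<Prod>j\<in>Basis. \<bar>?c j\<bar>))"
    unfolding T_def using assms by (intro lborel_affine_euclidean) auto
  also have "(\<Prod>j\<in>Basis. \<bar>?c j\<bar>) = \<bar>c\<bar>"
  proof -
    have "(\<Prod>j\<in>Basis. \<bar>?c j\<bar>) = (\<Prod>j\<in>(Basis :: (real^'n) set). if j = axis k 1 then \<bar>c\<bar> else 1)" by (intro prod.cong) auto
    then show ?thesis by (simp add: prod.delta)
  qed
  finally have lb: "lborel = density (distr lborel borel T) (\<lambda>_. ennreal \<bar>c\<bar>)" .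
  have Tm: "T \<in> measurable lborel borel"
    unfolding T using borel_measurable_continuous_onI[OF matrix_vector_mult_linear_continuous_on[of UNIV ?D]] by (simp add: T[abs_def])
  let ?B = "ball (0::real^'n) 1"
  have TB: "T ` ?B \<in> sets borel" unfolding T using invertible_image_borel[OF dD, of ?B] by simp
  have "inj T"
  proof (rule injI)
    fix x y assume "T x = T y"
    then have "?D *v x = ?D *v y" by (simp only: T)
    then show "x = y" using dD inj_matrix_vector_mult[of ?D] invertible_det_nz[of ?D] by (auto dest: injD)
  qed
  have "emeasure lborel (T ` ?B) = emeasure (density (distr lborel borel T) (\<lambda>_. ennreal \<bar>c\<bar>)) (T ` ?B)"
    by (simp add: lb[symmetric])
  also have "\<dots> = ennreal \<bar>c\<bar> * emeasure (distr lborel borel T) (T ` ?B)"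
    using TB by (intro emeasure_density_const) simp
  also have "emeasure (distr lborel borel T) (T ` ?B) = emeasure lborel (T -` (T ` ?B) \<inter> space lborel)"
    by (rule emeasure_distr[OF Tm TB])
  also have "T -` (T ` ?B) \<inter> space lborel = ?B" using inj_vimage_image_eq[OF \<open>inj T\<close>] by simp
  finally have "emeasure lborel ((*v) ?D ` ?B) = ennreal \<bar>c\<bar> * emeasure lborel ?B" by (simp only: T[abs_def])
  then show ?thesis using emeasure_lborel_unit_ball[where 'a="real^'n"] unfolding matrix_volume_def
    by (metis ennreal_mult_divide_eq infinity_ennreal_def less_irrefl)
qed

text \<open>Conjugating a shear by the dilation by 2 of the sheared coordinate squares it, so its volume factor is 1.\<close>

lemma matrix_volume_shear:
  assumes w: "w $ k = 1"
  shows "matrix_volume (column_matrix k w :: real^'n^'n) = 1"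
proof -
  let ?N = "column_matrix k w :: real^'n^'n" and ?D = "column_matrix k (2 *\<^sub>R axis k 1) :: real^'n^'n"
  have "(?N ** ?D) *v x = (?D ** (?N ** ?N)) *v x" for x
  proof -
    have wk: "(w - axis k 1) $ k = 0" by (simp add: w axis_def)
    have "?N *v (?D *v x) = ?D *v (?N *v (?N *v x))"
      unfolding column_matrix_mult using wk by (simp add: vec_eq_iff axis_def w algebra_simps)
    then show ?thesis by (simp only: matrix_vector_mul_assoc matrix_mul_assoc)
  qed
  then have eq: "?N ** ?D = ?D ** (?N ** ?N)" by (simp add: matrix_eq)
  have dN: "det ?N \<noteq> 0" "det ?D \<noteq> 0" "det (?N ** ?N) \<noteq> 0" by (simp_all add: det_column_matrix w det_mul)
  have vol: "matrix_volume ?N * matrix_volume ?D = matrix_volume ?D * (matrix_volume ?N * matrix_volume ?N)"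
    using eq dN by (simp add: matrix_volume_mult[symmetric])
  have D2: "matrix_volume ?D = ennreal 2" using matrix_volume_scale[of 2 k] by simp
  obtain m where m: "matrix_volume ?N = ennreal m" "0 \<le> m"
    using matrix_volume_finite[of ?N] by (cases "matrix_volume ?N") auto
  have "ennreal (m * 2) = ennreal (2 * (m * m))"
    using vol[unfolded m(1) D2] m(2) by (simp only: ennreal_mult mult_nonneg_nonneg zero_le_numeral)
  then have "m * 2 = 2 * (m * m)" using m(2) by (subst (asm) ennreal_inj) auto
  then have "m = 0 \<or> m = 1" by auto
  moreover have "m \<noteq> 0"
  proof
    assume "m = 0"
    obtain B where B: "?N ** B = mat 1" "B ** ?N = mat 1"
      using dN(1) unfolding invertible_det_nz[symmetric] invertible_def by blast
    have "det B \<noteq> 0" using B(1) det_mul[of ?N B] by auto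
    then have "matrix_volume (mat 1 :: real^'n^'n) = 0"
      using matrix_volume_mult[OF dN(1), of B] B m \<open>m = 0\<close> by simp
    then show False using matrix_volume_orthogonal[OF orthogonal_matrix_id, where 'n='n] by simp
  qed
  ultimately show ?thesis using m by simp
qed

lemma matrix_volume_column:
  assumes w: "w $ k \<noteq> 0"
  shows "matrix_volume (column_matrix k w :: real^'n^'n) = ennreal \<bar>w $ k\<bar>"
proof -
  define c where "c = w $ k"
  \<comment> \<open>This is \<open>w / c\<close>. Coordinate \<open>k\<close> is dilated by
    \<open>c\<close>, then the shear sends \<open>axis k 1\<close> to \<open>w / c\<close>; together
    \<open>axis k 1\<close> goes to \<open>w\<close>.\<close>
  define w' where "w' = axis k 1 + (1 / c) *\<^sub>R (w - c *\<^sub>R axis k 1)"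
  let ?N = "column_matrix k w' :: real^'n^'n" and ?D = "column_matrix k (c *\<^sub>R axis k 1) :: real^'n^'n"
  have c: "c \<noteq> 0" using w by (simp add: c_def)
  have w'k: "w' $ k = 1" by (simp add: w'_def c_def axis_def)
  have "(?N ** ?D) *v x = column_matrix k w *v x" for x
  proof -
    have "?N *v (?D *v x) = column_matrix k w *v x"
      unfolding column_matrix_mult using c by (simp add: w'_def axis_def algebra_simps)
    then show ?thesis by (simp only: matrix_vector_mul_assoc)
  qed
  then have "column_matrix k w = ?N ** ?D" by (simp add: matrix_eq)
  then have "matrix_volume (column_matrix k w :: real^'n^'n) = matrix_volume ?N * matrix_volume ?D"
    using c by (simp add: matrix_volume_mult det_column_matrix w'k)
  then show ?thesis using matrix_volume_shear[OF w'k] matrix_volume_scale[OF c, of k] by (simp add: c_def)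
qed

lemma column_mult: "column j (A ** B) = A *v column j (B :: real^'n^'n)"
  by (simp add: column_def matrix_matrix_mult_def matrix_vector_mult_def vec_eq_iff)

lemma matrix_columns_eqI: "(\<And>j. column j A = column j B) \<Longrightarrow> A = (B :: real^'n^'n)"
  by (simp add: column_def vec_eq_iff)

definition swap_matrix :: "'n \<Rightarrow> 'n \<Rightarrow> real^'n^'n" where
  "swap_matrix k l = (\<chi> i. axis (Transposition.transpose k l i) 1)"

lemma swap_matrix_mult: "swap_matrix k l *v x = (\<chi> i. x $ Transposition.transpose k l i)"
  by (simp add: swap_matrix_def vec_eq_iff matrix_vector_mul_component inner_axis')

lemma swap_matrix_axis: "swap_matrix k l *v axis j 1 = axis (Transposition.transpose k l j) 1"
  by (auto simp: swap_matrix_mult vec_eq_iff axis_def transpose_eq_iff)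

lemma orthogonal_swap_matrix: "orthogonal_matrix (swap_matrix k l :: real^'n^'n)"
proof -
  let ?\<tau> = "Transposition.transpose k l"
  have "(swap_matrix k l *v v) \<bullet> (swap_matrix k l *v w) = v \<bullet> w" for v w :: "real^'n"
  proof -
    have "(\<Sum>i\<in>UNIV. v $ ?\<tau> i * w $ ?\<tau> i) = (\<Sum>i\<in>UNIV. v $ i * w $ i)"
      by (rule sum.reindex_bij_betw[of ?\<tau> UNIV UNIV "\<lambda>i. v $ i * w $ i"]) simp
    then show ?thesis by (simp add: swap_matrix_mult inner_vec_def)
  qed
  then have "orthogonal_transformation ((*v) (swap_matrix k l :: real^'n^'n))"
    by (simp add: orthogonal_transformation_def)
  then show ?thesis by (simp add: orthogonal_transformation_matrix)
qed

text \<open>Induction on the set \<open>S\<close> of columns that may differ from the corresponding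
  unit vectors. Replacing column \<open>k\<close> by a unit vector \<open>axis l 1\<close> splits
  off a factor \<open>column_matrix k w\<close> of known volume; swapping the coordinates
  \<open>k\<close> and \<open>l\<close> then turns the new column into \<open>axis k 1\<close>, so
  that only the columns in \<open>S\<close> remain.\<close>

lemma matrix_volume_eq_det:
  fixes D :: "real^'n^'n"
  assumes "det D \<noteq> 0"
  shows "matrix_volume D = ennreal \<bar>det D\<bar>"
proof -
  have main: "matrix_volume D = ennreal \<bar>det D\<bar>"
    if "finite S" "det D \<noteq> 0" "\<And>j. j \<notin> S \<Longrightarrow> column j D = axis j 1" for S and D :: "real^'n^'n"
    using that
  proof (induction S arbitrary: D rule: finite_induct)
    case empty
    have "D = mat 1" using empty by (intro matrix_columns_eqI) (simp add: column_def vec_eq_iff mat_def axis_def)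
    then show ?case by (simp add: matrix_volume_orthogonal orthogonal_matrix_id)
  next
    case (insert k S)
    obtain B where B: "D ** B = mat 1" "B ** D = mat 1"
      using insert.prems(1) unfolding invertible_det_nz[symmetric] invertible_def by blast
    \<comment> \<open>By Cramer's rule, putting \<open>axis l 1\<close> into column \<open>k\<close>
      multiplies the determinant by \<open>B $ k $ l\<close>. A nonzero entry in row
      \<open>k\<close> of the inverse thus tells which \<open>l\<close> keeps the matrix
      invertible.\<close>
    have "\<exists>l. B $ k $ l \<noteq> 0"
    proof (rule ccontr)
      assume "\<not> ?thesis"
      then have "(B ** D) $ k $ k = 0" by (simp add: matrix_matrix_mult_def)
      then show False using B(2) by (simp add: mat_def)
    qed
    then obtain l where l: "B $ k $ l \<noteq> 0" by blast
    define x where "x = B *v axis l 1"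
    have xk: "x $ k \<noteq> 0" using l by (simp add: x_def matrix_vector_mult_basis column_def)
    have Dx: "D *v x = axis l 1" unfolding x_def by (simp only: matrix_vector_mul_assoc B matrix_vector_mul_lid)
    define D' where "D' = (\<chi> i j. if j = k then axis l 1 $ i else D $ i $ j)"
    have "det D' = x $ k * det D" unfolding D'_def Dx[symmetric] by (rule cramer_lemma)
    then have dD': "det D' \<noteq> 0" using xk insert.prems(1) by simp
    have colD': "column j D' = (if j = k then axis l 1 else column j D)" for j
      by (simp add: D'_def column_def vec_eq_iff)
    \<comment> \<open>Otherwise column \<open>l\<close> of \<open>D'\<close> would be
      \<open>axis l 1\<close> as well, and two equal columns would make the determinant vanish. So
      the swap leaves the unit columns outside \<open>insert k S\<close> alone.\<close>
    have lS: "l \<in> insert k S"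
    proof (rule ccontr)
      assume "l \<notin> insert k S"
      then have "column l D' = column k D'" "l \<noteq> k" using insert.prems(2) by (auto simp: colD')
      then show False using dD' det_identical_columns[of l k D'] by auto
    qed
    obtain B' where B': "D' ** B' = mat 1"
      using dD' unfolding invertible_det_nz[symmetric] invertible_def by blast
    define w where "w = B' *v column k D"
    have D'w: "D' *v w = column k D" unfolding w_def by (simp only: matrix_vector_mul_assoc B' matrix_vector_mul_lid)
    have colE: "column j (column_matrix k w) = (if j = k then w else axis j 1)" for j
      by (simp add: column_matrix_def column_def vec_eq_iff axis_def)
    have DE: "D = D' ** column_matrix k w"
    proof (rule matrix_columns_eqI)
      fix j
      show "column j D = column j (D' ** column_matrix k w)"
        unfolding column_mult colE using D'w by (simp add: matrix_vector_mult_basis colD')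
    qed
    have detD: "det D = det D' * w $ k" using DE det_mul[of D' "column_matrix k w"] by (simp add: det_column_matrix)
    then have wk: "w $ k \<noteq> 0" using insert.prems(1) by auto
    let ?\<tau> = "swap_matrix k l :: real^'n^'n"
    have d\<tau>: "\<bar>det ?\<tau>\<bar> = 1" using det_orthogonal_matrix[OF orthogonal_swap_matrix[of k l]] by auto
    have "matrix_volume (?\<tau> ** D') = ennreal \<bar>det (?\<tau> ** D')\<bar>"
    proof (rule insert.IH)
      show "det (?\<tau> ** D') \<noteq> 0" using d\<tau> dD' by (auto simp: det_mul)
      fix j assume j: "j \<notin> S"
      show "column j (?\<tau> ** D') = axis j 1"
      proof (cases "j = k")
        case True then show ?thesis unfolding column_mult colD' by (simp add: swap_matrix_axis)
      next
        case False
        then have "j \<noteq> l" using j lS by auto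
        then show ?thesis unfolding column_mult colD' using False j insert.prems(2)[of j]
          by (simp add: swap_matrix_axis transpose_apply_other)
      qed
    qed
    moreover have "matrix_volume (?\<tau> ** D') = matrix_volume D'"
      using d\<tau> dD' by (subst matrix_volume_mult) (auto simp: matrix_volume_orthogonal[OF orthogonal_swap_matrix])
    ultimately have "matrix_volume D' = ennreal \<bar>det D'\<bar>" using d\<tau> by (simp add: det_mul abs_mult)
    moreover have "matrix_volume D = matrix_volume D' * matrix_volume (column_matrix k w)"
      by (subst DE, rule matrix_volume_mult[OF dD']) (simp add: det_column_matrix wk)
    ultimately show ?case using matrix_volume_column[OF wk] by (simp add: detD abs_mult ennreal_mult)
  qed
  show ?thesis by (rule main[of UNIV]) (use assms in auto)
qed

lemma emeasure_lborel_matrix_image: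
  fixes D :: "real^'n^'n"
  assumes "det D \<noteq> 0" "A \<in> sets borel"
  shows "emeasure lborel ((*v) D ` A) = ennreal \<bar>det D\<bar> * emeasure lborel A"
  using emeasure_matrix_volume[OF assms] matrix_volume_eq_det[OF assms(1)] by simp

section \<open>Coercivity\<close>

lemma norm_matrix_le_sum: "norm (D :: real^'n^'m) \<le> (\<Sum>i\<in>UNIV. norm (D $ i))"
  unfolding norm_vec_def[of D] by (rule L2_set_le_sum) simp

lemma compact_matrix_rows:
  fixes K :: "(real^'n) set"
  assumes "compact K"
  shows "compact {P :: real^'n^'m. \<forall>i. P $ i \<in> K}"
  unfolding compact_eq_bounded_closed
proof
  obtain R where R: "\<And>x. x \<in> K \<Longrightarrow> norm x \<le> R"
    using compact_imp_bounded[OF assms] by (auto simp: bounded_iff)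
  have "norm P \<le> real CARD('m) * R" if "\<forall>i. P $ i \<in> K" for P :: "real^'n^'m"
  proof -
    have "norm P \<le> (\<Sum>i\<in>UNIV. norm (P $ i))" by (rule norm_matrix_le_sum)
    also have "\<dots> \<le> (\<Sum>i\<in>(UNIV::'m set). R)" using that R by (intro sum_mono) auto
    finally show ?thesis by simp
  qed
  then show "bounded {P :: real^'n^'m. \<forall>i. P $ i \<in> K}" by (auto simp: bounded_iff)
  have "closed ((\<lambda>P :: real^'n^'m. P $ i) -` K)" for i
    by (intro closed_vimage compact_imp_closed assms continuous_intros)
  then have "closed (\<Inter>i. (\<lambda>P :: real^'n^'m. P $ i) -` K)" by (intro closed_INT) auto
  also have "(\<Inter>i. (\<lambda>P :: real^'n^'m. P $ i) -` K) = {P. \<forall>i. P $ i \<in> K}" by auto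
  finally show "closed {P :: real^'n^'m. \<forall>i. P $ i \<in> K}" .
qed

text \<open>A simplex of maximal volume inscribed in \<open>K\<close> controls \<open>K\<close> from inside and outside. The rows of
  \<open>D\<close> are its edges at one vertex and \<open>\<xi>\<close> is its centroid.\<close>

lemma maximal_simplex:
  fixes K :: "(real^'n) set"
  assumes K: "compact K" "convex K" "interior K \<noteq> {}"
  obtains D :: "real^'n^'n" and \<xi> where "\<xi> \<in> K" "det D \<noteq> 0"
    "measure lebesgue K \<le> 2 ^ CARD('n) * \<bar>det D\<bar>"
    "\<And>u. norm (D *v u) \<le> real (CARD('n) * (CARD('n) + 1)) * (support_fun K u - \<xi> \<bullet> u)"
    "\<And>x y. x \<in> K \<Longrightarrow> y \<in> K \<Longrightarrow> norm (x - y) \<le> 2 * real CARD('n) * norm D"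
proof -
  let ?n = "CARD('n)"
  define E where "E z = (\<chi> i. snd z $ i - fst z)" for z :: "(real^'n) \<times> (real^'n^'n)"
  define S where "S = K \<times> {P :: real^'n^'n. \<forall>i. P $ i \<in> K}"
  have cS: "compact S" unfolding S_def by (intro compact_Times K compact_matrix_rows)
  have cont: "continuous_on S (\<lambda>z. \<bar>det (E z)\<bar>)"
    unfolding det_def E_def by (simp only: vec_lambda_beta vector_minus_component) (intro continuous_intros)
  obtain z where "z \<in> interior K" using K(3) by blast
  then obtain r where r: "0 < r" "cball z r \<subseteq> K" by (auto simp: mem_interior_cball)
  define P0 where "P0 = ((\<chi> i. z + r *\<^sub>R axis i 1) :: real^'n^'n)"
  have zP: "(z, P0) \<in> S"
  proof -
    have "z \<in> K" using r by auto
    moreover have "z + r *\<^sub>R axis i 1 \<in> K" for i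
      using r by (intro subsetD[OF r(2)]) (simp add: dist_norm norm_axis_1)
    ultimately show ?thesis by (simp add: S_def P0_def)
  qed
  have E0: "det (E (z, P0)) = r ^ ?n"
  proof -
    have "E (z, P0) = (\<chi> i. \<chi> j. if i = j then r else 0)"
      by (simp add: E_def P0_def vec_eq_iff axis_def)
    then show ?thesis by (simp add: det_diagonal)
  qed
  obtain w where w: "w \<in> S" "\<And>v. v \<in> S \<Longrightarrow> \<bar>det (E v)\<bar> \<le> \<bar>det (E w)\<bar>"
    using continuous_attains_sup[OF cS _ cont] zP by blast
  obtain p0 P where wP: "w = (p0, P)" by (cases w)
  have p0: "p0 \<in> K" and P: "\<And>i. P $ i \<in> K" using w(1) by (auto simp: wP S_def)
  define D where "D = E w"
  have Di: "D $ i = P $ i - p0" for i by (simp add: D_def E_def wP)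
  have detD: "det D \<noteq> 0"
  proof -
    have "r ^ ?n \<le> \<bar>det D\<bar>" using w(2)[OF zP] r(1) by (simp add: E0 D_def)
    then show ?thesis using r(1) by (metis abs_zero not_le zero_less_power)
  qed
  let ?A = "transpose D"
  \<comment> \<open>Cramer's rule writes each coordinate of \<open>x - p0\<close> in the basis of
    edges as a ratio of determinants. The numerator belongs to the simplex with the vertex
    \<open>P $ k\<close> replaced by \<open>x\<close>, so maximality bounds it by the
    denominator.\<close>
  have coord: "\<exists>t. x - p0 = ?A *v t \<and> (\<forall>i. \<bar>t $ i\<bar> \<le> 1)" if x: "x \<in> K" for x
  proof -
    define t where "t = (\<chi> k. det (\<chi> i j. if j = k then (x - p0) $ i else ?A $ i $ j) / det ?A)"
    have "?A *v t = x - p0" using cramer[of ?A t "x - p0"] detD by (simp add: t_def det_transpose)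
    moreover have "\<bar>t $ k\<bar> \<le> 1" for k
    proof -
      define Q where "Q = (\<chi> i. if i = k then x else P $ i)"
      have "(p0, Q) \<in> S" using p0 P x by (simp add: S_def Q_def)
      then have le: "\<bar>det (E (p0, Q))\<bar> \<le> \<bar>det D\<bar>" using w(2) by (simp add: D_def)
      have tr: "transpose (E (p0, Q)) = (\<chi> i j. if j = k then (x - p0) $ i else ?A $ i $ j)"
        by (simp add: vec_eq_iff transpose_def E_def Q_def Di)
      have "t $ k = det (transpose (E (p0, Q))) / det ?A" by (simp only: t_def vec_lambda_beta tr)
      then have "t $ k = det (E (p0, Q)) / det D" by (simp only: det_transpose)
      then show ?thesis using le detD by (simp add: abs_divide)
    qed
    ultimately show ?thesis by metis
  qed
  define \<xi> where "\<xi> = (1 / real (?n + 1)) *\<^sub>R (p0 + (\<Sum>i\<in>UNIV. P $ i))"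
  have \<xi>K: "\<xi> \<in> K"
  proof -
    define c where "c = (1 / real ?n) *\<^sub>R (\<Sum>i\<in>UNIV. P $ i)"
    have "(\<Sum>i\<in>UNIV. (1 / real ?n) *\<^sub>R (P $ i)) \<in> K"
      using P by (intro convex_sum[OF _ K(2)]) auto
    then have cK: "c \<in> K" by (simp add: c_def scaleR_sum_right)
    have n0: "real ?n > 0" by simp
    have "\<xi> = (1 / real (?n + 1)) *\<^sub>R p0 + (real ?n / real (?n + 1)) *\<^sub>R c"
      using n0 by (simp add: \<xi>_def c_def scaleR_add_right)
    also have "\<dots> \<in> K" by (intro convexD[OF K(2) p0 cK]) (auto simp: field_simps)
    finally show ?thesis .
  qed
  show ?thesis
  proof (rule that[OF \<xi>K detD])
    \<comment> \<open>\<open>K\<close> lies in the parallelotope of all combinations of the edges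
      with coefficients in \<open>[-1, 1]\<close>, whose volume is \<open>2 ^ n\<close> times the
      determinant.\<close>
    have sub: "K \<subseteq> (+) p0 ` ((\<lambda>t. ?A *v t) ` cbox (\<chi> i. - 1) (\<chi> i. 1))"
    proof
      fix x assume "x \<in> K"
      then obtain t where t: "x - p0 = ?A *v t" "\<forall>i. \<bar>t $ i\<bar> \<le> 1" using coord by blast
      have "t \<in> cbox (\<chi> i. - 1) (\<chi> i. 1)" using t(2) by (auto simp: mem_box_cart abs_le_iff minus_le_iff)
      moreover have "x = p0 + ?A *v t" unfolding t(1)[symmetric] by simp
      ultimately show "x \<in> (+) p0 ` ((\<lambda>t. ?A *v t) ` cbox (\<chi> i. - 1) (\<chi> i. 1))" by blast
    qed
    let ?C = "cbox (\<chi> i. - 1) (\<chi> i. 1) :: (real^'n) set"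
    have cC: "compact ((\<lambda>t. ?A *v t) ` ?C)"
      by (intro compact_continuous_image matrix_vector_mult_linear_continuous_on compact_cbox)
    have dA: "det ?A \<noteq> 0" using detD by (simp add: det_transpose)
    have "emeasure lborel K \<le> emeasure lborel ((+) p0 ` ((\<lambda>t. ?A *v t) ` ?C))"
      using borel_translation_image[OF borel_compact[OF cC]] by (intro emeasure_mono sub) (simp only: sets_lborel)
    also have "\<dots> = emeasure lborel ((\<lambda>t. ?A *v t) ` ?C)"
      by (rule emeasure_lborel_translation[OF borel_compact[OF cC]])
    also have "\<dots> = ennreal \<bar>det ?A\<bar> * emeasure lborel ?C" by (rule emeasure_lborel_matrix_image[OF dA]) simp
    also have "emeasure lborel ?C = ennreal (2 ^ ?n)"
    proof -
      have "measure lborel ?C = 2 ^ ?n" by (simp add: content_cbox_if_cart interval_eq_empty_cart)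
      moreover have "emeasure lborel ?C = ennreal (measure lborel ?C)"
        using emeasure_lborel_cbox_finite[of "(\<chi> i. - 1) :: real^'n" "\<chi> i. 1"] by (intro emeasure_eq_ennreal_measure) auto
      ultimately show ?thesis by simp
    qed
    finally have "emeasure lborel K \<le> ennreal (2 ^ ?n * \<bar>det D\<bar>)"
      by (simp add: det_transpose ennreal_mult[symmetric] mult.commute)
    then show "measure lebesgue K \<le> 2 ^ ?n * \<bar>det D\<bar>"
      using borel_compact[OF K(1)] by (simp add: measure_def enn2real_leI)
  next
    fix u
    let ?h = "support_fun K u"
    have hp: "P $ i \<bullet> u \<le> ?h" "p0 \<bullet> u \<le> ?h" for i
      using support_fun_upper[OF K(1)] P p0 by auto
    \<comment> \<open>At the \<open>n + 1\<close> vertices the gaps between \<open>h\<close> and the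
      inner product with \<open>u\<close> are nonnegative and add up to \<open>n + 1\<close> times
      the gap at the centroid. Each entry of \<open>D *v u\<close> is a difference of two of them;
      adding up the \<open>n\<close> entries yields the factor \<open>n (n + 1)\<close>.\<close>
    have "real (?n + 1) * (?h - \<xi> \<bullet> u) = real (?n + 1) * ?h - (p0 \<bullet> u + (\<Sum>i\<in>UNIV. P $ i \<bullet> u))"
      by (simp add: \<xi>_def inner_add_left inner_sum_left right_diff_distrib)
    also have "\<dots> = (?h - p0 \<bullet> u) + (\<Sum>i\<in>UNIV. ?h - P $ i \<bullet> u)"
      by (simp add: sum_subtractf algebra_simps)
    finally have eq: "real (?n + 1) * (?h - \<xi> \<bullet> u) = (?h - p0 \<bullet> u) + (\<Sum>i\<in>UNIV. ?h - P $ i \<bullet> u)" .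
    have "\<bar>(D *v u) $ i\<bar> \<le> real (?n + 1) * (?h - \<xi> \<bullet> u)" for i
    proof -
      have "?h - P $ i \<bullet> u \<le> (\<Sum>i\<in>UNIV. ?h - P $ i \<bullet> u)" using hp by (intro member_le_sum) auto
      moreover have "(D *v u) $ i = P $ i \<bullet> u - p0 \<bullet> u" by (simp add: matrix_vector_mul_component Di inner_diff_left)
      ultimately show ?thesis unfolding eq using hp(1)[of i] hp(2) by (simp add: abs_le_iff)
    qed
    then have "(\<Sum>i\<in>UNIV. \<bar>(D *v u) $ i\<bar>) \<le> (\<Sum>i\<in>(UNIV :: 'n set). real (?n + 1) * (?h - \<xi> \<bullet> u))"
      by (intro sum_mono)
    then show "norm (D *v u) \<le> real (?n * (?n + 1)) * (?h - \<xi> \<bullet> u)"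
      using norm_le_l1_cart[of "D *v u"] by (simp add: algebra_simps)
  next
    have half: "norm (x - p0) \<le> real ?n * norm D" if x: "x \<in> K" for x
    proof -
      obtain t where t: "x - p0 = ?A *v t" "\<forall>i. \<bar>t $ i\<bar> \<le> 1" using coord[OF x] by blast
      have sumA: "?A *v t = (\<Sum>i\<in>UNIV. t $ i *\<^sub>R D $ i)"
        by (simp add: vec_eq_iff matrix_vector_mult_def transpose_def sum_component mult.commute)
      have "norm (x - p0) \<le> (\<Sum>i\<in>UNIV. norm (t $ i *\<^sub>R D $ i))" unfolding t(1) sumA by (rule norm_sum)
      also have "\<dots> \<le> (\<Sum>i\<in>(UNIV :: 'n set). norm D)"
      proof (rule sum_mono)
        fix i
        have "norm (t $ i *\<^sub>R D $ i) \<le> 1 * norm D"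
          unfolding norm_scaleR using t(2) Finite_Cartesian_Product.norm_nth_le[of D i] by (intro mult_mono) auto
        then show "norm (t $ i *\<^sub>R D $ i) \<le> norm D" by simp
      qed
      finally show ?thesis by simp
    qed
    fix x y assume "x \<in> K" "y \<in> K"
    have "norm (x - y) \<le> norm (x - p0) + norm (y - p0)"
      using norm_triangle_ineq4[of "x - p0" "y - p0"] by simp
    then show "norm (x - y) \<le> 2 * real ?n * norm D" using half[OF \<open>x \<in> K\<close>] half[OF \<open>y \<in> K\<close>] by linarith
  qed
qed

text \<open>A single small integral contradicts a uniform lower bound for \<Psi>, hence the form
  with one index \<open>j\<close>. The condition speaks of matrices because a maximal simplex
  reduces a body to its edge matrix.\<close>

locale coercive_functional = sphere_functional \<mu> q for \<mu> :: "(real^'n) measure" and q +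
  assumes coercive: "\<And>(D :: nat \<Rightarrow> real^'n^'n) d a. 0 < d \<Longrightarrow> (\<And>j. d \<le> \<bar>det (D j)\<bar>) \<Longrightarrow>
    filterlim (\<lambda>j. norm (D j)) at_top sequentially \<Longrightarrow> 0 < a \<Longrightarrow>
    \<exists>j. (\<integral>\<^sup>+u. inv_pow q (norm (D j *v u)) \<partial>\<mu>) < ennreal a"
begin

text \<open>Otherwise there are bodies reaching arbitrarily far with \<Psi> at least
  \<open>a\<close>. Their volume bounds the determinants of the maximal simplices below by
  \<open>1 / 2 ^ n\<close>, their diameter drives the norms to infinity, and \<Psi> is at most the
  value of \<open>F\<close> at the centroid, which coercivity makes small.\<close>

lemma \<Psi>_large_bounded:
  assumes a: "0 < a"
  obtains R where "0 < R" "\<And>K. convex_body K \<Longrightarrow> 0 \<in> K \<Longrightarrow> 1 \<le> measure lebesgue K \<Longrightarrow> ennreal a \<le> \<Psi> K \<Longrightarrow> K \<subseteq> cball 0 R"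
proof (rule ccontr)
  let ?n = "CARD('n)"
  assume "\<not> thesis"
  have ex: "\<exists>K. convex_body K \<and> 0 \<in> K \<and> 1 \<le> measure lebesgue K \<and> ennreal a \<le> \<Psi> K \<and> \<not> K \<subseteq> cball 0 (real (Suc j))" for j
  proof (rule ccontr)
    assume "\<not> ?thesis"
    then have "\<And>K. convex_body K \<Longrightarrow> 0 \<in> K \<Longrightarrow> 1 \<le> measure lebesgue K \<Longrightarrow> ennreal a \<le> \<Psi> K \<Longrightarrow> K \<subseteq> cball 0 (real (Suc j))" by blast
    then show False using \<open>\<not> thesis\<close> that[of "real (Suc j)"] by auto
  qed
  have ex': "\<exists>D :: real^'n^'n. 1 / 2 ^ ?n \<le> \<bar>det D\<bar> \<and> real (Suc j) \<le> 2 * real ?n * norm D \<and>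
      ennreal a \<le> ennreal (real (?n * (?n + 1)) powr q) * (\<integral>\<^sup>+u. inv_pow q (norm (D *v u)) \<partial>\<mu>)" for j
  proof -
    obtain K where K: "convex_body K" "0 \<in> K" "1 \<le> measure lebesgue K" "ennreal a \<le> \<Psi> K" "\<not> K \<subseteq> cball 0 (real (Suc j))"
      using ex by blast
    then obtain x where x: "x \<in> K" "real (Suc j) < norm x" by force
    have cK: "compact K" "convex K" "interior K \<noteq> {}" using K(1) by (auto simp: convex_body_def)
    obtain D :: "real^'n^'n" and \<xi> where D: "\<xi> \<in> K" "det D \<noteq> 0" "measure lebesgue K \<le> 2 ^ CARD('n) * \<bar>det D\<bar>"
      "\<And>u. norm (D *v u) \<le> real (?n * (?n + 1)) * (support_fun K u - \<xi> \<bullet> u)"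
      "\<And>x y. x \<in> K \<Longrightarrow> y \<in> K \<Longrightarrow> norm (x - y) \<le> 2 * real ?n * norm D"
      by (rule maximal_simplex[OF cK]) (rule that, assumption+)
    let ?c = "real (?n * (?n + 1))"
    have c: "0 < ?c" by (simp only: of_nat_0_less_iff) simp
    have "1 \<le> 2 ^ ?n * \<bar>det D\<bar>" using K(3) D(3) by simp
    then have 1: "1 / 2 ^ ?n \<le> \<bar>det D\<bar>" by (simp add: field_simps)
    have 2: "real (Suc j) \<le> 2 * real ?n * norm D" using D(5)[OF x(1) K(2)] x(2) by simp
    have "\<Psi> K \<le> F K \<xi>" by (rule \<Psi>_le[OF D(1)])
    also have "\<dots> \<le> (\<integral>\<^sup>+u. ennreal (?c powr q) * inv_pow q (norm (D *v u)) \<partial>\<mu>)"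
      unfolding F_def
    proof (rule nn_integral_mono)
      fix u
      have "(1 / ?c) * norm (D *v u) \<le> support_fun K u - \<xi> \<bullet> u" using D(4)[of u] c by (simp add: field_simps)
      then have "inv_pow q (support_fun K u - \<xi> \<bullet> u) \<le> inv_pow q ((1 / ?c) * norm (D *v u))" by (intro inv_pow_antimono q_pos)
      also have "\<dots> = ennreal ((1 / ?c) powr (- q)) * inv_pow q (norm (D *v u))" using c by (intro inv_pow_mult) (simp only: zero_less_divide_1_iff)
      also have "(1 / ?c) powr (- q) = ?c powr q" using c by (simp only: powr_minus inverse_eq_divide powr_divide) simp
      finally show "inv_pow q (support_fun K u - \<xi> \<bullet> u) \<le> ennreal (?c powr q) * inv_pow q (norm (D *v u))" .
    qed
    also have "\<dots> = ennreal (?c powr q) * (\<integral>\<^sup>+u. inv_pow q (norm (D *v u)) \<partial>\<mu>)"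
    proof (intro nn_integral_cmult measurable_mu)
      have "(\<lambda>u. norm (D *v u)) \<in> borel_measurable borel"
        by (intro borel_measurable_continuous_onI continuous_on_norm matrix_vector_mult_linear_continuous_on)
      then show "(\<lambda>u. inv_pow q (norm (D *v u))) \<in> borel_measurable borel" by measurable
    qed
    finally show ?thesis using 1 2 order_trans[OF K(4)] by blast
  qed
  then obtain D :: "nat \<Rightarrow> real^'n^'n" where D: "\<And>j. 1 / 2 ^ ?n \<le> \<bar>det (D j)\<bar>" "\<And>j. real (Suc j) \<le> 2 * real ?n * norm (D j)"
      "\<And>j. ennreal a \<le> ennreal (real (?n * (?n + 1)) powr q) * (\<integral>\<^sup>+u. inv_pow q (norm (D j *v u)) \<partial>\<mu>)"
    by metis
  have "filterlim (\<lambda>j. 1 / (2 * real ?n) * real (Suc j)) at_top sequentially"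
    by (rule filterlim_tendsto_pos_mult_at_top[OF tendsto_const])
       (auto intro!: filterlim_tendsto_add_at_top[OF tendsto_const filterlim_real_sequentially])
  then have lim: "filterlim (\<lambda>j. norm (D j)) at_top sequentially"
  proof (rule filterlim_at_top_mono)
    show "\<forall>\<^sub>F j in sequentially. 1 / (2 * real ?n) * real (Suc j) \<le> norm (D j)"
      using D(2) by (intro always_eventually allI) (simp add: field_simps)
  qed
  let ?C = "real (?n * (?n + 1)) powr q"
  have C: "0 < ?C" by (simp only: powr_gt_zero of_nat_eq_0_iff) simp
  obtain j where "(\<integral>\<^sup>+u. inv_pow q (norm (D j *v u)) \<partial>\<mu>) < ennreal (a / ?C)"
    using coercive[of "1 / 2 ^ ?n" D "a / ?C"] D(1) lim a C by (auto simp: divide_pos_pos)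
  then have "ennreal ?C * (\<integral>\<^sup>+u. inv_pow q (norm (D j *v u)) \<partial>\<mu>) < ennreal ?C * ennreal (a / ?C)"
    using C by (intro ennreal_mult_strict_left_mono) auto
  also have "\<dots> = ennreal a" using a C by (simp add: ennreal_mult'[symmetric])
  finally show False using D(3)[of j] by simp
qed

end

section \<open>Polar coordinates\<close>

lemma emeasure_lborel_scaleR:
  fixes A :: "'a::euclidean_space set"
  assumes s: "0 < s" and A: "A \<in> sets borel"
  shows "(*\<^sub>R) s ` A \<in> sets borel" "emeasure lborel ((*\<^sub>R) s ` A) = ennreal (s ^ DIM('a)) * emeasure lborel A"
proof -
  have "(*\<^sub>R) s ` A = (*\<^sub>R) (1 / s) -` A \<inter> space borel"
  proof (rule Set.set_eqI)
    fix x :: 'a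
    have "x = s *\<^sub>R y \<longleftrightarrow> y = (1 / s) *\<^sub>R x" for y
    proof
      assume "x = s *\<^sub>R y" then show "y = (1 / s) *\<^sub>R x" using s by (simp add: scaleR_scaleR)
    next
      assume "y = (1 / s) *\<^sub>R x" then show "x = s *\<^sub>R y" using s by (simp add: scaleR_scaleR)
    qed
    then show "x \<in> (*\<^sub>R) s ` A \<longleftrightarrow> x \<in> (*\<^sub>R) (1 / s) -` A \<inter> space borel" by (simp add: image_iff)
  qed
  also have "\<dots> \<in> sets borel" by (rule measurable_sets[OF _ A]) measurable
  finally show sA: "(*\<^sub>R) s ` A \<in> sets borel" .
  obtain c where c: "0 < c" "\<And>A :: 'a set. A \<in> sets borel \<Longrightarrow> hausdorff_outer (DIM('a)) A = ennreal c * emeasure lborel A"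
    using hausdorff_outer_full_dimension by blast
  have inv: "ennreal (1 / c) * (ennreal c * x) = x" for x
    using c(1) by (simp add: mult.assoc[symmetric] ennreal_mult[symmetric])
  have "ennreal c * emeasure lborel ((*\<^sub>R) s ` A) = ennreal c * (ennreal (s ^ DIM('a)) * emeasure lborel A)"
    using hausdorff_outer_scaleR[OF s, of "DIM('a)" A] by (simp add: c(2)[OF A] c(2)[OF sA] mult.left_commute)
  then show "emeasure lborel ((*\<^sub>R) s ` A) = ennreal (s ^ DIM('a)) * emeasure lborel A"
    by (metis inv)
qed

text \<open>The cone over \<omega> without its apex, described by the radial projection, so that it
  is Borel for every Borel \<omega>, whereas \<open>cone_of\<close> is an image.\<close>

definition sector :: "'a::euclidean_space set \<Rightarrow> real \<Rightarrow> 'a set" where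
  "sector \<omega> s = {x. x \<noteq> 0 \<and> x /\<^sub>R norm x \<in> \<omega> \<and> norm x \<le> s}"

lemma sector_borel [measurable]:
  assumes [measurable]: "\<omega> \<in> sets borel"
  shows "sector \<omega> s \<in> sets borel"
  unfolding sector_def by measurable

lemma emeasure_sphere_cone:
  fixes \<omega> :: "'a::euclidean_space set"
  assumes \<omega>: "\<omega> \<in> sets (restrict_space borel (sphere 0 1))"
  shows "emeasure (cone_measure (cball 0 1)) \<omega> = emeasure lborel (sector \<omega> 1)"
proof -
  note w = sphere_setD[OF \<omega>]
  have 1: "sector \<omega> 1 \<subseteq> cone_of \<omega>"
  proof
    fix x assume x: "x \<in> sector \<omega> 1"
    then have "x = norm x *\<^sub>R (x /\<^sub>R norm x)" by (simp add: sector_def)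
    then show "x \<in> cone_of \<omega>" unfolding cone_of_def using x
      by (intro image_eqI[of _ _ "(norm x, x /\<^sub>R norm x)"]) (auto simp: sector_def)
  qed
  have 2: "cone_of \<omega> \<subseteq> sector \<omega> 1 \<union> {0}"
  proof
    fix x assume "x \<in> cone_of \<omega>"
    then obtain t u where tu: "0 \<le> t" "t \<le> 1" "u \<in> \<omega>" "x = t *\<^sub>R u" by (auto simp: cone_of_def)
    then have "norm u = 1" using w(2) by auto
    then show "x \<in> sector \<omega> 1 \<union> {0}" using tu by (cases "t = 0") (auto simp: sector_def)
  qed
  have "cone_of \<omega> = sector \<omega> 1 \<or> cone_of \<omega> = sector \<omega> 1 \<union> {0}" using 1 2 by blast
  moreover have "emeasure lebesgue (sector \<omega> 1 \<union> {0}) = emeasure lebesgue (sector \<omega> 1)"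
    using w(1) by (intro emeasure_Un_null_set) (auto simp: null_sets_def)
  ultimately have "emeasure lebesgue (cone_of \<omega>) = emeasure lborel (sector \<omega> 1)" using w(1) by auto
  then show ?thesis
    using emeasure_cone_measure[OF convex_body_unit_ball _ \<omega>] w(2) by (simp add: normal_preimage_unit_ball)
qed

lemma emeasure_sector:
  fixes \<omega> :: "'a::euclidean_space set"
  assumes s: "0 < s" and w: "\<omega> \<in> sets borel"
  shows "emeasure lborel (sector \<omega> s) = ennreal (s ^ DIM('a)) * emeasure lborel (sector \<omega> 1)"
proof -
  have "sector \<omega> s = (*\<^sub>R) s ` sector \<omega> 1"
  proof (rule Set.set_eqI, rule iffI)
    fix x assume x: "x \<in> sector \<omega> s"
    then have "(1 / s) *\<^sub>R x \<in> sector \<omega> 1" using s by (auto simp: sector_def divide_simps)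
    then show "x \<in> (*\<^sub>R) s ` sector \<omega> 1" by (rule image_eqI[rotated]) (use s in simp)
  next
    fix x assume "x \<in> (*\<^sub>R) s ` sector \<omega> 1"
    then obtain y where "y \<in> sector \<omega> 1" "x = s *\<^sub>R y" by blast
    then show "x \<in> sector \<omega> s" using s by (auto simp: sector_def divide_simps)
  qed
  then show ?thesis using emeasure_lborel_scaleR(2)[OF s, of "sector \<omega> 1"] w by simp
qed

text \<open>The level sets of a simple function below \<open>G\<close> are tested against
  \<open>N\<close> one by one. This bounds an integral by a mass from estimates on sets on which
  \<open>G\<close> exceeds a constant.\<close>

lemma nn_integral_le_by_sets:
  fixes G :: "'a \<Rightarrow> ennreal"
  assumes N: "sets N = sets M"
    and le: "\<And>a \<omega>. \<omega> \<in> sets M \<Longrightarrow> (\<And>u. u \<in> \<omega> \<Longrightarrow> a \<le> G u) \<Longrightarrow> a * emeasure M \<omega> \<le> emeasure N \<omega>"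
  shows "(\<integral>\<^sup>+u. G u \<partial>M) \<le> emeasure N (space N)"
  unfolding nn_integral_def
proof (rule SUP_least, clarify)
  fix g assume g: "simple_function M g" "g \<le> G"
  let ?A = "\<lambda>x. g -` {x} \<inter> space M"
  have A: "?A x \<in> sets M" for x using g(1) by (rule simple_functionD)
  have fin: "finite (g ` space M)" using g(1) by (rule simple_functionD)
  have "integral\<^sup>S M g = (\<Sum>x\<in>g ` space M. x * emeasure M (?A x))" by (simp add: simple_integral_def)
  also have "\<dots> \<le> (\<Sum>x\<in>g ` space M. emeasure N (?A x))"
    using g(2) by (intro sum_mono le A) (auto simp: le_fun_def)
  also have "\<dots> = emeasure N (\<Union>x\<in>g ` space M. ?A x)"
    using A fin N by (intro sum_emeasure) (auto simp: disjoint_family_on_def)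
  also have "\<dots> \<le> emeasure N (space N)" by (rule emeasure_space)
  finally show "integral\<^sup>S M g \<le> emeasure N (space N)" .
qed

lemma matrix_norm_pos:
  fixes D :: "real^'n^'n"
  assumes "det D \<noteq> 0" "u \<noteq> 0"
  shows "0 < norm (D *v u)"
proof -
  obtain B where B: "B ** D = mat 1" using assms(1) unfolding invertible_det_nz[symmetric] invertible_def by blast
  have "B *v (D *v u) = u" by (simp only: matrix_vector_mul_assoc B matrix_vector_mul_lid)
  then have "D *v u \<noteq> 0" using assms(2) by (metis matrix_vector_mult_0_right)
  then show ?thesis by simp
qed

lemma continuous_on_matrix_norm: "continuous_on S (\<lambda>u. norm ((D :: real^'n^'m) *v u))"
  by (intro continuous_on_norm matrix_vector_mult_linear_continuous_on)

text \<open>The integral is the volume of the ellipsoid where \<open>norm (D *v x) \<le> 1\<close>,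
  computed in polar coordinates: its radial function is the reciprocal of
  \<open>norm (D *v u)\<close>. The factor \<open>n\<close> of polar coordinates is contained in the
  cone measure.\<close>

lemma sphere_integral_inv_pow:
  fixes D :: "real^'n^'n"
  assumes D: "det D \<noteq> 0"
  shows "(\<integral>\<^sup>+u. inv_pow (real CARD('n)) (norm (D *v u)) \<partial>cone_measure (cball 0 1))
    \<le> ennreal (unit_ball_vol (real CARD('n)) / \<bar>det D\<bar>)"
proof -
  let ?n = "CARD('n)"
  let ?\<Omega> = "restrict_space borel (sphere (0::real^'n) 1)"
  define S where "S = {x. norm (D *v x) \<le> 1}"
  have Sb[measurable]: "S \<in> sets borel"
    unfolding S_def by (intro borel_closed closed_Collect_le continuous_on_matrix_norm continuous_intros)
  have im: "(*v) D ` S = cball 0 1"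
  proof
    show "(*v) D ` S \<subseteq> cball 0 1" by (auto simp: S_def)
    show "cball 0 1 \<subseteq> (*v) D ` S"
    proof
      fix y :: "real^'n" assume y: "y \<in> cball 0 1"
      obtain B where B: "D ** B = mat 1" using D unfolding invertible_det_nz[symmetric] invertible_def by blast
      have e: "D *v (B *v y) = y" by (simp only: matrix_vector_mul_assoc B matrix_vector_mul_lid)
      then show "y \<in> (*v) D ` S" using y by (intro image_eqI[of _ _ "B *v y"]) (auto simp: S_def)
    qed
  qed
  have vol: "emeasure lborel S = ennreal (unit_ball_vol (real ?n) / \<bar>det D\<bar>)"
  proof -
    have "ennreal \<bar>det D\<bar> * emeasure lborel S = ennreal (unit_ball_vol (real ?n))"
      using emeasure_lborel_matrix_image[OF D Sb] by (simp add: im emeasure_cball)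
    then have "ennreal (1 / \<bar>det D\<bar>) * (ennreal \<bar>det D\<bar> * emeasure lborel S) = ennreal (1 / \<bar>det D\<bar> * unit_ball_vol (real ?n))"
      by (simp add: ennreal_mult[symmetric])
    moreover have "ennreal (1 / \<bar>det D\<bar>) * (ennreal \<bar>det D\<bar> * x) = x" for x
      using D by (simp add: mult.assoc[symmetric] ennreal_mult[symmetric])
    ultimately show ?thesis by simp
  qed
  define S0 where "S0 = S - {0}"
  have S0b: "S0 \<in> sets borel" by (simp add: S0_def)
  define pr where "pr x = x /\<^sub>R norm x" for x :: "real^'n"
  have prm: "pr \<in> measurable (restrict_space lborel S0) ?\<Omega>"
  proof (rule measurable_restrict_space2)
    show "pr \<in> space (restrict_space lborel S0) \<rightarrow> sphere 0 1"
      by (auto simp: space_restrict_space S0_def pr_def)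
    have "pr \<in> borel_measurable lborel" unfolding pr_def by measurable
    then show "pr \<in> borel_measurable (restrict_space lborel S0)" by (rule measurable_restrict_space1)
  qed
  define N where "N = distr (restrict_space lborel S0) ?\<Omega> pr"
  have emN: "emeasure N \<omega> = emeasure lborel {x \<in> S0. pr x \<in> \<omega>}" if "\<omega> \<in> sets ?\<Omega>" for \<omega>
  proof -
    have "emeasure N \<omega> = emeasure (restrict_space lborel S0) (pr -` \<omega> \<inter> S0)"
      unfolding N_def using emeasure_distr[OF prm that] by (simp add: space_restrict_space)
    also have "\<dots> = emeasure lborel (pr -` \<omega> \<inter> S0)" using S0b by (intro emeasure_restrict_space) auto
    also have "pr -` \<omega> \<inter> S0 = {x \<in> S0. pr x \<in> \<omega>}" by auto
    finally show ?thesis .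
  qed
  have meas: "{x \<in> S0. pr x \<in> \<omega>} \<in> sets borel" if "\<omega> \<in> sets ?\<Omega>" for \<omega>
  proof -
    have [measurable]: "\<omega> \<in> sets borel" using sphere_setD[OF that] by simp
    have "pr \<in> borel_measurable borel" unfolding pr_def by measurable
    then have "pr -` \<omega> \<inter> space borel \<in> sets borel" by (rule measurable_sets) simp
    then have "S0 \<inter> (pr -` \<omega> \<inter> space borel) \<in> sets borel" using S0b by (rule sets.Int[rotated])
    moreover have "S0 \<inter> (pr -` \<omega> \<inter> space borel) = {x \<in> S0. pr x \<in> \<omega>}" by auto
    ultimately show ?thesis by simp
  qed
  have "(\<integral>\<^sup>+u. inv_pow (real ?n) (norm (D *v u)) \<partial>cone_measure (cball 0 1)) \<le> emeasure N (space N)"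
  proof (rule nn_integral_le_by_sets)
    show "sets N = sets (cone_measure (cball 0 1))" by (simp add: N_def)
    fix a and \<omega> :: "(real^'n) set"
    assume w0: "\<omega> \<in> sets (cone_measure (cball 0 1))" and a: "\<And>u. u \<in> \<omega> \<Longrightarrow> a \<le> inv_pow (real ?n) (norm (D *v u))"
    have w: "\<omega> \<in> sets ?\<Omega>" using w0 by simp
    note wS = sphere_setD[OF w]
    have em\<sigma>: "emeasure (cone_measure (cball 0 1)) \<omega> = emeasure lborel (sector \<omega> 1)" by (rule emeasure_sphere_cone[OF w])
    show "a * emeasure (cone_measure (cball 0 1)) \<omega> \<le> emeasure N \<omega>"
    proof (cases "\<omega> = {} \<or> a = 0")
      case False
      then obtain u0 where u0: "u0 \<in> \<omega>" by auto
      have pos: "0 < norm (D *v u)" if "u \<in> \<omega>" for u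
        using wS(2) that by (intro matrix_norm_pos[OF D]) auto
      have "a \<le> ennreal (norm (D *v u0) powr (- real ?n))" using a[OF u0] pos[OF u0] by (simp add: inv_pow_def)
      then obtain r where r: "a = ennreal r" "0 \<le> r" by (cases a) (auto simp: top_unique)
      with False have r0: "0 < r" by auto
      \<comment> \<open>The sector of radius \<open>s\<close> has \<open>r = s ^ n\<close> times the
        volume of the unit sector. Over directions where the integrand is at least \<open>r\<close>,
        it stays inside the ellipsoid.\<close>
      define s where "s = r powr (1 / real ?n)"
      have s: "0 < s" "s ^ ?n = r" using r0 by (auto simp: s_def powr_powr powr_realpow[symmetric])
      have su: "s * norm (D *v u) \<le> 1" if u: "u \<in> \<omega>" for u
      proof -
        have "r \<le> norm (D *v u) powr (- real ?n)" using a[OF u] pos[OF u] r by (simp add: inv_pow_def)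
        then have "s ^ ?n \<le> (1 / norm (D *v u)) ^ ?n"
          using pos[OF u] s by (simp add: powr_minus powr_realpow power_divide inverse_eq_divide)
        then have "s \<le> 1 / norm (D *v u)" using s(1) pos[OF u] by (intro power_le_imp_le_base[of s "?n - 1"]) auto
        then show ?thesis using pos[OF u] by (simp add: field_simps)
      qed
      have sub: "sector \<omega> s \<subseteq> {x \<in> S0. pr x \<in> \<omega>}"
      proof
        fix x assume x: "x \<in> sector \<omega> s"
        then have xx: "x \<noteq> 0" "pr x \<in> \<omega>" "norm x \<le> s" by (auto simp: sector_def pr_def)
        have "D *v x = norm x *\<^sub>R (D *v pr x)" using xx(1) by (simp add: pr_def matrix_vector_mult_scaleR)
        then have "norm (D *v x) = norm x * norm (D *v pr x)" by simp
        also have "\<dots> \<le> s * norm (D *v pr x)" using xx(3) by (intro mult_right_mono) auto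
        also have "\<dots> \<le> 1" by (rule su[OF xx(2)])
        finally show "x \<in> {x \<in> S0. pr x \<in> \<omega>}" using xx by (simp add: S0_def S_def)
      qed
      have "a * emeasure (cone_measure (cball 0 1)) \<omega> = emeasure lborel (sector \<omega> s)"
        unfolding em\<sigma> using emeasure_sector[OF s(1) wS(1)] by (simp add: r s(2))
      also have "\<dots> \<le> emeasure lborel {x \<in> S0. pr x \<in> \<omega>}" using meas[OF w] by (intro emeasure_mono sub) simp
      also have "\<dots> = emeasure N \<omega>" by (rule emN[OF w, symmetric])
      finally show ?thesis .
    qed auto
  qed
  also have "emeasure N (space N) = emeasure N (sphere 0 1)" by (simp add: N_def space_restrict_space)
  also have "\<dots> = emeasure lborel {x \<in> S0. pr x \<in> sphere 0 1}" by (intro emN sphere_setI) auto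
  also have "\<dots> \<le> emeasure lborel S" using Sb by (intro emeasure_mono) (auto simp: S0_def)
  also have "\<dots> = ennreal (unit_ball_vol (real ?n) / \<bar>det D\<bar>)" by (rule vol)
  finally show ?thesis .
qed

lemma sphere_cone_subsphere_null:
  fixes v :: "real^'n"
  assumes "v \<noteq> 0"
  shows "emeasure (cone_measure (cball 0 1)) {u \<in> sphere 0 1. u \<bullet> v = 0} = 0"
proof -
  have cl: "closed {u. u \<bullet> v = 0}" by (intro closed_Collect_eq continuous_intros)
  then have "sphere 0 1 \<inter> {u. u \<bullet> v = 0} \<in> sets borel" by (intro borel_closed closed_Int) auto
  then have w: "{u \<in> sphere 0 1. u \<bullet> v = 0} \<in> sets (restrict_space borel (sphere 0 1))"
    by (intro sphere_setI) (auto simp: Int_def)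
  have "negligible {u. v \<bullet> u = 0}" using assms by (intro negligible_hyperplane) auto
  then have "{u. u \<bullet> v = 0} \<in> null_sets lebesgue" by (simp add: negligible_iff_null_sets inner_commute)
  then have "{u. u \<bullet> v = 0} \<in> null_sets lborel" using cl null_sets_completion_iff[of "{u. u \<bullet> v = 0}" lborel] by auto
  moreover have "sector {u \<in> sphere 0 1. u \<bullet> v = 0} 1 \<subseteq> {u. u \<bullet> v = 0}" by (auto simp: sector_def)
  moreover have "sector {u \<in> sphere 0 1. u \<bullet> v = 0} 1 \<in> sets lborel" using sphere_setD(1)[OF w] by simp
  ultimately have "emeasure lborel (sector {u \<in> sphere 0 1. u \<bullet> v = 0} 1) = 0"
    by (meson null_setsD1 null_sets_subset)
  then show ?thesis using emeasure_sphere_cone[OF w] by simp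
qed

text \<open>Compare \<open>B\<close> with \<open>\<kappa> A\<close>: in either case the larger of
  the two bounds the product. A small \<kappa> makes the coefficient of \<open>A\<close> small at
  the expense of that of \<open>B\<close>.\<close>

lemma weighted_young:
  fixes A B \<kappa> \<theta> :: real
  assumes "0 < A" "0 \<le> B" "0 < \<kappa>" "0 < \<theta>" "\<theta> < 1"
  shows "A powr \<theta> * B powr (1 - \<theta>) \<le> \<kappa> powr (1 - \<theta>) * A + \<kappa> powr (- \<theta>) * B"
proof (cases "B \<le> \<kappa> * A")
  case True
  have "A powr \<theta> * B powr (1 - \<theta>) \<le> A powr \<theta> * (\<kappa> * A) powr (1 - \<theta>)"
    using assms True by (intro mult_left_mono powr_mono2) auto
  also have "\<dots> = \<kappa> powr (1 - \<theta>) * (A powr \<theta> * A powr (1 - \<theta>))" using assms by (simp add: powr_mult mult_ac)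
  also have "A powr \<theta> * A powr (1 - \<theta>) = A" using assms by (simp add: powr_add[symmetric])
  finally show ?thesis using assms by (smt (verit) mult_nonneg_nonneg powr_ge_zero)
next
  case False
  moreover have "0 < \<kappa> * A" using assms by simp
  ultimately have "0 < B" by linarith
  moreover have "A \<le> B / \<kappa>" using False assms by (simp add: field_simps)
  ultimately have B: "0 < B" "A \<le> B / \<kappa>" by auto
  have "A powr \<theta> * B powr (1 - \<theta>) \<le> (B / \<kappa>) powr \<theta> * B powr (1 - \<theta>)"
    using assms B by (intro mult_right_mono powr_mono2) auto
  also have "\<dots> = \<kappa> powr (- \<theta>) * (B powr \<theta> * B powr (1 - \<theta>))" using assms B by (simp add: powr_divide powr_minus field_simps)
  also have "B powr \<theta> * B powr (1 - \<theta>) = B" using B by (simp add: powr_add[symmetric])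
  finally show ?thesis using assms by (smt (verit) mult_nonneg_nonneg powr_ge_zero)
qed

lemma mem_of_support_fun:
  fixes K :: "'a::euclidean_space set"
  assumes K: "compact K" "convex K" "K \<noteq> {}" and x: "\<And>u. norm u = 1 \<Longrightarrow> x \<bullet> u \<le> support_fun K u"
  shows "x \<in> K"
proof (rule ccontr)
  assume "x \<notin> K"
  then obtain a b where ab: "a \<bullet> x < b" "\<And>y. y \<in> K \<Longrightarrow> b < a \<bullet> y"
    using separating_hyperplane_closed_point[OF K(2) compact_imp_closed[OF K(1)]] by blast
  have "a \<noteq> 0"
  proof
    assume "a = 0"
    obtain y where "y \<in> K" using K(3) by blast
    then show False using ab(1) ab(2)[of y] \<open>a = 0\<close> by simp
  qed
  define u where "u = - (a /\<^sub>R norm a)"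
  have u: "norm u = 1" "y \<bullet> u = - (a \<bullet> y) / norm a" for y using \<open>a \<noteq> 0\<close> by (auto simp: u_def inner_commute divide_inverse)
  obtain y where y: "y \<in> K" "support_fun K u = y \<bullet> u" by (rule support_fun_attained[OF K(1,3)])
  have "- (a \<bullet> y) / norm a < - (a \<bullet> x) / norm a"
    using ab(1) ab(2)[OF y(1)] \<open>a \<noteq> 0\<close> by (intro divide_strict_right_mono) auto
  then show False using x[OF u(1)] y(2) by (simp only: u(2))
qed

lemma convex_body_of_measure:
  fixes K :: "'a::euclidean_space set"
  assumes "compact K" "convex K" "0 < measure lebesgue K"
  shows "convex_body K"
proof -
  have "\<not> negligible K" using assms(3) negligible_imp_measure0[of K] by auto
  then have "interior K \<noteq> {}" using negligible_convex_interior[OF assms(2)] by auto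
  then show ?thesis using assms by (simp add: convex_body_def)
qed

section \<open>Existence of a maximiser\<close>

definition admissible :: "(real^'n^'n) set \<Rightarrow> (real^'n) set \<Rightarrow> bool" where
  "admissible G K \<longleftrightarrow> convex_body K \<and> 0 \<in> K \<and> body_invariant G K"

context coercive_functional
begin

text \<open>Along a maximising sequence the support functions are bounded by \<open>R\<close> and
  Lipschitz with constant \<open>R\<close>, so Arzela-Ascoli yields a uniform limit
  \<open>g\<close>. The candidate is the Wulff shape of \<open>g\<close>, the intersection of the
  half-spaces it describes; its support function is at most \<open>g\<close>. It remains to see that
  volume and \<Psi> do not drop below the limits.\<close>

lemma maximizer_exists:
  assumes G: "\<And>A. A \<in> G \<Longrightarrow> orthogonal_matrix A"
  obtains K where "admissible G K" "1 \<le> measure lebesgue K"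
    "\<And>L. admissible G L \<Longrightarrow> 1 \<le> measure lebesgue L \<Longrightarrow> \<Psi> L \<le> \<Psi> K"
proof -
  let ?n = "CARD('n)"
  define \<A> where "\<A> = {K. admissible G K \<and> 1 \<le> measure lebesgue K}"
  have "\<exists>K. K \<in> \<A>"
  proof -
    let ?w = "unit_ball_vol (real ?n)"
    define r where "r = max 1 (1 / ?w)"
    have w: "0 < ?w" by simp
    have r: "1 \<le> r" "1 / ?w \<le> r" by (auto simp: r_def)
    have "1 \<le> ?w * r" using r(2) w by (simp add: field_simps)
    also have "\<dots> \<le> ?w * r ^ ?n" using r w by (intro mult_left_mono self_le_power) auto
    also have "\<dots> = measure lebesgue (cball (0::real^'n) r)" using r by (simp add: content_cball)
    finally have m: "1 \<le> measure lebesgue (cball (0::real^'n) r)" .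
    have "body_invariant G (cball 0 r)"
      unfolding body_invariant_def
    proof
      fix A assume "A \<in> G"
      then have A: "orthogonal_matrix A" by (rule G)
      show "(\<lambda>x. A *v x) ` cball 0 r = cball 0 r"
        by (rule invariant_image_eqI[OF A]) (simp_all only: mem_cball dist_0_norm orthogonal_matrix_simps[OF A])
    qed
    moreover have "convex_body (cball (0::real^'n) r)" using r by (simp add: convex_body_def)
    ultimately have "cball 0 r \<in> \<A>" using r m by (simp add: \<A>_def admissible_def)
    then show ?thesis by blast
  qed
  then have ne: "\<Psi> ` \<A> \<noteq> {}" by blast
  obtain f :: "nat \<Rightarrow> ennreal" where f: "incseq f" "range f \<subseteq> \<Psi> ` \<A>" "(SUP K\<in>\<A>. \<Psi> K) = (SUP i. f i)"
    using ennreal_Sup_countable_SUP[OF ne] by blast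
  define S where "S = (SUP K\<in>\<A>. \<Psi> K)"
  have "\<exists>K. K \<in> \<A> \<and> f j = \<Psi> K" for j using f(2) by blast
  then obtain K where KA: "\<And>j. K j \<in> \<A>" and fK: "\<And>j. f j = \<Psi> (K j)" by metis
  have Kc: "compact (K j)" "convex (K j)" "K j \<noteq> {}" "0 \<in> K j" "convex_body (K j)" "body_invariant G (K j)" "1 \<le> measure lebesgue (K j)" for j
    using KA[of j] by (auto simp: \<A>_def admissible_def convex_body_def)
  define a where "a = enn2real (\<Psi> (K 0))"
  have a: "0 < a" "ennreal a = \<Psi> (K 0)"
    using \<Psi>_pos[OF Kc(1,3)[of 0]] \<Psi>_finite[OF Kc(5)[of 0]] by (auto simp: a_def enn2real_positive_iff less_top)
  \<comment> \<open>The values along the maximising sequence increase, so the first one, which is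
    positive, bounds all of them below, and coercivity confines all bodies to one ball.\<close>
  have aj: "ennreal a \<le> \<Psi> (K j)" for j using f(1) by (simp add: a(2) fK[symmetric] incseq_def)
  obtain R where R: "0 < R" "\<And>K. convex_body K \<Longrightarrow> 0 \<in> K \<Longrightarrow> 1 \<le> measure lebesgue K \<Longrightarrow> ennreal a \<le> \<Psi> K \<Longrightarrow> K \<subseteq> cball 0 R"
    using \<Psi>_large_bounded[OF a(1)] by blast
  have KR: "K j \<subseteq> cball 0 R" for j by (rule R(2)[OF Kc(5,4,7) aj])
  let ?S = "sphere (0::real^'n) 1"
  have hR: "support_fun (K j) u \<le> R" "0 \<le> support_fun (K j) u" if "u \<in> ?S" for j u
  proof -
    show "support_fun (K j) u \<le> R"
    proof (rule support_fun_least[OF Kc(3)])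
      fix x assume "x \<in> K j"
      then have "norm x \<le> R" using KR[of j] by auto
      then show "x \<bullet> u \<le> R" using norm_cauchy_schwarz[of x u] that by simp
    qed
    show "0 \<le> support_fun (K j) u" by (rule support_fun_nonneg[OF Kc(1,4)])
  qed
  obtain g k where g: "continuous_on ?S g" and k: "strict_mono (k :: nat \<Rightarrow> nat)"
    and unif: "\<And>e. 0 < e \<Longrightarrow> \<exists>N. \<forall>n x. n \<ge> N \<and> x \<in> ?S \<longrightarrow> norm (support_fun (K (k n)) x - g x) < e"
  proof (rule Arzela_Ascoli[of ?S "\<lambda>j. support_fun (K j)" R])
    show "norm (support_fun (K j) x) \<le> R" if "x \<in> ?S" for j x using hR[OF that, of j] by simp
    fix x :: "real^'n" and e :: real assume "x \<in> ?S" "0 < e"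
    show "\<exists>d>0. \<forall>n y. y \<in> ?S \<and> norm (x - y) < d \<longrightarrow> norm (support_fun (K n) x - support_fun (K n) y) < e"
    proof (intro exI conjI allI impI)
      show "0 < e / R" using \<open>0 < e\<close> R(1) by simp
      fix n y assume "y \<in> ?S \<and> norm (x - y) < e / R"
      then have "R * norm (x - y) < e" using R(1) by (simp add: field_simps)
      then show "norm (support_fun (K n) x - support_fun (K n) y) < e"
        using support_fun_lipschitz[OF Kc(1,3) KR, of n x y] by simp
    qed
  qed auto
  have ptw: "(\<lambda>n. support_fun (K (k n)) u) \<longlonglongrightarrow> g u" if "u \<in> ?S" for u
    unfolding LIMSEQ_def dist_norm using unif that by blast
  have g0: "0 \<le> g u" "g u \<le> R" if "u \<in> ?S" for u
    using hR[OF that] ptw[OF that] by (auto intro: LIMSEQ_le_const LIMSEQ_le_const2)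
  define L where "L e = {x. \<forall>u\<in>?S. x \<bullet> u \<le> g u + e}" for e
  have L_halfspaces: "L e = (\<Inter>u\<in>?S. {x. u \<bullet> x \<le> g u + e})" for e by (auto simp: L_def inner_commute)
  have L_norm: "norm x \<le> R + e" if "x \<in> L e" "0 \<le> e" for x e
  proof (cases "x = 0")
    case False
    then have "x /\<^sub>R norm x \<in> ?S" by simp
    then have "x \<bullet> (x /\<^sub>R norm x) \<le> R + e" using that g0(2)[of "x /\<^sub>R norm x"] unfolding L_def by fastforce
    also have "x \<bullet> (x /\<^sub>R norm x) = norm x" using False by (simp add: dot_square_norm power2_eq_square)
    finally show ?thesis .
  qed (use R that in auto)
  have L_compact: "compact (L e)" if "0 \<le> e" for e
    unfolding compact_eq_bounded_closed
  proof
    show "bounded (L e)" using L_norm[OF _ that] by (auto simp: bounded_iff)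
    show "closed (L e)" unfolding L_halfspaces by (intro closed_INT ballI closed_halfspace_le)
  qed
  have L_convex: "convex (L e)" for e unfolding L_halfspaces by (intro convex_INT convex_halfspace_le)
  have zero: "0 \<in> L 0" using g0(1) by (auto simp: L_def)
  have L_volume: "1 \<le> emeasure lborel (L e)" if e: "0 < e" for e
  proof -
    obtain N where N: "\<forall>n x. n \<ge> N \<and> x \<in> ?S \<longrightarrow> norm (support_fun (K (k n)) x - g x) < e" using unif[OF e] by blast
    have "K (k N) \<subseteq> L e"
    proof
      fix x assume x: "x \<in> K (k N)"
      have "x \<bullet> u \<le> g u + e" if "u \<in> ?S" for u
      proof -
        have "norm (support_fun (K (k N)) u - g u) < e" using N that by blast
        then show ?thesis using support_fun_upper[OF Kc(1) x, of u] by simp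
      qed
      then show "x \<in> L e" by (simp add: L_def)
    qed
    then have "emeasure lborel (K (k N)) \<le> emeasure lborel (L e)"
      using borel_compact[OF L_compact] e by (intro emeasure_mono) auto
    moreover have "1 \<le> emeasure lborel (K (k N))"
    proof -
      have "emeasure lborel (K (k N)) = ennreal (measure lebesgue (K (k N)))"
        using borel_compact[OF Kc(1)] emeasure_bounded_finite[OF compact_imp_bounded[OF Kc(1)]]
        by (simp add: measure_def less_top[symmetric])
      then show ?thesis using Kc(7)[of "k N"] by (metis ennreal_1 ennreal_leI)
    qed
    ultimately show ?thesis by simp
  qed
  define K0 where "K0 = L 0"
  have K0: "compact K0" "convex K0" "0 \<in> K0" "K0 \<noteq> {}" using L_compact[of 0] L_convex zero by (auto simp: K0_def)
  have emK0: "emeasure lborel K0 = ennreal (measure lebesgue K0)"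
    using borel_compact[OF K0(1)] emeasure_bounded_finite[OF compact_imp_bounded[OF K0(1)]]
    by (simp add: measure_def less_top[symmetric])
  \<comment> \<open>Relaxing \<open>g\<close> by \<open>e > 0\<close> gives a compact set that
    contains a body of the sequence, hence has volume at least 1. These sets decrease to
    \<open>K0\<close>.\<close>
  have vol: "1 \<le> measure lebesgue K0"
  proof -
    let ?e = "\<lambda>m. 1 / real (Suc m)"
    have dec: "decseq (\<lambda>m. L (?e m))"
    proof (rule decseq_SucI)
      fix m
      have "?e (Suc m) \<le> ?e m" by (intro divide_left_mono) auto
      then show "L (?e (Suc m)) \<subseteq> L (?e m)" by (fastforce simp: L_def)
    qed
    have INT: "(\<Inter>m. L (?e m)) = K0"
    proof
      show "K0 \<subseteq> (\<Inter>m. L (?e m))"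
      proof (intro INT_greatest subsetI)
        fix m x assume x: "x \<in> K0"
        have "x \<bullet> u \<le> g u + ?e m" if "u \<in> ?S" for u
        proof -
          have "x \<bullet> u \<le> g u + 0" using x that unfolding K0_def L_def by blast
          also have "\<dots> \<le> g u + ?e m" by (intro add_left_mono) simp
          finally show ?thesis .
        qed
        then show "x \<in> L (?e m)" unfolding L_def by blast
      qed
      show "(\<Inter>m. L (?e m)) \<subseteq> K0"
      proof
        fix x assume x: "x \<in> (\<Inter>m. L (?e m))"
        have "x \<bullet> u \<le> g u" if u: "u \<in> ?S" for u
        proof (rule field_le_epsilon)
          fix e :: real assume "0 < e"
          then obtain m where "inverse (real (Suc m)) < e" using reals_Archimedean by blast
          moreover have "x \<bullet> u \<le> g u + ?e m" using x u by (auto simp: L_def)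
          ultimately show "x \<bullet> u \<le> g u + e" by (simp add: inverse_eq_divide)
        qed
        then show "x \<in> K0" by (simp add: K0_def L_def)
      qed
    qed
    have "(INF m. emeasure lborel (L (?e m))) = emeasure lborel (\<Inter>m. L (?e m))"
    proof (rule INF_emeasure_decseq[OF _ dec])
      show "range (\<lambda>m. L (?e m)) \<subseteq> sets lborel" by (auto intro!: borel_compact L_compact)
      fix m
      have "emeasure lborel (L (?e m)) < \<infinity>"
        by (intro emeasure_bounded_finite compact_imp_bounded L_compact) simp
      then show "emeasure lborel (L (?e m)) \<noteq> \<infinity>" by simp
    qed
    moreover have "1 \<le> (INF m. emeasure lborel (L (?e m)))" by (intro INF_greatest L_volume) simp
    ultimately have "1 \<le> ennreal (measure lebesgue K0)" by (simp only: INT emK0)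
    then show ?thesis by simp
  qed
  have hK0: "support_fun K0 u \<le> g u" if "u \<in> ?S" for u
    using that by (intro support_fun_least K0) (auto simp: K0_def L_def)
  have body: "convex_body K0" using vol by (intro convex_body_of_measure K0) simp
  have inv: "body_invariant G K0"
    unfolding body_invariant_def
  proof
    fix A assume "A \<in> G"
    then have A: "orthogonal_matrix A" by (rule G)
    have gA: "g (transpose A *v u) = g u" if u: "u \<in> ?S" for u
    proof (rule LIMSEQ_unique)
      have "transpose A *v u \<in> ?S" using u by (simp only: mem_sphere dist_0_norm orthogonal_matrix_simps[OF A])
      from ptw[OF this] show "(\<lambda>n. support_fun (K (k n)) (transpose A *v u)) \<longlonglongrightarrow> g (transpose A *v u)" .
      have "support_fun (K (k n)) (transpose A *v u) = support_fun (K (k n)) u" for n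
        using Kc(6) \<open>A \<in> G\<close> by (intro support_fun_invariant Kc A) (simp add: body_invariant_def)
      then show "(\<lambda>n. support_fun (K (k n)) (transpose A *v u)) \<longlonglongrightarrow> g u" using ptw[OF u] by simp
    qed
    show "(\<lambda>x. A *v x) ` K0 = K0"
    proof (rule invariant_image_eqI[OF A])
      fix x assume x: "x \<in> K0"
      have "(A *v x) \<bullet> u \<le> g u" if u: "u \<in> ?S" for u
      proof -
        have Au: "transpose A *v u \<in> ?S" using u by (simp only: mem_sphere dist_0_norm orthogonal_matrix_simps[OF A])
        then have "x \<bullet> (transpose A *v u) \<le> g (transpose A *v u) + 0" using x unfolding K0_def L_def by blast
        then show ?thesis unfolding gA[OF u] by (simp only: orthogonal_matrix_simps[OF A] add_0_right)
      qed
      then show "A *v x \<in> K0" by (simp add: K0_def L_def)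
      have "(transpose A *v x) \<bullet> u \<le> g u" if u: "u \<in> ?S" for u
      proof -
        have Au: "A *v u \<in> ?S" using u by (simp only: mem_sphere dist_0_norm orthogonal_matrix_simps[OF A])
        then have "x \<bullet> (A *v u) \<le> g (A *v u) + 0" using x unfolding K0_def L_def by blast
        also have "g (A *v u) = g u" using gA[OF Au] by (simp only: orthogonal_matrix_simps[OF A])
        finally show ?thesis by (simp only: orthogonal_matrix_simps[OF A] add_0_right)
      qed
      then have "\<forall>u\<in>?S. (transpose A *v x) \<bullet> u \<le> g u + 0" by (simp only: add_0_right) blast
      then show "transpose A *v x \<in> K0" unfolding K0_def L_def by blast
    qed
  qed
  \<comment> \<open>The minimum point \<xi> of \<open>K0\<close> is moved towards an interior point
    \<open>z\<close>. The new point \<zeta> keeps a positive distance from all supporting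
    hyperplanes of \<open>K0\<close>, which absorbs the error of uniform approximation: \<zeta> also
    lies in the bodies late in the sequence, and their functional at \<zeta> exceeds that of
    \<open>K0\<close> at \<xi> by a factor close to 1 at most.\<close>
  have max: "S \<le> \<Psi> K0"
  proof (rule ennreal_le_of_le_mult)
    fix \<theta> :: real assume \<theta>: "1 < \<theta>"
    \<comment> \<open>Chosen with \<open>(1 - l) powr (- q) = \<theta>\<close>. Moving \<xi> loses
      one factor \<open>1 - l\<close>, the uniform error loses another provided it is below
      \<open>l\<^sup>2 * r\<close>; together they give \<open>\<theta>\<^sup>2\<close>.\<close>
    define l where "l = 1 - \<theta> powr (- 1 / q)"
    have l: "0 < l" "l < 1"
    proof -
      have "\<theta> powr (- 1 / q) < \<theta> powr 0" using \<theta> q_pos by (intro powr_less_mono) auto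
      then show "0 < l" "l < 1" using \<theta> by (auto simp: l_def)
    qed
    have l\<theta>: "(1 - l) powr (- q) = \<theta>" using \<theta> q_pos by (simp add: l_def powr_powr)
    obtain \<xi> where \<xi>: "\<xi> \<in> K0" "F K0 \<xi> = \<Psi> K0" by (rule \<Psi>_attained[OF K0(1,4)])
    obtain z where z: "z \<in> interior K0" using body by (auto simp: convex_body_def)
    then obtain r where r: "0 < r" "cball z r \<subseteq> K0" by (auto simp: mem_interior_cball)
    define \<zeta> where "\<zeta> = (1 - l) *\<^sub>R \<xi> + l *\<^sub>R z"
    have e: "0 < l\<^sup>2 * r" using l r by simp
    obtain N where N: "\<forall>n x. n \<ge> N \<and> x \<in> ?S \<longrightarrow> norm (support_fun (K (k n)) x - g x) < l\<^sup>2 * r" using unif[OF e] by blast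
    have low: "(1 - l)\<^sup>2 * (support_fun K0 u - \<xi> \<bullet> u) \<le> support_fun (K (k n)) u - \<zeta> \<bullet> u \<and> 0 \<le> support_fun (K (k n)) u - \<zeta> \<bullet> u"
      if n: "N \<le> n" and u: "u \<in> ?S" for n u
    proof -
      let ?h = "support_fun K0 u"
      have hx: "0 \<le> ?h - \<xi> \<bullet> u" using support_fun_upper[OF K0(1) \<xi>(1), of u] by simp
      have "(z + r *\<^sub>R u) \<bullet> u \<le> ?h" using r u by (intro support_fun_upper[OF K0(1)] subsetD[OF r(2)]) (simp add: dist_norm)
      then have hz: "r \<le> ?h - z \<bullet> u" using u by (simp add: inner_add_left norm_eq_1)
      have split: "?h - \<zeta> \<bullet> u = (1 - l) * (?h - \<xi> \<bullet> u) + l * (?h - z \<bullet> u)"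
        by (simp add: \<zeta>_def inner_add_left algebra_simps)
      have p1: "(1 - l) * (?h - \<xi> \<bullet> u) \<le> ?h - \<zeta> \<bullet> u"
        unfolding split using l hz r(1) by (simp add: mult_nonneg_nonneg)
      have "l * r \<le> l * (?h - z \<bullet> u)" using l hz by (intro mult_left_mono) auto
      then have p2: "l * r \<le> ?h - \<zeta> \<bullet> u" unfolding split using l hx by (simp add: add_increasing)
      have "norm (support_fun (K (k n)) u - g u) < l\<^sup>2 * r" using N n u by blast
      then have "?h - l\<^sup>2 * r \<le> support_fun (K (k n)) u" using hK0[OF u] by simp
      moreover have "l\<^sup>2 * r \<le> l * (?h - \<zeta> \<bullet> u)"
        using mult_left_mono[OF p2, of l] l by (simp add: power2_eq_square mult.assoc)
      ultimately have p3: "(1 - l) * (?h - \<zeta> \<bullet> u) \<le> support_fun (K (k n)) u - \<zeta> \<bullet> u" by (simp add: algebra_simps)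
      have p4: "(1 - l) * ((1 - l) * (?h - \<xi> \<bullet> u)) \<le> (1 - l) * (?h - \<zeta> \<bullet> u)" using p1 l by (intro mult_left_mono) auto
      have "0 \<le> (1 - l) * ((1 - l) * (?h - \<xi> \<bullet> u))" using l hx by (intro mult_nonneg_nonneg) auto
      then show ?thesis using p3 p4 by (simp add: power2_eq_square mult.assoc)
    qed
    have "\<Psi> (K (k n)) \<le> ennreal (\<theta>\<^sup>2) * \<Psi> K0" if n: "N \<le> n" for n
    proof -
      have "\<zeta> \<in> K (k n)"
        using low[OF n] by (intro mem_of_support_fun Kc) (simp add: algebra_simps)
      then have "\<Psi> (K (k n)) \<le> F (K (k n)) \<zeta>" by (rule \<Psi>_le)
      also have "\<dots> \<le> (\<integral>\<^sup>+u. inv_pow q ((1 - l)\<^sup>2 * (support_fun K0 u - \<xi> \<bullet> u)) \<partial>\<mu>)"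
        unfolding F_def using low[OF n] by (intro nn_integral_mono inv_pow_antimono q_pos) (simp add: space_mu)
      also have "\<dots> = (\<integral>\<^sup>+u. ennreal (\<theta>\<^sup>2) * inv_pow q (support_fun K0 u - \<xi> \<bullet> u) \<partial>\<mu>)"
      proof -
        have "((1 - l)\<^sup>2) powr (- q) = \<theta>\<^sup>2"
          using l l\<theta> by (simp add: power2_eq_square powr_mult)
        then show ?thesis using l by (subst inv_pow_mult) auto
      qed
      also have "\<dots> = ennreal (\<theta>\<^sup>2) * F K0 \<xi>" unfolding F_def by (intro nn_integral_cmult F_measurable K0)
      finally show ?thesis by (simp only: \<xi>(2))
    qed
    then have "eventually (\<lambda>n. \<Psi> (K (k n)) \<le> ennreal (\<theta>\<^sup>2) * \<Psi> K0) sequentially"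
      by (auto simp: eventually_sequentially)
    moreover have "(\<lambda>n. \<Psi> (K (k n))) \<longlonglongrightarrow> S"
      using LIMSEQ_subseq_LIMSEQ[OF LIMSEQ_SUP[OF f(1)] k] by (simp add: S_def f(3) o_def fK)
    ultimately show "S \<le> ennreal (\<theta>\<^sup>2) * \<Psi> K0" by (intro tendsto_upperbound) auto
  qed
  show ?thesis
  proof (rule that[of K0])
    show "admissible G K0" using body K0(3) inv by (simp add: admissible_def)
    show "1 \<le> measure lebesgue K0" by (rule vol)
    fix L assume "admissible G L" "1 \<le> measure lebesgue L"
    then have "\<Psi> L \<le> S" unfolding S_def by (intro SUP_upper) (simp add: \<A>_def)
    then show "\<Psi> L \<le> \<Psi> K0" using max by (rule order_trans)
  qed
qed

end

section \<open>The first variation\<close>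

text \<open>On \<omega> the support function of the cut body is at most \<open>1 - t\<close> times
  that of \<open>K\<close>, possibly less; elsewhere it may drop too. Such upper bounds only
  increase the functional, so they point in the direction required.\<close>

definition cut :: "'a::euclidean_space set \<Rightarrow> 'a set \<Rightarrow> real \<Rightarrow> 'a set" where
  "cut K \<omega> t = {x \<in> K. \<forall>u\<in>\<omega>. x \<bullet> u \<le> (1 - t) * support_fun K u}"

definition slab :: "'a::euclidean_space set \<Rightarrow> 'a set \<Rightarrow> real \<Rightarrow> 'a set" where
  "slab K \<omega> t = {y \<in> K. \<exists>u\<in>\<omega>. (1 - t) * support_fun K u \<le> y \<bullet> u}"

lemma cut_props:
  fixes K :: "'a::euclidean_space set"
  assumes "compact K" "convex K"
  shows "compact (cut K \<omega> t)" "convex (cut K \<omega> t)" "cut K \<omega> t \<subseteq> K"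
proof -
  have eq: "cut K \<omega> t = K \<inter> (\<Inter>u\<in>\<omega>. {x. u \<bullet> x \<le> (1 - t) * support_fun K u})" by (auto simp: cut_def inner_commute)
  show "compact (cut K \<omega> t)" unfolding eq by (intro compact_Int_closed assms closed_INT ballI closed_halfspace_le)
  show "convex (cut K \<omega> t)" unfolding eq by (intro convex_Int assms convex_INT convex_halfspace_le)
  show "cut K \<omega> t \<subseteq> K" by (auto simp: cut_def)
qed

lemma compact_slab:
  fixes K :: "'a::euclidean_space set"
  assumes K: "compact K" "K \<noteq> {}" and \<omega>: "compact \<omega>"
  shows "compact (slab K \<omega> t)"
proof -
  let ?C = "{z :: 'a \<times> 'a. (1 - t) * support_fun K (snd z) \<le> fst z \<bullet> snd z}"
  have "continuous_on UNIV (\<lambda>z::'a\<times>'a. support_fun K (snd z))"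
    by (intro continuous_on_compose2[OF continuous_support_fun[OF K, of UNIV]] continuous_intros) simp
  then have "closed ?C" by (intro closed_Collect_le continuous_intros)
  then have "compact (K \<times> \<omega> \<inter> ?C)" by (intro compact_Int_closed compact_Times K \<omega>)
  then have "compact (fst ` (K \<times> \<omega> \<inter> ?C))" by (intro compact_continuous_image continuous_intros)
  also have "fst ` (K \<times> \<omega> \<inter> ?C) = slab K \<omega> t"
  proof (rule Set.set_eqI, rule iffI)
    fix y assume "y \<in> fst ` (K \<times> \<omega> \<inter> ?C)"
    then show "y \<in> slab K \<omega> t" by (auto simp: slab_def)
  next
    fix y assume "y \<in> slab K \<omega> t"
    then obtain u where "y \<in> K" "u \<in> \<omega>" "(1 - t) * support_fun K u \<le> y \<bullet> u" by (auto simp: slab_def)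
    then show "y \<in> fst ` (K \<times> \<omega> \<inter> ?C)" by (intro image_eqI[of _ _ "(y, u)"]) auto
  qed
  finally show ?thesis .
qed

lemma cone_of_scale:
  fixes B :: "'a::real_vector set"
  assumes "0 \<le> s" "s \<le> 1"
  shows "(*\<^sub>R) s ` cone_of B \<subseteq> cone_of B"
proof
  fix x assume "x \<in> (*\<^sub>R) s ` cone_of B"
  then obtain r y where ry: "0 \<le> r" "r \<le> 1" "y \<in> B" "x = (s * r) *\<^sub>R y" by (auto simp: cone_of_def)
  have "0 \<le> s * r" "s * r \<le> 1" using assms ry by (auto intro: mult_le_one)
  then show "x \<in> cone_of B" unfolding cone_of_def using ry by (intro image_eqI[of _ _ "(s * r, y)"]) auto
qed

lemma compact_measure_lborel:
  fixes K :: "'a::euclidean_space set"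
  assumes "compact K"
  shows "emeasure lborel K = ennreal (measure lborel K)" "emeasure lborel K < \<infinity>"
proof -
  show f: "emeasure lborel K < \<infinity>" by (intro emeasure_bounded_finite compact_imp_bounded assms)
  then show "emeasure lborel K = ennreal (measure lborel K)" by (intro emeasure_eq_ennreal_measure) simp
qed

text \<open>Every removed point lies in the slab but not in \<open>(1 - t) K\<close>, hence in the cone over the slab
  minus its dilate by \<open>1 - t\<close>.\<close>

lemma cut_volume:
  fixes K :: "'a::euclidean_space set"
  assumes K: "compact K" "convex K" "0 \<in> K" and \<omega>: "compact \<omega>" and t: "0 < t" "t < 1"
  shows "measure lborel K - real (DIM('a)) * t * measure lborel (cone_of (slab K \<omega> t)) \<le> measure lborel (cut K \<omega> t)"
proof -
  have Kne: "K \<noteq> {}" using K(3) by auto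
  define D where "D = cone_of (slab K \<omega> t)"
  define D' where "D' = (*\<^sub>R) (1 - t) ` D"
  have cD: "compact D" unfolding D_def by (intro compact_cone_of compact_slab K Kne \<omega>)
  have Db: "D \<in> sets borel" by (rule borel_compact[OF cD])
  have D'b: "D' \<in> sets borel" unfolding D'_def using t Db by (intro emeasure_lborel_scaleR) auto
  have D'D: "D' \<subseteq> D" unfolding D'_def D_def using t by (intro cone_of_scale) auto
  have cut: "cut K \<omega> t \<in> sets borel" "emeasure lborel (cut K \<omega> t) \<noteq> \<infinity>"
    using borel_compact[OF cut_props(1)[OF K(1,2)]] compact_measure_lborel(2)[OF cut_props(1)[OF K(1,2)], of \<omega> t] by (auto simp del: infinity_ennreal_def)
  have Dfin: "emeasure lborel D \<noteq> \<infinity>" using compact_measure_lborel(2)[OF cD] by auto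
  have D'fin: "emeasure lborel D' \<noteq> \<infinity>"
    using emeasure_mono[OF D'D, of lborel] Db Dfin by (auto simp: top_unique)
  have mD': "measure lborel D' = (1 - t) ^ DIM('a) * measure lborel D"
    using emeasure_lborel_scaleR(2)[of "1 - t" D] t Db unfolding D'_def by (simp add: measure_def enn2real_mult)
  have sub: "K \<subseteq> cut K \<omega> t \<union> (D - D')"
  proof
    fix x assume x: "x \<in> K"
    show "x \<in> cut K \<omega> t \<union> (D - D')"
    proof (cases "x \<in> cut K \<omega> t")
      case False
      then obtain u where u: "u \<in> \<omega>" "(1 - t) * support_fun K u < x \<bullet> u" using x by (auto simp: cut_def not_le)
      then have xs: "x \<in> slab K \<omega> t" using x by (auto simp: slab_def intro!: bexI[of _ u])
      have "x \<in> D" unfolding D_def cone_of_def using xs by (intro image_eqI[of _ _ "(1, x)"]) auto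
      moreover have "x \<notin> D'"
      proof
        assume "x \<in> D'"
        then obtain y where y: "y \<in> D" "x = (1 - t) *\<^sub>R y" by (auto simp: D'_def)
        have "D \<subseteq> K" unfolding D_def by (intro cone_of_subset K) (auto simp: slab_def)
        then have "y \<bullet> u \<le> support_fun K u" using y(1) by (intro support_fun_upper K) auto
        then have "x \<bullet> u \<le> (1 - t) * support_fun K u" using t y(2) by (simp add: mult_left_mono)
        then show False using u(2) by simp
      qed
      ultimately show ?thesis by blast
    qed blast
  qed
  have "measure lborel K \<le> measure lborel (cut K \<omega> t \<union> (D - D'))"
  proof (rule measure_mono_fmeasurable[OF sub])
    show "K \<in> sets lborel" using borel_compact[OF K(1)] by simp
    show "cut K \<omega> t \<union> (D - D') \<in> fmeasurable lborel"
      using cut Db D'b Dfin D'fin by (intro fmeasurable.Un fmeasurable.Diff fmeasurableI) (auto simp: less_top)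
  qed
  also have "\<dots> \<le> measure lborel (cut K \<omega> t) + measure lborel (D - D')"
    using cut Db D'b Dfin D'fin by (intro measure_Un_le) auto
  also have "measure lborel (D - D') = measure lborel D - measure lborel D'"
    using Db D'b D'D Dfin by (intro measure_Diff) auto
  also have "\<dots> = (1 - (1 - t) ^ DIM('a)) * measure lborel D" by (simp add: mD' algebra_simps)
  also have "\<dots> \<le> (real DIM('a) * t) * measure lborel D"
    using Bernoulli_inequality[of "- t" "DIM('a)"] t by (intro mult_right_mono) auto
  finally show ?thesis by (simp add: D_def)
qed

section \<open>Shallow cuts and the first-order limit\<close>

lemma one_over_shift_tendsto: "(\<lambda>j. 1 / real (j + 2)) \<longlonglongrightarrow> 0"
  by (rule LIMSEQ_ignore_initial_segment[OF lim_1_over_n])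

text \<open>The cones over the slabs decrease to the cone over the normal preimage. A point in all
  of them has witnesses (parameter, boundary candidate, direction) in one compact set, and in the
  limit the slab condition says that the direction is normal at the candidate.\<close>

lemma slab_limit:
  fixes K :: "'a::euclidean_space set"
  assumes K: "compact K" "0 \<in> K" and \<omega>: "compact \<omega>" "\<omega> \<subseteq> sphere 0 1"
  shows "(\<lambda>j. measure lborel (cone_of (slab K \<omega> (1 / real (j + 2))))) \<longlonglongrightarrow> measure lborel (cone_of (normal_preimage K \<omega>))"
proof -
  let ?t = "\<lambda>j. 1 / real (j + 2)"
  let ?A = "\<lambda>j. cone_of (slab K \<omega> (?t j))"
  have Kne: "K \<noteq> {}" using K(2) by auto
  have cA: "compact (?A j)" for j by (intro compact_cone_of compact_slab K Kne \<omega>)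
  have h0: "0 \<le> support_fun K u" for u by (rule support_fun_nonneg[OF K])
  have "decseq ?A"
  proof (rule decseq_SucI)
    fix j
    have "(1 - ?t j) * support_fun K u \<le> (1 - ?t (Suc j)) * support_fun K u" for u
      using h0 by (intro mult_right_mono diff_left_mono divide_left_mono) auto
    then have "slab K \<omega> (?t (Suc j)) \<subseteq> slab K \<omega> (?t j)" unfolding slab_def by (blast intro: order_trans)
    then show "?A (Suc j) \<subseteq> ?A j" by (rule cone_of_mono)
  qed
  then have lim: "(\<lambda>j. measure lborel (?A j)) \<longlonglongrightarrow> measure lborel (\<Inter>j. ?A j)"
  proof (intro Lim_measure_decseq)
    show "range ?A \<subseteq> sets lborel" using cA by (auto intro: borel_compact)
    show "emeasure lborel (?A j) \<noteq> \<infinity>" for j using compact_measure_lborel(2)[OF cA, of j] by simp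
  qed
  have "(\<Inter>j. ?A j) = cone_of (normal_preimage K \<omega>)"
  proof
    have "normal_preimage K \<omega> \<subseteq> slab K \<omega> (?t j)" for j
    proof
      fix y assume "y \<in> normal_preimage K \<omega>"
      then obtain u where u: "y \<in> K" "u \<in> \<omega>" "y \<bullet> u = support_fun K u" by (auto simp: normal_preimage_def)
      have "(1 - ?t j) * support_fun K u \<le> 1 * support_fun K u" using h0 by (intro mult_right_mono) auto
      then have "(1 - ?t j) * support_fun K u \<le> y \<bullet> u" unfolding u(3) mult_1 .
      then show "y \<in> slab K \<omega> (?t j)" unfolding slab_def using u(1,2) by blast
    qed
    then show "cone_of (normal_preimage K \<omega>) \<subseteq> (\<Inter>j. ?A j)" by (intro INT_greatest cone_of_mono)
    show "(\<Inter>j. ?A j) \<subseteq> cone_of (normal_preimage K \<omega>)"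
    proof
      fix x assume x: "x \<in> (\<Inter>j. ?A j)"
      let ?C = "{0..1::real} \<times> (K \<times> \<omega>)"
      have "\<exists>z. z \<in> ?C \<and> x = fst z *\<^sub>R fst (snd z) \<and> (1 - ?t j) * support_fun K (snd (snd z)) \<le> fst (snd z) \<bullet> snd (snd z)" for j
      proof -
        have "x \<in> ?A j" using x by blast
        then obtain r y where ry: "0 \<le> r" "r \<le> 1" "y \<in> slab K \<omega> (?t j)" "x = r *\<^sub>R y" by (auto simp: cone_of_def)
        then obtain u where "y \<in> K" "u \<in> \<omega>" "(1 - ?t j) * support_fun K u \<le> y \<bullet> u" unfolding slab_def by blast
        then show ?thesis using ry by (intro exI[of _ "(r, y, u)"]) simp
      qed
      then obtain z where z: "\<And>j. z j \<in> ?C" "\<And>j. x = fst (z j) *\<^sub>R fst (snd (z j))"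
        "\<And>j. (1 - ?t j) * support_fun K (snd (snd (z j))) \<le> fst (snd (z j)) \<bullet> snd (snd (z j))" by metis
      have "compact ?C" by (intro compact_Times K \<omega>) simp
      then obtain l r where l: "l \<in> ?C" "strict_mono (r :: nat \<Rightarrow> nat)" "(z \<circ> r) \<longlonglongrightarrow> l"
        using z(1) unfolding compact_def by metis
      have zr: "(\<lambda>j. z (r j)) \<longlonglongrightarrow> l" using l(3) by (simp add: o_def)
      have "(\<lambda>j. fst (z (r j)) *\<^sub>R fst (snd (z (r j)))) \<longlonglongrightarrow> fst l *\<^sub>R fst (snd l)" by (intro tendsto_intros zr)
      then have xl: "x = fst l *\<^sub>R fst (snd l)" using z(2) by (simp add: LIMSEQ_const_iff)
      have "?t \<longlonglongrightarrow> 0" by (rule one_over_shift_tendsto)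
      then have tr: "(\<lambda>j. ?t (r j)) \<longlonglongrightarrow> 0" using LIMSEQ_subseq_LIMSEQ[OF _ l(2), of ?t 0] by (simp add: o_def)
      have "isCont (support_fun K) (snd (snd l))"
        using continuous_support_fun[OF K(1) Kne, of UNIV] by (simp add: continuous_on_eq_continuous_at)
      then have hl: "(\<lambda>j. support_fun K (snd (snd (z (r j))))) \<longlonglongrightarrow> support_fun K (snd (snd l))"
        by (rule isCont_tendsto_compose) (intro tendsto_intros zr)
      have "(1 - 0) * support_fun K (snd (snd l)) \<le> fst (snd l) \<bullet> snd (snd l)"
      proof (rule LIMSEQ_le)
        show "(\<lambda>j. (1 - ?t (r j)) * support_fun K (snd (snd (z (r j))))) \<longlonglongrightarrow> (1 - 0) * support_fun K (snd (snd l))"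
          by (intro tendsto_intros tr hl)
        show "(\<lambda>j. fst (snd (z (r j))) \<bullet> snd (snd (z (r j)))) \<longlonglongrightarrow> fst (snd l) \<bullet> snd (snd l)"
          by (intro tendsto_intros zr)
        show "\<exists>N. \<forall>j\<ge>N. (1 - ?t (r j)) * support_fun K (snd (snd (z (r j)))) \<le> fst (snd (z (r j))) \<bullet> snd (snd (z (r j)))"
          using z(3) by blast
      qed
      moreover have "fst (snd l) \<in> K" "snd (snd l) \<in> \<omega>" "0 \<le> fst l" "fst l \<le> 1" using l(1) by auto
      ultimately have "fst (snd l) \<in> normal_preimage K \<omega>"
        using support_fun_upper[OF K(1), of "fst (snd l)" "snd (snd l)"] \<omega>(2)
        by (auto simp: normal_preimage_def intro!: bexI[of _ "snd (snd l)"])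
      then show "x \<in> cone_of (normal_preimage K \<omega>)"
        unfolding cone_of_def using xl \<open>0 \<le> fst l\<close> \<open>fst l \<le> 1\<close> by (intro image_eqI[of _ _ "(fst l, fst (snd l))"]) auto
    qed
  qed
  then show ?thesis using lim by simp
qed

text \<open>Pointwise gain of a cut. The tangent of the convex power at \<open>m = h - x\<close> is
  followed down by \<open>t h\<close>; its slope contains \<open>m powr (- q - 1)\<close>, which
  \<open>m \<le> h (1 + \<rho> / \<delta>)\<close> trades for \<open>h powr (- q - 1)\<close>. The
  correction factor tends to 1 with \<rho> tending to 0. If the cut passes the point, the right-hand
  side is infinite.\<close>

lemma inv_pow_cut:
  assumes q: "0 < q" and t: "0 < t" and h: "0 < \<delta>" "\<delta> \<le> h" and x: "\<bar>x\<bar> \<le> \<rho>" "x \<le> h" and h': "h' \<le> (1 - t) * h"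
  shows "inv_pow q (h - x) + ennreal (q * t * (1 + \<rho> / \<delta>) powr (- q - 1)) * inv_pow q h \<le> inv_pow q (h' - x)"
proof (cases "(1 - t) * h - x \<le> 0")
  case True
  then have "h' - x \<le> 0" using h' by linarith
  then show ?thesis by (simp add: inv_pow_def)
next
  case False
  define m where "m = h - x"
  define y where "y = (1 - t) * h - x"
  have y: "0 < y" "y = m - t * h" using False by (auto simp: y_def m_def algebra_simps)
  have h0: "0 < h" using h by simp
  then have "0 < t * h" using t by simp
  with y have m: "0 < m" by linarith
  have \<rho>: "0 \<le> \<rho>" using x by simp
  have "m \<le> h + \<rho>" using x by (simp add: m_def)
  also have "\<dots> \<le> h * (1 + \<rho> / \<delta>)"
  proof -
    have "\<delta> * \<rho> \<le> h * \<rho>" using h \<rho> by (intro mult_right_mono) auto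
    then show ?thesis using h by (simp add: field_simps)
  qed
  finally have mh: "m \<le> h * (1 + \<rho> / \<delta>)" .
  have c: "0 < 1 + \<rho> / \<delta>" using \<rho> h by (simp add: add_pos_nonneg)
  have "h powr (- q) * (1 + \<rho> / \<delta>) powr (- q - 1) = h * (h powr (- q - 1) * (1 + \<rho> / \<delta>) powr (- q - 1))"
    using h0 by (simp add: powr_diff)
  also have "\<dots> = h * (h * (1 + \<rho> / \<delta>)) powr (- q - 1)" using h0 c by (simp add: powr_mult)
  also have "\<dots> \<le> h * m powr (- q - 1)" using h0 mh m q by (intro mult_left_mono powr_mono2') auto
  finally have 1: "h powr (- q) * (1 + \<rho> / \<delta>) powr (- q - 1) \<le> h * m powr (- q - 1)" .
  have "m powr (- q) + q * t * (1 + \<rho> / \<delta>) powr (- q - 1) * h powr (- q)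
      \<le> m powr (- q) + q * m powr (- q - 1) * (t * h)"
    using mult_left_mono[OF 1, of "q * t"] q t by (simp add: mult_ac)
  also have "\<dots> = m powr (- q) - q * m powr (- q - 1) * (y - m)" by (simp add: y(2))
  also have "\<dots> \<le> y powr (- q)" by (rule powr_neg_tangent(1)[OF y(1) m q])
  finally have 2: "m powr (- q) + q * t * (1 + \<rho> / \<delta>) powr (- q - 1) * h powr (- q) \<le> y powr (- q)" .
  have "inv_pow q (h - x) + ennreal (q * t * (1 + \<rho> / \<delta>) powr (- q - 1)) * inv_pow q h
     = ennreal (m powr (- q) + q * t * (1 + \<rho> / \<delta>) powr (- q - 1) * h powr (- q))"
    using m h0 q t by (simp add: inv_pow_def m_def[symmetric] ennreal_mult[symmetric])
  also have "\<dots> \<le> ennreal (y powr (- q))" by (rule ennreal_leI[OF 2])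
  also have "\<dots> = inv_pow q y" using y(1) by (simp add: inv_pow_def)
  also have "\<dots> \<le> inv_pow q (h' - x)" using h' by (intro inv_pow_antimono q) (simp add: y_def)
  finally show ?thesis .
qed

text \<open>Here \<open>P\<close> stands for the maximal value, \<open>V\<close> for the volume,
  \<open>I\<close> for the integral over \<omega> and \<open>v j\<close> for the cone volume of the
  slab. Both sides of \<open>ineq\<close> differ from \<open>P\<close> to first order in
  \<open>t j\<close>. Logarithms with \<open>ln x \<le> x - 1\<close> on either side isolate these
  terms, which are divided by \<open>q * t j\<close> before the limit.\<close>

lemma first_order_limit:
  fixes t c v :: "nat \<Rightarrow> real"
  assumes pos: "0 < V" "0 < P" "0 \<le> I" "0 < q" "0 < n"
    and t: "\<And>j. 0 < t j" "t \<longlonglongrightarrow> 0" and c: "\<And>j. 0 \<le> c j" "c \<longlonglongrightarrow> 1"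
    and v: "\<And>j. 0 \<le> v j" "v \<longlonglongrightarrow> v0"
    and b: "\<And>j. n * t j * v j / V < 1"
    and ineq: "\<And>j. P + q * t j * c j * I \<le> (1 / (1 - n * t j * v j / V)) powr (q / n) * P"
  shows "I * V \<le> P * v0"
proof -
  define a where "a j = q * t j * c j * I / P" for j
  define \<beta> where "\<beta> j = n * t j * v j / V" for j
  have a0: "0 \<le> a j" for j unfolding a_def using pos t(1)[of j] c(1)[of j] by simp
  have main: "(c j * I / P) / (1 + a j) \<le> (v j / V) / (1 - \<beta> j)" for j
  proof -
    have \<beta>: "\<beta> j < 1" "0 \<le> \<beta> j" using b[of j] pos t(1)[of j] v(1)[of j] by (auto simp: \<beta>_def)
    have "P * (1 + a j) \<le> P * (1 / (1 - \<beta> j)) powr (q / n)"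
      using ineq[of j] pos by (simp add: a_def \<beta>_def algebra_simps)
    then have "1 + a j \<le> (1 / (1 - \<beta> j)) powr (q / n)" using pos by simp
    then have "ln (1 + a j) \<le> ln ((1 / (1 - \<beta> j)) powr (q / n))" using a0[of j] by (intro ln_mono) auto
    also have "\<dots> = (q / n) * ln (1 / (1 - \<beta> j))" by (rule ln_powr)
    also have "\<dots> \<le> (q / n) * (1 / (1 - \<beta> j) - 1)" using \<beta> pos by (intro mult_left_mono ln_le_minus_one) auto
    also have "1 / (1 - \<beta> j) - 1 = \<beta> j / (1 - \<beta> j)" using \<beta> by (simp add: field_simps)
    finally have up: "ln (1 + a j) \<le> (q / n) * (\<beta> j / (1 - \<beta> j))" .
    have "ln (1 / (1 + a j)) \<le> 1 / (1 + a j) - 1" using a0[of j] by (intro ln_le_minus_one) auto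
    moreover have "ln (1 / (1 + a j)) = - ln (1 + a j)" using a0[of j] by (simp add: ln_div)
    moreover have "1 / (1 + a j) - 1 = - (a j / (1 + a j))" using a0[of j] by (simp add: field_simps)
    ultimately have "a j / (1 + a j) \<le> (q / n) * (\<beta> j / (1 - \<beta> j))" using up by linarith
    then have "(q * t j) * ((c j * I / P) / (1 + a j)) \<le> (q * t j) * ((v j / V) / (1 - \<beta> j))"
      using pos by (simp add: a_def \<beta>_def mult_ac)
    moreover have "0 < q * t j" using pos t(1)[of j] by simp
    ultimately show ?thesis by (rule mult_left_le_imp_le)
  qed
  have "a \<longlonglongrightarrow> q * 0 * 1 * I / P" unfolding a_def using pos by (intro tendsto_intros t c) auto
  then have al: "a \<longlonglongrightarrow> 0" by simp
  have "\<beta> \<longlonglongrightarrow> n * 0 * v0 / V" unfolding \<beta>_def using pos by (intro tendsto_intros t v) auto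
  then have bl: "\<beta> \<longlonglongrightarrow> 0" by simp
  have "(1 * I / P) / (1 + 0) \<le> (v0 / V) / (1 - 0)"
  proof (rule LIMSEQ_le)
    show "(\<lambda>j. (c j * I / P) / (1 + a j)) \<longlonglongrightarrow> (1 * I / P) / (1 + 0)" using pos by (intro tendsto_intros c al) auto
    show "(\<lambda>j. (v j / V) / (1 - \<beta> j)) \<longlonglongrightarrow> (v0 / V) / (1 - 0)" using pos by (intro tendsto_intros v bl) auto
  qed (use main in blast)
  then show ?thesis using pos by (simp add: field_simps)
qed

lemma measure_lborel_scaleR:
  fixes A :: "'a::euclidean_space set"
  assumes "0 < s" "A \<in> sets borel"
  shows "measure lborel ((*\<^sub>R) s ` A) = s ^ DIM('a) * measure lborel A"
  using emeasure_lborel_scaleR(2)[OF assms] assms(1) by (simp add: measure_def enn2real_mult)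

context coercive_functional
begin

text \<open>The cut body, rescaled to the volume of \<open>K\<close>, competes with
  \<open>K\<close>; this bounds \<Psi> of the cut body above. Evaluated at its own minimum point
  \<open>\<xi> j\<close>, it is bounded below by \<open>F K (\<xi> j)\<close> plus a first-order
  gain. Both bounds together force \<open>\<xi> j\<close> towards the minimum point of
  \<open>F K\<close>, the origin, and there the gain becomes the integral over \<omega>.\<close>

lemma euler_lagrange:
  assumes G: "\<And>A. A \<in> G \<Longrightarrow> orthogonal_matrix A"
    and K: "admissible G K" "1 \<le> measure lebesgue K"
    and max: "\<And>L. admissible G L \<Longrightarrow> 1 \<le> measure lebesgue L \<Longrightarrow> \<Psi> L \<le> \<Psi> K"
    and min: "F K 0 = \<Psi> K"
    and \<omega>: "closed \<omega>" "\<omega> \<subseteq> sphere 0 1" "\<And>u. u \<in> \<omega> \<Longrightarrow> 0 < support_fun K u"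
    and inv: "\<And>A u. A \<in> G \<Longrightarrow> u \<in> \<omega> \<Longrightarrow> A *v u \<in> \<omega>" "\<And>A u. A \<in> G \<Longrightarrow> u \<in> \<omega> \<Longrightarrow> transpose A *v u \<in> \<omega>"
  shows "(\<integral>\<^sup>+u. inv_pow q (support_fun K u) * indicator \<omega> u \<partial>\<mu>) * emeasure lborel K
    \<le> \<Psi> K * emeasure lborel (cone_of (normal_preimage K \<omega>))"
proof (cases "\<omega> = {}")
  case False
  let ?n = "CARD('n)"
  have Kc: "convex_body K" "0 \<in> K" "body_invariant G K" "compact K" "convex K" "K \<noteq> {}"
    using K(1) by (auto simp: admissible_def convex_body_def)
  have c\<omega>: "compact \<omega>" using \<omega>(1,2) compact_sphere by (metis closed_Int_compact inf.absorb1)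
  have bor: "X \<in> sets borel \<Longrightarrow> measure lebesgue X = measure lborel X" for X :: "(real^'n) set" by (simp add: measure_def)
  obtain u1 where u1: "u1 \<in> \<omega>" "\<And>u. u \<in> \<omega> \<Longrightarrow> support_fun K u1 \<le> support_fun K u"
    using continuous_attains_inf[OF c\<omega> False continuous_support_fun[OF Kc(4,6)]] by blast
  define \<delta> where "\<delta> = support_fun K u1"
  have \<delta>: "0 < \<delta>" "\<And>u. u \<in> \<omega> \<Longrightarrow> \<delta> \<le> support_fun K u" using u1 \<omega>(3) by (auto simp: \<delta>_def)
  define V where "V = measure lborel K"
  have V: "1 \<le> V" "emeasure lborel K = ennreal V"
    using K(2) bor[OF borel_compact[OF Kc(4)]] compact_measure_lborel(1)[OF Kc(4)] by (auto simp: V_def)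
  define P where "P = enn2real (\<Psi> K)"
  have P: "0 < P" "\<Psi> K = ennreal P"
    using \<Psi>_pos[OF Kc(4,6)] \<Psi>_finite[OF Kc(1)] by (auto simp: P_def enn2real_positive_iff less_top)
  define Ie where "Ie = (\<integral>\<^sup>+u. inv_pow q (support_fun K u) * indicator \<omega> u \<partial>\<mu>)"
  have "Ie \<le> F K 0" unfolding Ie_def F_def by (intro nn_integral_mono) (auto simp: indicator_def)
  then have "Ie < \<infinity>" using min P by (simp add: order_le_less_trans)
  then obtain I where I: "Ie = ennreal I" "0 \<le> I" by (cases Ie) auto
  have hm: "support_fun K \<in> borel_measurable \<mu>" by (rule measurable_mu[OF borel_measurable_support_fun[OF Kc(4,6)]])
  have \<omega>m: "\<omega> \<in> sets \<mu>" unfolding sets_mu by (intro sphere_setI \<omega> borel_closed)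
  \<comment> \<open>The shift by 2 keeps \<open>t j\<close> strictly between 0 and 1, also for
    \<open>j = 0\<close>.\<close>
  define t where "t j = 1 / real (j + 2)" for j
  have t: "0 < t j" "t j < 1" for j by (auto simp: t_def)
  have tl: "t \<longlonglongrightarrow> 0" unfolding t_def by (rule one_over_shift_tendsto)
  define v where "v j = measure lborel (cone_of (slab K \<omega> (t j)))" for j
  define v0 where "v0 = measure lborel (cone_of (normal_preimage K \<omega>))"
  have vl: "v \<longlonglongrightarrow> v0" unfolding v_def v0_def t_def by (rule slab_limit[OF Kc(4,2) c\<omega> \<omega>(2)])
  have v0e: "emeasure lborel (cone_of (normal_preimage K \<omega>)) = ennreal v0"
    unfolding v0_def by (intro compact_measure_lborel compact_cone_of compact_normal_preimage Kc \<omega>)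
  define C where "C j = cut K \<omega> (t j)" for j
  have Cp: "compact (C j)" "convex (C j)" "C j \<subseteq> K" for j unfolding C_def using cut_props[OF Kc(4,5)] by auto
  have C0: "0 \<in> C j" for j
    using Kc(2) t[of j] support_fun_nonneg[OF Kc(4,2)] by (auto simp: C_def cut_def intro!: mult_nonneg_nonneg)
  have Cv: "V - real ?n * t j * v j \<le> measure lborel (C j)" for j
    using cut_volume[OF Kc(4,5,2) c\<omega> t, of j] by (simp add: V_def v_def C_def)
  have "(\<lambda>j. real ?n * t j * v j / V) \<longlonglongrightarrow> real ?n * 0 * v0 / V" using V by (intro tendsto_intros tl vl) auto
  then have "(\<lambda>j. real ?n * t j * v j / V) \<longlonglongrightarrow> 0" by simp
  then have "eventually (\<lambda>j. real ?n * t j * v j / V < 1) sequentially" by (rule order_tendstoD(2)) simp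
  then obtain J where J: "\<And>j. J \<le> j \<Longrightarrow> real ?n * t j * v j / V < 1" by (auto simp: eventually_sequentially)
  have Cbody: "convex_body (C j)" "0 < measure lborel (C j)" if "J \<le> j" for j
  proof -
    have "real ?n * t j * v j < V" using J[OF that] V by (simp add: field_simps)
    then show m: "0 < measure lborel (C j)" using Cv[of j] by linarith
    then show "convex_body (C j)" using bor[OF borel_compact[OF Cp(1)]] by (intro convex_body_of_measure Cp) simp
  qed
  have Cinv: "body_invariant G (C j)" for j
    unfolding body_invariant_def
  proof
    fix A assume AG: "A \<in> G"
    then have A: "orthogonal_matrix A" by (rule G)
    have KA: "(\<lambda>x. A *v x) ` K = K" using Kc(3) AG by (simp add: body_invariant_def)
    note sA = support_fun_invariant[OF A KA]
    show "(\<lambda>x. A *v x) ` C j = C j"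
    proof (rule invariant_image_eqI[OF A])
      fix x assume x: "x \<in> C j"
      then have xK: "x \<in> K" and xu: "\<And>u. u \<in> \<omega> \<Longrightarrow> x \<bullet> u \<le> (1 - t j) * support_fun K u" by (auto simp: C_def cut_def)
      have "(A *v x) \<bullet> u \<le> (1 - t j) * support_fun K u" if "u \<in> \<omega>" for u
        using xu[OF inv(2)[OF AG that]] unfolding sA by (simp only: orthogonal_matrix_simps[OF A])
      then show "A *v x \<in> C j" unfolding C_def cut_def using invariant_memD[OF A KA xK] by blast
      have "(transpose A *v x) \<bullet> u \<le> (1 - t j) * support_fun K u" if "u \<in> \<omega>" for u
      proof -
        have "support_fun K (A *v u) = support_fun K u" using sA[of "A *v u"] by (simp only: orthogonal_matrix_simps[OF A])
        then show ?thesis using xu[OF inv(1)[OF AG that]] by (simp only: orthogonal_matrix_simps[OF A])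
      qed
      then show "transpose A *v x \<in> C j" unfolding C_def cut_def using invariant_memD[OF A KA xK] by blast
    qed
  qed
  have "\<exists>\<xi>. \<xi> \<in> C j \<and> F (C j) \<xi> = \<Psi> (C j)" for j
    using \<Psi>_attained[of "C j"] Cp[of j] C0[of j] by (metis empty_iff)
  then obtain \<xi> where \<xi>: "\<And>j. \<xi> j \<in> C j" "\<And>j. F (C j) (\<xi> j) = \<Psi> (C j)" by metis
  have h_le: "support_fun (C j) u \<le> support_fun K u" for j u
    using Cp(3)[of j] C0[of j] by (intro support_fun_least) (auto intro: support_fun_upper[OF Kc(4)])
  have h_cut: "support_fun (C j) u \<le> (1 - t j) * support_fun K u" if "u \<in> \<omega>" for j u
    using that C0[of j] by (intro support_fun_least) (auto simp: C_def cut_def)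
  \<comment> \<open>The dilation \<open>s\<close> restores the volume \<open>V\<close>. Homogeneity
    turns maximality of \<open>K\<close> into a bound with the factor
    \<open>s powr q = (V / m) powr (q / n)\<close>, and \<open>m\<close> is bounded below by the
    volume estimate for cuts.\<close>
  have \<Psi>C: "\<Psi> (C j) \<le> ennreal ((1 / (1 - real ?n * t j * v j / V)) powr (q / real ?n) * P)" if j: "J \<le> j" for j
  proof -
    define m where "m = measure lborel (C j)"
    have m: "0 < m" using Cbody[OF j] by (simp add: m_def)
    define s where "s = (V / m) powr (1 / real ?n)"
    have s: "0 < s" "s ^ ?n = V / m" using V m by (auto simp: s_def powr_powr powr_realpow[symmetric])
    let ?L = "(*\<^sub>R) s ` C j"
    have mL: "measure lebesgue ?L = V"
      using measure_lborel_scaleR[OF s(1) borel_compact[OF Cp(1)], of j] emeasure_lborel_scaleR(1)[OF s(1) borel_compact[OF Cp(1)], of j]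
        s(2) m by (simp add: bor m_def)
    have cL: "compact ?L" "convex ?L" by (intro compact_continuous_image convex_scaling Cp continuous_intros)+
    have "admissible G ?L"
      unfolding admissible_def
    proof (intro conjI)
      show "convex_body ?L" using mL V by (intro convex_body_of_measure cL) simp
      show "0 \<in> ?L" using C0[of j] by (intro image_eqI[of _ _ 0]) auto
      show "body_invariant G ?L"
        unfolding body_invariant_def
      proof
        fix A assume "A \<in> G"
        then have "(\<lambda>x. A *v x) ` C j = C j" using Cinv by (simp add: body_invariant_def)
        moreover have "(\<lambda>x. A *v x) ` ?L = (*\<^sub>R) s ` ((\<lambda>x. A *v x) ` C j)"
          by (simp only: image_image matrix_vector_mult_scaleR)
        ultimately show "(\<lambda>x. A *v x) ` ?L = ?L" by simp
      qed
    qed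
    then have "\<Psi> ?L \<le> \<Psi> K" using mL V by (intro max) auto
    then have "ennreal (s powr (- q)) * \<Psi> (C j) \<le> ennreal P"
      using \<Psi>_scaleR[of "C j" s] Cp C0 s by (metis P(2) empty_iff)
    then have "ennreal (s powr q) * (ennreal (s powr (- q)) * \<Psi> (C j)) \<le> ennreal (s powr q) * ennreal P"
      by (rule mult_left_mono) simp
    moreover have "ennreal (s powr q) * (ennreal (s powr (- q)) * x) = x" for x
      using s(1) by (simp add: mult.assoc[symmetric] ennreal_mult[symmetric] powr_add[symmetric])
    ultimately have 1: "\<Psi> (C j) \<le> ennreal (s powr q * P)" using P by (simp add: ennreal_mult)
    have "s powr q = (V / m) powr (q / real ?n)" by (simp add: s_def powr_powr)
    also have "\<dots> \<le> (1 / (1 - real ?n * t j * v j / V)) powr (q / real ?n)"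
    proof (rule powr_mono2)
      have "V * (1 - real ?n * t j * v j / V) \<le> m" using Cv[of j] V by (simp add: m_def algebra_simps)
      then show "V / m \<le> 1 / (1 - real ?n * t j * v j / V)" using J[OF j] m V by (simp add: field_simps)
    qed (use q_pos V m in auto)
    finally have "s powr q * P \<le> (1 / (1 - real ?n * t j * v j / V)) powr (q / real ?n) * P" using P by (intro mult_right_mono) auto
    then show ?thesis using 1 by (meson ennreal_leI order_trans)
  qed
  \<comment> \<open>On \<omega> the pointwise gain applies with \<rho> the norm of
    \<open>\<xi> j\<close>; off \<omega> it suffices that the support function of the cut body is at
    most that of \<open>K\<close>.\<close>
  have FK: "F K (\<xi> j) + ennreal (q * t j * (1 + norm (\<xi> j) / \<delta>) powr (- q - 1)) * Ie \<le> \<Psi> (C j)" for j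
  proof -
    let ?c = "ennreal (q * t j * (1 + norm (\<xi> j) / \<delta>) powr (- q - 1))"
    have meas: "(\<lambda>u. inv_pow q (support_fun K u - \<xi> j \<bullet> u)) \<in> borel_measurable \<mu>" by (rule F_measurable[OF Kc(4,6)])
    have meas2: "(\<lambda>u. inv_pow q (support_fun K u) * indicator \<omega> u) \<in> borel_measurable \<mu>"
      using measurable_compose[OF hm inv_pow_measurable] \<omega>m by (intro borel_measurable_times_ennreal borel_measurable_indicator)
    have "F K (\<xi> j) + ?c * Ie = (\<integral>\<^sup>+u. inv_pow q (support_fun K u - \<xi> j \<bullet> u) + ?c * (inv_pow q (support_fun K u) * indicator \<omega> u) \<partial>\<mu>)"
      unfolding F_def Ie_def using meas meas2 by (simp add: nn_integral_add nn_integral_cmult)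
    also have "\<dots> \<le> F (C j) (\<xi> j)"
      unfolding F_def
    proof (rule nn_integral_mono)
      fix u assume "u \<in> space \<mu>"
      then have u: "norm u = 1" by (simp add: space_mu)
      show "inv_pow q (support_fun K u - \<xi> j \<bullet> u) + ?c * (inv_pow q (support_fun K u) * indicator \<omega> u) \<le> inv_pow q (support_fun (C j) u - \<xi> j \<bullet> u)"
      proof (cases "u \<in> \<omega>")
        case True
        have "\<bar>\<xi> j \<bullet> u\<bar> \<le> norm (\<xi> j)" using Cauchy_Schwarz_ineq2[of "\<xi> j" u] u by simp
        moreover have "\<xi> j \<bullet> u \<le> support_fun K u" using \<xi>(1)[of j] Cp(3)[of j] by (intro support_fun_upper[OF Kc(4)]) auto
        ultimately show ?thesis
          using inv_pow_cut[OF q_pos t(1) \<delta>(1) \<delta>(2)[OF True] _ _ h_cut[OF True], of "\<xi> j \<bullet> u" "norm (\<xi> j)" j] True by simp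
      next
        case False
        then show ?thesis using h_le[of j u] q_pos by (auto intro!: inv_pow_antimono)
      qed
    qed
    finally show ?thesis by (simp only: \<xi>(2))
  qed
  \<comment> \<open>From index \<open>J\<close> on the lower bound for the cut volume is positive,
    so the upper bound for \<Psi> of the cut body holds and squeezes \<open>F K\<close> at these
    points to \<Psi>(K).\<close>
  let ?x = "\<lambda>j. \<xi> (j + J)"
  have xK: "?x j \<in> K" for j using \<xi>(1)[of "j + J"] Cp(3)[of "j + J"] by blast
  have limF: "(\<lambda>j. F K (?x j)) \<longlonglongrightarrow> \<Psi> K"
  proof (rule tendsto_sandwich)
    show "\<forall>\<^sub>F j in sequentially. \<Psi> K \<le> F K (?x j)" using xK by (intro always_eventually allI \<Psi>_le)
    show "\<forall>\<^sub>F j in sequentially. F K (?x j) \<le> ennreal ((1 / (1 - real ?n * t (j + J) * v (j + J) / V)) powr (q / real ?n) * P)"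
    proof (intro always_eventually allI)
      fix j
      have "F K (?x j) \<le> F K (?x j) + ennreal (q * t (j + J) * (1 + norm (\<xi> (j + J)) / \<delta>) powr (- q - 1)) * Ie"
        by (metis add.right_neutral add_left_mono zero_le)
      also have "\<dots> \<le> \<Psi> (C (j + J))" by (rule FK)
      also have "\<dots> \<le> ennreal ((1 / (1 - real ?n * t (j + J) * v (j + J) / V)) powr (q / real ?n) * P)" by (rule \<Psi>C) simp
      finally show "F K (?x j) \<le> ennreal ((1 / (1 - real ?n * t (j + J) * v (j + J) / V)) powr (q / real ?n) * P)" .
    qed
    have "(\<lambda>j. (1 / (1 - real ?n * t (j + J) * v (j + J) / V)) powr (q / real ?n) * P) \<longlonglongrightarrow>
        (1 / (1 - real ?n * 0 * v0 / V)) powr (q / real ?n) * P"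
      using V by (intro tendsto_intros LIMSEQ_ignore_initial_segment tl vl) auto
    then have "(\<lambda>j. ennreal ((1 / (1 - real ?n * t (j + J) * v (j + J) / V)) powr (q / real ?n) * P)) \<longlonglongrightarrow>
        ennreal ((1 / (1 - real ?n * 0 * v0 / V)) powr (q / real ?n) * P)" by (rule tendsto_ennrealI)
    then show "(\<lambda>j. ennreal ((1 / (1 - real ?n * t (j + J) * v (j + J) / V)) powr (q / real ?n) * P)) \<longlonglongrightarrow> \<Psi> K"
      by (simp add: P(2))
  qed simp
  obtain r \<xi>0 where r: "strict_mono r" "(?x \<circ> r) \<longlonglongrightarrow> \<xi>0" "\<xi>0 \<in> K" "F K \<xi>0 \<le> \<Psi> K"
    by (rule minimizing_sequence_limit[OF Kc(4,6) xK limF])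
  have "\<xi>0 = 0"
  proof (rule F_unique_minimizer[OF Kc(4,5,2) r(3)])
    show "F K 0 < \<infinity>" using min P by simp
    show "F K \<xi>0 = F K 0" using r(4) \<Psi>_le[OF r(3)] min by (metis antisym)
    show "F K 0 \<le> F K \<zeta>" if "\<zeta> \<in> K" for \<zeta> using \<Psi>_le[OF that] min by simp
  qed
  define k where "k j = r j + J" for j
  have kmono: "strict_mono k" using r(1) by (auto simp: k_def strict_mono_def)
  have kJ: "J \<le> k j" for j by (simp add: k_def)
  have xl: "(\<lambda>j. \<xi> (k j)) \<longlonglongrightarrow> 0" using r(2) \<open>\<xi>0 = 0\<close> by (simp add: o_def k_def)
  define c where "c j = (1 + norm (\<xi> (k j)) / \<delta>) powr (- q - 1)" for j
  have "I * V \<le> P * v0"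
  proof (rule first_order_limit[where t = "\<lambda>j. t (k j)" and c = c and v = "\<lambda>j. v (k j)" and q = q and n = "real ?n"])
    show "(\<lambda>j. t (k j)) \<longlonglongrightarrow> 0" using LIMSEQ_subseq_LIMSEQ[OF tl kmono] by (simp add: o_def)
    show "(\<lambda>j. v (k j)) \<longlonglongrightarrow> v0" using LIMSEQ_subseq_LIMSEQ[OF vl kmono] by (simp add: o_def)
    have "c \<longlonglongrightarrow> (1 + norm (0 :: real^'n) / \<delta>) powr (- q - 1)"
      unfolding c_def using \<delta>(1) by (intro tendsto_intros xl) auto
    then show "c \<longlonglongrightarrow> 1" by simp
    fix j
    have "ennreal (P + q * t (k j) * c j * I) = ennreal P + ennreal (q * t (k j) * c j) * Ie"
      using P(1) I q_pos t(1)[of "k j"] by (simp add: c_def ennreal_mult)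
    also have "\<dots> \<le> F K (\<xi> (k j)) + ennreal (q * t (k j) * c j) * Ie"
      using \<Psi>_le[of "\<xi> (k j)" K] \<xi>(1)[of "k j"] Cp(3)[of "k j"] by (intro add_right_mono) (auto simp: P(2)[symmetric])
    also have "\<dots> \<le> \<Psi> (C (k j))" unfolding c_def by (rule FK)
    also have "\<dots> \<le> ennreal ((1 / (1 - real ?n * t (k j) * v (k j) / V)) powr (q / real ?n) * P)" by (rule \<Psi>C[OF kJ])
    finally show "P + q * t (k j) * c j * I \<le> (1 / (1 - real ?n * t (k j) * v (k j) / V)) powr (q / real ?n) * P"
      using P(1) by (subst (asm) ennreal_le_iff) auto
  qed (use V P I q_pos t J[OF kJ] in \<open>auto simp: c_def v_def\<close>)
  then show ?thesis
    unfolding Ie_def[symmetric] I(1) V(2) P(2) v0e using I(2) V(1) P(1) by (simp add: ennreal_mult[symmetric] ennreal_leI v0_def)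
qed simp

end

section \<open>Coercivity for densities\<close>

lemma sets_sphere_measure [simp, measurable_cong]:
  "sets (sphere_measure :: (real^'n) measure) = sets (restrict_space borel (sphere 0 1))"
  by (simp add: sphere_measure_def sets_restrict_space)

lemma matrix_norm_row_le: "\<bar>D $ i \<bullet> u\<bar> \<le> norm ((D :: real^'n^'m) *v u)"
  using component_le_norm_cart[of "D *v u" i] by (simp add: matrix_vector_mul_component)

text \<open>The normalised matrices have a limit \<open>N0\<close> of norm 1 along a subsequence,
  and \<open>v\<close> is a nonzero row of it. Off the hyperplane orthogonal to \<open>v\<close>,
  the corresponding entry of the image of \<open>u\<close> already grows like the norm of the
  matrix.\<close>

lemma matrix_sequence_blowup:
  fixes D :: "nat \<Rightarrow> real^'n^'m"
  assumes "\<And>j. D j \<noteq> 0" "filterlim (\<lambda>j. norm (D j)) at_top sequentially"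
  obtains r v where "strict_mono (r :: nat \<Rightarrow> nat)" "v \<noteq> 0"
    "\<And>u. u \<bullet> v \<noteq> 0 \<Longrightarrow> filterlim (\<lambda>j. norm (D (r j) *v u)) at_top sequentially"
proof -
  define N where "N j = D j /\<^sub>R norm (D j)" for j
  have "N j \<in> sphere 0 1" for j using assms(1)[of j] by (simp add: N_def)
  then obtain N0 r where N0: "N0 \<in> sphere 0 1" "strict_mono (r :: nat \<Rightarrow> nat)" "(N \<circ> r) \<longlonglongrightarrow> N0"
    using compact_sphere[of 0 1] unfolding compact_def by metis
  have "N0 \<noteq> 0" using N0(1) by auto
  then obtain i where i: "N0 $ i \<noteq> 0" by (metis vec_eq_iff zero_index)
  show ?thesis
  proof (rule that[OF N0(2) i])
    fix u assume u: "u \<bullet> N0 $ i \<noteq> 0"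
    have "(\<lambda>j. \<bar>N (r j) $ i \<bullet> u\<bar>) \<longlonglongrightarrow> \<bar>N0 $ i \<bullet> u\<bar>"
      using N0(3) by (intro tendsto_intros) (simp add: o_def)
    moreover have "filterlim (\<lambda>j. norm (D (r j))) at_top sequentially"
      using filterlim_compose[OF assms(2) filterlim_subseq[OF N0(2)]] .
    ultimately have "filterlim (\<lambda>j. \<bar>N (r j) $ i \<bullet> u\<bar> * norm (D (r j))) at_top sequentially"
      using u by (intro filterlim_tendsto_pos_mult_at_top[where c = "\<bar>N0 $ i \<bullet> u\<bar>"]) (auto simp: inner_commute)
    then show "filterlim (\<lambda>j. norm (D (r j) *v u)) at_top sequentially"
    proof (rule filterlim_at_top_mono)
      show "\<forall>\<^sub>F j in sequentially. \<bar>N (r j) $ i \<bullet> u\<bar> * norm (D (r j)) \<le> norm (D (r j) *v u)"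
      proof (intro always_eventually allI)
        fix j
        have "\<bar>N (r j) $ i \<bullet> u\<bar> * norm (D (r j)) = \<bar>D (r j) $ i \<bullet> u\<bar>"
          using assms(1)[of "r j"] by (simp add: N_def abs_mult divide_simps)
        then show "\<bar>N (r j) $ i \<bullet> u\<bar> * norm (D (r j)) \<le> norm (D (r j) *v u)"
          using matrix_norm_row_le[of "D (r j)" i u] by simp
      qed
    qed
  qed
qed

text \<open>Here \<open>x\<close> will be the norm of the image of \<open>u\<close>. For
  \<open>x \<ge> M\<close> the power itself is small. For \<open>x < M\<close> Young's inequality
  with weight \<open>q / n\<close> separates \<open>x powr (- n)\<close>, whose integral is bounded
  and whose coefficient is small with \<kappa>, from \<open>f powr r\<close>, which is integrable
  and confined to a shrinking set.\<close>

lemma density_split_bound: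
  fixes x M f \<kappa> q n r c :: real
  assumes "0 < x" "0 < M" "0 \<le> f" "0 < \<kappa>" "0 < q" "q < n" "0 \<le> c" and r: "r = n / (n - q)"
  shows "c * f * x powr (- q) \<le> c * f * M powr (- q) + (c * \<kappa> powr (1 - q / n)) * x powr (- n)
     + (if x < M then \<kappa> powr (- (q / n)) * (c * f powr r) else 0)"
proof (cases "x < M")
  case False
  have "x powr (- q) \<le> M powr (- q)" using False assms by (intro powr_mono2') auto
  then have "c * f * x powr (- q) \<le> c * f * M powr (- q)" using assms by (intro mult_left_mono) auto
  then show ?thesis using False assms by (simp add: add_increasing2)
next
  case True
  let ?\<theta> = "q / n"
  have \<theta>: "0 < ?\<theta>" "?\<theta> < 1" using assms by auto
  have n0: "n \<noteq> 0" "n - q \<noteq> 0" using assms by auto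
  have A: "(x powr (- n)) powr ?\<theta> = x powr (- q)" using assms n0 by (simp add: powr_powr)
  have "r * (1 - ?\<theta>) = 1" unfolding r using n0 by (simp add: field_simps)
  then have B: "(f powr r) powr (1 - ?\<theta>) = f" using assms by (simp add: powr_powr)
  have "x powr (- q) * f \<le> \<kappa> powr (1 - ?\<theta>) * x powr (- n) + \<kappa> powr (- ?\<theta>) * f powr r"
    using weighted_young[of "x powr (- n)" "f powr r" \<kappa> ?\<theta>] assms \<theta> unfolding A B by simp
  then have "c * (x powr (- q) * f) \<le> c * (\<kappa> powr (1 - ?\<theta>) * x powr (- n) + \<kappa> powr (- ?\<theta>) * f powr r)"
    using assms by (intro mult_left_mono)
  moreover have "0 \<le> c * f * M powr (- q)" using assms by simp
  ultimately show ?thesis using True by (simp add: algebra_simps)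
qed

lemma ennreal_add_le_less:
  fixes x y a b :: ennreal
  assumes "x \<le> a" "y < b" "a < \<infinity>"
  shows "x + y < a + b"
proof -
  have "x + y \<le> a + y" using assms(1) by (rule add_right_mono)
  also have "\<dots> < a + b" using assms by (simp add: ennreal_add_left_cancel_less)
  finally show ?thesis .
qed

lemma density_coercive:
  fixes p :: real and f :: "real^'n \<Rightarrow> real"
  assumes p: "- real CARD('n) < p" "p < 0"
    and f: "f \<in> Lq_functions (real CARD('n) / (real CARD('n) + p)) sphere_measure"
    and f0: "\<forall>u \<in> sphere 0 1. 0 \<le> f u"
    and \<mu>: "\<mu> = density sphere_measure (\<lambda>u. ennreal (f u))"
    and nz: "emeasure \<mu> (space \<mu>) \<noteq> 0"
  shows "coercive_functional \<mu> (- p)"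
proof -
  let ?n = "real CARD('n)" and ?\<sigma> = "cone_measure (cball (0::real^'n) 1)"
  define q where "q = - p"
  define r where "r = ?n / (?n - q)"
  define cn where "cn = hausdorff_scale TYPE('n) * ?n"
  have q: "0 < q" "q < ?n" using p by (auto simp: q_def)
  have r1: "1 \<le> r" using q by (simp add: r_def)
  have cn0: "0 \<le> cn" using hausdorff_scale(1)[where 'n='n] by (simp add: cn_def)
  have sm: "(sphere_measure :: (real^'n) measure) = density ?\<sigma> (\<lambda>_. ennreal cn)"
    unfolding cn_def by (rule sphere_measure_eq)
  have fm[measurable]: "f \<in> borel_measurable ?\<sigma>"
    using f by (simp add: Lq_functions_def measurable_def space_cone_measure) (simp add: sphere_measure_def space_restrict_space)
  have int: "integrable (sphere_measure :: (real^'n) measure) (\<lambda>u. \<bar>f u\<bar> powr r)"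
    using f by (simp add: Lq_functions_def r_def q_def)
  have \<mu>\<sigma>: "\<mu> = density ?\<sigma> (\<lambda>u. ennreal cn * ennreal (f u))"
    unfolding \<mu> sm by (rule density_density_eq) auto
  have space\<sigma>: "space ?\<sigma> = sphere 0 1" by (rule space_cone_measure)
  have sets\<mu>: "sets \<mu> = sets (restrict_space borel (sphere 0 1))" unfolding \<mu>\<sigma> by simp
  have space\<mu>: "space \<mu> = sphere 0 1" unfolding \<mu>\<sigma> using space\<sigma> by simp
  define W where "W u = ennreal (cn * \<bar>f u\<bar> powr r)" for u
  have W[measurable]: "W \<in> borel_measurable ?\<sigma>" unfolding W_def by measurable
  have Wfin: "(\<integral>\<^sup>+u. W u \<partial>?\<sigma>) < \<infinity>"
  proof -
    have "(\<integral>\<^sup>+u. ennreal (\<bar>f u\<bar> powr r) \<partial>sphere_measure) < \<infinity>"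
      using int by (simp add: integrable_iff_bounded)
    also have "(\<integral>\<^sup>+u. ennreal (\<bar>f u\<bar> powr r) \<partial>sphere_measure) = (\<integral>\<^sup>+u. ennreal cn * ennreal (\<bar>f u\<bar> powr r) \<partial>?\<sigma>)"
      unfolding sm by (rule nn_integral_density) measurable
    also have "\<dots> = (\<integral>\<^sup>+u. W u \<partial>?\<sigma>)" unfolding W_def using cn0 by (simp add: ennreal_mult)
    finally show ?thesis .
  qed
  have \<sigma>fin: "emeasure ?\<sigma> A < \<infinity>" for A by (rule cone_measure_finite(2)[OF convex_body_unit_ball]) simp
  have int\<mu>: "(\<integral>\<^sup>+u. g u \<partial>\<mu>) = (\<integral>\<^sup>+u. ennreal cn * ennreal (f u) * g u \<partial>?\<sigma>)" if "g \<in> borel_measurable ?\<sigma>" for g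
    unfolding \<mu>\<sigma> using that by (intro nn_integral_density) auto
  have sph: "sphere (0::real^'n) 1 \<in> sets ?\<sigma>" unfolding sets_cone_measure by (intro sphere_setI) auto
  have em\<mu>: "emeasure \<mu> (sphere 0 1) = (\<integral>\<^sup>+u. ennreal cn * ennreal (f u) \<partial>?\<sigma>)"
  proof -
    have "emeasure \<mu> (sphere 0 1) = (\<integral>\<^sup>+u. 1 \<partial>\<mu>)" using space\<mu> by simp
    then show ?thesis using int\<mu>[of "\<lambda>_. 1"] by simp
  qed
  \<comment> \<open>Since \<open>r \<ge> 1\<close>, \<open>f u\<close> is at most
    \<open>1 + f u powr r\<close>, and the sphere has finite measure.\<close>
  have \<mu>fin: "emeasure \<mu> (sphere 0 1) < \<infinity>"
  proof -
    have "(\<integral>\<^sup>+u. ennreal cn * ennreal (f u) \<partial>?\<sigma>) \<le> (\<integral>\<^sup>+u. ennreal cn + W u \<partial>?\<sigma>)"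
    proof (rule nn_integral_mono)
      fix u assume "u \<in> space ?\<sigma>"
      then have fu: "0 \<le> f u" using f0 space\<sigma> by auto
      have "f u \<le> 1 + f u powr r"
      proof (cases "f u \<le> 1")
        case False
        then have "f u powr 1 \<le> f u powr r" using r1 by (intro powr_mono) auto
        then show ?thesis using False by simp
      qed (simp add: add_increasing2)
      then have "cn * f u \<le> cn * (1 + f u powr r)" using cn0 by (rule mult_left_mono)
      then show "ennreal cn * ennreal (f u) \<le> ennreal cn + W u"
        using cn0 fu by (simp add: W_def ennreal_mult[symmetric] ennreal_plus[symmetric] distrib_left ennreal_leI del: ennreal_plus)
    qed
    also have "\<dots> = ennreal cn * emeasure ?\<sigma> (sphere 0 1) + (\<integral>\<^sup>+u. W u \<partial>?\<sigma>)"
      by (simp add: nn_integral_add space\<sigma>)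
    also have "\<dots> < \<infinity>" using \<sigma>fin Wfin by (simp add: ennreal_mult_less_top)
    finally show ?thesis unfolding em\<mu> .
  qed
  show ?thesis
    unfolding q_def[symmetric]
  proof (unfold_locales, rule sets\<mu>, rule \<mu>fin)
    show "emeasure \<mu> (sphere 0 1) \<noteq> 0" using nz space\<mu> by simp
    show "0 < q" by (rule q)
    show "emeasure \<mu> {u \<in> sphere 0 1. u \<bullet> v = 0} = 0" if "v \<noteq> 0" for v
    proof -
      have "closed {u. u \<bullet> v = 0}" by (intro closed_Collect_eq continuous_intros)
      then have "sphere 0 1 \<inter> {u. u \<bullet> v = 0} \<in> sets borel" by (intro borel_closed closed_Int) auto
      then have A: "{u \<in> sphere 0 1. u \<bullet> v = 0} \<in> sets ?\<sigma>"
        unfolding sets_cone_measure by (intro sphere_setI) (auto simp: Int_def)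
      then have "{u \<in> sphere 0 1. u \<bullet> v = 0} \<in> null_sets ?\<sigma>"
        using sphere_cone_subsphere_null[OF that] by (intro null_setsI)
      moreover have "absolutely_continuous ?\<sigma> \<mu>"
        unfolding \<mu>\<sigma> by (intro absolutely_continuousI_density) auto
      ultimately show ?thesis unfolding absolutely_continuous_def by auto
    qed
    fix D :: "nat \<Rightarrow> real^'n^'n" and d a :: real
    assume d: "0 < d" "\<And>j. d \<le> \<bar>det (D j)\<bar>" and lim: "filterlim (\<lambda>j. norm (D j)) at_top sequentially" and a: "0 < a"
    have detD: "det (D j) \<noteq> 0" for j using d(1) d(2)[of j] by auto
    then have D0: "D j \<noteq> 0" for j using det_0[where 'a=real and 'n='n] by (metis mat_0)
    obtain s v where s: "strict_mono (s :: nat \<Rightarrow> nat)" and v: "v \<noteq> 0"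
      and blow: "\<And>u. u \<bullet> v \<noteq> 0 \<Longrightarrow> filterlim (\<lambda>j. norm (D (s j) *v u)) at_top sequentially"
      using matrix_sequence_blowup[OF D0 lim] by blast
    let ?\<theta> = "q / ?n"
    have \<theta>: "0 < ?\<theta>" "?\<theta> < 1" using q by auto
    define w where "w = unit_ball_vol ?n / d"
    have w: "0 \<le> w" using d by (simp add: w_def)
    \<comment> \<open>The three terms of \<open>density_split_bound\<close> are brought to at most
      \<open>a / 3\<close> each: \<kappa> takes care of the one with exponent \<open>- n\<close>,
      \<open>M\<close> of the one with \<open>M powr (- q)\<close>, and a late index
      \<open>j\<close> of the last, which becomes strictly smaller. Adding 1 in the denominators
      covers the case of a factor 0.\<close>
    define \<kappa> where "\<kappa> = (a / (3 * (cn * w + 1))) powr (1 / (1 - ?\<theta>))"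
    have cw: "0 < cn * w + 1" using cn0 w by (simp add: add_nonneg_pos)
    have \<kappa>: "0 < \<kappa>" "\<kappa> powr (1 - ?\<theta>) = a / (3 * (cn * w + 1))"
      using a cw \<theta> by (auto simp: \<kappa>_def powr_powr)
    define m where "m = enn2real (emeasure \<mu> (sphere 0 1))"
    have m: "0 \<le> m" "emeasure \<mu> (sphere 0 1) = ennreal m" using \<mu>fin by (auto simp: m_def less_top)
    define M where "M = (a / (3 * (m + 1))) powr (- 1 / q)"
    have M: "0 < M" "M powr (- q) = a / (3 * (m + 1))"
      using a m q by (auto simp: M_def powr_powr)
    define H where "H j u = W u * indicator {u. norm (D (s j) *v u) < M} u" for j u
    have nD[measurable]: "(\<lambda>u. norm (D j *v u)) \<in> borel_measurable ?\<sigma>" for j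
      by (subst measurable_cong_sets[OF sets_cone_measure refl])
         (intro measurable_restrict_space1 borel_measurable_continuous_onI continuous_on_matrix_norm)
    have Hm[measurable]: "H j \<in> borel_measurable ?\<sigma>" for j
    proof -
      have "H j = (\<lambda>u. if norm (D (s j) *v u) < M then W u else 0)" by (auto simp: H_def indicator_def)
      then show ?thesis by simp
    qed
    \<comment> \<open>Dominated convergence with majorant \<open>W\<close>: off a null great
      subsphere the norms blow up, so \<open>H j u\<close> is eventually 0.\<close>
    have "(\<lambda>j. \<integral>\<^sup>+u. H j u \<partial>?\<sigma>) \<longlonglongrightarrow> (\<integral>\<^sup>+u. 0 \<partial>?\<sigma>)"
    proof (rule nn_integral_dominated_convergence[where w = W])
      show "AE u in ?\<sigma>. H j u \<le> W u" for j by (rule AE_I2) (auto simp: H_def indicator_def)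
      have "AE u in ?\<sigma>. u \<bullet> v \<noteq> 0"
      proof (rule AE_I)
        show "emeasure ?\<sigma> {u \<in> sphere 0 1. u \<bullet> v = 0} = 0" by (rule sphere_cone_subsphere_null[OF v])
        have "closed {u. u \<bullet> v = 0}" by (intro closed_Collect_eq continuous_intros)
        then have "sphere 0 1 \<inter> {u. u \<bullet> v = 0} \<in> sets borel" by (intro borel_closed closed_Int) auto
        then show "{u \<in> sphere 0 1. u \<bullet> v = 0} \<in> sets ?\<sigma>"
          unfolding sets_cone_measure by (intro sphere_setI) (auto simp: Int_def)
      qed (auto simp: space\<sigma>)
      then show "AE u in ?\<sigma>. (\<lambda>j. H j u) \<longlonglongrightarrow> 0"
      proof eventually_elim
        case (elim u)
        have "eventually (\<lambda>j. M \<le> norm (D (s j) *v u)) sequentially"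
          using blow[OF elim] by (simp add: filterlim_at_top)
        then have "eventually (\<lambda>j. H j u = 0) sequentially" by eventually_elim (simp add: H_def)
        then show ?case by (rule tendsto_eventually)
      qed
    qed (use Wfin in auto)
    then have "(\<lambda>j. \<integral>\<^sup>+u. H j u \<partial>?\<sigma>) \<longlonglongrightarrow> 0" by simp
    moreover have "(0::ennreal) < ennreal (a / 3 * \<kappa> powr ?\<theta>)" using a \<kappa> by simp
    ultimately have "eventually (\<lambda>j. (\<integral>\<^sup>+u. H j u \<partial>?\<sigma>) < ennreal (a / 3 * \<kappa> powr ?\<theta>)) sequentially"
      by (rule order_tendstoD(2))
    then obtain j where j: "(\<integral>\<^sup>+u. H j u \<partial>?\<sigma>) < ennreal (a / 3 * \<kappa> powr ?\<theta>)" by (auto simp: eventually_sequentially)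
    let ?D = "D (s j)"
    have "(\<integral>\<^sup>+u. inv_pow q (norm (?D *v u)) \<partial>\<mu>) = (\<integral>\<^sup>+u. ennreal cn * ennreal (f u) * inv_pow q (norm (?D *v u)) \<partial>?\<sigma>)"
      using measurable_compose[OF nD inv_pow_measurable] by (intro int\<mu>)
    also have "\<dots> \<le> (\<integral>\<^sup>+u. ennreal (M powr (- q)) * (ennreal cn * ennreal (f u))
        + (ennreal (cn * \<kappa> powr (1 - ?\<theta>)) * inv_pow ?n (norm (?D *v u)) + ennreal (\<kappa> powr (- ?\<theta>)) * H j u) \<partial>?\<sigma>)"
    proof (rule nn_integral_mono)
      fix u assume "u \<in> space ?\<sigma>"
      then have u: "norm u = 1" "0 \<le> f u" using f0 space\<sigma> by auto
      have x: "0 < norm (?D *v u)" using u by (intro matrix_norm_pos[OF detD]) auto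
      let ?x = "norm (?D *v u)"
      have "ennreal cn * ennreal (f u) * inv_pow q ?x = ennreal (cn * f u * ?x powr (- q))"
        using x u cn0 by (simp add: inv_pow_def ennreal_mult[symmetric])
      also have "\<dots> \<le> ennreal (cn * f u * M powr (- q) + (cn * \<kappa> powr (1 - ?\<theta>)) * ?x powr (- ?n)
           + (if ?x < M then \<kappa> powr (- ?\<theta>) * (cn * f u powr r) else 0))"
        by (intro ennreal_leI density_split_bound x M u \<kappa> q cn0 r_def)
      also have "\<dots> = ennreal (M powr (- q)) * (ennreal cn * ennreal (f u))
        + (ennreal (cn * \<kappa> powr (1 - ?\<theta>)) * inv_pow ?n ?x + ennreal (\<kappa> powr (- ?\<theta>)) * H j u)"
        using x u cn0 by (auto simp: H_def W_def inv_pow_def ennreal_mult[symmetric] ennreal_plus[symmetric] mult_ac add_ac simp del: ennreal_plus)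
      finally show "ennreal cn * ennreal (f u) * inv_pow q ?x \<le> ennreal (M powr (- q)) * (ennreal cn * ennreal (f u))
        + (ennreal (cn * \<kappa> powr (1 - ?\<theta>)) * inv_pow ?n ?x + ennreal (\<kappa> powr (- ?\<theta>)) * H j u)" .
    qed
    also have "\<dots> = ennreal (M powr (- q)) * emeasure \<mu> (sphere 0 1)
        + (ennreal (cn * \<kappa> powr (1 - ?\<theta>)) * (\<integral>\<^sup>+u. inv_pow ?n (norm (?D *v u)) \<partial>?\<sigma>) + ennreal (\<kappa> powr (- ?\<theta>)) * (\<integral>\<^sup>+u. H j u \<partial>?\<sigma>))"
    proof -
      have [measurable]: "(\<lambda>u. inv_pow ?n (norm (?D *v u))) \<in> borel_measurable ?\<sigma>" by (rule measurable_compose[OF nD inv_pow_measurable])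
      show ?thesis unfolding em\<mu> by (simp add: nn_integral_add nn_integral_cmult)
    qed
    also have "\<dots> < ennreal a"
    proof -
      have 1: "ennreal (M powr (- q)) * emeasure \<mu> (sphere 0 1) \<le> ennreal (a / 3)"
      proof -
        have "M powr (- q) * m \<le> a / 3" unfolding M(2) using a m by (simp add: field_simps)
        then show ?thesis using m(1) by (simp add: m(2) ennreal_mult[symmetric] ennreal_leI del: M)
      qed
      have 2: "ennreal (cn * \<kappa> powr (1 - ?\<theta>)) * (\<integral>\<^sup>+u. inv_pow ?n (norm (?D *v u)) \<partial>?\<sigma>) \<le> ennreal (a / 3)"
      proof -
        have "(\<integral>\<^sup>+u. inv_pow ?n (norm (?D *v u)) \<partial>?\<sigma>) \<le> ennreal (unit_ball_vol ?n / \<bar>det ?D\<bar>)"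
          by (rule sphere_integral_inv_pow[OF detD])
        also have "\<dots> \<le> ennreal w" unfolding w_def using d by (intro ennreal_leI divide_left_mono) (auto intro!: mult_pos_pos simp: detD)
        finally have "ennreal (cn * \<kappa> powr (1 - ?\<theta>)) * (\<integral>\<^sup>+u. inv_pow ?n (norm (?D *v u)) \<partial>?\<sigma>) \<le> ennreal (cn * \<kappa> powr (1 - ?\<theta>)) * ennreal w"
          by (rule mult_left_mono) simp
        also have "\<dots> = ennreal (cn * w * (a / (3 * (cn * w + 1))))"
          unfolding \<kappa>(2) using cn0 w a cw by (subst ennreal_mult[symmetric]) (auto simp: mult_ac)
        also have "cn * w * (a / (3 * (cn * w + 1))) \<le> a / 3" using a cw by (simp add: field_simps)
        finally show ?thesis by (simp add: ennreal_leI)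
      qed
      have 3: "ennreal (\<kappa> powr (- ?\<theta>)) * (\<integral>\<^sup>+u. H j u \<partial>?\<sigma>) < ennreal (a / 3)"
      proof -
        have "ennreal (\<kappa> powr (- ?\<theta>)) * (\<integral>\<^sup>+u. H j u \<partial>?\<sigma>) < ennreal (\<kappa> powr (- ?\<theta>)) * ennreal (a / 3 * \<kappa> powr ?\<theta>)"
          using \<kappa> by (intro ennreal_mult_strict_left_mono j) auto
        also have "\<dots> = ennreal (a / 3)" using \<kappa> a by (simp add: ennreal_mult[symmetric] powr_minus divide_simps)
        finally show ?thesis .
      qed
      have "ennreal (cn * \<kappa> powr (1 - ?\<theta>)) * (\<integral>\<^sup>+u. inv_pow ?n (norm (?D *v u)) \<partial>?\<sigma>) + ennreal (\<kappa> powr (- ?\<theta>)) * (\<integral>\<^sup>+u. H j u \<partial>?\<sigma>) < ennreal (a / 3) + ennreal (a / 3)"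
        using 2 3 by (intro ennreal_add_le_less) auto
      from ennreal_add_le_less[OF 1 this] have "ennreal (M powr (- q)) * emeasure \<mu> (sphere 0 1)
        + (ennreal (cn * \<kappa> powr (1 - ?\<theta>)) * (\<integral>\<^sup>+u. inv_pow ?n (norm (?D *v u)) \<partial>?\<sigma>) + ennreal (\<kappa> powr (- ?\<theta>)) * (\<integral>\<^sup>+u. H j u \<partial>?\<sigma>))
        < ennreal (a / 3) + (ennreal (a / 3) + ennreal (a / 3))"
        by simp
      also have "\<dots> = ennreal a" using a by (simp add: ennreal_plus[symmetric] del: ennreal_plus)
      finally show ?thesis .
    qed
    finally show "\<exists>j. (\<integral>\<^sup>+u. inv_pow q (norm (D j *v u)) \<partial>\<mu>) < ennreal a" by blast
  qed
qed

section \<open>Measures agreeing on invariant sets\<close>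

lemma integral_continuous_bounded:
  fixes \<psi> :: "'a::euclidean_space \<Rightarrow> real"
  assumes N: "finite_measure N" "sets N = sets (restrict_space borel S)" and S: "S \<subseteq> B"
    and \<psi>: "continuous_on B \<psi>" "\<And>x. x \<in> B \<Longrightarrow> \<bar>\<psi> x\<bar> \<le> c"
  shows "\<psi> \<in> borel_measurable N" "integrable N \<psi>"
proof -
  have sp: "space N = S" using sets_eq_imp_space_eq[OF N(2)] by (simp add: space_restrict_space)
  have "continuous_on S \<psi>" using \<psi>(1) S by (rule continuous_on_subset)
  then have "\<psi> \<in> borel_measurable (restrict_space borel S)" by (rule borel_measurable_continuous_on_restrict)
  then show m: "\<psi> \<in> borel_measurable N" by (subst measurable_cong_sets[OF N(2) refl])
  show "integrable N \<psi>"
    using \<psi>(2) S sp by (intro finite_measure.integrable_const_bound[OF N(1), where B = c] m AE_I2) auto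
qed

lemma integral_uniform_limit:
  fixes \<psi> :: "nat \<Rightarrow> 'a::euclidean_space \<Rightarrow> real"
  assumes N: "finite_measure N" "sets N = sets (restrict_space borel S)" and S: "S \<subseteq> B"
    and \<psi>: "\<And>k. continuous_on B (\<psi> k)" "\<And>k x. x \<in> B \<Longrightarrow> \<bar>\<psi> k x\<bar> \<le> c" and g: "continuous_on B g"
    and lim: "\<And>x. x \<in> B \<Longrightarrow> (\<lambda>k. \<psi> k x) \<longlonglongrightarrow> g x"
  shows "(\<lambda>k. \<integral>x. \<psi> k x \<partial>N) \<longlonglongrightarrow> (\<integral>x. g x \<partial>N)"
proof (rule integral_dominated_convergence[where w = "\<lambda>_. c"])
  have sp: "space N = S" using sets_eq_imp_space_eq[OF N(2)] by (simp add: space_restrict_space)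
  have gc: "\<bar>g x\<bar> \<le> c" if "x \<in> B" for x
    using tendsto_rabs[OF lim[OF that]] \<psi>(2)[OF that] by (intro LIMSEQ_le_const2) auto
  show "g \<in> borel_measurable N" by (rule integral_continuous_bounded(1)[OF N S g gc])
  show "\<psi> k \<in> borel_measurable N" for k by (rule integral_continuous_bounded(1)[OF N S \<psi>])
  show "integrable N (\<lambda>_. c)" using N(1) by (simp add: finite_measure.integrable_const)
  show "AE x in N. (\<lambda>k. \<psi> k x) \<longlonglongrightarrow> g x" using lim S sp by (intro AE_I2) auto
  show "AE x in N. norm (\<psi> k x) \<le> c" for k using \<psi>(2) S sp by (intro AE_I2) auto
qed

lemma transpose_lipschitz:
  fixes A :: "real^'n^'n" and \<psi> :: "real^'n \<Rightarrow> real"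
  assumes A: "orthogonal_matrix A" and \<psi>: "\<And>x y. x \<in> cball 0 r \<Longrightarrow> y \<in> cball 0 r \<Longrightarrow> \<bar>\<psi> x - \<psi> y\<bar> \<le> L * norm (x - y)"
    and "x \<in> cball 0 r" "y \<in> cball 0 r"
  shows "\<bar>\<psi> (transpose A *v x) - \<psi> (transpose A *v y)\<bar> \<le> L * norm (x - y)"
proof -
  have "norm (transpose A *v x - transpose A *v y) = norm (x - y)"
    unfolding matrix_vector_mult_diff_distrib[symmetric] by (rule orthogonal_matrix_simps(6)[OF A])
  moreover have "transpose A *v x \<in> cball 0 r" "transpose A *v y \<in> cball 0 r"
    using assms(3,4) by (simp_all only: mem_cball dist_0_norm orthogonal_matrix_simps[OF A])
  ultimately show ?thesis using \<psi> by metis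
qed

text \<open>Replaces averaging over the Haar measure of \<open>G\<close>: among the functions with the same Lipschitz
  constant and the same integrals as \<open>\<phi>\<close>, the one of least \<open>L\<^sup>2\<close> norm is \<open>G\<close>-invariant by
  uniqueness.\<close>

lemma invariant_average_exists:
  fixes m w :: "(real^'n) measure" and \<phi> :: "real^'n \<Rightarrow> real"
  assumes fin: "finite_measure m" "finite_measure w"
    and sets: "sets m = sets (restrict_space borel (sphere 0 1))" "sets w = sets (restrict_space borel (sphere 0 1))"
    and G: "\<And>A. A \<in> G \<Longrightarrow> orthogonal_matrix A"
    and inv: "measure_invariant G m" "measure_invariant G w"
    and \<phi>: "\<And>x. 0 \<le> \<phi> x \<and> \<phi> x \<le> 1" "\<And>x y. \<bar>\<phi> x - \<phi> y\<bar> \<le> L * norm (x - y)" and L: "0 < L"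
  obtains \<psi> where "continuous_on (sphere 0 1) \<psi>" "\<And>x. x \<in> sphere 0 1 \<Longrightarrow> 0 \<le> \<psi> x \<and> \<psi> x \<le> 1"
    "\<And>A x. A \<in> G \<Longrightarrow> x \<in> sphere 0 1 \<Longrightarrow> \<psi> (transpose A *v x) = \<psi> x"
    "(\<integral>x. \<psi> x \<partial>m) = (\<integral>x. \<phi> x \<partial>m)" "(\<integral>x. \<psi> x \<partial>w) = (\<integral>x. \<phi> x \<partial>w)"
proof -
  let ?B = "cball (0::real^'n) 2" and ?S = "sphere (0::real^'n) 1"
  \<comment> \<open>Lebesgue measure on a ball containing the sphere in its interior. It is
    invariant under orthogonal maps and charges every nonempty open part of the ball, so a
    continuous function with vanishing square integral vanishes on the sphere.\<close>
  define \<nu> where "\<nu> = restrict_space lborel ?B"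
  have SB: "?S \<subseteq> ?B" by auto
  have sets\<nu>: "sets \<nu> = sets (restrict_space borel ?B)" by (simp add: \<nu>_def sets_restrict_space)
  have sp\<nu>: "space \<nu> = ?B" by (simp add: \<nu>_def space_restrict_space)
  have em\<nu>: "emeasure \<nu> X = emeasure lborel X" if "X \<subseteq> ?B" "X \<in> sets borel" for X
    unfolding \<nu>_def using that by (intro emeasure_restrict_space) auto
  have fin\<nu>: "finite_measure \<nu>"
  proof (rule finite_measureI)
    have "emeasure lborel ?B < \<infinity>" by (rule emeasure_bounded_finite) simp
    then show "emeasure \<nu> (space \<nu>) \<noteq> \<infinity>" unfolding sp\<nu> by (simp add: em\<nu>)
  qed
  \<comment> \<open>Bounds, Lipschitz constant and integrals all survive uniform limits, composition
    with the transposes of elements of \<open>G\<close> (the measures are invariant) and averaging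
    of two functions. Arzela-Ascoli then provides a minimiser of \<open>Q\<close>.\<close>
  define C where "C = {\<psi> :: real^'n \<Rightarrow> real. (\<forall>x\<in>?B. 0 \<le> \<psi> x \<and> \<psi> x \<le> 1)
      \<and> (\<forall>x\<in>?B. \<forall>y\<in>?B. \<bar>\<psi> x - \<psi> y\<bar> \<le> L * norm (x - y))
      \<and> (\<integral>x. \<psi> x \<partial>m) = (\<integral>x. \<phi> x \<partial>m) \<and> (\<integral>x. \<psi> x \<partial>w) = (\<integral>x. \<phi> x \<partial>w)}"
  define Q where "Q \<psi> = (\<integral>x. (\<psi> x)\<^sup>2 \<partial>\<nu>)" for \<psi> :: "real^'n \<Rightarrow> real"
  have lip_cont: "continuous_on ?B \<psi>" if "\<And>x y. x \<in> ?B \<Longrightarrow> y \<in> ?B \<Longrightarrow> \<bar>\<psi> x - \<psi> y\<bar> \<le> L * norm (x - y)" for \<psi> :: "real^'n \<Rightarrow> real"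
  proof -
    have "L-lipschitz_on ?B \<psi>" using that L by (intro lipschitz_onI) (auto simp: dist_norm)
    then show ?thesis by (rule lipschitz_on_continuous_on)
  qed
  have Cc: "continuous_on ?B \<psi>" if "\<psi> \<in> C" for \<psi> using that by (intro lip_cont) (auto simp: C_def)
  have Cb: "0 \<le> \<psi> x" "\<psi> x \<le> 1" "\<bar>\<psi> x\<bar> \<le> 1" if "\<psi> \<in> C" "x \<in> ?B" for \<psi> x using that by (auto simp: C_def)
  have Q0: "0 \<le> Q \<psi>" for \<psi> unfolding Q_def by simp
  have "\<phi> \<in> C" using \<phi> by (simp add: C_def)
  then have ne: "Q ` C \<noteq> {}" by blast
  define I where "I = Inf (Q ` C)"
  have bdd: "bdd_below (Q ` C)" using Q0 by (auto intro!: bdd_belowI[of _ 0])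
  have Ile: "I \<le> Q \<psi>" if "\<psi> \<in> C" for \<psi> unfolding I_def using that bdd by (intro cInf_lower) auto
  have "\<exists>\<psi>\<in>C. Q \<psi> < I + 1 / real (Suc k)" for k
  proof -
    have "Inf (Q ` C) < I + 1 / real (Suc k)" by (simp add: I_def)
    then show ?thesis using cInf_lessD[OF ne] by blast
  qed
  then obtain \<psi>s where \<psi>s: "\<And>k. \<psi>s k \<in> C" "\<And>k. Q (\<psi>s k) < I + 1 / real (Suc k)" by metis
  obtain \<psi> r where \<psi>: "continuous_on ?B \<psi>" and r: "strict_mono (r :: nat \<Rightarrow> nat)"
    and ulim: "\<And>e. 0 < e \<Longrightarrow> \<exists>N. \<forall>n x. n \<ge> N \<and> x \<in> ?B \<longrightarrow> norm (\<psi>s (r n) x - \<psi> x) < e"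
  proof (rule Arzela_Ascoli[of ?B \<psi>s 1])
    show "compact ?B" by simp
    show "norm (\<psi>s n x) \<le> 1" if "x \<in> ?B" for n x using Cb(3)[OF \<psi>s(1) that] by simp
    fix x :: "real^'n" and e :: real assume x: "x \<in> ?B" and e: "0 < e"
    show "\<exists>d. 0 < d \<and> (\<forall>n y. y \<in> ?B \<and> norm (x - y) < d \<longrightarrow> norm (\<psi>s n x - \<psi>s n y) < e)"
    proof (intro exI[of _ "e / L"] conjI allI impI)
      show "0 < e / L" using e L by simp
      fix n y assume y: "y \<in> ?B \<and> norm (x - y) < e / L"
      have "\<bar>\<psi>s n x - \<psi>s n y\<bar> \<le> L * norm (x - y)" using \<psi>s(1)[of n] x y by (auto simp: C_def)
      also have "\<dots> < e" using y L by (simp add: field_simps)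
      finally show "norm (\<psi>s n x - \<psi>s n y) < e" by simp
    qed
  qed (rule that, assumption+)
  have lim: "(\<lambda>k. \<psi>s (r k) x) \<longlonglongrightarrow> \<psi> x" if "x \<in> ?B" for x
    unfolding LIMSEQ_iff using ulim that by blast
  have intlim: "(\<lambda>k. \<integral>x. \<psi>s (r k) x \<partial>N) \<longlonglongrightarrow> (\<integral>x. \<psi> x \<partial>N)"
    if "finite_measure N" "sets N = sets (restrict_space borel ?S)" for N
    by (rule integral_uniform_limit[where \<psi> = "\<lambda>k. \<psi>s (r k)", OF that SB Cc[OF \<psi>s(1)] Cb(3)[OF \<psi>s(1)] \<psi> lim])
  have \<psi>C: "\<psi> \<in> C"
    unfolding C_def mem_Collect_eq
  proof (intro conjI ballI)
    fix x assume x: "x \<in> ?B"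
    show "0 \<le> \<psi> x" using LIMSEQ_le_const[OF lim[OF x]] Cb(1)[OF \<psi>s(1) x] by blast
    show "\<psi> x \<le> 1" using LIMSEQ_le_const2[OF lim[OF x]] Cb(2)[OF \<psi>s(1) x] by blast
    fix y assume y: "y \<in> ?B"
    have "\<bar>\<psi>s (r k) x - \<psi>s (r k) y\<bar> \<le> L * norm (x - y)" for k using \<psi>s(1)[of "r k"] x y by (auto simp: C_def)
    then show "\<bar>\<psi> x - \<psi> y\<bar> \<le> L * norm (x - y)"
      using LIMSEQ_le_const2[OF tendsto_rabs[OF tendsto_diff[OF lim[OF x] lim[OF y]]]] by blast
  next
    have "(\<integral>x. \<psi>s (r k) x \<partial>m) = (\<integral>x. \<phi> x \<partial>m)" "(\<integral>x. \<psi>s (r k) x \<partial>w) = (\<integral>x. \<phi> x \<partial>w)" for k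
      using \<psi>s(1)[of "r k"] by (auto simp: C_def)
    then show "(\<integral>x. \<psi> x \<partial>m) = (\<integral>x. \<phi> x \<partial>m)" "(\<integral>x. \<psi> x \<partial>w) = (\<integral>x. \<phi> x \<partial>w)"
      using intlim[OF fin(1) sets(1)] intlim[OF fin(2) sets(2)] by (auto dest: LIMSEQ_unique[OF tendsto_const])
  qed
  have sqc: "continuous_on ?B (\<lambda>x. (\<psi> x)\<^sup>2)" if "continuous_on ?B \<psi>" for \<psi> :: "real^'n \<Rightarrow> real"
    using that by (intro continuous_intros)
  have sqb: "\<bar>(\<psi> x)\<^sup>2\<bar> \<le> 1" if "\<psi> \<in> C" "x \<in> ?B" for \<psi> x
    using Cb[OF that] by (simp add: power_le_one)
  have Q\<psi>: "Q \<psi> \<le> I"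
  proof (rule LIMSEQ_le)
    show "(\<lambda>k. Q (\<psi>s (r k))) \<longlonglongrightarrow> Q \<psi>"
      unfolding Q_def
      by (rule integral_uniform_limit[where \<psi> = "\<lambda>k x. (\<psi>s (r k) x)\<^sup>2", OF fin\<nu> sets\<nu> subset_refl sqc[OF Cc[OF \<psi>s(1)]] sqb[OF \<psi>s(1)] sqc[OF \<psi>]])
         (assumption, intro tendsto_power lim)
    show "(\<lambda>k. I + 1 / real (Suc (r k))) \<longlonglongrightarrow> I"
      using tendsto_add[OF tendsto_const LIMSEQ_subseq_LIMSEQ[OF LIMSEQ_inverse_real_of_nat r], of I]
      by (simp add: o_def inverse_eq_divide)
    show "\<exists>N. \<forall>k\<ge>N. Q (\<psi>s (r k)) \<le> I + 1 / real (Suc (r k))" using \<psi>s(2) by (meson less_imp_le)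
  qed
  show ?thesis
  proof (rule that[of \<psi>])
    show "continuous_on ?S \<psi>" using \<psi> SB by (rule continuous_on_subset)
    show "0 \<le> \<psi> x \<and> \<psi> x \<le> 1" if "x \<in> ?S" for x using Cb[OF \<psi>C] that SB by blast
    show "(\<integral>x. \<psi> x \<partial>m) = (\<integral>x. \<phi> x \<partial>m)" "(\<integral>x. \<psi> x \<partial>w) = (\<integral>x. \<phi> x \<partial>w)" using \<psi>C by (auto simp: C_def)
    fix A x assume AG: "A \<in> G" and x: "x \<in> ?S"
    have A: "orthogonal_matrix A" by (rule G[OF AG])
    note simps = orthogonal_matrix_simps[OF A]
    let ?T = "\<lambda>x. transpose A *v x"
    define \<psi>A where "\<psi>A x = \<psi> (?T x)" for x
    have TB: "?T x \<in> ?B" if "x \<in> ?B" for x using that by (simp only: mem_cball dist_0_norm simps)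
    have int_inv: "(\<integral>x. g (?T x) \<partial>N) = (\<integral>x. g x \<partial>N)"
      if "N = m \<or> N = w \<or> N = \<nu>" "g \<in> borel_measurable N" for N and g :: "real^'n \<Rightarrow> real"
    proof -
      have TN: "?T \<in> measurable N N \<and> distr N N ?T = N"
        using that(1)
      proof (elim disjE)
        assume N: "N = m"
        show ?thesis unfolding N
          by (intro conjI orthogonal_measurable(1)[OF A sets(1) orthogonal_sphere(1)[OF A]] invariant_distr[OF A sets(1) orthogonal_sphere(1)[OF A]])
             (use inv(1) AG in \<open>simp only: measure_invariant_def\<close>)
      next
        assume N: "N = w"
        show ?thesis unfolding N
          by (intro conjI orthogonal_measurable(1)[OF A sets(2) orthogonal_sphere(1)[OF A]] invariant_distr[OF A sets(2) orthogonal_sphere(1)[OF A]])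
             (use inv(2) AG in \<open>simp only: measure_invariant_def\<close>)
      next
        assume N: "N = \<nu>"
        have em: "emeasure \<nu> ((\<lambda>x. A *v x) ` X) = emeasure \<nu> X" if "X \<in> sets \<nu>" for X
        proof -
          obtain X' where "X' \<in> sets borel" "X = ?B \<inter> X'"
            using \<open>X \<in> sets \<nu>\<close> unfolding sets\<nu> sets_restrict_space by blast
          then have X: "X \<in> sets borel" "X \<subseteq> ?B" by auto
          have AX: "(\<lambda>x. A *v x) ` X \<subseteq> ?B"
          proof
            fix y assume "y \<in> (\<lambda>x. A *v x) ` X"
            then obtain z where "z \<in> X" "y = A *v z" by blast
            then show "y \<in> ?B" using X(2) by (simp only: mem_cball dist_0_norm simps subset_eq)
          qed
          have "sets (borel :: (real^'n) measure) = sets (restrict_space borel UNIV)" by (simp add: sets_restrict_space)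
          then have b: "(\<lambda>x. A *v x) ` X \<in> sets borel"
            by (rule orthogonal_measurable(3)[OF A _ _ X(1)]) simp
          have "dist (A *v x) (A *v y) = dist x y" for x y
            unfolding dist_norm matrix_vector_mult_diff_distrib[symmetric] by (rule simps(5))
          then have "emeasure lborel ((\<lambda>x. A *v x) ` X) = emeasure lborel X"
            using X(1) b by (rule emeasure_lborel_isometry)
          then show ?thesis by (simp only: em\<nu>[OF AX b] em\<nu>[OF X(2,1)])
        qed
        show ?thesis unfolding N
          by (intro conjI orthogonal_measurable(1)[OF A sets\<nu> orthogonal_sphere(2)[OF A]] invariant_distr[OF A sets\<nu> orthogonal_sphere(2)[OF A]] em)
      qed
      then have "(\<integral>x. g x \<partial>distr N N ?T) = (\<integral>x. g (?T x) \<partial>N)" using that(2) by (intro integral_distr) auto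
      then show ?thesis using TN by simp
    qed
    have meas: "g \<in> borel_measurable N" "integrable N g"
      if "N = m \<or> N = w \<or> N = \<nu>" "continuous_on ?B g" "\<And>x. x \<in> ?B \<Longrightarrow> \<bar>g x\<bar> \<le> 1" for N and g :: "real^'n \<Rightarrow> real"
    proof -
      have "g \<in> borel_measurable N \<and> integrable N g"
        using that(1)
      proof (elim disjE)
        assume N: "N = m"
        show ?thesis unfolding N by (intro conjI integral_continuous_bounded[OF fin(1) sets(1) SB that(2,3)])
      next
        assume N: "N = w"
        show ?thesis unfolding N by (intro conjI integral_continuous_bounded[OF fin(2) sets(2) SB that(2,3)])
      next
        assume N: "N = \<nu>"
        show ?thesis unfolding N by (intro conjI integral_continuous_bounded[OF fin\<nu> sets\<nu> subset_refl that(2,3)])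
      qed
      then show "g \<in> borel_measurable N" "integrable N g" by auto
    qed
    have \<psi>L: "\<bar>\<psi> x - \<psi> y\<bar> \<le> L * norm (x - y)" if "x \<in> ?B" "y \<in> ?B" for x y using \<psi>C that by (auto simp: C_def)
    have \<psi>AL: "\<bar>\<psi>A x - \<psi>A y\<bar> \<le> L * norm (x - y)" if "x \<in> ?B" "y \<in> ?B" for x y
      unfolding \<psi>A_def by (rule transpose_lipschitz[OF A \<psi>L that])
    have \<psi>AC: "\<psi>A \<in> C"
      unfolding C_def mem_Collect_eq
    proof (intro conjI ballI)
      show "0 \<le> \<psi>A x" "\<psi>A x \<le> 1" if "x \<in> ?B" for x unfolding \<psi>A_def using Cb[OF \<psi>C TB[OF that]] by auto
      show "\<bar>\<psi>A x - \<psi>A y\<bar> \<le> L * norm (x - y)" if "x \<in> ?B" "y \<in> ?B" for x y by (rule \<psi>AL[OF that])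
      show "(\<integral>x. \<psi>A x \<partial>m) = (\<integral>x. \<phi> x \<partial>m)" "(\<integral>x. \<psi>A x \<partial>w) = (\<integral>x. \<phi> x \<partial>w)"
        using int_inv[of m \<psi>] int_inv[of w \<psi>] meas[OF _ \<psi> Cb(3)[OF \<psi>C]] \<psi>C by (auto simp: C_def \<psi>A_def)
    qed
    define \<chi>' where "\<chi>' x = (\<psi> x + \<psi>A x) / 2" for x
    define d where "d x = (\<psi> x - \<psi>A x) / 2" for x
    have \<chi>C: "\<chi>' \<in> C"
      unfolding C_def mem_Collect_eq
    proof (intro conjI ballI)
      show "0 \<le> \<chi>' x" "\<chi>' x \<le> 1" if "x \<in> ?B" for x unfolding \<chi>'_def using Cb[OF \<psi>C that] Cb[OF \<psi>AC that] by auto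
      show "\<bar>\<chi>' x - \<chi>' y\<bar> \<le> L * norm (x - y)" if "x \<in> ?B" "y \<in> ?B" for x y
        unfolding \<chi>'_def using \<psi>L[OF that] \<psi>AL[OF that] by (simp add: abs_le_iff field_simps)
      have i: "(\<integral>x. \<chi>' x \<partial>N) = ((\<integral>x. \<psi> x \<partial>N) + (\<integral>x. \<psi>A x \<partial>N)) / 2" if "N = m \<or> N = w" for N
        unfolding \<chi>'_def using that meas(2)[OF _ Cc[OF \<psi>C] Cb(3)[OF \<psi>C], of N] meas(2)[OF _ Cc[OF \<psi>AC] Cb(3)[OF \<psi>AC], of N] by auto
      show "(\<integral>x. \<chi>' x \<partial>m) = (\<integral>x. \<phi> x \<partial>m)" "(\<integral>x. \<chi>' x \<partial>w) = (\<integral>x. \<phi> x \<partial>w)"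
        using i[of m] i[of w] \<psi>C \<psi>AC by (auto simp: C_def)
    qed
    have dc: "continuous_on ?B d" unfolding d_def using Cc[OF \<psi>C] Cc[OF \<psi>AC] by (intro continuous_intros) auto
    have db: "\<bar>d x\<bar> \<le> 1" if "x \<in> ?B" for x unfolding d_def using Cb[OF \<psi>C that] Cb[OF \<psi>AC that] by (auto simp: abs_le_iff)
    have db2: "\<bar>(d x)\<^sup>2\<bar> \<le> 1" if "x \<in> ?B" for x
      using power_mono[OF db[OF that], of 2] by simp
    note int2 = meas(2)[of \<nu>, OF _ sqc[OF Cc] sqb]
    have id2: "integrable \<nu> (\<lambda>x. (d x)\<^sup>2)" using meas(2)[of \<nu>, OF _ sqc[OF dc] db2] by simp
    \<comment> \<open>Parallelogram identity: the mean of \<psi> and its transform lies in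
      \<open>C\<close>, and its square integral is smaller by that of half the difference.
      Minimality of \<psi> makes the difference vanish almost everywhere.\<close>
    have "Q \<chi>' + (\<integral>x. (d x)\<^sup>2 \<partial>\<nu>) = (\<integral>x. (\<chi>' x)\<^sup>2 + (d x)\<^sup>2 \<partial>\<nu>)"
      unfolding Q_def using int2[OF _ \<chi>C \<chi>C] id2 by simp
    also have "\<dots> = (\<integral>x. ((\<psi> x)\<^sup>2 + (\<psi>A x)\<^sup>2) / 2 \<partial>\<nu>)"
      by (intro Bochner_Integration.integral_cong refl) (simp add: \<chi>'_def d_def power2_eq_square field_simps)
    also have "\<dots> = (Q \<psi> + Q \<psi>A) / 2"
      unfolding Q_def using int2[OF _ \<psi>C \<psi>C] int2[OF _ \<psi>AC \<psi>AC] by simp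
    also have "Q \<psi>A = Q \<psi>"
      unfolding Q_def \<psi>A_def using int_inv[of \<nu> "\<lambda>x. (\<psi> x)\<^sup>2"] meas(1)[of \<nu>, OF _ sqc[OF \<psi>] sqb[OF \<psi>C]] by simp
    finally have "(\<integral>x. (d x)\<^sup>2 \<partial>\<nu>) \<le> 0" using Ile[OF \<chi>C] Q\<psi> by simp
    then have "(\<integral>x. (d x)\<^sup>2 \<partial>\<nu>) = 0" by (intro antisym integral_nonneg_AE) auto
    then have "AE x in \<nu>. (d x)\<^sup>2 = 0" using integral_nonneg_eq_0_iff_AE[OF id2] by simp
    then have AE0: "AE x in lborel. x \<in> ?B \<longrightarrow> d x = 0"
      unfolding \<nu>_def by (subst (asm) AE_restrict_space_iff) auto
    have "d x = 0"
    proof (rule ccontr)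
      assume dx: "d x \<noteq> 0"
      define U where "U = d -` (- {0}) \<inter> ball 0 2"
      have "continuous_on (ball 0 2) d" using dc ball_subset_cball by (rule continuous_on_subset)
      then have U: "open U" unfolding U_def by (simp add: continuous_on_open_vimage open_Compl)
      moreover have "x \<in> U" using x dx by (simp add: U_def)
      moreover have "negligible U"
      proof -
        have "AE x in lborel. x \<notin> U" using AE0 by eventually_elim (auto simp: U_def)
        then have "U \<in> null_sets lborel" using U by (subst AE_iff_null_sets) auto
        then show ?thesis by (simp add: negligible_iff_null_sets null_sets_completionI)
      qed
      ultimately show False using open_not_negligible by blast
    qed
    then show "\<psi> (transpose A *v x) = \<psi> x" by (simp add: d_def \<psi>A_def)
  qed
qed

lemma sphere_measure_eqI:
  fixes m w :: "'a::euclidean_space measure"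
  assumes sets: "sets m = sets (restrict_space borel (sphere 0 1))" "sets w = sets (restrict_space borel (sphere 0 1))"
    and fin: "emeasure m (sphere 0 1) < \<infinity>" "emeasure w (sphere 0 1) < \<infinity>"
    and eq: "\<And>\<omega>. compact \<omega> \<Longrightarrow> \<omega> \<subseteq> sphere 0 1 \<Longrightarrow> emeasure m \<omega> = emeasure w \<omega>"
  shows "m = w"
proof (rule measure_eqI)
  show "sets m = sets w" by (simp add: sets)
  fix X assume X: "X \<in> sets m"
  then have Xw: "X \<in> sets w" by (simp add: sets)
  have XS: "X \<subseteq> sphere 0 1" using X unfolding sets by (rule sphere_setD(2))
  have "(SUP K \<in> {K. K \<subseteq> X \<and> compact K}. emeasure m K) = (SUP K \<in> {K. K \<subseteq> X \<and> compact K}. emeasure w K)"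
    using XS by (intro SUP_cong refl eq) auto
  then show "emeasure m X = emeasure w X"
    using sphere_inner_regular[OF sets(1) fin(1) X] sphere_inner_regular[OF sets(2) fin(2) Xw] by simp
qed

text \<open>For a continuous \<open>G\<close>-invariant function the closed superlevel and sublevel
  sets are invariant, so the hypotheses on \<open>le\<close> and \<open>total\<close> identify its
  distributions under \<open>m\<close> and \<open>w\<close>. Lipschitz approximations of the
  indicator of a compact set are then exchanged for invariant functions with the same
  integrals.\<close>

lemma invariant_measure_eqI:
  fixes m w :: "(real^'n) measure"
  assumes sets: "sets m = sets (restrict_space borel (sphere 0 1))" "sets w = sets (restrict_space borel (sphere 0 1))"
    and fin: "emeasure m (sphere 0 1) < \<infinity>" "emeasure w (sphere 0 1) < \<infinity>"
    and G: "\<And>A. A \<in> G \<Longrightarrow> orthogonal_matrix A"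
    and inv: "measure_invariant G m" "measure_invariant G w"
    and le: "\<And>\<omega>. closed \<omega> \<Longrightarrow> \<omega> \<subseteq> sphere 0 1 \<Longrightarrow>
      (\<And>A u. A \<in> G \<Longrightarrow> u \<in> \<omega> \<Longrightarrow> A *v u \<in> \<omega> \<and> transpose A *v u \<in> \<omega>) \<Longrightarrow> emeasure m \<omega> \<le> emeasure w \<omega>"
    and total: "emeasure w (sphere 0 1) \<le> emeasure m (sphere 0 1)"
  shows "m = w"
proof -
  let ?S = "sphere (0::real^'n) 1"
  have sp: "space m = ?S" "space w = ?S" using sets_eq_imp_space_eq[OF sets(1)] sets_eq_imp_space_eq[OF sets(2)] by (simp_all add: space_restrict_space)
  have fm: "finite_measure m" "finite_measure w" using fin sp by (auto intro!: finite_measureI)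
  have closed_sets: "X \<in> sets m" "X \<in> sets w" if "closed X" "X \<subseteq> ?S" for X
    unfolding sets using that by (auto intro!: sphere_setI)
  have invariant_integral: "(\<integral>x. \<psi> x \<partial>m) = (\<integral>x. \<psi> x \<partial>w)"
    if c: "continuous_on ?S \<psi>" and i: "\<And>A x. A \<in> G \<Longrightarrow> x \<in> ?S \<Longrightarrow> \<psi> (transpose A *v x) = \<psi> x" for \<psi> :: "real^'n \<Rightarrow> real"
  proof -
    have \<psi>m: "\<psi> \<in> borel_measurable m" "\<psi> \<in> borel_measurable w"
      using borel_measurable_continuous_on_restrict[OF c]
      by (simp_all add: measurable_cong_sets[OF sets(1) refl] measurable_cong_sets[OF sets(2) refl])
    have le': "emeasure m {x \<in> ?S. \<psi> x \<in> J} \<le> emeasure w {x \<in> ?S. \<psi> x \<in> J}" if "closed J" for J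
    proof (rule le)
      have "closed (?S \<inter> \<psi> -` J)" using c that by (intro continuous_closed_preimage) auto
      then show "closed {x \<in> ?S. \<psi> x \<in> J}" by (simp add: Int_def vimage_def)
      fix A u assume A: "A \<in> G" and u: "u \<in> {x \<in> ?S. \<psi> x \<in> J}"
      note simps = orthogonal_matrix_simps[OF G[OF A]]
      have u: "u \<in> ?S" "\<psi> u \<in> J" using u by auto
      have S: "A *v u \<in> ?S" "transpose A *v u \<in> ?S" using u(1) by (simp_all only: sphere_def mem_Collect_eq dist_0_norm simps)
      moreover have "\<psi> (A *v u) = \<psi> u" using i[OF A S(1)] by (simp only: simps)
      ultimately show "A *v u \<in> {x \<in> ?S. \<psi> x \<in> J} \<and> transpose A *v u \<in> {x \<in> ?S. \<psi> x \<in> J}"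
        using i[OF A u(1)] u(2) by (simp only: mem_Collect_eq simp_thms)
    qed auto
    have meas: "{x \<in> ?S. \<psi> x \<in> J} \<in> sets m" "{x \<in> ?S. \<psi> x \<in> J} \<in> sets w" if "J \<in> sets borel" for J
      using measurable_sets[OF \<psi>m(1) that] measurable_sets[OF \<psi>m(2) that] by (simp_all add: sp vimage_def Int_def conj_commute)
    have eq: "emeasure m {x \<in> ?S. \<psi> x \<in> {s<..}} = emeasure w {x \<in> ?S. \<psi> x \<in> {s<..}}" for s
    proof (rule antisym)
      \<comment> \<open>Open superlevel sets are increasing unions of closed invariant sets, which
        gives one of the two inequalities.\<close>
      define X where "X k = {x \<in> ?S. \<psi> x \<in> {s + 1 / real (Suc k)..}}" for k
      have "mono X" unfolding X_def
      proof (rule monoI, rule subsetI, clarsimp)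
        fix j k :: nat and x assume "j \<le> k" "s + 1 / (1 + real j) \<le> \<psi> x"
        moreover have "1 / (1 + real k) \<le> 1 / (1 + real j)" using \<open>j \<le> k\<close> by (intro divide_left_mono) auto
        ultimately show "s + 1 / (1 + real k) \<le> \<psi> x" by linarith
      qed
      have Xm: "range X \<subseteq> sets m" "range X \<subseteq> sets w"
        unfolding X_def by (intro image_subsetI meas borel_closed closed_atLeast)+
      have U: "(\<Union>k. X k) = {x \<in> ?S. \<psi> x \<in> {s<..}}"
      proof (rule Set.set_eqI, rule iffI)
        fix x assume "x \<in> (\<Union>k. X k)"
        then obtain k where "x \<in> ?S" "s + 1 / real (Suc k) \<le> \<psi> x" by (auto simp: X_def)
        moreover have "0 < 1 / real (Suc k)" by simp
        ultimately have "x \<in> ?S" "s < \<psi> x" by linarith+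
        then show "x \<in> {x \<in> ?S. \<psi> x \<in> {s<..}}" by simp
      next
        fix x assume x: "x \<in> {x \<in> ?S. \<psi> x \<in> {s<..}}"
        then have "0 < \<psi> x - s" by simp
        then obtain k where "inverse (real (Suc k)) < \<psi> x - s" using reals_Archimedean by blast
        then have "s + 1 / real (Suc k) \<le> \<psi> x" by (simp add: inverse_eq_divide)
        then show "x \<in> (\<Union>k. X k)" using x by (intro UN_I[of k]) (auto simp: X_def)
      qed
      have "emeasure m (\<Union>k. X k) = (SUP k. emeasure m (X k))"
        by (rule SUP_emeasure_incseq[symmetric, OF Xm(1) \<open>mono X\<close>])
      also have "\<dots> \<le> (SUP k. emeasure w (X k))" unfolding X_def by (intro SUP_mono' le') simp
      also have "\<dots> = emeasure w (\<Union>k. X k)"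
        by (rule SUP_emeasure_incseq[OF Xm(2) \<open>mono X\<close>])
      finally show "emeasure m {x \<in> ?S. \<psi> x \<in> {s<..}} \<le> emeasure w {x \<in> ?S. \<psi> x \<in> {s<..}}" unfolding U .
      \<comment> \<open>For the other inequality pass to the closed sublevel sets; taking
        complements reverses the comparison, and the total masses are ordered accordingly.\<close>
      have split: "measure N {x \<in> ?S. \<psi> x \<in> {s<..}} = measure N ?S - measure N {x \<in> ?S. \<psi> x \<in> {..s}}"
        if N: "finite_measure N" "space N = ?S" "{x \<in> ?S. \<psi> x \<in> {..s}} \<in> sets N" for N
      proof -
        have "?S - {x \<in> ?S. \<psi> x \<in> {..s}} = {x \<in> ?S. \<psi> x \<in> {s<..}}" by auto
        then show ?thesis using finite_measure.finite_measure_compl[OF N(1,3)] unfolding N(2) by (simp only:)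
      qed
      have "measure m {x \<in> ?S. \<psi> x \<in> {..s}} \<le> measure w {x \<in> ?S. \<psi> x \<in> {..s}}" "measure w ?S \<le> measure m ?S"
        using le'[of "{..s}"] total fm by (simp_all add: finite_measure.emeasure_eq_measure)
      then have "measure w {x \<in> ?S. \<psi> x \<in> {s<..}} \<le> measure m {x \<in> ?S. \<psi> x \<in> {s<..}}"
        using split[OF fm(1) sp(1) meas(1)] split[OF fm(2) sp(2) meas(2)] by simp
      then show "emeasure w {x \<in> ?S. \<psi> x \<in> {s<..}} \<le> emeasure m {x \<in> ?S. \<psi> x \<in> {s<..}}"
        using fm by (simp add: finite_measure.emeasure_eq_measure)
    qed
    have em: "emeasure (distr m borel \<psi>) {s<..} = emeasure m {x \<in> ?S. \<psi> x \<in> {s<..}}"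
      "emeasure (distr w borel \<psi>) {s<..} = emeasure w {x \<in> ?S. \<psi> x \<in> {s<..}}" for s
      using \<psi>m by (simp_all add: emeasure_distr sp vimage_def Int_def conj_commute)
    have "distr m borel \<psi> = distr w borel \<psi>"
    proof (rule measure_eqI_lessThan)
      show "emeasure (distr m borel \<psi>) {s<..} < \<infinity>" for s
        unfolding em using fm(1) by (simp add: finite_measure.emeasure_eq_measure)
      show "emeasure (distr m borel \<psi>) {s<..} = emeasure (distr w borel \<psi>) {s<..}" for s
        unfolding em by (rule eq)
    qed simp_all
    moreover have "(\<integral>x. \<psi> x \<partial>m) = (\<integral>x. x \<partial>distr m borel \<psi>)" "(\<integral>x. \<psi> x \<partial>w) = (\<integral>x. x \<partial>distr w borel \<psi>)"
      using \<psi>m by (simp_all add: integral_distr)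
    ultimately show ?thesis by simp
  qed
  have compact_eq: "emeasure m \<omega> = emeasure w \<omega>" if \<omega>: "compact \<omega>" "\<omega> \<subseteq> ?S" for \<omega>
  proof (cases "\<omega> = {}")
    case False
    \<comment> \<open>Lipschitz with constant \<open>k + 1\<close>, equal to 1 on \<omega> and
      decreasing to its indicator, because points outside the closed set \<omega> have positive
      distance from it.\<close>
    define \<phi> where "\<phi> k x = max 0 (1 - real (Suc k) * infdist x \<omega>)" for k x
    have \<phi>01: "0 \<le> \<phi> k x \<and> \<phi> k x \<le> 1" for k x by (simp add: \<phi>_def infdist_nonneg)
    have \<phi>L: "\<bar>\<phi> k x - \<phi> k y\<bar> \<le> real (Suc k) * norm (x - y)" for k x y
    proof -
      have "\<bar>\<phi> k x - \<phi> k y\<bar> \<le> \<bar>real (Suc k) * infdist x \<omega> - real (Suc k) * infdist y \<omega>\<bar>"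
        unfolding \<phi>_def by linarith
      also have "\<dots> = real (Suc k) * \<bar>infdist x \<omega> - infdist y \<omega>\<bar>" by (simp only: right_diff_distrib[symmetric] abs_mult abs_of_nat)
      also have "\<dots> \<le> real (Suc k) * norm (x - y)"
        unfolding dist_norm[symmetric] by (intro mult_left_mono infdist_triangle_abs) simp
      finally show ?thesis .
    qed
    have eq: "(\<integral>x. \<phi> k x \<partial>m) = (\<integral>x. \<phi> k x \<partial>w)" for k
    proof -
      obtain \<psi> where "continuous_on ?S \<psi>" "\<And>A x. A \<in> G \<Longrightarrow> x \<in> ?S \<Longrightarrow> \<psi> (transpose A *v x) = \<psi> x"
        and "(\<integral>x. \<psi> x \<partial>m) = (\<integral>x. \<phi> k x \<partial>m)" "(\<integral>x. \<psi> x \<partial>w) = (\<integral>x. \<phi> k x \<partial>w)"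
        using invariant_average_exists[OF fm sets G inv \<phi>01 \<phi>L] by (metis of_nat_0_less_iff zero_less_Suc)
      then show ?thesis using invariant_integral by metis
    qed
    have lim: "(\<lambda>k. \<phi> k x) \<longlonglongrightarrow> indicator \<omega> x" for x
    proof (cases "x \<in> \<omega>")
      case True
      then show ?thesis by (simp add: \<phi>_def)
    next
      case x: False
      then have pos: "0 < infdist x \<omega>"
        using in_closed_iff_infdist_zero[OF compact_imp_closed[OF \<omega>(1)] False, of x] infdist_nonneg[of x \<omega>] by linarith
      then obtain N where N: "inverse (real (Suc N)) < infdist x \<omega>" using reals_Archimedean by blast
      have "\<phi> k x = 0" if "N \<le> k" for k
      proof -
        have "1 \<le> real (Suc N) * infdist x \<omega>" using N by (simp add: field_simps)
        also have "\<dots> \<le> real (Suc k) * infdist x \<omega>" using that pos by (intro mult_right_mono) auto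
        finally show ?thesis by (simp add: \<phi>_def)
      qed
      then have "eventually (\<lambda>k. \<phi> k x = indicator \<omega> x) sequentially"
        using x by (auto simp: eventually_sequentially)
      then show ?thesis by (rule tendsto_eventually)
    qed
    have "(\<lambda>k. \<integral>x. \<phi> k x \<partial>N) \<longlonglongrightarrow> measure N \<omega>"
      if N: "finite_measure N" "sets N = sets (restrict_space borel ?S)" for N
    proof -
      have \<omega>N: "\<omega> \<in> sets N" unfolding N(2) using \<omega> by (intro sphere_setI borel_closed compact_imp_closed)
      have "(\<lambda>k. \<integral>x. \<phi> k x \<partial>N) \<longlonglongrightarrow> (\<integral>x. indicator \<omega> x \<partial>N)"
      proof (rule integral_dominated_convergence[where w = "\<lambda>_. 1"])
        show "indicator \<omega> \<in> borel_measurable N" using \<omega>N by simp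
        have "continuous_on ?S (\<phi> k)" for k unfolding \<phi>_def by (intro continuous_intros)
        then show "\<phi> k \<in> borel_measurable N" for k
          by (subst measurable_cong_sets[OF N(2) refl]) (rule borel_measurable_continuous_on_restrict)
        show "integrable N (\<lambda>_. 1)" using N(1) by (simp add: finite_measure.integrable_const)
        show "AE x in N. (\<lambda>k. \<phi> k x) \<longlonglongrightarrow> indicator \<omega> x" using lim by simp
        show "AE x in N. norm (\<phi> k x) \<le> 1" for k using \<phi>01[of k] by (intro AE_I2) auto
      qed
      then show ?thesis using \<omega>N sets.sets_into_space[OF \<omega>N] by (simp add: Int_absorb2)
    qed
    from this[OF fm(1) sets(1)] this[OF fm(2) sets(2)] have "measure m \<omega> = measure w \<omega>"
      unfolding eq by (rule LIMSEQ_unique)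
    then show ?thesis using fm by (simp add: finite_measure.emeasure_eq_measure)
  qed simp
  show ?thesis by (rule sphere_measure_eqI[OF sets fin compact_eq])
qed

section \<open>Solution of the Minkowski problem\<close>

lemma cone_of_linear_image:
  assumes "linear g"
  shows "cone_of (g ` B) = g ` cone_of B"
  unfolding cone_of_image_image by (simp add: cone_of_image image_image linear_scale[OF assms])

lemma normal_preimage_orthogonal:
  fixes K :: "(real^'n) set"
  assumes K: "compact K" "K \<noteq> {}" and A: "orthogonal_matrix A" and inv: "(\<lambda>x. A *v x) ` K = K"
  shows "normal_preimage K ((\<lambda>x. A *v x) ` \<omega>) = (\<lambda>x. A *v x) ` normal_preimage K \<omega>"
proof -
  note simps = orthogonal_matrix_simps[OF A]
  have h: "support_fun K (A *v u) = support_fun K u" for u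
    using support_fun_invariant[OF A inv, of "A *v u"] by (simp only: simps)
  show ?thesis
  proof (rule Set.set_eqI, rule iffI)
    fix x assume "x \<in> normal_preimage K ((\<lambda>x. A *v x) ` \<omega>)"
    then obtain u where u: "x \<in> K" "u \<in> \<omega>" "norm (A *v u) = 1" "x \<bullet> (A *v u) = support_fun K (A *v u)"
      by (auto simp: normal_preimage_def)
    have "transpose A *v x \<in> K" by (rule invariant_memD(2)[OF A inv u(1)])
    moreover have "norm u = 1" "(transpose A *v x) \<bullet> u = support_fun K u" using u(3,4) by (simp_all only: simps h)
    ultimately have "transpose A *v x \<in> normal_preimage K \<omega>" unfolding normal_preimage_def using u(2) by blast
    then show "x \<in> (\<lambda>x. A *v x) ` normal_preimage K \<omega>" by (rule image_eqI[rotated]) (simp only: simps)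
  next
    fix x assume "x \<in> (\<lambda>x. A *v x) ` normal_preimage K \<omega>"
    then obtain y u where u: "x = A *v y" "y \<in> K" "u \<in> \<omega>" "norm u = 1" "y \<bullet> u = support_fun K u"
      by (auto simp: normal_preimage_def)
    have "x \<in> K" unfolding u(1) by (rule invariant_memD(1)[OF A inv u(2)])
    moreover have "norm (A *v u) = 1" "x \<bullet> (A *v u) = support_fun K (A *v u)"
      using u(4,5) by (simp_all only: u(1) simps h)
    ultimately show "x \<in> normal_preimage K ((\<lambda>x. A *v x) ` \<omega>)" unfolding normal_preimage_def using u(3) by blast
  qed
qed

text \<open>For compact \<omega> the cones are compact and \<open>A\<close> maps the cone over the
  normal preimage of \<omega> isometrically onto the one belonging to its image. Agreement on
  compact sets extends to all Borel sets.\<close>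

lemma cone_measure_invariant:
  fixes K :: "(real^'n) set"
  assumes K: "convex_body K" "0 \<in> K" and A: "orthogonal_matrix A" and inv: "(\<lambda>x. A *v x) ` K = K"
    and \<omega>: "\<omega> \<in> sets (cone_measure K)"
  shows "emeasure (cone_measure K) ((\<lambda>x. A *v x) ` \<omega>) = emeasure (cone_measure K) \<omega>"
proof -
  note simps = orthogonal_matrix_simps[OF A]
  have cK: "compact K" "K \<noteq> {}" using K by (auto simp: convex_body_def)
  let ?M = "cone_measure K" and ?T = "\<lambda>x. transpose A *v x" and ?S = "sphere (0::real^'n) 1"
  note T = orthogonal_measurable[OF A sets_cone_measure[of K] orthogonal_sphere(1)[OF A]]
  have eq: "distr ?M ?M ?T = ?M"
  proof (rule sphere_measure_eqI)
    fix \<omega> :: "(real^'n) set" assume c: "compact \<omega>" and \<omega>: "\<omega> \<subseteq> ?S"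
    have lin: "linear (\<lambda>x. A *v x)" by (rule matrix_vector_mul_linear)
    have cA: "compact ((\<lambda>x. A *v x) ` X)" if "compact X" for X
      by (intro compact_continuous_image matrix_vector_mult_linear_continuous_on that)
    have AS: "(\<lambda>x. A *v x) ` \<omega> \<subseteq> ?S" using \<omega> orthogonal_sphere(1)[OF A, of 1] by blast
    have \<omega>M: "\<omega> \<in> sets ?M" using c \<omega> unfolding sets_cone_measure by (intro sphere_setI borel_closed compact_imp_closed)
    let ?C = "cone_of (normal_preimage K \<omega>)"
    have cC: "compact ?C" using cK c by (intro compact_cone_of compact_normal_preimage compact_imp_closed)
    have "emeasure (distr ?M ?M ?T) \<omega> = emeasure ?M ((\<lambda>x. A *v x) ` \<omega>)"
      using emeasure_distr[OF T(1) \<omega>M] unfolding T(2)[OF \<omega>M] .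
    also have "\<dots> = emeasure lborel (cone_of (normal_preimage K ((\<lambda>x. A *v x) ` \<omega>)))"
      by (rule emeasure_cone_measure_closed[OF K compact_imp_closed[OF cA[OF c]] AS])
    also have "cone_of (normal_preimage K ((\<lambda>x. A *v x) ` \<omega>)) = (\<lambda>x. A *v x) ` ?C"
      unfolding normal_preimage_orthogonal[OF cK A inv] by (rule cone_of_linear_image[OF lin])
    also have "emeasure lborel \<dots> = emeasure lborel ?C"
    proof (rule emeasure_lborel_isometry)
      show "dist (A *v x) (A *v y) = dist x y" for x y
        unfolding dist_norm matrix_vector_mult_diff_distrib[symmetric] by (rule simps(5))
    qed (rule borel_compact cC cA[OF cC])+
    also have "\<dots> = emeasure ?M \<omega>" by (rule emeasure_cone_measure_closed[OF K compact_imp_closed[OF c] \<omega>, symmetric])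
    finally show "emeasure (distr ?M ?M ?T) \<omega> = emeasure ?M \<omega>" .
  next
    have "emeasure (distr ?M ?M ?T) ?S \<le> emeasure (distr ?M ?M ?T) (space ?M)" by (simp add: space_cone_measure)
    also have "\<dots> = emeasure ?M (?T -` space ?M \<inter> space ?M)" by (rule emeasure_distr[OF T(1) sets.top])
    also have "\<dots> < \<infinity>" by (rule cone_measure_finite(2)[OF K])
    finally show "emeasure (distr ?M ?M ?T) ?S < \<infinity>" .
  qed (simp_all add: cone_measure_finite(2)[OF K, simplified])
  have "emeasure ?M \<omega> = emeasure (distr ?M ?M ?T) \<omega>" unfolding eq ..
  also have "\<dots> = emeasure ?M ((\<lambda>x. A *v x) ` \<omega>)" using emeasure_distr[OF T(1) \<omega>] unfolding T(2)[OF \<omega>] .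
  finally show ?thesis ..
qed

lemma convex_body_scaleR:
  fixes K :: "'a::euclidean_space set"
  assumes "convex_body K" "0 < s"
  shows "convex_body ((*\<^sub>R) s ` K)"
  using assms interior_injective_linear_image[of "(*\<^sub>R) s" K]
  by (auto simp: convex_body_def convex_scaling compact_scaling inj_on_def)

lemma normal_preimage_scaleR:
  fixes K :: "(real^'n) set"
  assumes "compact K" "K \<noteq> {}" "0 < s"
  shows "normal_preimage ((*\<^sub>R) s ` K) \<omega> = (*\<^sub>R) s ` normal_preimage K \<omega>"
proof -
  have "{y \<in> (*\<^sub>R) s ` K. Q y} = (*\<^sub>R) s ` {x \<in> K. Q (s *\<^sub>R x)}" for Q :: "real^'n \<Rightarrow> bool" by blast
  then show ?thesis using assms(3) by (simp add: normal_preimage_def support_fun_scaleR[OF assms])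
qed

lemma cone_measure_scaleR:
  fixes K :: "(real^'n) set"
  assumes K: "convex_body K" "0 \<in> K" and s: "0 < s"
  shows "cone_measure ((*\<^sub>R) s ` K) = density (cone_measure K) (\<lambda>_. ennreal (s ^ CARD('n)))"
proof (rule sphere_measure_eqI)
  have cK: "compact K" "K \<noteq> {}" using K by (auto simp: convex_body_def)
  have sK: "convex_body ((*\<^sub>R) s ` K)" "0 \<in> (*\<^sub>R) s ` K" using convex_body_scaleR[OF K(1) s] K(2) by auto
  have em: "emeasure (density (cone_measure K) (\<lambda>_. ennreal (s ^ CARD('n)))) \<omega> = ennreal (s ^ CARD('n)) * emeasure (cone_measure K) \<omega>"
    if "\<omega> \<in> sets (cone_measure K)" for \<omega> using that by (rule emeasure_density_const)
  show "emeasure (cone_measure ((*\<^sub>R) s ` K)) (sphere 0 1) < \<infinity>" by (rule cone_measure_finite(2)[OF sK])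
  have "sphere (0::real^'n) 1 \<in> sets (cone_measure K)" unfolding sets_cone_measure by (intro sphere_setI) auto
  then show "emeasure (density (cone_measure K) (\<lambda>_. ennreal (s ^ CARD('n)))) (sphere 0 1) < \<infinity>"
    using cone_measure_finite(2)[OF K, of "sphere 0 1"] by (simp add: em ennreal_mult_less_top)
  fix \<omega> :: "(real^'n) set" assume c: "compact \<omega>" and \<omega>: "\<omega> \<subseteq> sphere 0 1"
  have \<omega>M: "\<omega> \<in> sets (cone_measure K)" using c \<omega> unfolding sets_cone_measure by (intro sphere_setI borel_closed compact_imp_closed)
  have cC: "compact (cone_of (normal_preimage K \<omega>))" using cK c by (intro compact_cone_of compact_normal_preimage compact_imp_closed)
  have "emeasure (cone_measure ((*\<^sub>R) s ` K)) \<omega> = emeasure lborel (cone_of ((*\<^sub>R) s ` normal_preimage K \<omega>))"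
    unfolding normal_preimage_scaleR[OF cK s, symmetric] by (rule emeasure_cone_measure_closed[OF sK compact_imp_closed[OF c] \<omega>])
  also have "\<dots> = emeasure lborel ((*\<^sub>R) s ` cone_of (normal_preimage K \<omega>))"
    by (subst cone_of_linear_image) (auto intro: linear_scaleR)
  also have "\<dots> = ennreal (s ^ CARD('n)) * emeasure (cone_measure K) \<omega>"
    using emeasure_lborel_scaleR(2)[OF s borel_compact[OF cC]] emeasure_cone_measure_closed[OF K compact_imp_closed[OF c] \<omega>] by simp
  finally show "emeasure (cone_measure ((*\<^sub>R) s ` K)) \<omega> = emeasure (density (cone_measure K) (\<lambda>_. ennreal (s ^ CARD('n)))) \<omega>"
    unfolding em[OF \<omega>M] .
qed simp_all

context coercive_functional
begin

lemma maximizer_centred: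
  assumes G: "\<And>A. A \<in> G \<Longrightarrow> orthogonal_matrix A" and inv: "measure_invariant G \<mu>"
  obtains K where "admissible G K" "1 \<le> measure lebesgue K"
    "\<And>L. admissible G L \<Longrightarrow> 1 \<le> measure lebesgue L \<Longrightarrow> \<Psi> L \<le> \<Psi> K" "F K 0 = \<Psi> K"
proof -
  obtain K1 where K1: "admissible G K1" "1 \<le> measure lebesgue K1"
    "\<And>L. admissible G L \<Longrightarrow> 1 \<le> measure lebesgue L \<Longrightarrow> \<Psi> L \<le> \<Psi> K1"
    using maximizer_exists[OF G] by metis
  then have c: "convex_body K1" "compact K1" "K1 \<noteq> {}" "convex K1" "body_invariant G K1"
    by (auto simp: admissible_def convex_body_def)
  obtain \<xi> where \<xi>: "\<xi> \<in> K1" "F K1 \<xi> = \<Psi> K1" by (rule \<Psi>_attained[OF c(2,3)])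
  have AK: "(\<lambda>x. A *v x) ` K1 = K1" if "A \<in> G" for A using c(5) that by (simp add: body_invariant_def)
  have fixed: "A *v \<xi> = \<xi>" if A: "A \<in> G" for A
  proof (rule F_unique_minimizer[OF c(2,4) \<xi>(1)])
    show "A *v \<xi> \<in> K1" by (rule invariant_memD(1)[OF G[OF A] AK[OF A] \<xi>(1)])
    show "F K1 \<xi> < \<infinity>" using \<Psi>_finite[OF c(1)] \<xi>(2) by simp
    show "F K1 (A *v \<xi>) = F K1 \<xi>"
      by (rule F_invariant[OF c(2,3) G[OF A] AK[OF A]]) (use inv A in \<open>simp add: measure_invariant_def\<close>)
    show "F K1 \<xi> \<le> F K1 \<zeta>" if "\<zeta> \<in> K1" for \<zeta> unfolding \<xi>(2) by (rule \<Psi>_le[OF that])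
  qed
  define K where "K = (+) (- \<xi>) ` K1"
  have "body_invariant G K"
    unfolding body_invariant_def
  proof
    fix A assume A: "A \<in> G"
    have "(\<lambda>x. A *v x) ` K = (\<lambda>x. A *v (- \<xi> + x)) ` K1" unfolding K_def image_image ..
    also have "\<dots> = (+) (- \<xi>) ` ((\<lambda>x. A *v x) ` K1)"
      using matrix_vector_mult_diff_distrib[of A _ \<xi>] by (simp add: image_image fixed[OF A])
    finally show "(\<lambda>x. A *v x) ` K = K" unfolding AK[OF A] K_def .
  qed
  moreover have "convex_body K"
    using c(1) unfolding K_def convex_body_def interior_translation
    by (intro conjI compact_translation convex_translation) auto
  moreover have "0 \<in> K" unfolding K_def by (rule image_eqI[OF _ \<xi>(1)]) simp
  ultimately have "admissible G K" by (simp add: admissible_def)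
  moreover have "1 \<le> measure lebesgue K" using K1(2) unfolding K_def by (simp only: measure_translation)
  moreover have "\<Psi> K = \<Psi> K1" unfolding K_def by (rule \<Psi>_translation[OF c(2,3)])
  moreover have "F K 0 = \<Psi> K1" using F_translation[OF c(2,3), of "- \<xi>" \<xi>] \<xi>(2) unfolding K_def by simp
  ultimately show ?thesis using that K1(3) by metis
qed

lemma cone_measure_solution:
  assumes G: "\<And>A. A \<in> G \<Longrightarrow> orthogonal_matrix A" and inv: "measure_invariant G \<mu>"
  obtains K c where "admissible G K" "0 < c"
    "\<mu> = density (cone_measure K) (\<lambda>u. ennreal (c * support_fun K u powr q))"
proof -
  let ?S = "sphere (0::real^'n) 1"
  obtain K where K: "admissible G K" "1 \<le> measure lebesgue K"
    "\<And>L. admissible G L \<Longrightarrow> 1 \<le> measure lebesgue L \<Longrightarrow> \<Psi> L \<le> \<Psi> K" "F K 0 = \<Psi> K"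
    using maximizer_centred[OF G inv] by metis
  have Kc: "convex_body K" "0 \<in> K" "compact K" "K \<noteq> {}" and AK: "\<And>A. A \<in> G \<Longrightarrow> (\<lambda>x. A *v x) ` K = K"
    using K(1) by (auto simp: admissible_def convex_body_def body_invariant_def)
  let ?h = "support_fun K" and ?C = "cone_measure K"
  have h0: "0 \<le> ?h u" for u by (rule support_fun_nonneg[OF Kc(3,2)])
  define V where "V = measure lborel K"
  have V: "1 \<le> V" "emeasure lborel K = ennreal V"
    using K(2) measure_completion[of K lborel] compact_measure_lborel(1)[OF Kc(3)] borel_compact[OF Kc(3)] by (auto simp: V_def)
  define P where "P = enn2real (\<Psi> K)"
  have P: "0 < P" "\<Psi> K = ennreal P"
    using \<Psi>_pos[OF Kc(3,4)] \<Psi>_finite[OF Kc(1)] by (auto simp: P_def enn2real_positive_iff less_top)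
  have F0: "F K 0 = (\<integral>\<^sup>+u. inv_pow q (?h u) \<partial>\<mu>)" by (simp add: F_def)
  have im: "(\<lambda>u. inv_pow q (?h u)) \<in> borel_measurable \<mu>" using F_measurable[OF Kc(3,4), of 0] by simp
  \<comment> \<open>\<open>inv_pow\<close> is infinite at 0, so finiteness of \<open>F K 0\<close>
    excludes support value 0 outside a \<mu>-null set, even if the origin is a boundary
    point.\<close>
  have hpos: "AE u in \<mu>. 0 < ?h u"
  proof -
    have "AE u in \<mu>. inv_pow q (?h u) \<noteq> \<infinity>"
      using P K(4) by (intro nn_integral_PInf_AE im) (simp add: F0)
    then show ?thesis by eventually_elim (auto simp: inv_pow_def split: if_splits)
  qed
  \<comment> \<open>\<open>m\<close> has total mass \<open>P\<close>. The factor
    \<open>P / V\<close> is the constant of \<open>euler_lagrange\<close>, and it gives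
    \<open>w\<close> total mass at most \<open>P\<close>, since the cones lie inside
    \<open>K\<close>.\<close>
  define m where "m = density \<mu> (\<lambda>u. inv_pow q (?h u))"
  define w where "w = density ?C (\<lambda>_. ennreal (P / V))"
  have sm: "sets m = sets (restrict_space borel ?S)" by (simp add: m_def sets_mu)
  have sw: "sets w = sets (restrict_space borel ?S)" by (simp add: w_def)
  have emm: "emeasure m \<omega> = (\<integral>\<^sup>+u. inv_pow q (?h u) * indicator \<omega> u \<partial>\<mu>)" if "\<omega> \<in> sets \<mu>" for \<omega>
    unfolding m_def by (rule emeasure_density[OF im that])
  have emw: "emeasure w \<omega> = ennreal (P / V) * emeasure ?C \<omega>" if "\<omega> \<in> sets ?C" for \<omega>
    unfolding w_def using that by (rule emeasure_density_const)
  have S: "?S \<in> sets \<mu>" "?S \<in> sets ?C" unfolding sets_mu sets_cone_measure by (auto intro!: sphere_setI)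
  have mS: "emeasure m ?S = ennreal P"
  proof -
    have "emeasure m ?S = F K 0" unfolding emm[OF S(1)] F0 by (intro nn_integral_cong) (simp add: space_mu)
    then show ?thesis using K(4) P by simp
  qed
  have wS: "emeasure w ?S \<le> ennreal P"
  proof -
    have "emeasure w ?S \<le> ennreal (P / V) * ennreal V"
      unfolding emw[OF S(2)] V(2)[symmetric] by (intro mult_left_mono cone_measure_finite(1)[OF Kc(1,2)]) simp
    also have "\<dots> = ennreal P" using V P by (simp add: ennreal_mult[symmetric])
    finally show ?thesis .
  qed
  have hA: "?h (transpose A *v u) = ?h u" "?h (A *v u) = ?h u" if A: "A \<in> G" for A u
  proof -
    show 1: "?h (transpose A *v u) = ?h u" for u by (rule support_fun_invariant[OF G[OF A] AK[OF A]])
    show "?h (A *v u) = ?h u" using 1[of "A *v u"] by (simp only: orthogonal_matrix_simps[OF G[OF A]])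
  qed
  have mw: "m = w"
  proof (rule invariant_measure_eqI[OF sm sw _ _ G])
    show "emeasure m ?S < \<infinity>" unfolding mS by simp
    show "emeasure w ?S < \<infinity>" using wS by (rule order_le_less_trans) simp
    show "emeasure w ?S \<le> emeasure m ?S" unfolding mS by (rule wS)
    show "measure_invariant G w"
      unfolding measure_invariant_def
    proof (intro ballI)
      fix A \<omega> assume A: "A \<in> G" and "\<omega> \<in> sets w"
      then have \<omega>: "\<omega> \<in> sets ?C" by (simp add: w_def)
      have "(\<lambda>x. A *v x) ` \<omega> \<in> sets ?C"
        by (rule orthogonal_measurable(3)[OF G[OF A] sets_cone_measure orthogonal_sphere(1)[OF G[OF A]] \<omega>])
      then show "emeasure w ((\<lambda>x. A *v x) ` \<omega>) = emeasure w \<omega>"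
        using cone_measure_invariant[OF Kc(1,2) G[OF A] AK[OF A] \<omega>] by (simp only: emw \<omega>)
    qed
    show "measure_invariant G m"
      unfolding measure_invariant_def
    proof (intro ballI)
      fix A \<omega> assume A: "A \<in> G" and "\<omega> \<in> sets m"
      then have \<omega>: "\<omega> \<in> sets \<mu>" by (simp add: m_def)
      let ?T = "\<lambda>x. transpose A *v x"
      note T = orthogonal_measurable[OF G[OF A] sets_mu orthogonal_sphere(1)[OF G[OF A]]]
      have distr: "distr \<mu> \<mu> ?T = \<mu>"
        by (rule invariant_distr[OF G[OF A] sets_mu orthogonal_sphere(1)[OF G[OF A]]])
           (use inv A in \<open>simp only: measure_invariant_def\<close>)
      let ?g = "\<lambda>u. inv_pow q (?h u) * indicator \<omega> u"
      have g: "?g \<in> borel_measurable \<mu>" using im \<omega> by measurable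
      have "emeasure m ((\<lambda>x. A *v x) ` \<omega>) = (\<integral>\<^sup>+u. ?g (?T u) \<partial>\<mu>)"
        unfolding emm[OF T(3)[OF \<omega>]]
      proof (intro nn_integral_cong)
        fix u assume "u \<in> space \<mu>"
        then have "u \<in> (\<lambda>x. A *v x) ` \<omega> \<longleftrightarrow> ?T u \<in> \<omega>" unfolding T(2)[OF \<omega>, symmetric] by blast
        then show "inv_pow q (?h u) * indicator ((\<lambda>x. A *v x) ` \<omega>) u = ?g (?T u)"
          unfolding hA[OF A] by (simp only: indicator_def)
      qed
      also have "\<dots> = (\<integral>\<^sup>+u. ?g u \<partial>distr \<mu> \<mu> ?T)"
        using g by (intro nn_integral_distr[symmetric] T(1)) simp
      also have "\<dots> = emeasure m \<omega>" unfolding distr emm[OF \<omega>] ..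
      finally show "emeasure m ((\<lambda>x. A *v x) ` \<omega>) = emeasure m \<omega>" .
    qed
    fix \<omega> :: "(real^'n) set" assume \<omega>: "closed \<omega>" "\<omega> \<subseteq> ?S"
      and \<omega>G: "\<And>A u. A \<in> G \<Longrightarrow> u \<in> \<omega> \<Longrightarrow> A *v u \<in> \<omega> \<and> transpose A *v u \<in> \<omega>"
    \<comment> \<open>The first variation requires positive support values on a closed set. The
      pieces with values at least \<open>1 / (k + 1)\<close> are closed, and they stay invariant
      because the support function is.\<close>
    define X where "X k = {u \<in> \<omega>. 1 / real (Suc k) \<le> ?h u}" for k
    have Xc: "closed (X k)" for k
    proof -
      have "closed (\<omega> \<inter> {u. 1 / real (Suc k) \<le> ?h u})"
        using \<omega>(1) by (intro closed_Int closed_Collect_le continuous_intros continuous_support_fun Kc)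
      then show ?thesis by (simp add: X_def Int_def)
    qed
    have XS: "X k \<subseteq> ?S" for k using \<omega>(2) by (auto simp: X_def)
    have Xm: "X k \<in> sets \<mu>" "X k \<in> sets ?C" for k
      unfolding sets_mu sets_cone_measure by (intro sphere_setI borel_closed Xc XS)+
    have \<omega>m: "\<omega> \<in> sets \<mu>" "\<omega> \<in> sets ?C"
      unfolding sets_mu sets_cone_measure by (intro sphere_setI borel_closed \<omega>)+
    have X_le: "emeasure m (X k) \<le> emeasure w \<omega>" for k
    proof -
      have XG: "A *v u \<in> X k" "transpose A *v u \<in> X k" if "A \<in> G" "u \<in> X k" for A u
        using \<omega>G[OF that(1), of u] that(2) unfolding X_def by (simp_all only: hA[OF that(1)] mem_Collect_eq simp_thms)
      have Xp: "0 < ?h u" if "u \<in> X k" for u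
      proof -
        have "0 < 1 / real (Suc k)" by simp
        then show ?thesis using that unfolding X_def by (simp only: mem_Collect_eq) linarith
      qed
      have "emeasure m (X k) * ennreal V \<le> ennreal P * emeasure ?C (X k)"
        using euler_lagrange[OF G K Xc XS Xp XG]
        unfolding emm[OF Xm(1)] emeasure_cone_measure_closed[OF Kc(1,2) Xc XS] V(2) P(2) .
      then have "ennreal (1 / V) * (emeasure m (X k) * ennreal V) \<le> ennreal (1 / V) * (ennreal P * emeasure ?C (X k))"
        by (rule mult_left_mono) simp
      also have "ennreal (1 / V) * (emeasure m (X k) * ennreal V) = emeasure m (X k)"
        unfolding mult.left_commute[of _ "emeasure m (X k)"] using V(1) by (simp add: ennreal_mult[symmetric])
      also have "ennreal (1 / V) * (ennreal P * emeasure ?C (X k)) = emeasure w (X k)"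
        unfolding emw[OF Xm(2)] using V(1) P(1) by (simp add: mult.assoc[symmetric] ennreal_mult[symmetric])
      also have "\<dots> \<le> emeasure w \<omega>" using \<omega>m(2) by (intro emeasure_mono) (auto simp: X_def w_def)
      finally show ?thesis .
    qed
    have "incseq X"
    proof (rule incseq_SucI, rule subsetI)
      fix k u assume "u \<in> X k"
      moreover have "1 / real (Suc (Suc k)) \<le> 1 / real (Suc k)" by (intro divide_left_mono) auto
      ultimately show "u \<in> X (Suc k)" unfolding X_def by (simp only: mem_Collect_eq) (blast intro: order_trans)
    qed
    \<comment> \<open>The directions left over by the pieces have support value 0 and are null for
      \<mu>, hence for \<open>m\<close>.\<close>
    have "emeasure m \<omega> = emeasure m (\<Union>k. X k)"
    proof (rule emeasure_eq_AE)
      have "AE u in m. 0 < ?h u"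
        unfolding m_def by (subst AE_density[OF im]) (use hpos in \<open>eventually_elim, simp\<close>)
      then show "AE u in m. (u \<in> \<omega>) = (u \<in> (\<Union>k. X k))"
      proof eventually_elim
        case (elim u)
        then obtain k where "inverse (real (Suc k)) < ?h u" using reals_Archimedean by blast
        then have "u \<in> \<omega> \<Longrightarrow> u \<in> X k" by (simp add: X_def inverse_eq_divide)
        then show ?case by (auto simp: X_def)
      qed
    qed (use \<omega>m Xm in \<open>auto simp: m_def\<close>)
    also have "\<dots> = (SUP k. emeasure m (X k))"
      using Xm(1) by (intro SUP_emeasure_incseq[symmetric] \<open>incseq X\<close>) (auto simp: m_def)
    also have "\<dots> \<le> emeasure w \<omega>" by (rule SUP_least) (rule X_le)
    finally show "emeasure m \<omega> \<le> emeasure w \<omega>" .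
  qed
  have hm: "(\<lambda>u. ennreal (?h u powr q)) \<in> borel_measurable \<mu>" "(\<lambda>u. ennreal (?h u powr q)) \<in> borel_measurable ?C"
  proof -
    have [measurable]: "?h \<in> borel_measurable borel" by (rule borel_measurable_support_fun[OF Kc(3,4)])
    have b: "(\<lambda>u. ennreal (?h u powr q)) \<in> borel_measurable borel" by measurable
    show "(\<lambda>u. ennreal (?h u powr q)) \<in> borel_measurable \<mu>" by (rule measurable_mu[OF b])
    show "(\<lambda>u. ennreal (?h u powr q)) \<in> borel_measurable ?C"
      by (subst measurable_cong_sets[OF sets_cone_measure refl]) (rule measurable_restrict_space1[OF b])
  qed
  have "\<mu> = density \<mu> (\<lambda>_. 1)" by (simp add: density_1)
  \<comment> \<open>\<open>inv_pow\<close> and \<open>h powr q\<close> are reciprocal where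
    \<open>h > 0\<close>, that is \<mu>-almost everywhere.\<close>
  also have "\<dots> = density \<mu> (\<lambda>u. inv_pow q (?h u) * ennreal (?h u powr q))"
  proof (rule density_cong)
    show "AE u in \<mu>. 1 = inv_pow q (?h u) * ennreal (?h u powr q)"
      using hpos by eventually_elim (simp add: inv_pow_def ennreal_mult[symmetric] powr_add[symmetric])
  qed (use im hm in auto)
  also have "\<dots> = density m (\<lambda>u. ennreal (?h u powr q))"
    unfolding m_def by (rule density_density_eq[symmetric, OF im hm(1)])
  also have "\<dots> = density ?C (\<lambda>u. ennreal (P / V) * ennreal (?h u powr q))"
    unfolding mw w_def by (rule density_density_eq[OF _ hm(2)]) simp
  also have "\<dots> = density ?C (\<lambda>u. ennreal (P / V * ?h u powr q))" using P V by (subst ennreal_mult) auto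
  finally show ?thesis using P V by (intro that[of K "P / V"] K(1)) auto
qed

end

lemma Lp_Minkowski_solution:
  fixes p :: real and f :: "real^'n \<Rightarrow> real"
  assumes p: "- real CARD('n) < p" "p < 0"
    and f: "f \<in> Lq_functions (real CARD('n) / (real CARD('n) + p)) sphere_measure"
    and f0: "\<forall>u \<in> sphere 0 1. 0 \<le> f u"
    and \<mu>: "\<mu> = density sphere_measure (\<lambda>u. ennreal (f u))"
    and nz: "emeasure \<mu> (space \<mu>) \<noteq> 0"
    and G: "\<And>A. A \<in> G \<Longrightarrow> orthogonal_matrix A" "measure_invariant G \<mu>"
  obtains K where "K \<in> convex_bodies_0" "\<mu> = Lp_surface_area_measure p K" "body_invariant G K"
proof -
  let ?n = "CARD('n)"
  interpret coercive_functional \<mu> "- p" by (rule density_coercive[OF p f f0 \<mu> nz])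
  obtain K c where K: "admissible G K" and c: "0 < c"
    and \<mu>K: "\<mu> = density (cone_measure K) (\<lambda>u. ennreal (c * support_fun K u powr (- p)))"
    using cone_measure_solution[OF G] by metis
  have Kc: "convex_body K" "0 \<in> K" "compact K" "K \<noteq> {}" and AK: "body_invariant G K"
    using K by (auto simp: admissible_def convex_body_def)
  define cn where "cn = hausdorff_scale TYPE('n) * real ?n"
  \<comment> \<open>Otherwise the sphere would have measure 0, and \<mu>, being absolutely
    continuous, would be trivial.\<close>
  have "cn \<noteq> 0"
  proof
    assume "cn = 0"
    then have zero: "(sphere_measure :: (real^'n) measure) = density (cone_measure (cball 0 1)) (\<lambda>_. 0)"
      unfolding sphere_measure_eq cn_def[symmetric] by simp
    have "absolutely_continuous sphere_measure \<mu>"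
      unfolding \<mu> using f by (intro absolutely_continuousI_density) (auto simp: Lq_functions_def)
    moreover have "sphere (0::real^'n) 1 \<in> sets (cone_measure (cball 0 1))"
      unfolding sets_cone_measure by (intro sphere_setI) auto
    then have "sphere 0 1 \<in> null_sets (sphere_measure :: (real^'n) measure)"
      unfolding zero by (intro null_setsI) (simp_all add: emeasure_density)
    ultimately show False using mu_pos unfolding absolutely_continuous_def by auto
  qed
  then have cn: "0 < cn" using hausdorff_scale(1)[where 'n='n] by (simp add: cn_def zero_less_mult_iff)
  \<comment> \<open>Dilation by \<open>s\<close> contributes \<open>s ^ n\<close> through the cone
    measure and \<open>s powr (- p)\<close> through the support function, so \<open>s\<close> solves
    \<open>cn * s powr (n - p) = c\<close>. The exponent is positive as
    \<open>p < 0\<close>.\<close>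
  define s where "s = (c / cn) powr (1 / (real ?n - p))"
  have s: "0 < s" using c cn by (simp add: s_def)
  have "s powr (real ?n - p) = c / cn" using p c cn by (simp add: s_def powr_powr)
  then have scn: "s ^ ?n * (cn * s powr (- p)) = c"
    using s cn by (simp add: powr_realpow[symmetric] powr_diff powr_minus field_simps)
  let ?L = "(*\<^sub>R) s ` K"
  have L: "convex_body ?L" "0 \<in> ?L" using convex_body_scaleR[OF Kc(1) s] Kc(2) by auto
  have hm: "support_fun K \<in> borel_measurable (cone_measure K)"
    by (subst measurable_cong_sets[OF sets_cone_measure refl])
       (intro measurable_restrict_space1 borel_measurable_support_fun Kc)
  have "Lp_surface_area_measure p ?L = density (density (cone_measure K) (\<lambda>_. ennreal (s ^ ?n)))
      (\<lambda>u. ennreal (cn * (s * support_fun K u) powr (- p)))"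
    unfolding Lp_surface_area_measure_eq[OF L] cone_measure_scaleR[OF Kc(1,2) s] support_fun_scaleR[OF Kc(3,4) s] cn_def ..
  also have "\<dots> = density (cone_measure K) (\<lambda>u. ennreal (s ^ ?n) * ennreal (cn * (s * support_fun K u) powr (- p)))"
    using hm by (intro density_density_eq) auto
  also have "\<dots> = \<mu>"
  proof -
    have "ennreal (s ^ ?n) * ennreal (cn * (s * support_fun K u) powr (- p)) = ennreal (c * support_fun K u powr (- p))" for u
    proof -
      have "s ^ ?n * (cn * (s * support_fun K u) powr (- p)) = (s ^ ?n * (cn * s powr (- p))) * support_fun K u powr (- p)"
        using s support_fun_nonneg[OF Kc(3,2)] by (simp add: powr_mult)
      then show ?thesis unfolding scn using s cn by (simp add: ennreal_mult[symmetric])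
    qed
    then show ?thesis unfolding \<mu>K by simp
  qed
  finally have "\<mu> = Lp_surface_area_measure p ?L" ..
  moreover have "body_invariant G ?L"
    unfolding body_invariant_def
  proof
    fix A assume "A \<in> G"
    then have "(\<lambda>x. A *v x) ` K = K" using AK by (simp add: body_invariant_def)
    moreover have "(\<lambda>x. A *v x) ` ?L = (*\<^sub>R) s ` ((\<lambda>x. A *v x) ` K)"
      by (simp only: image_image matrix_vector_mult_scaleR)
    ultimately show "(\<lambda>x. A *v x) ` ?L = ?L" by simp
  qed
  ultimately show ?thesis using L that[of ?L] by (simp add: convex_bodies_0_def)
qed

theorem theorem1p5:
  fixes p :: real and f :: "real ^ 'n \<Rightarrow> real" and \<mu> :: "(real ^ 'n) measure"
  assumes "- real CARD('n) < p" and "p < 0"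
    and "f \<in> Lq_functions (real CARD('n) / (real CARD('n) + p)) sphere_measure"
    and "\<forall>u \<in> sphere 0 1. 0 \<le> f u"
    and "\<mu> = density sphere_measure (\<lambda>u. ennreal (f u))"
    and "emeasure \<mu> (space \<mu>) \<noteq> 0"
  shows "(\<exists>K \<in> convex_bodies_0. \<mu> = Lp_surface_area_measure p K) \<and>
         (\<forall>G. subgroup G orthogonal_group \<and> closed G \<and> measure_invariant G \<mu> \<longrightarrow>
            (\<exists>K \<in> convex_bodies_0. \<mu> = Lp_surface_area_measure p K \<and> body_invariant G K))"
proof (intro conjI allI impI)
  \<comment> \<open>The empty set of matrices imposes no symmetry.\<close>
  show "\<exists>K \<in> convex_bodies_0. \<mu> = Lp_surface_area_measure p K"
    using Lp_Minkowski_solution[OF assms, of "{}"] by (auto simp: measure_invariant_def)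
next
  fix G assume G: "subgroup G (orthogonal_group :: (real^'n^'n) monoid) \<and> closed G \<and> measure_invariant G \<mu>"
  then have "\<And>A. A \<in> G \<Longrightarrow> orthogonal_matrix A"
    using subgroup.subset[of G orthogonal_group] by (auto simp: orthogonal_group_def)
  then show "\<exists>K \<in> convex_bodies_0. \<mu> = Lp_surface_area_measure p K \<and> body_invariant G K"
    using Lp_Minkowski_solution[OF assms] G by metis
qed

end
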